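(* Let $d\ge2$, $s>0$ and $\beta\ge\frac{2-d}{4}$. Then there exists a constant $C>0$ such that $$\big\||\square|^{\beta}\big(e^{it\phi_s(D)}f\,\overline{e^{it\phi_s(D)}g}\big)\big\|_{L^2(\mathbb{R}^{d+1})}\le C\,\|\phi_s(D)^{\frac{d-1}{4}+\beta}f\|_{L^2(\mathbb{R}^d)}\|\phi_s(D)^{\frac{d-1}{4}+\beta}g\|_{L^2(\mathbb{R}^d)}\qquad( * )$$ holds whenever $f$ and $g$ are radially symmetric. Moreover, for $\beta\in[\frac{2-d}{4},\frac{3-d}{4}]\cup[\frac{5-d}{4},\infty)$, the optimal constant in $( * )$ for radially symmetric $f$ and $g$ is $\mathbf F(\beta,d)^{\frac12}$, where $$\mathbf F(\beta,d):=2^{d-3+4\beta}\pi^{-\frac d2}\frac{\Gamma(\frac d2)\Gamma(\frac{d-1}{2}+2\beta)}{(d-2+2\beta)\,\Gamma(\frac{3d-5}{2}+2\beta)},$$ but there does not exist a non-trivial pair of functions $(f,g)$ that attains equality.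
   Context: For $s>0$ and $r\ge0$, $\phi_s(r)=\sqrt{s^2+r^2}$. Spatial Fourier transform: $\widehat f(\xi)=\int_{\mathbb R^d}e^{-ix\cdot\xi}f(x)\,\mathrm dx$. $D=\sqrt{-\Delta_x}$; $\phi_s(D)^\alpha$ is the Fourier multiplier with symbol $\phi_s(|\xi|)^\alpha$; the Klein--Gordon propagator is $e^{it\phi_s(D)}f(x)=(2\pi)^{-d}\int_{\mathbb R^d}e^{i(x\cdot\xi+t\phi_s(|\xi|))}\widehat f(\xi)\,\mathrm d\xi$. The operator $|\square|^\beta$, where $\square=\partial_t^2-\Delta_x$, is the space-time Fourier multiplier with symbol $\big|\tau^2-|\xi|^2\big|^\beta$, $(\tau,\xi)$ dual to $(t,x)\in\mathbb R\times\mathbb R^d$. $f,g$ range over functions on $\mathbb R^d$ for which the right-hand side of $( * )$ is finite; non-trivial means that neither $f$ nor $g$ vanishes almost everywhere. $\Gamma$ is the gamma function.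
   Formalization: The single case d = 2, β = 0 is excluded: there d−2+2β = 0, so F(β,d) is undefined, and the estimate ( * ) itself fails for every constant C by a logarithmic divergence (radial f = g with Fourier transform the indicator of N ≤ |ξ| ≤ 2N, N → ∞). *)

theory Defs
  imports "HOL-Analysis.Analysis"
begin

text \<open>
  Complex functions on a Euclidean space are taken with Lebesgue measure, in Borel measurable
  representatives. All notions below are invariant under changes on null sets.
\<close>

definition L2 :: "('a::euclidean_space \<Rightarrow> complex) set" where
  "L2 = {f \<in> borel_measurable borel. integrable lborel (\<lambda>x. (norm (f x))\<^sup>2)}"

definition L2_norm :: "('a::euclidean_space \<Rightarrow> complex) \<Rightarrow> real" where
  "L2_norm f = sqrt (LINT x|lborel. (norm (f x))\<^sup>2)"

definition fourier_integral :: "('a::euclidean_space \<Rightarrow> complex) \<Rightarrow> 'a \<Rightarrow> complex" where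
  "fourier_integral f \<xi> = (LINT x|lborel. exp (- (\<i> * complex_of_real (x \<bullet> \<xi>))) * f x)"

text \<open>
  Schwartz functions. Coinductively: a Schwartz function is totally differentiable, decays faster
  than every power, and all its partial derivatives are again Schwartz functions.
\<close>

coinductive schwartz :: "('a::euclidean_space \<Rightarrow> complex) \<Rightarrow> bool" where
  "\<lbrakk>\<And>x. (\<psi> has_derivative D x) (at x);
    \<And>k::nat. bounded (range (\<lambda>x. norm x ^ k *\<^sub>R \<psi> x));
    \<forall>b\<in>Basis. schwartz (\<lambda>x. D x b)\<rbrakk>
   \<Longrightarrow> schwartz \<psi>"

definition tempered_function :: "('a::euclidean_space \<Rightarrow> complex) \<Rightarrow> bool" where
  "tempered_function f \<longleftrightarrow> f \<in> borel_measurable borel \<and>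
     (\<exists>N::nat. integrable lborel (\<lambda>x. f x /\<^sub>R (1 + norm x) ^ N))"

text \<open>
  \<open>F\<close> is the Fourier transform of \<open>f\<close>, in the sense of tempered distributions; \<open>F\<close> is then unique
  up to null sets. This is the Fourier integral if \<open>f\<close> is integrable and the Plancherel extension
  if \<open>f\<close> is square integrable. The distributional sense is needed because the space-time function
  to which the power of the wave operator is applied need be neither.
\<close>

definition has_fourier :: "('a::euclidean_space \<Rightarrow> complex) \<Rightarrow> ('a \<Rightarrow> complex) \<Rightarrow> bool" where
  "has_fourier f F \<longleftrightarrow> tempered_function f \<and> tempered_function F \<and>
     (\<forall>\<psi>. schwartz \<psi> \<longrightarrow>
        (LINT x|lborel. f x * fourier_integral \<psi> x) = (LINT \<xi>|lborel. F \<xi> * \<psi> \<xi>))"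

text \<open>\<open>h\<close> is the image of \<open>f\<close> under the Fourier multiplier with symbol \<open>m\<close>.\<close>

definition is_multiplier ::
  "('a::euclidean_space \<Rightarrow> complex) \<Rightarrow> ('a \<Rightarrow> complex) \<Rightarrow> ('a \<Rightarrow> complex) \<Rightarrow> bool" where
  "is_multiplier m f h \<longleftrightarrow> (\<exists>F. has_fourier f F \<and> has_fourier h (\<lambda>\<xi>. m \<xi> * F \<xi>))"

text \<open>
  The \<open>L\<^sup>2\<close> norm of the image of \<open>f\<close> under the multiplier \<open>m\<close>. The infimum is over a set with
  at most one element up to null sets; it is \<open>\<infinity>\<close> if the image is not an \<open>L\<^sup>2\<close> function.
\<close>

definition multiplier_norm :: "('a::euclidean_space \<Rightarrow> complex) \<Rightarrow> ('a \<Rightarrow> complex) \<Rightarrow> ennreal" where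
  "multiplier_norm m f = (INF h\<in>{h \<in> L2. is_multiplier m f h}. ennreal (L2_norm h))"

definition phi :: "real \<Rightarrow> real \<Rightarrow> real" where
  "phi s r = sqrt (s\<^sup>2 + r\<^sup>2)"

definition phi_norm :: "real \<Rightarrow> real \<Rightarrow> ('a::euclidean_space \<Rightarrow> complex) \<Rightarrow> ennreal" where
  "phi_norm s \<alpha> f = multiplier_norm (\<lambda>\<xi>. complex_of_real (phi s (norm \<xi>) powr \<alpha>)) f"

text \<open>
  \<open>u (t, x) = (2 \<pi>)\<^sup>-\<^sup>d \<integral> exp (\<i> (x \<bullet> \<xi> + t \<phi>\<^sub>s(|\<xi>|))) F(\<xi>) d\<xi>\<close> with \<open>F\<close> the Fourier transform of \<open>f\<close>.
  As \<open>F\<close> need not be integrable, the right-hand side is read as the inverse Fourier transform of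
  \<open>exp (\<i> t \<phi>\<^sub>s(|\<xi>|)) F(\<xi>)\<close> in the sense of \<^const>\<open>has_fourier\<close>. For each \<open>t\<close> this determines
  \<open>u (t, _)\<close> only up to null sets, hence the explicit joint measurability.
\<close>

definition is_kg_propagation ::
  "real \<Rightarrow> ('a::euclidean_space \<Rightarrow> complex) \<Rightarrow> (real \<times> 'a \<Rightarrow> complex) \<Rightarrow> bool" where
  "is_kg_propagation s f u \<longleftrightarrow> u \<in> borel_measurable borel \<and>
     (\<forall>t. is_multiplier (\<lambda>\<xi>. exp (\<i> * complex_of_real (t * phi s (norm \<xi>)))) f (\<lambda>x. u (t, x)))"

definition kg_propagator ::
  "real \<Rightarrow> ('a::euclidean_space \<Rightarrow> complex) \<Rightarrow> real \<times> 'a \<Rightarrow> complex" where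
  "kg_propagator s f = (SOME u. is_kg_propagation s f u)"

text \<open>
  The symbol gets the value 0 on the light cone, a null set, also for \<open>\<beta> \<le> 0\<close>.
\<close>

definition box_norm :: "real \<Rightarrow> (real \<times> 'a::euclidean_space \<Rightarrow> complex) \<Rightarrow> ennreal" where
  "box_norm \<beta> w =
     multiplier_norm (\<lambda>(\<tau>, \<xi>). complex_of_real (\<bar>\<tau>\<^sup>2 - (norm \<xi>)\<^sup>2\<bar> powr \<beta>)) w"

definition kg_lhs ::
  "real \<Rightarrow> real \<Rightarrow> ('a::euclidean_space \<Rightarrow> complex) \<Rightarrow> ('a \<Rightarrow> complex) \<Rightarrow> ennreal" where
  "kg_lhs s \<beta> f g = box_norm \<beta> (\<lambda>z. kg_propagator s f z * cnj (kg_propagator s g z))"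

definition kg_exponent :: "'a::euclidean_space itself \<Rightarrow> real \<Rightarrow> real" where
  "kg_exponent _ \<beta> = (real DIM('a) - 1) / 4 + \<beta>"

definition kg_rhs ::
  "real \<Rightarrow> real \<Rightarrow> ('a::euclidean_space \<Rightarrow> complex) \<Rightarrow> ('a \<Rightarrow> complex) \<Rightarrow> ennreal" where
  "kg_rhs s \<beta> f g =
     phi_norm s (kg_exponent TYPE('a) \<beta>) f * phi_norm s (kg_exponent TYPE('a) \<beta>) g"

definition radial :: "('a::euclidean_space \<Rightarrow> complex) \<Rightarrow> bool" where
  "radial f \<longleftrightarrow> (\<forall>x y. norm x = norm y \<longrightarrow> f x = f y)"

text \<open>
  The radial functions that the estimate is about. Each factor on the right-hand side is
  required to be finite, which excludes products \<open>0 * \<infinity>\<close>.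
\<close>

definition radial_data :: "real \<Rightarrow> real \<Rightarrow> ('a::euclidean_space \<Rightarrow> complex) set" where
  "radial_data s \<beta> = {f. radial f \<and> phi_norm s (kg_exponent TYPE('a) \<beta>) f < \<infinity>}"

definition kg_constants :: "'a::euclidean_space itself \<Rightarrow> real \<Rightarrow> real \<Rightarrow> real set" where
  "kg_constants _ s \<beta> =
     {C. 0 < C \<and> (\<forall>f \<in> radial_data s \<beta>. \<forall>g \<in> radial_data s \<beta>.
           kg_lhs s \<beta> f (g :: 'a \<Rightarrow> complex) \<le> ennreal C * kg_rhs s \<beta> f g)}"

text \<open>
  For \<open>d \<ge> 2\<close> and \<open>\<beta> \<ge> (2 - d) / 4\<close> the denominator vanishes only at \<open>d = 2\<close>, \<open>\<beta> = 0\<close>, where the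
  formula is meaningless and the estimate fails by a logarithm for every constant.
\<close>

definition F_const :: "real \<Rightarrow> real \<Rightarrow> real" where
  "F_const \<beta> d =
     2 powr (d - 3 + 4 * \<beta>) * pi powr (- d / 2) *
     (Gamma (d / 2) * Gamma ((d - 1) / 2 + 2 * \<beta>)) /
     ((d - 2 + 2 * \<beta>) * Gamma ((3 * d - 5) / 2 + 2 * \<beta>))"

end

theory Submission
  imports Defs "HOL-Probability.Probability"
begin

text \<open>
  Regard the Fourier transforms \<open>F\<close>, \<open>G\<close> of radial data as functions of the energy \<open>E = \<phi>\<^sub>s(|\<xi>|)\<close>. In
  bipolar coordinates the space-time Fourier transform of the product of the two solutions is a
  density: its value at \<open>(\<tau>, \<xi>)\<close> is an integral over \<open>E\<close> of \<open>F(E)\<close> times the conjugate of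
  \<open>G(E - \<tau>)\<close>, weighted with a power of the area of the triangle with sides \<open>|\<xi>|\<close> and the two
  momenta. By Plancherel the left-hand side is a quadratic form in \<open>E F(E)\<close>, \<open>E G(E)\<close>, and
  \<open>2xy \<le> x\<^sup>2 + y\<^sup>2\<close>, applied after exchanging the energies of the two factors \<open>G\<close>, makes it diagonal.
  The product of the two squared areas is, up to a factor, the maximum over \<open>u\<close> of a Gram
  determinant that is quadratic in the cosine \<open>u\<close> of the angle between two momenta. A Beta integral
  therefore writes the kernel as an integral over \<open>u\<close>, \<open>\<tau>\<close> and \<open>|\<xi>|\<close> of a power of the determinant;
  integrated over \<open>\<tau>\<close> first, it is an average over \<open>u\<close> of an explicit function of
  \<open>a b - u \<surd>(a\<^sup>2 - s\<^sup>2) \<surd>(b\<^sup>2 - s\<^sup>2)\<close>, where \<open>a\<close> and \<open>b\<close> are the energies.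

  With \<open>\<gamma> = 2\<beta> + (d - 3)/2\<close>, the integrand is strictly smaller than that of the massless limit, and for
  \<open>\<gamma> \<le> 0\<close> or \<open>\<gamma> \<ge> 1\<close> the convexity of \<open>x \<mapsto> x\<^sup>\<gamma>\<close> shows that the average is strictly smaller than its
  limit at infinite energy; hence equality is never attained. For \<open>F(E) = G(E) = exp (- \<epsilon> E) / E\<close> the
  first inequality is an equality, and the energy escapes to infinity as \<open>\<epsilon>\<close> tends to \<open>0\<close>, so
  that the constant is optimal.
\<close>

section \<open>Gaussians and Fourier inversion\<close>

text \<open>All thresholds become visible in \<gamma> and p = (d - 3)/2. The bound \<beta> \<ge> (2
  - d)/4 means \<gamma> \<ge> -1/2, which is what the comparison with the massless integrand needs.
  Positivity of \<gamma> + p + 1 = 2 \<beta> + d - 2 is integrability of the massless angular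
  average at u = 1; it fails only for d = 2, \<beta> = 0. The two intervals of the sharp statement
  are \<gamma> \<le> 0 and \<gamma> \<ge> 1; for 0 < \<gamma> < 1 the power is concave, Jensen
  points the other way, and only some finite constant is obtained. One obstacle is the kernel: at
  fixed energies it is a double integral of two area factors to the power p with no evident
  primitive. Representing their product by an extra angle turns each integration, over \<tau> and
  then over \<rho>^2 - \<tau>^2, into a Beta integral. The other obstacle is the generality of the
  data: the product of two solutions and its space-time transform are only known to be integrable on
  slices, so the transform has to be identified by pairing with Schwartz functions. This is why
  uniqueness, inversion and Plancherel are developed for tempered functions.\<close>

lemma lborel_prod_Basis:
  fixes f :: "'a::euclidean_space \<Rightarrow> real \<Rightarrow> complex"
  assumes f: "\<And>b. b \<in> Basis \<Longrightarrow> integrable lborel (f b)"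
  shows "integrable lborel (\<lambda>x::'a. \<Prod>b\<in>Basis. f b (x \<bullet> b))"
    and "(LINT x|lborel. (\<Prod>b\<in>Basis. f b ((x::'a) \<bullet> b))) = (\<Prod>b\<in>Basis. integral\<^sup>L lborel (f b))"
proof -
  interpret product_sigma_finite "\<lambda>_::'a. lborel :: real measure" ..
  have m[measurable]: "f b \<in> borel_measurable borel" if "b \<in> Basis" for b
    using borel_measurable_integrable[OF f[OF that]] by simp
  have *: "(\<Prod>b\<in>Basis. f b ((\<Sum>b'\<in>Basis. x b' *\<^sub>R b') \<bullet> b)) = (\<Prod>b\<in>Basis. f b (x b))" for x
    by (intro prod.cong) (auto simp: inner_sum_left inner_Basis if_distrib cong: if_cong)
  have e: "(\<lambda>x::'a. \<Prod>b\<in>Basis. f b (x \<bullet> b)) \<in> borel_measurable borel"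
    by measurable
  show "integrable lborel (\<lambda>x::'a. \<Prod>b\<in>Basis. f b (x \<bullet> b))"
    by (subst lborel_eq, subst integrable_distr_eq) (use e in \<open>auto simp: * intro!: product_integrable_prod f\<close>)
  show "(LINT x|lborel. (\<Prod>b\<in>Basis. f b ((x::'a) \<bullet> b))) = (\<Prod>b\<in>Basis. integral\<^sup>L lborel (f b))"
    by (subst lborel_eq, subst integral_distr) (use e in \<open>auto simp: * intro!: product_integral_prod f\<close>)
qed

lemma norm_exp_minus_i [simp]: "cmod (exp (- (\<i> * of_real r))) = 1"
  "norm (exp (\<i> * of_real r)) = 1"
  by (simp_all add: norm_exp_eq_Re)

lemma integrable_exp_i_mult [intro]:
  fixes f :: "'a::euclidean_space \<Rightarrow> complex"
  assumes "integrable lborel f"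
  shows "integrable lborel (\<lambda>x. exp (- (\<i> * of_real (x \<bullet> \<xi>))) * f x)"
  by (rule Bochner_Integration.integrable_bound[OF assms])
     (use borel_measurable_integrable[OF assms] in \<open>auto simp: norm_mult\<close>)

text \<open>The substitution x -> \<open>sqrt c * x\<close> reduces both parts to c = 1, where the
  transform is the characteristic function of the standard normal distribution, read off at
  \<open>- u\<close> because of the opposite sign convention.\<close>

lemma gauss_real_fourier:
  fixes c t :: real
  assumes c: "c > 0"
  shows "integrable lborel (\<lambda>x. exp (- (\<i> * of_real (x * t))) * exp (- c * x\<^sup>2 / 2))"
    and "(LINT x|lborel. exp (- (\<i> * of_real (x * t))) * exp (- c * x\<^sup>2 / 2))
           = complex_of_real (sqrt (2 * pi / c) * exp (- t\<^sup>2 / (2 * c)))"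
proof -
  let ?f = "\<lambda>x. exp (- (\<i> * of_real (x * t))) * exp (- c * x\<^sup>2 / 2)"
  have i: "integrable lborel (\<lambda>x. complex_of_real (exp (- x\<^sup>2 / 2)))"
    using integrable_mult_right[OF integrable_normal_moment[of 1 0 0], of "sqrt (2 * pi)"]
    by (intro integrable_of_real) (simp add: std_normal_density_def)
  have "integrable lborel (\<lambda>x. complex_of_real (exp (- (0 + sqrt c * x)\<^sup>2 / 2)))"
    using lborel_integrable_real_affine[OF i, of "sqrt c" 0] c by simp
  then have ic: "integrable lborel (\<lambda>x. complex_of_real (exp (- c * x\<^sup>2 / 2)))"
    using c by (simp add: power_mult_distrib)
  from integrable_exp_i_mult[OF this, of t]
  show "integrable lborel (\<lambda>x. ?f x)"
    by simp
  have ch: "(LINT x|lborel. exp (- (\<i> * of_real (x * u))) * exp (- x\<^sup>2 / 2)) = complex_of_real (sqrt (2 * pi) * exp (- u\<^sup>2 / 2))" for u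
  proof -
    have "complex_of_real (exp (- ((-u)\<^sup>2) / 2)) = char std_normal_distribution (-u)"
      by (simp add: char_std_normal_distribution)
    also have "\<dots> = (LINT x|lborel. std_normal_density x *\<^sub>R iexp (- u * x))"
      unfolding char_def by (subst integral_density) auto
    also have "\<dots> = (LINT x|lborel. complex_of_real (1 / sqrt (2 * pi)) * (exp (- (\<i> * of_real (x * u))) * exp (- x\<^sup>2 / 2)))"
      by (intro Bochner_Integration.integral_cong) (auto simp: std_normal_density_def scaleR_conv_of_real mult_ac)
    finally show ?thesis
      by (simp add: field_simps)
  qed
  have "complex_of_real (sqrt (2 * pi) * exp (- (t / sqrt c)\<^sup>2 / 2))
      = sqrt c *\<^sub>R (LINT x|lborel. exp (- (\<i> * of_real ((0 + sqrt c * x) * (t / sqrt c)))) * exp (- (0 + sqrt c * x)\<^sup>2 / 2))"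
    unfolding ch[symmetric] using c by (subst lborel_integral_real_affine[of "sqrt c" _ 0]) auto
  also have "\<dots> = sqrt c *\<^sub>R (LINT x|lborel. ?f x)"
    using c by (simp add: power_mult_distrib)
  finally show "(LINT x|lborel. ?f x)
           = complex_of_real (sqrt (2 * pi / c) * exp (- t\<^sup>2 / (2 * c)))"
    using c by (simp add: field_simps real_sqrt_divide scaleR_conv_of_real)
qed

lemma norm_sq_Basis: "(norm (x::'a::euclidean_space))\<^sup>2 = (\<Sum>b\<in>Basis. (x \<bullet> b)\<^sup>2)"
  by (subst power2_norm_eq_inner, subst euclidean_inner) (simp add: power2_eq_square)

definition gauss :: "real \<Rightarrow> 'a::euclidean_space \<Rightarrow> complex" where
  "gauss c x = complex_of_real (exp (- c * (norm x)\<^sup>2 / 2))"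

lemma gauss_measurable [measurable]: "gauss c \<in> borel_measurable borel"
  unfolding gauss_def[abs_def] by measurable

lemma gauss_fourier:
  fixes \<xi> :: "'a::euclidean_space"
  assumes c: "c > 0"
  shows "integrable lborel (gauss c :: 'a \<Rightarrow> complex)"
    and "fourier_integral (gauss c) \<xi> = complex_of_real (sqrt (2 * pi / c) ^ DIM('a)) * gauss (1 / c) \<xi>"
proof -
  have e: "exp (- (\<i> * of_real (x \<bullet> z))) * gauss c x
     = (\<Prod>b\<in>Basis. exp (- (\<i> * of_real ((x \<bullet> b) * (z \<bullet> b)))) * exp (- c * (x \<bullet> b)\<^sup>2 / 2))" for x z :: 'a
    unfolding gauss_def norm_sq_Basis[of x] euclidean_inner[of x z] prod.distrib
    by (simp add: exp_sum[symmetric] sum_distrib_left sum_negf sum_divide_distrib flip: exp_of_real)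
  have "integrable lborel (\<lambda>x::'a. exp (- (\<i> * of_real (x \<bullet> 0))) * gauss c x)"
    unfolding e by (rule lborel_prod_Basis) (rule gauss_real_fourier[OF c])
  then show "integrable lborel (gauss c :: 'a \<Rightarrow> complex)" by simp
  have "fourier_integral (gauss c) \<xi> = (\<Prod>b\<in>Basis. complex_of_real (sqrt (2 * pi / c) * exp (- (\<xi> \<bullet> b)\<^sup>2 / (2 * c))))"
    unfolding fourier_integral_def e
    by (subst lborel_prod_Basis) (auto simp only: gauss_real_fourier[OF c])
  also have "\<dots> = complex_of_real (sqrt (2 * pi / c) ^ DIM('a)) * gauss (1 / c) \<xi>"
    unfolding gauss_def norm_sq_Basis[of \<xi>]
    by (simp add: prod.distrib exp_sum[symmetric] sum_negf sum_divide_distrib flip: exp_of_real of_real_prod)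
       (simp add: sum_distrib_left sum_divide_distrib mult.commute)
  finally show "fourier_integral (gauss c) \<xi> = complex_of_real (sqrt (2 * pi / c) ^ DIM('a)) * gauss (1 / c) \<xi>" .
qed

text \<open>A tensor product of integrable functions times a bounded kernel: the integrability
  criterion behind the Fubini steps with oscillating or Gaussian kernels.\<close>

lemma integrable_pair_mult:
  fixes f :: "'a::euclidean_space \<Rightarrow> complex" and g :: "'b::euclidean_space \<Rightarrow> complex"
  assumes f: "integrable lborel f" and g: "integrable lborel g"
    and K[measurable]: "(\<lambda>(x, y). K x y) \<in> borel_measurable (lborel \<Otimes>\<^sub>M lborel)"
    and B: "\<And>x y. cmod (K x y) \<le> B"
  shows "integrable (lborel \<Otimes>\<^sub>M lborel) (\<lambda>(x, y). K x y * f x * g y)"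
proof -
  note [measurable] = borel_measurable_integrable[OF f] borel_measurable_integrable[OF g]
  have "integrable (lborel \<Otimes>\<^sub>M lborel) (\<lambda>(x, y). f x * g y)"
    by (rule lborel_pair.Fubini_integrable) (use f g in \<open>auto simp: norm_mult\<close>)
  then have "integrable (lborel \<Otimes>\<^sub>M lborel) (\<lambda>(x, y). complex_of_real B * (f x * g y))"
    unfolding case_prod_beta' by (rule integrable_mult_right)
  then show ?thesis
  proof (rule Bochner_Integration.integrable_bound)
    show "AE x in lborel \<Otimes>\<^sub>M lborel. norm (case x of (x, y) \<Rightarrow> K x y * f x * g y) \<le> norm (case x of (x, y) \<Rightarrow> complex_of_real B * (f x * g y))"
    proof (intro AE_I2, clarsimp)
      fix a b
      have "cmod (K a b) \<le> \<bar>B\<bar>" using B[of a b] by linarith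
      then show "cmod (K a b * f a * g b) \<le> cmod (complex_of_real B * (f a * g b))"
        by (simp add: norm_mult mult_right_mono mult.assoc)
    qed
  qed measurable
qed

lemma fourier_integral_measurable [measurable]:
  fixes f :: "'a::euclidean_space \<Rightarrow> complex"
  assumes [measurable]: "f \<in> borel_measurable borel"
  shows "fourier_integral f \<in> borel_measurable borel"
  unfolding fourier_integral_def[abs_def] by measurable

lemma cmod_fourier_integral_le:
  fixes f :: "'a::euclidean_space \<Rightarrow> complex"
  assumes "integrable lborel f"
  shows "cmod (fourier_integral f x) \<le> (LINT x|lborel. cmod (f x))"
  unfolding fourier_integral_def
  by (rule order_trans[OF integral_norm_bound]) (simp add: norm_mult)

lemma fourier_multiplication_formula:
  fixes f g :: "'a::euclidean_space \<Rightarrow> complex"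
  assumes f: "integrable lborel f" and g: "integrable lborel g"
  shows "(LINT x|lborel. fourier_integral f x * g x) = (LINT x|lborel. f x * fourier_integral g x)"
proof -
  let ?f = "\<lambda>x y. exp (- (\<i> * of_real (x \<bullet> y))) * f x * g y"
  note [measurable] = borel_measurable_integrable[OF f] borel_measurable_integrable[OF g]
  have i: "integrable (lborel \<Otimes>\<^sub>M lborel) (\<lambda>(x, y). ?f x y)"
    by (rule integrable_pair_mult[OF f g, where B = 1]) auto
  have "(LINT y|lborel. fourier_integral f y * g y) = (LINT y|lborel. LINT x|lborel. ?f x y)"
    unfolding fourier_integral_def by simp
  also have "\<dots> = (LINT x|lborel. LINT y|lborel. ?f x y)"
    by (rule lborel_pair.Fubini_integral[OF i])
  also have "\<dots> = (LINT x|lborel. f x * fourier_integral g x)"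
    unfolding fourier_integral_def integral_mult_right_zero[symmetric]
    by (simp add: inner_commute mult_ac)
  finally show ?thesis .
qed

lemma gauss_nonneg: "gauss c x = complex_of_real (cmod (gauss c x))"
  by (simp add: gauss_def)

lemma cmod_gauss: "cmod (gauss c x) = exp (- c * (norm x)\<^sup>2 / 2)"
  by (simp add: gauss_def)

lemma cmod_gauss_le_1: "c \<ge> 0 \<Longrightarrow> cmod (gauss c x) \<le> 1"
  by (simp add: cmod_gauss)

lemma gauss_minus_commute: "gauss c (x - y) = gauss c (y - x)"
  by (simp add: gauss_def norm_minus_commute)

lemma integrable_gauss: "c > 0 \<Longrightarrow> integrable lborel (gauss c)"
  by (rule gauss_fourier)

lemma integrable_gauss_shift:
  fixes y :: "'a::euclidean_space"
  assumes "c > 0" shows "integrable lborel (\<lambda>x. gauss c (x - y))"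
proof -
  have "integrable (distr lborel borel (\<lambda>x. - y + x)) (gauss c :: 'a \<Rightarrow> complex)"
    using integrable_gauss[OF assms] by (simp only: lborel_distr_plus)
  then show ?thesis by (subst (asm) integrable_distr_eq) auto
qed

lemma gauss_fourier_shift:
  fixes \<xi> :: "'a::euclidean_space"
  assumes c: "c > 0"
  shows "fourier_integral (\<lambda>x. exp (\<i> * of_real (x \<bullet> \<xi>)) * gauss c x) y =
    complex_of_real (sqrt (2 * pi / c) ^ DIM('a)) * gauss (1 / c) (y - \<xi>)"
  unfolding gauss_fourier(2)[OF c, symmetric] unfolding fourier_integral_def
  by (simp add: inner_diff_right exp_diff exp_minus field_simps)

lemma integrable_bounded_mult:
  fixes f g :: "'a::euclidean_space \<Rightarrow> complex"
  assumes f: "integrable lborel f" and [measurable]: "g \<in> borel_measurable borel" and B: "\<And>x. cmod (g x) \<le> B"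
  shows "integrable lborel (\<lambda>x. g x * f x)" "integrable lborel (\<lambda>x. f x * g x)"
proof -
  note [measurable] = borel_measurable_integrable[OF f]
  have "integrable lborel (\<lambda>x. complex_of_real B * f x)"
    using f by simp
  then show "integrable lborel (\<lambda>x. g x * f x)"
  proof (rule Bochner_Integration.integrable_bound, goal_cases)
    case 2
    show ?case
    proof (rule AE_I2)
      fix x
      have "cmod (g x) \<le> \<bar>B\<bar>" using B[of x] by linarith
      then show "cmod (g x * f x) \<le> cmod (complex_of_real B * f x)"
        by (simp add: norm_mult mult_right_mono)
    qed
  qed measurable
  then show "integrable lborel (\<lambda>x. f x * g x)"
    by (simp add: mult.commute)
qed

text \<open>The test function is a modulated Gaussian, whose transform is a Gaussian centred at
  \<xi>. Damping the transform of f by a Gaussian thus amounts to averaging f itself around \<xi>;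
  inversion, uniqueness and the Plancherel bound all start here.\<close>

lemma fourier_gauss_smoothing:
  fixes f :: "'a::euclidean_space \<Rightarrow> complex"
  assumes f: "integrable lborel f" and c: "c > 0"
  shows "(LINT x|lborel. fourier_integral f x * (exp (\<i> * of_real (x \<bullet> \<xi>)) * gauss c x)) =
    complex_of_real (sqrt (2 * pi / c) ^ DIM('a)) * (LINT y|lborel. f y * gauss (1 / c) (y - \<xi>))"
proof -
  have "integrable lborel (\<lambda>x. exp (\<i> * of_real (x \<bullet> \<xi>)) * gauss c x)"
    by (rule integrable_bounded_mult[OF integrable_gauss[OF c], where B = 1]) auto
  from fourier_multiplication_formula[OF f this] show ?thesis
    unfolding gauss_fourier_shift[OF c] by (simp add: mult.left_commute[of _ "complex_of_real _ ^ _"])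
qed

lemma lborel_integral_affine:
  fixes f :: "'a::euclidean_space \<Rightarrow> complex"
  assumes c: "c \<noteq> 0" and [measurable]: "f \<in> borel_measurable borel"
  shows "(LINT x|lborel. f x) = \<bar>c\<bar> ^ DIM('a) *\<^sub>R (LINT x|lborel. f (t + c *\<^sub>R x))"
  by (subst lborel_affine[OF c, of t]) (simp add: integral_density integral_distr)

text \<open>The parameter of the Gaussian is a square, so that the substitution y = x + z / (k + 1)
  moves the whole dependence on k into the argument of h and leaves one fixed Gaussian as dominating
  weight. \<open>Suc k\<close> keeps the scale nonzero at k = 0.\<close>

lemma gauss_approx_identity:
  fixes h :: "'a::euclidean_space \<Rightarrow> complex"
  assumes [measurable]: "h \<in> borel_measurable borel" and B: "\<And>x. cmod (h x) \<le> B" and ct: "isCont h x"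
  shows "(\<lambda>k. complex_of_real ((real (Suc k) / sqrt (2 * pi)) ^ DIM('a)) *
     (LINT y|lborel. h y * gauss ((real (Suc k))\<^sup>2) (y - x))) \<longlonglongrightarrow> h x"
proof -
  let ?g = "complex_of_real ((1 / sqrt (2 * pi)) ^ DIM('a))"
  let ?f = "\<lambda>k z. x + (1 / real (Suc k)) *\<^sub>R z"
  define g1 where "g1 = (gauss 1 :: 'a \<Rightarrow> complex)"
  have g1i: "integrable lborel g1" unfolding g1_def by (rule integrable_gauss) simp
  have [measurable]: "g1 \<in> borel_measurable borel" unfolding g1_def by simp
  have "(\<lambda>k. LINT z|lborel. h (?f k z) * g1 z) \<longlonglongrightarrow> (LINT z|lborel. h x * g1 z)"
  proof (rule integral_dominated_convergence[where w = "\<lambda>z. B * cmod (g1 z)"])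
    show "AE z in lborel. (\<lambda>k. h (?f k z) * g1 z) \<longlonglongrightarrow> h x * g1 z"
    proof (intro AE_I2 tendsto_mult tendsto_const)
      fix z
      have "(\<lambda>k. ?f k z) \<longlonglongrightarrow> x + 0 *\<^sub>R z"
        by (intro tendsto_intros LIMSEQ_Suc[OF lim_1_over_n])
      then show "(\<lambda>k. h (?f k z)) \<longlonglongrightarrow> h x"
        using isCont_tendsto_compose[OF ct] by simp
    qed
    show "AE z in lborel. norm (h (?f k z) * g1 z) \<le> B * cmod (g1 z)" for k
      by (intro AE_I2) (simp add: norm_mult mult_right_mono B)
  qed (use g1i in auto)
  then have lim: "(\<lambda>k. ?g * (LINT z|lborel. h (?f k z) * g1 z)) \<longlonglongrightarrow>
     ?g * (LINT z|lborel. h x * g1 z)"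
    by (intro tendsto_intros)
  have "(LINT z|lborel. g1 z) = complex_of_real (sqrt (2 * pi) ^ DIM('a))"
    using gauss_fourier(2)[of 1 "0::'a"] by (simp add: fourier_integral_def g1_def gauss_def)
  then have r: "?g * (LINT z|lborel. h x * g1 z) = h x"
    by (simp add: field_simps)
  have "complex_of_real ((real (Suc k) / sqrt (2 * pi)) ^ DIM('a)) * (LINT y|lborel. h y * gauss ((real (Suc k))\<^sup>2) (y - x))
     = ?g * (LINT z|lborel. h (?f k z) * g1 z)" for k
  proof -
    have g: "gauss ((real (Suc k))\<^sup>2) ((1 / real (Suc k)) *\<^sub>R z) = g1 z" for z :: 'a
      by (simp add: gauss_def g1_def power_mult_distrib power_divide del: of_nat_Suc)
    have "(LINT y|lborel. h y * gauss ((real (Suc k))\<^sup>2) (y - x))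
       = (1 / real (Suc k)) ^ DIM('a) *\<^sub>R (LINT z|lborel. h (?f k z) * g1 z)"
      by (subst lborel_integral_affine[where c = "1 / real (Suc k)" and t = x]) (simp_all only: add_diff_cancel_left' g, simp_all del: of_nat_Suc)
    then show ?thesis
      by (simp add: scaleR_conv_of_real field_simps del: of_nat_Suc)
  qed
  then show ?thesis using lim unfolding r by simp
qed

lemma gauss_total:
  assumes c: "c > 0"
  shows "(LINT y|lborel. gauss c (y - x :: 'a::euclidean_space)) = complex_of_real (sqrt (2 * pi / c) ^ DIM('a))"
proof -
  have "(LINT y|lborel. gauss c (y - x)) = (LINT y|lborel. gauss c (y::'a))"
    using lborel_integral_affine[of 1 "\<lambda>y. gauss c (y - x)" x] by simp
  also have "\<dots> = complex_of_real (sqrt (2 * pi / c) ^ DIM('a))"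
    using gauss_fourier(2)[OF c, of "0::'a"] by (simp add: fourier_integral_def gauss_def)
  finally show ?thesis .
qed

text \<open>With damping parameter \<open>1 / (real (Suc k))\<^sup>2\<close>, the factor of
  \<open>fourier_gauss_smoothing\<close> is the normalisation of the approximate identity times
  \<open>(2 * pi) ^ n\<close>: the origin of the factor in the inversion formula.\<close>

lemma gauss_const: "complex_of_real (sqrt (2 * pi / (1 / (real (Suc k))\<^sup>2)) ^ n) =
  complex_of_real ((2 * pi) ^ n) * complex_of_real ((real (Suc k) / sqrt (2 * pi)) ^ n)"
proof -
  have "sqrt (2 * pi / (1 / (real (Suc k))\<^sup>2)) = (2 * pi) * (real (Suc k) / sqrt (2 * pi))"
    by (simp add: real_sqrt_mult real_div_sqrt divide_simps del: of_nat_Suc) (simp add: algebra_simps real_sqrt_mult_self)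
  then show ?thesis by (simp only: power_mult_distrib of_real_mult)
qed

text \<open>The damped inverse integrals have two limits: dominated convergence removes the damping,
  while the smoothing identity turns them into an approximate identity applied to f at its point of
  continuity.\<close>

theorem fourier_inversion:
  fixes f :: "'a::euclidean_space \<Rightarrow> complex"
  assumes f: "integrable lborel f" and B: "\<And>x. cmod (f x) \<le> B" and ct: "isCont f \<xi>"
    and ff: "integrable lborel (fourier_integral f)"
  shows "(LINT x|lborel. fourier_integral f x * exp (\<i> * of_real (x \<bullet> \<xi>))) = (2 * pi) ^ DIM('a) * f \<xi>"
proof (rule LIMSEQ_unique)
  let ?g = "\<lambda>x. fourier_integral f x * exp (\<i> * of_real (x \<bullet> \<xi>))"
  let ?f = "\<lambda>x k. fourier_integral f x * (exp (\<i> * of_real (x \<bullet> \<xi>)) * gauss (1 / (real (Suc k))\<^sup>2) x)"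
  note [measurable] = borel_measurable_integrable[OF f] borel_measurable_integrable[OF ff]
  let ?L = "\<lambda>k. LINT x|lborel. ?f x k"
  have L: "?L k = complex_of_real ((2 * pi) ^ DIM('a)) * (complex_of_real ((real (Suc k) / sqrt (2 * pi)) ^ DIM('a)) *
     (LINT y|lborel. f y * gauss ((real (Suc k))\<^sup>2) (y - \<xi>)))" for k
    by (subst fourier_gauss_smoothing[OF f]) (simp_all only: gauss_const, simp_all del: of_nat_Suc of_real_power of_real_mult)
  show "?L \<longlonglongrightarrow> (2 * pi) ^ DIM('a) * f \<xi>"
    unfolding L using tendsto_mult_left[OF gauss_approx_identity[OF _ B ct], of "complex_of_real ((2 * pi) ^ DIM('a))"] by simp
  show "?L \<longlonglongrightarrow> (LINT x|lborel. ?g x)"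
  proof (rule integral_dominated_convergence[where w = "\<lambda>x. cmod (fourier_integral f x)"])
    show "AE x in lborel. (\<lambda>k. ?f x k) \<longlonglongrightarrow>
       ?g x"
    proof (intro AE_I2)
      fix x :: 'a
      have "(\<lambda>k. gauss ((1 / (real (Suc k)))\<^sup>2) x) \<longlonglongrightarrow> complex_of_real (exp (- 0\<^sup>2 * (norm x)\<^sup>2 / 2))"
        unfolding gauss_def by (intro tendsto_intros LIMSEQ_Suc[OF lim_1_over_n]) auto
      then have "(\<lambda>k. gauss (1 / (real (Suc k))\<^sup>2) x) \<longlonglongrightarrow> 1"
        by (simp add: power_divide)
      from tendsto_mult[OF tendsto_const tendsto_mult[OF tendsto_const this]]
      show "(\<lambda>k. ?f x k) \<longlonglongrightarrow>
       ?g x" by simp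
    qed
    show "AE x in lborel. norm (?f x k)
       \<le> cmod (fourier_integral f x)" for k
      by (intro AE_I2) (auto simp: norm_mult intro!: mult_left_le cmod_gauss_le_1)
  qed (use ff in \<open>auto simp: o_def\<close>)
qed

text \<open>The hypothesis kills the pairing of G with every Gaussian. Mollification writes \<kappa>
  as a bounded limit of superpositions of Gaussians, so its pairing with G vanishes by Fubini and
  dominated convergence.\<close>

lemma fourier_zero_imp_test_zero:
  fixes G :: "'a::euclidean_space \<Rightarrow> complex"
  assumes G: "integrable lborel G" and z: "\<And>x. fourier_integral G x = 0"
    and chi: "integrable lborel \<kappa>" and ct: "continuous_on UNIV \<kappa>" and B: "\<And>x. cmod (\<kappa> x) \<le> B"
  shows "(LINT y|lborel. G y * \<kappa> y) = 0"
proof (rule LIMSEQ_unique)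
  let ?g = "\<lambda>c k y \<xi>. gauss (c k) (y - \<xi>) * \<kappa> \<xi> * G y"
  let ?f = "\<lambda>c k y. LINT \<xi>|lborel. \<kappa> \<xi> * gauss (c k) (\<xi> - y)"
  note [measurable] = borel_measurable_integrable[OF G] borel_measurable_integrable[OF chi]
  define s where "s k = complex_of_real ((real (Suc k) / sqrt (2 * pi)) ^ DIM('a))" for k
  define c where "c k = (real (Suc k))\<^sup>2" for k
  have c0: "c k > 0" for k by (simp add: c_def)
  have z': "(LINT y|lborel. G y * gauss (c k) (y - \<xi>)) = 0" for k \<xi>
  proof -
    have "complex_of_real (sqrt (2 * pi / (1 / c k)) ^ DIM('a)) * (LINT y|lborel. G y * gauss (1 / (1 / c k)) (y - \<xi>)) = 0"
      using c0[of k] by (subst fourier_gauss_smoothing[OF G, symmetric]) (auto simp: z)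
    then show ?thesis using c0[of k] by simp
  qed
  have "integrable (lborel \<Otimes>\<^sub>M lborel) (\<lambda>(\<xi>, y). ?g c k y \<xi>)" for k
    by (rule integrable_pair_mult[OF chi G, where B = 1]) (use c0[of k] in \<open>auto intro: cmod_gauss_le_1\<close>)
  from lborel_pair.Fubini_integral[OF this]
  have F: "(LINT y|lborel. LINT \<xi>|lborel. ?g c k y \<xi>) =
     (LINT \<xi>|lborel. LINT y|lborel. ?g c k y \<xi>)" for k .
  have "(LINT y|lborel. ?g c k y \<xi>) = 0" for k \<xi>
  proof -
    have "(LINT y|lborel. ?g c k y \<xi>) = \<kappa> \<xi> * (LINT y|lborel. G y * gauss (c k) (y - \<xi>))"
      by (subst integral_mult_right_zero[symmetric]) (rule Bochner_Integration.integral_cong; simp add: mult_ac)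
    then show ?thesis by (simp add: z')
  qed
  with F have "(LINT y|lborel. G y * (?f c k y)) = 0" for k
    by (simp add: mult_ac gauss_minus_commute[of "c k"])
  then have "(LINT y|lborel. G y * (s k * (?f c k y))) = 0" for k
    by (simp add: mult.left_commute[of "G _"])
  then show "(\<lambda>k. LINT y|lborel. G y * (s k * (?f c k y))) \<longlonglongrightarrow> 0"
    by simp
  \<comment> \<open>The normalised Gaussian has total mass 1, so the mollified \<kappa> inherits the
    bound B; this is the domination needed for the limit.\<close>
  have sk: "cmod (s k * (?f c k y)) \<le> B" for k y
  proof -
    have B0: "B \<ge> 0" using B[of 0] norm_ge_zero order_trans by blast
    have i: "integrable lborel (\<lambda>\<xi>. gauss (c k) (\<xi> - y))" by (rule integrable_gauss_shift[OF c0])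
    have "cmod (?f c k y) \<le> (LINT \<xi>|lborel. cmod (\<kappa> \<xi> * gauss (c k) (\<xi> - y)))"
      by (rule integral_norm_bound)
    also have "\<dots> \<le> (LINT \<xi>|lborel. B * cmod (gauss (c k) (\<xi> - y)))"
      by (intro integral_mono integrable_norm integrable_mult_right integrable_bounded_mult[OF i] B)
         (use i in \<open>auto simp: norm_mult intro!: mult_right_mono B\<close>)
    also have "\<dots> = B * sqrt (2 * pi / c k) ^ DIM('a)"
    proof -
      have "complex_of_real (LINT \<xi>|lborel. cmod (gauss (c k) (\<xi> - y))) = (LINT \<xi>|lborel. gauss (c k) (\<xi> - y))"
        by (subst integral_of_real[symmetric]) (use i in \<open>simp_all add: gauss_nonneg[symmetric]\<close>)
      then have "(LINT \<xi>|lborel. cmod (gauss (c k) (\<xi> - y))) = sqrt (2 * pi / c k) ^ DIM('a)"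
        using gauss_total[OF c0, of k y] by (metis of_real_eq_iff)
      then show ?thesis by simp
    qed
    finally have "cmod (s k * (?f c k y)) \<le> cmod (s k) * (B * sqrt (2 * pi / c k) ^ DIM('a))"
      by (simp add: norm_mult mult_left_mono)
    also have "\<dots> = B * ((real (Suc k) / sqrt (2 * pi)) * sqrt (2 * pi / c k)) ^ DIM('a)"
      by (simp add: s_def norm_power norm_divide power_mult_distrib power_divide del: of_nat_Suc)
    also have "(real (Suc k) / sqrt (2 * pi)) * sqrt (2 * pi / c k) = 1"
      by (simp add: c_def real_sqrt_divide del: of_nat_Suc)
    finally show ?thesis by simp
  qed
  show "(\<lambda>k. LINT y|lborel. G y * (s k * (?f c k y))) \<longlonglongrightarrow> (LINT y|lborel. G y * \<kappa> y)"
  proof (rule integral_dominated_convergence[where w = "\<lambda>y. B * cmod (G y)"])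
    show "AE y in lborel. (\<lambda>k. G y * (s k * (?f c k y))) \<longlonglongrightarrow> G y * \<kappa> y"
      unfolding s_def c_def
      by (intro AE_I2 tendsto_mult tendsto_const gauss_approx_identity[OF _ B])
         (use ct in \<open>auto simp: continuous_on_eq_continuous_at\<close>)
    show "AE y in lborel. norm (G y * (s k * (?f c k y))) \<le> B * cmod (G y)" for k
      by (intro AE_I2, subst norm_mult, subst mult.commute) (intro mult_right_mono sk norm_ge_zero)
  qed (use G in auto)
qed

text \<open>\<open>density_zero\<close> asks for vanishing integrals over all measurable sets.
  Continuous integrable test functions give the open sets, and the pi-lambda theorem the
  rest.\<close>

theorem fourier_integral_unique:
  fixes G :: "'a::euclidean_space \<Rightarrow> complex"
  assumes G: "integrable lborel G" and z: "\<And>x. fourier_integral G x = 0"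
  shows "AE x in lborel. G x = 0"
proof (rule sigma_finite_measure.density_zero[OF sigma_finite_lborel G])
  note [measurable] = borel_measurable_integrable[OF G]
  have tot: "set_lebesgue_integral lborel UNIV G = 0"
    using z[of 0] by (simp add: fourier_integral_def set_lebesgue_integral_def)
  have op: "set_lebesgue_integral lborel U G = 0" if U: "open U" for U
  proof (cases "U = UNIV")
    case True then show ?thesis using tot by simp
  next
    case False
    then have ne: "- U \<noteq> {}" by auto
    \<comment> \<open>Continuous cut-offs tending to the indicator of U: the distance factor
      vanishes outside U, and the Gaussian makes the product integrable. The case U = UNIV is
      treated apart because \<open>infdist\<close> to the empty set is 0.\<close>
    define \<kappa> where "\<kappa> j x = complex_of_real (min 1 (real j * infdist x (- U))) * gauss (1 / real (Suc j)) x" for j x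
    have \<kappa>1: "cmod (\<kappa> j x) \<le> 1" for j x
      unfolding \<kappa>_def norm_mult by (intro mult_le_one cmod_gauss_le_1) (auto simp: infdist_nonneg)
    have [measurable]: "(\<lambda>x. infdist x (- U)) \<in> borel_measurable borel"
      by (intro borel_measurable_continuous_onI continuous_intros)
    have ct: "continuous_on UNIV (\<kappa> j)" for j
      unfolding \<kappa>_def[abs_def] gauss_def by (intro continuous_intros) auto
    have [measurable]: "\<kappa> j \<in> borel_measurable borel" for j
      by (rule borel_measurable_continuous_onI[OF ct])
    have "integrable lborel (\<kappa> j)" for j
      unfolding \<kappa>_def by (rule integrable_bounded_mult[OF integrable_gauss, where B = 1]) (auto simp: infdist_nonneg)
    then have 0: "(LINT y|lborel. G y * \<kappa> j y) = 0" for j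
      by (rule fourier_zero_imp_test_zero[OF G z _ ct \<kappa>1])
    have "(\<lambda>j. LINT y|lborel. G y * \<kappa> j y) \<longlonglongrightarrow> (LINT y|lborel. G y * complex_of_real (indicat_real U y))"
    proof (rule integral_dominated_convergence[where w = "\<lambda>y. cmod (G y)"])
      show "AE y in lborel. (\<lambda>j. G y * \<kappa> j y) \<longlonglongrightarrow> G y * complex_of_real (indicat_real U y)"
      proof (intro AE_I2 tendsto_mult tendsto_const)
        fix y :: 'a
        have g: "(\<lambda>j. gauss (1 / real (Suc j)) y) \<longlonglongrightarrow> complex_of_real (exp (- 0 * (norm y)\<^sup>2 / 2))"
          unfolding gauss_def by (intro tendsto_intros LIMSEQ_Suc[OF lim_1_over_n]) auto
        have m: "(\<lambda>j. min 1 (real j * infdist y (- U))) \<longlonglongrightarrow> indicat_real U y"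
        proof (cases "y \<in> U")
          case True
          then have "infdist y (- U) > 0"
            using U ne by (intro infdist_pos_not_in_closed) auto
          then obtain N where N: "1 \<le> real N * infdist y (- U)"
            using reals_Archimedean3 less_imp_le by metis
          have "eventually (\<lambda>j. min 1 (real j * infdist y (- U)) = 1) sequentially"
            using eventually_ge_at_top[of N]
          proof eventually_elim
            case (elim j)
            then have "real N * infdist y (- U) \<le> real j * infdist y (- U)"
              by (intro mult_right_mono) (auto simp: infdist_nonneg)
            with N show ?case by simp
          qed
          then show ?thesis using True by (simp add: tendsto_eventually)
        next
          case False then show ?thesis by simp
        qed
        from tendsto_mult[OF tendsto_of_real[OF m] g]
        show "(\<lambda>j. \<kappa> j y) \<longlonglongrightarrow> complex_of_real (indicat_real U y)"
          unfolding \<kappa>_def by simp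
      qed
      show "AE y in lborel. norm (G y * \<kappa> j y) \<le> cmod (G y)" for j
        by (intro AE_I2) (auto simp: norm_mult intro!: mult_left_le \<kappa>1)
    qed (use G U in auto)
    then have "(LINT y|lborel. G y * complex_of_real (indicat_real U y)) = 0"
      by (simp add: 0 LIMSEQ_const_iff)
    then show ?thesis by (simp add: set_lebesgue_integral_def scaleR_conv_of_real mult.commute)
  qed
  fix A :: "'a set" assume "A \<in> sets lborel"
  then have A: "A \<in> sigma_sets UNIV {S. open S}" by (simp add: borel_def)
  have "Int_stable {S :: 'a set. open S}" "{S :: 'a set. open S} \<subseteq> Pow UNIV"
    by (auto simp: Int_stable_def)
  from this A show "set_lebesgue_integral lborel A G = 0"
  proof (induction rule: sigma_sets_induct_disjoint)
    case (basic A) then show ?case using op by auto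
  next
    case empty show ?case by (simp add: set_lebesgue_integral_def)
  next
    case (compl A)
    then have [measurable]: "A \<in> sets borel" by (simp add: borel_def)
    have "set_lebesgue_integral lborel UNIV G = set_lebesgue_integral lborel (A \<union> (UNIV - A)) G"
      by (simp add: Un_Diff_cancel)
    also have "\<dots> = set_lebesgue_integral lborel A G + set_lebesgue_integral lborel (UNIV - A) G"
      by (rule set_integral_Un) (auto simp: set_integrable_def intro!: integrable_mult_indicator G)
    finally show ?case using compl tot by simp
  next
    case (union A)
    have [measurable]: "A i \<in> sets borel" for i using union by (auto simp: borel_def)
    have "set_lebesgue_integral lborel (\<Union>i. A i) G = (\<Sum>i. set_lebesgue_integral lborel (A i) G)"
      by (rule lebesgue_integral_countable_add)
         (use union in \<open>auto simp: set_integrable_def disjoint_family_on_def intro!: integrable_mult_indicator G\<close>)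
    then show ?case using union by simp
  qed
qed

section \<open>The Plancherel bound\<close>

abbreviation sqnorm :: "'a measure \<Rightarrow> ('a \<Rightarrow> complex) \<Rightarrow> ennreal" where
  "sqnorm M f \<equiv> \<integral>\<^sup>+x. ennreal ((cmod (f x))\<^sup>2) \<partial>M"

lemma L2_iff: "f \<in> L2 \<longleftrightarrow> f \<in> borel_measurable borel \<and> sqnorm lborel f < \<infinity>"
  unfolding L2_def by (auto simp: integrable_iff_bounded)

lemma L2_measurable [measurable_dest]: "f \<in> L2 \<Longrightarrow> f \<in> borel_measurable borel"
  by (simp add: L2_def)

lemma sqnorm_eq_L2_norm:
  assumes "f \<in> L2" shows "sqnorm lborel f = ennreal ((L2_norm f)\<^sup>2)"
proof -
  have "integrable lborel (\<lambda>x. (cmod (f x))\<^sup>2)" using assms by (simp add: L2_def)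
  then show ?thesis unfolding L2_norm_def
    by (subst nn_integral_eq_integral) auto
qed

lemma borel_measurable_cnj [measurable (raw)]:
  "f \<in> borel_measurable M \<Longrightarrow> (\<lambda>x. cnj (f x)) \<in> borel_measurable M"
  by (rule borel_measurable_continuous_on[of cnj]) (auto intro: continuous_intros)

text \<open>Only an inequality, but for every integrable f, square integrable or not. After Gaussian
  damping the left side is a double integral of f(x), the conjugate of f(y) and a Gaussian in y - x.
  The bound xy \<le> (x^2 + y^2)/2 removes the coupling, and the mass of the Gaussian times the
  prefactor no longer depends on the damping. Equality is recovered later by using the bound in both
  directions.\<close>

lemma plancherel_bound:
  fixes f :: "'a::euclidean_space \<Rightarrow> complex"
  assumes f: "integrable lborel f"
  shows "sqnorm lborel (fourier_integral f) \<le> ennreal ((2 * pi) ^ DIM('a)) * sqnorm lborel f"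
proof -
  let ?f = "\<integral>\<^sup>+x. ennreal ((cmod (f x))\<^sup>2 / 2) \<partial>lborel"
  note [measurable] = borel_measurable_integrable[OF f]
  let ?F = "fourier_integral f"
  have bd: "(\<integral>\<^sup>+x. ennreal ((cmod (?F x))\<^sup>2 * exp (- c * (norm x)\<^sup>2 / 2)) \<partial>lborel) \<le> ennreal ((2 * pi) ^ DIM('a)) * sqnorm lborel f"
    if c: "c > 0" for c
  proof -
    \<comment> \<open>Chosen so that the transform of f times g is the damped squared modulus. The
      multiplication formula then moves the transform onto g, where it becomes the conjugate of a
      Gaussian average of f.\<close>
    define g where "g x = gauss c x * cnj (?F x)" for x
    have gi: "integrable lborel g" unfolding g_def
      by (rule integrable_bounded_mult(2)[OF integrable_gauss[OF c]])
         (auto intro!: cmod_fourier_integral_le[OF f])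
    define s where "s = sqrt (2 * pi / c) ^ DIM('a)"
    have s0: "s \<ge> 0" using c by (simp add: s_def)
    have Fg: "fourier_integral g \<xi> = cnj (complex_of_real s * (LINT y|lborel. f y * gauss (1 / c) (y - \<xi>)))" for \<xi>
    proof -
      have "fourier_integral g \<xi> = cnj (LINT x|lborel. ?F x * (exp (\<i> * of_real (x \<bullet> \<xi>)) * gauss c x))"
        unfolding fourier_integral_def[of g]
        by (subst Bochner_Integration.integral_cnj[symmetric], intro Bochner_Integration.integral_cong)
           (auto simp: g_def exp_cnj gauss_def)
      then show ?thesis by (subst (asm) fourier_gauss_smoothing[OF f c]) (simp add: s_def)
    qed
    have i: "integrable lborel (\<lambda>x. ?F x * g x)"
      by (rule integrable_bounded_mult[OF gi]) (auto intro!: cmod_fourier_integral_le[OF f])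
    have eq: "?F x * g x = complex_of_real ((cmod (?F x))\<^sup>2 * exp (- c * (norm x)\<^sup>2 / 2))" for x
    proof -
      have "?F x * g x = gauss c x * (?F x * cnj (?F x))" by (simp add: g_def mult_ac)
      then show ?thesis by (simp only: complex_norm_square[symmetric] gauss_def of_real_mult mult.commute)
    qed
    have ir: "integrable lborel (\<lambda>x. (cmod (?F x))\<^sup>2 * exp (- c * (norm x)\<^sup>2 / 2))"
      using i unfolding eq by (simp only: complex_of_real_integrable_eq)
    have [measurable]: "(\<lambda>(x, y). gauss (1 / c) (y - x)) \<in> borel_measurable (lborel \<Otimes>\<^sub>M lborel :: ('a \<times> 'a) measure)"
      by measurable
    let ?k = "\<lambda>x y :: 'a. ennreal (exp (- (1 / c) * (norm (y - x))\<^sup>2 / 2))"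
    have tot: "(\<integral>\<^sup>+y. ?k x y \<partial>lborel) = ennreal (sqrt (2 * pi * c) ^ DIM('a))" for x
    proof -
      have "(\<integral>\<^sup>+y. ?k x y \<partial>lborel) = (\<integral>\<^sup>+y. ennreal (cmod (gauss (1 / c) (y - x))) \<partial>lborel)"
        by (simp add: cmod_gauss)
      also have "\<dots> = ennreal (LINT y|lborel. cmod (gauss (1 / c) (y - x)))"
        using integrable_gauss_shift[of "1 / c" x] c by (subst nn_integral_eq_integral) auto
      also have "complex_of_real (LINT y|lborel. cmod (gauss (1 / c) (y - x))) = (LINT y|lborel. gauss (1 / c) (y - x))"
        using integrable_gauss_shift[of "1 / c" x] c by (subst integral_of_real[symmetric]) (auto simp: gauss_nonneg[symmetric])
      then have "(LINT y|lborel. cmod (gauss (1 / c) (y - x))) = sqrt (2 * pi * c) ^ DIM('a)"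
        using gauss_total[of "1 / c" x] c by (metis (no_types) of_real_eq_iff divide_divide_eq_right div_by_1 zero_less_divide_1_iff)
      finally show ?thesis .
    qed
    have "ennreal (LINT x|lborel. (cmod (?F x))\<^sup>2 * exp (- c * (norm x)\<^sup>2 / 2)) = ennreal (cmod (LINT x|lborel. ?F x * g x))"
      unfolding eq by (subst integral_of_real[OF ir]) (simp add: integral_nonneg_AE)
    also have "\<dots> = ennreal (cmod (LINT x|lborel. f x * fourier_integral g x))"
      by (subst fourier_multiplication_formula[OF f gi]) simp
    also have "\<dots> \<le> (\<integral>\<^sup>+x. ennreal (cmod (f x * fourier_integral g x)) \<partial>lborel)"
      by (rule integral_norm_bound_ennreal) (rule integrable_bounded_mult(2)[OF f _ cmod_fourier_integral_le[OF gi]], use gi in simp)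
    also have "\<dots> \<le> (\<integral>\<^sup>+x. ennreal s * (\<integral>\<^sup>+y. ennreal (cmod (f x) * cmod (f y)) * ?k x y \<partial>lborel) \<partial>lborel)"
    proof (rule nn_integral_mono)
      fix x
      have "ennreal (cmod (f x * fourier_integral g x)) = ennreal s * (ennreal (cmod (f x)) * ennreal (cmod (LINT y|lborel. f y * gauss (1 / c) (y - x))))"
        unfolding Fg using s0 by (simp add: norm_mult ennreal_mult' mult_ac)
      also have "\<dots> \<le> ennreal s * (ennreal (cmod (f x)) * (\<integral>\<^sup>+y. ennreal (cmod (f y * gauss (1 / c) (y - x))) \<partial>lborel))"
        by (intro mult_left_mono integral_norm_bound_ennreal integrable_bounded_mult[OF f, where B = 1] cmod_gauss_le_1) (use c in auto)
      also have "ennreal (cmod (f x)) * (\<integral>\<^sup>+y. ennreal (cmod (f y * gauss (1 / c) (y - x))) \<partial>lborel) =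
          (\<integral>\<^sup>+y. ennreal (cmod (f x) * cmod (f y)) * ?k x y \<partial>lborel)"
        by (subst nn_integral_cmult[symmetric]) (auto intro!: nn_integral_cong simp: norm_mult cmod_gauss ennreal_mult' mult.assoc)
      finally show "ennreal (cmod (f x * fourier_integral g x)) \<le> ennreal s * (\<integral>\<^sup>+y. ennreal (cmod (f x) * cmod (f y)) * ?k x y \<partial>lborel)" .
    qed
    also have "\<dots> \<le> (\<integral>\<^sup>+x. ennreal s * (\<integral>\<^sup>+y. (ennreal ((cmod (f x))\<^sup>2 / 2) + ennreal ((cmod (f y))\<^sup>2 / 2)) * ?k x y \<partial>lborel) \<partial>lborel)"
    proof (intro nn_integral_mono mult_left_mono mult_right_mono)
      fix x y
      have "cmod (f x) * cmod (f y) \<le> (cmod (f x))\<^sup>2 / 2 + (cmod (f y))\<^sup>2 / 2"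
        using sum_squares_bound[of "cmod (f x)" "cmod (f y)"] by simp
      then show "ennreal (cmod (f x) * cmod (f y)) \<le> ennreal ((cmod (f x))\<^sup>2 / 2) + ennreal ((cmod (f y))\<^sup>2 / 2)"
        by (simp flip: ennreal_plus add: ennreal_leI)
    qed auto
    also have "\<dots> = ennreal s * ((\<integral>\<^sup>+x. \<integral>\<^sup>+y. ennreal ((cmod (f x))\<^sup>2 / 2) * ?k x y \<partial>lborel \<partial>lborel)
         + (\<integral>\<^sup>+x. \<integral>\<^sup>+y. ennreal ((cmod (f y))\<^sup>2 / 2) * ?k x y \<partial>lborel \<partial>lborel))"
      by (simp add: nn_integral_cmult nn_integral_add distrib_right)
    also have "(\<integral>\<^sup>+x. \<integral>\<^sup>+y. ennreal ((cmod (f y))\<^sup>2 / 2) * ?k x y \<partial>lborel \<partial>lborel)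
       = (\<integral>\<^sup>+y. \<integral>\<^sup>+x. ennreal ((cmod (f y))\<^sup>2 / 2) * ?k x y \<partial>lborel \<partial>lborel)"
      by (rule lborel_pair.Fubini') measurable
    also have "\<dots> = (\<integral>\<^sup>+x. \<integral>\<^sup>+y. ennreal ((cmod (f x))\<^sup>2 / 2) * ?k x y \<partial>lborel \<partial>lborel)"
      by (simp add: norm_minus_commute)
    also have "(\<integral>\<^sup>+x. \<integral>\<^sup>+y. ennreal ((cmod (f x))\<^sup>2 / 2) * ?k x y \<partial>lborel \<partial>lborel) =
        ?f * ennreal (sqrt (2 * pi * c) ^ DIM('a))"
      by (simp add: nn_integral_cmult tot[simplified] nn_integral_multc)
    also have "ennreal s * (\<dots> + \<dots>) = ennreal (s * sqrt (2 * pi * c) ^ DIM('a)) * (?f + ?f)"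
      using s0 c by (simp add: ennreal_mult distrib_left distrib_right mult_ac)
    also have "?f + ?f = sqnorm lborel f"
      by (subst nn_integral_add[symmetric]) (auto simp flip: ennreal_plus)
    also have "s * sqrt (2 * pi * c) ^ DIM('a) = (2 * pi) ^ DIM('a)"
    proof -
      have "sqrt (2 * pi / c) * sqrt (2 * pi * c) = sqrt ((2 * pi)\<^sup>2)"
        using c by (simp flip: real_sqrt_mult add: power2_eq_square)
      then have "sqrt (2 * pi / c) * sqrt (2 * pi * c) = 2 * pi" by (simp only: real_sqrt_abs) simp
      then show ?thesis unfolding s_def power_mult_distrib[symmetric] by simp
    qed
    finally show ?thesis using ir by (subst nn_integral_eq_integral) auto
  qed
  have "sqnorm lborel ?F = (\<integral>\<^sup>+x. (SUP k. ennreal ((cmod (?F x))\<^sup>2 * exp (- (1 / real (Suc k)) * (norm x)\<^sup>2 / 2))) \<partial>lborel)"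
  proof (rule nn_integral_cong, rule LIMSEQ_unique)
    fix x :: 'a
    let ?h = "\<lambda>k. ennreal ((cmod (?F x))\<^sup>2 * exp (- (1 / real (Suc k)) * (norm x)\<^sup>2 / 2))"
    have "(\<lambda>k. (cmod (?F x))\<^sup>2 * exp (- (1 / real (Suc k)) * (norm x)\<^sup>2 / 2)) \<longlonglongrightarrow> (cmod (?F x))\<^sup>2 * exp (- 0 * (norm x)\<^sup>2 / 2)"
      by (intro tendsto_intros LIMSEQ_Suc[OF lim_1_over_n]) auto
    then show "?h \<longlonglongrightarrow> ennreal ((cmod (?F x))\<^sup>2)" by (simp add: tendsto_ennrealI)
    have "incseq ?h"
      by (intro monoI ennreal_leI mult_left_mono) (auto simp: frac_le mult_right_mono divide_right_mono)
    then show "?h \<longlonglongrightarrow> (SUP k. ?h k)" by (rule LIMSEQ_SUP)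
  qed
  also have "\<dots> = (SUP k. \<integral>\<^sup>+x. ennreal ((cmod (?F x))\<^sup>2 * exp (- (1 / real (Suc k)) * (norm x)\<^sup>2 / 2)) \<partial>lborel)"
    by (intro nn_integral_monotone_convergence_SUP)
       (auto intro!: monoI le_funI ennreal_leI mult_left_mono simp: frac_le mult_right_mono divide_right_mono)
  also have "\<dots> \<le> ennreal ((2 * pi) ^ DIM('a)) * sqnorm lborel f"
    by (intro SUP_least bd) simp
  finally show ?thesis .
qed

lemma four_power_eq: "(4::real) ^ j = (2 ^ j)\<^sup>2"
  by (simp add: power2_eq_square flip: power_mult_distrib)

text \<open>Riesz-Fischer without passing to a subsequence. Squared increments of order 8^-j remain
  summable after multiplication by 4^j. Where that sum S is finite, the increments are at most sqrt
  S times 2^-j, and the geometric tail gives both the pointwise limit and the limit in mean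
  square.\<close>

lemma L2_fast_convergence:
  fixes h :: "nat \<Rightarrow> 'a \<Rightarrow> complex"
  assumes [measurable]: "\<And>j. h j \<in> borel_measurable M"
    and C: "C < \<infinity>" and b: "\<And>j. sqnorm M (\<lambda>x. h (Suc j) x - h j x) \<le> C * ennreal ((1 / 8) ^ j)"
  shows "AE x in M. convergent (\<lambda>j. h j x)"
    and "(\<lambda>j. sqnorm M (\<lambda>x. h j x - lim (\<lambda>j. h j x))) \<longlonglongrightarrow> 0"
proof -
  let ?g = "\<lambda>x. lim (\<lambda>j. h j x)"
  let ?f = "\<lambda>j x. 4 ^ j * (cmod (h (Suc j) x - h j x))\<^sup>2"
  define S where "S x = (\<Sum>j. ennreal (?f j x))" for x
  have [measurable]: "S \<in> borel_measurable M" unfolding S_def[abs_def] by measurable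
  have "(\<integral>\<^sup>+x. S x \<partial>M) = (\<Sum>j. \<integral>\<^sup>+x. ennreal (?f j x) \<partial>M)"
    unfolding S_def by (rule nn_integral_suminf) measurable
  also have "\<dots> \<le> (\<Sum>j. C * ennreal ((1 / 2) ^ j))"
  proof (rule suminf_le)
    fix j
    have "(\<integral>\<^sup>+x. ennreal (?f j x) \<partial>M) = ennreal (4 ^ j) * sqnorm M (\<lambda>x. h (Suc j) x - h j x)"
      by (simp add: ennreal_mult' nn_integral_cmult)
    also have "\<dots> \<le> ennreal (4 ^ j) * (C * ennreal ((1 / 8) ^ j))" by (intro mult_left_mono b) auto
    also have "\<dots> = C * ennreal ((1 / 2) ^ j)"
      by (simp add: mult.left_commute ennreal_mult'[symmetric] power_mult_distrib[symmetric] del: ennreal_power ennreal_numeral)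
    finally show "(\<integral>\<^sup>+x. ennreal (?f j x) \<partial>M) \<le> C * ennreal ((1 / 2) ^ j)" .
  qed auto
  also have "\<dots> = C * (\<Sum>j. ennreal ((1 / 2) ^ j))" by (rule ennreal_suminf_cmult)
  also have "(\<Sum>j. ennreal ((1 / 2) ^ j)) = ennreal 2"
    by (subst suminf_ennreal2) (auto simp: suminf_geometric intro!: summable_geometric)
  finally have IS: "(\<integral>\<^sup>+x. S x \<partial>M) \<le> C * ennreal 2" .
  also have "\<dots> < \<infinity>" using C by (auto simp: ennreal_mult_less_top)
  finally have "AE x in M. S x \<noteq> \<infinity>" by (intro nn_integral_noteq_infinite) auto
  then have key: "AE x in M. convergent (\<lambda>j. h j x) \<and> (\<forall>j. ennreal ((cmod (h j x - ?g x))\<^sup>2) \<le> ennreal (4 / 4 ^ j) * S x)"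
  proof (rule AE_mp, intro AE_I2 impI)
    fix x assume "S x \<noteq> \<infinity>"
    then obtain c where c: "c \<ge> 0" "S x = ennreal c" by (cases "S x") auto
    have d: "cmod (h (Suc j) x - h j x) \<le> sqrt c * (1 / 2) ^ j" for j
    proof -
      have "ennreal (?f j x) \<le> S x"
      proof -
        define f where "f = (\<lambda>j. ennreal (?f j x))"
        have "sum f {j} \<le> suminf f" by (rule sum_le_suminf) auto
        then show ?thesis unfolding S_def f_def[symmetric] by (simp add: f_def)
      qed
      then have "?f j x \<le> c"
        unfolding c(2) using c(1) by (subst (asm) ennreal_le_iff) auto
      moreover have "?f j x = (2 ^ j * cmod (h (Suc j) x - h j x))\<^sup>2"
        by (simp add: power_mult_distrib four_power_eq)
      ultimately have "2 ^ j * cmod (h (Suc j) x - h j x) \<le> sqrt c" by (simp add: real_le_rsqrt)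
      then show ?thesis by (simp add: field_simps)
    qed
    have sm: "summable (\<lambda>j. sqrt c * (1 / 2) ^ j)" by (intro summable_mult summable_geometric) auto
    have sn: "summable (\<lambda>j. cmod (h (Suc j) x - h j x))"
      by (rule summable_comparison_test'[OF sm]) (use d in auto)
    then have s: "summable (\<lambda>j. h (Suc j) x - h j x)" by (rule summable_norm_cancel)
    then have cv: "convergent (\<lambda>j. h j x)"
    proof -
      have "convergent (\<lambda>n. \<Sum>i<n. h (Suc i) x - h i x)" using s by (simp add: summable_iff_convergent)
      then have "convergent (\<lambda>n. h n x + (- h 0 x))"
        using sum_lessThan_telescope[of "\<lambda>i. h i x"] by simp
      then show ?thesis by (simp only: convergent_add_const_right_iff)
    qed
    show "convergent (\<lambda>j. h j x) \<and> (\<forall>j. ennreal ((cmod (h j x - ?g x))\<^sup>2) \<le> ennreal (4 / 4 ^ j) * S x)"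
    proof (intro conjI cv allI)
      fix j
      have L: "(\<lambda>j. h j x) \<longlonglongrightarrow> ?g x" using cv convergent_LIMSEQ_iff by blast
      have "cmod (h (j + n) x - h j x) \<le> 2 * sqrt c * (1 / 2) ^ j" for n
      proof -
        have "h (j + n) x - h j x = (\<Sum>i<n. h (j + Suc i) x - h (j + i) x)"
          by (subst sum_lessThan_telescope) simp
        also have "cmod \<dots> \<le> (\<Sum>i<n. sqrt c * (1 / 2) ^ (j + i))"
          by (rule order_trans[OF norm_sum]) (intro sum_mono, use d in simp)
        also have "\<dots> = sqrt c * (1 / 2) ^ j * (\<Sum>i<n. (1 / 2) ^ i)"
          by (simp add: power_add sum_distrib_left mult_ac)
        also have "\<dots> \<le> sqrt c * (1 / 2) ^ j * 2"
        proof (rule mult_left_mono)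
          have "(\<Sum>i<n. (1 / 2) ^ i) = 2 - 2 * (1 / 2::real) ^ n" by (induction n) auto
          moreover have "(0::real) \<le> (1 / 2) ^ n" by simp
          ultimately show "(\<Sum>i<n. (1 / 2) ^ i) \<le> (2::real)" by linarith
        qed (use c in simp)
        finally show ?thesis by simp
      qed
      moreover have "(\<lambda>n. cmod (h (j + n) x - h j x)) \<longlonglongrightarrow> cmod (?g x - h j x)"
        using LIMSEQ_ignore_initial_segment[OF L, of j] by (intro tendsto_intros) (simp add: add.commute)
      ultimately have "cmod (?g x - h j x) \<le> 2 * sqrt c * (1 / 2) ^ j"
        by (intro LIMSEQ_le_const2) auto
      then have "(cmod (h j x - ?g x))\<^sup>2 \<le> (2 * sqrt c * (1 / 2) ^ j)\<^sup>2"
        by (intro power_mono) (auto simp: norm_minus_commute)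
      also have "\<dots> = 4 / 4 ^ j * c"
        using c(1) by (simp add: power_mult_distrib power_divide four_power_eq)
      finally show "ennreal ((cmod (h j x - ?g x))\<^sup>2) \<le> ennreal (4 / 4 ^ j) * S x"
        unfolding c(2) using c(1) by (subst ennreal_mult'[symmetric]) (auto intro: ennreal_leI)
    qed
  qed
  then show "AE x in M. convergent (\<lambda>j. h j x)" by auto
  have le: "sqnorm M (\<lambda>x. h j x - ?g x) \<le> ennreal (4 / 4 ^ j) * (C * ennreal 2)" for j
  proof -
    have "sqnorm M (\<lambda>x. h j x - ?g x) \<le> (\<integral>\<^sup>+x. ennreal (4 / 4 ^ j) * S x \<partial>M)"
      using key by (intro nn_integral_mono_AE) auto
    also have "\<dots> \<le> ennreal (4 / 4 ^ j) * (C * ennreal 2)"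
      by (subst nn_integral_cmult) (use IS in \<open>auto intro!: mult_left_mono\<close>)
    finally show ?thesis .
  qed
  have "(\<lambda>j. 4 * (1 / 4) ^ j :: real) \<longlonglongrightarrow> 4 * 0" by (intro tendsto_intros LIMSEQ_power_zero) auto
  then have "(\<lambda>j. ennreal (4 / 4 ^ j)) \<longlonglongrightarrow> 0"
    using tendsto_ennrealI by (fastforce simp: power_divide)
  then have "(\<lambda>j. ennreal (4 / 4 ^ j) * (C * ennreal 2)) \<longlonglongrightarrow> 0 * (C * ennreal 2)"
    using C by (intro tendsto_mult_ennreal tendsto_const) (auto simp: ennreal_mult_eq_top_iff)
  then have U: "(\<lambda>j. ennreal (4 / 4 ^ j) * (C * ennreal 2)) \<longlonglongrightarrow> 0" by (simp only: mult_zero_left)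
  show "(\<lambda>j. sqnorm M (\<lambda>x. h j x - ?g x)) \<longlonglongrightarrow> 0"
    by (rule tendsto_sandwich[OF _ _ tendsto_const U]) (intro always_eventually allI zero_le le)+
qed

section \<open>Rapidly decreasing and Schwartz functions\<close>

text \<open>The decay half of the Schwartz condition. It suffices for pairing with tempered
  functions and, unlike smoothness, survives multiplication by bounded measurable functions.\<close>

definition rapid :: "('a::euclidean_space \<Rightarrow> complex) \<Rightarrow> bool" where
  "rapid f \<longleftrightarrow> f \<in> borel_measurable borel \<and> (\<forall>k::nat. \<exists>C. \<forall>x. (1 + norm x) ^ k * cmod (f x) \<le> C)"

lemma rapid_measurable [measurable_dest]: "rapid f \<Longrightarrow> f \<in> borel_measurable borel"
  by (simp add: rapid_def)

lemma rapidE: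
  assumes "rapid f"
  obtains C where "C \<ge> 0" "\<And>x. cmod (f x) \<le> C / (1 + norm x) ^ k"
proof -
  obtain C where C: "\<And>x. (1 + norm x) ^ k * cmod (f x) \<le> C" using assms unfolding rapid_def by blast
  have "0 \<le> (1 + norm (0::'a)) ^ k * cmod (f 0)" by simp
  then have "C \<ge> 0" using C[of 0] by linarith
  moreover have "cmod (f x) \<le> C / (1 + norm x) ^ k" for x
  proof -
    have "0 < (1 + norm x) ^ k" by (intro zero_less_power add_pos_nonneg) auto
    then show ?thesis using C[of x] by (simp add: field_simps)
  qed
  ultimately show ?thesis using that by blast
qed

lemma integrable_inverse_one_plus_sq: "integrable lborel (\<lambda>x::real. 1 / (1 + x\<^sup>2))"
  using integrable_inverse_1_plus_square by (simp add: set_integrable_def inverse_eq_divide)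

text \<open>The exponent 2 d comes from comparison with the product of d one-dimensional factors
  1/(1 + t^2), each at least (1 + norm x)^-2.\<close>

lemma integrable_inverse_poly:
  "integrable lborel (\<lambda>x::'a::euclidean_space. 1 / (1 + norm x) ^ (2 * DIM('a)))"
proof -
  let ?f = "\<lambda>x. \<Prod>b\<in>Basis. complex_of_real (1 / (1 + (x \<bullet> b)\<^sup>2))"
  have "integrable lborel (\<lambda>x::'a. ?f x)"
    by (rule lborel_prod_Basis) (intro integrable_of_real integrable_inverse_one_plus_sq)
  then show ?thesis
  proof (rule Bochner_Integration.integrable_bound, goal_cases)
    case 2
    show ?case
    proof (rule AE_I2)
      fix x :: 'a
      have le: "1 + (x \<bullet> b)\<^sup>2 \<le> (1 + norm x)\<^sup>2" if "b \<in> Basis" for b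
      proof -
        have "(x \<bullet> b)\<^sup>2 \<le> (norm x)\<^sup>2"
          using Basis_le_norm[OF that, of x] by (simp add: abs_le_square_iff[symmetric])
        also have "1 + (norm x)\<^sup>2 \<le> (1 + norm x)\<^sup>2" by (simp add: power2_sum)
        finally show ?thesis by simp
      qed
      have "(\<Prod>b\<in>(Basis::'a set). 1 / (1 + norm x)\<^sup>2) \<le> (\<Prod>b\<in>Basis. 1 / (1 + (x \<bullet> b)\<^sup>2))"
        by (intro prod_mono conjI frac_le le add_pos_nonneg) auto
      then have "1 / (1 + norm x) ^ (2 * DIM('a)) \<le> (\<Prod>b\<in>Basis. 1 / (1 + (x \<bullet> b)\<^sup>2))"
        by (simp add: power_divide flip: power_mult)
      also have "\<dots> = norm (?f x)"
        unfolding prod_norm[symmetric] by (intro prod.cong refl) (simp add: norm_divide add_nonneg_nonneg flip: of_real_power of_real_add)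
      finally show "norm (1 / (1 + norm x) ^ (2 * DIM('a))) \<le> norm (?f x)"
        by simp
    qed
  qed measurable
qed

lemma rapid_bounded:
  assumes "rapid f" obtains C where "\<And>x. cmod (f x) \<le> C"
  using rapidE[OF assms, of 0] by (metis div_by_1 power_0)

lemma tempered_rapid_integrable:
  assumes h: "tempered_function h" and f: "rapid f"
  shows "integrable lborel (\<lambda>x. h x * f x)" "integrable lborel (\<lambda>x. f x * h x)"
proof -
  obtain N where i: "integrable lborel (\<lambda>x. h x /\<^sub>R (1 + norm x) ^ N)" and [measurable]: "h \<in> borel_measurable borel"
    using h unfolding tempered_function_def by blast
  note [measurable] = rapid_measurable[OF f]
  obtain C where C: "C \<ge> 0" "\<And>x. cmod (f x) \<le> C / (1 + norm x) ^ N" using rapidE[OF f] by blast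
  show "integrable lborel (\<lambda>x. h x * f x)"
  proof (rule Bochner_Integration.integrable_bound[OF integrable_mult_right[OF i, of "complex_of_real C"]])
    show "AE x in lborel. norm (h x * f x) \<le> norm (complex_of_real C * (h x /\<^sub>R (1 + norm x) ^ N))"
    proof (rule AE_I2)
      fix x
      have "cmod (h x) * cmod (f x) \<le> cmod (h x) * (C / (1 + norm x) ^ N)"
        by (intro mult_left_mono C) auto
      moreover have "0 \<le> (1 + norm x) ^ N" by simp
      ultimately show "norm (h x * f x) \<le> norm (complex_of_real C * (h x /\<^sub>R (1 + norm x) ^ N))"
        using C(1) by (simp add: norm_mult divide_inverse mult_ac)
    qed
  qed measurable
  then show "integrable lborel (\<lambda>x. f x * h x)" by (simp add: mult.commute)
qed

lemma tempered_const: "tempered_function (\<lambda>x::'a::euclidean_space. c)"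
  unfolding tempered_function_def
proof (intro conjI exI)
  show "integrable lborel (\<lambda>x::'a. c /\<^sub>R (1 + norm x) ^ (2 * DIM('a)))"
    using integrable_scaleR_left[OF integrable_inverse_poly[where 'a='a], of c] by (simp add: inverse_eq_divide)
qed simp

lemma rapid_integrable: "rapid f \<Longrightarrow> integrable lborel f"
  using tempered_rapid_integrable(1)[OF tempered_const, of f 1] by simp

lemma rapid_mult_bounded:
  assumes f: "rapid f" and [measurable]: "g \<in> borel_measurable borel" and B: "\<And>x. cmod (g x) \<le> B"
  shows "rapid (\<lambda>x. g x * f x)"
  unfolding rapid_def
proof (intro conjI allI)
  note [measurable] = rapid_measurable[OF f]
  show "(\<lambda>x. g x * f x) \<in> borel_measurable borel" by measurable
  fix k
  obtain C where C: "\<And>x. (1 + norm x) ^ k * cmod (f x) \<le> C" using f unfolding rapid_def by blast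
  have "B \<ge> 0" using B[of 0] norm_ge_zero order_trans by blast
  then have "(1 + norm x) ^ k * cmod (g x * f x) \<le> B * C" for x
    using mult_mono[OF B[of x] C[of x]] by (simp add: norm_mult mult_ac)
  then show "\<exists>C. \<forall>x. (1 + norm x) ^ k * cmod (g x * f x) \<le> C" by blast
qed

lemma rapid_L2: assumes f: "rapid f" shows "f \<in> L2"
proof -
  note [measurable] = rapid_measurable[OF f]
  obtain B where B: "\<And>x. cmod (f x) \<le> B" using rapid_bounded[OF f] by blast
  have "integrable lborel (\<lambda>x. cnj (f x) * f x)"
    by (intro rapid_integrable rapid_mult_bounded[OF f, where B = B]) (use B in auto)
  then have "integrable lborel (\<lambda>x. complex_of_real ((cmod (f x))\<^sup>2))"
    by (simp only: complex_norm_square mult.commute)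
  then show ?thesis unfolding L2_def by (simp only: complex_of_real_integrable_eq) simp
qed

lemma schwartzD:
  assumes "schwartz \<psi>"
  obtains D where "\<And>x. (\<psi> has_derivative D x) (at x)" "\<And>b. b \<in> Basis \<Longrightarrow> schwartz (\<lambda>x. D x b)"
    "\<And>k::nat. bounded (range (\<lambda>x. norm x ^ k *\<^sub>R \<psi> x))"
  using assms by (cases rule: schwartz.cases) auto

lemma schwartz_continuous: "schwartz \<psi> \<Longrightarrow> continuous_on UNIV \<psi>"
  by (meson continuous_at_imp_continuous_on has_derivative_continuous schwartzD)

lemma schwartz_rapid: assumes "schwartz \<psi>" shows "rapid \<psi>"
  unfolding rapid_def
proof (intro conjI allI)
  show "\<psi> \<in> borel_measurable borel" by (rule borel_measurable_continuous_onI[OF schwartz_continuous[OF assms]])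
  fix k :: nat
  have b: "bounded (range (\<lambda>x. norm x ^ j *\<^sub>R \<psi> x))" for j :: nat using assms schwartzD by metis
  obtain B0 where B0: "\<And>x. norm (norm x ^ 0 *\<^sub>R \<psi> x) \<le> B0" using b[of 0] unfolding bounded_iff by auto
  obtain B1 where B1: "\<And>x. norm (norm x ^ k *\<^sub>R \<psi> x) \<le> B1" using b[of k] unfolding bounded_iff by auto
  have "(1 + norm x) ^ k * cmod (\<psi> x) \<le> 2 ^ k * (B0 + B1)" for x
  proof -
    have "(1 + norm x) ^ k \<le> (2 * max 1 (norm x)) ^ k" by (intro power_mono) auto
    also have "\<dots> \<le> 2 ^ k * (1 + norm x ^ k)"
      unfolding power_mult_distrib by (intro mult_left_mono) (auto simp: max_def)
    finally have "(1 + norm x) ^ k * cmod (\<psi> x) \<le> 2 ^ k * (1 + norm x ^ k) * cmod (\<psi> x)"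
      by (rule mult_right_mono) simp
    also have "\<dots> = 2 ^ k * (norm (norm x ^ 0 *\<^sub>R \<psi> x) + norm (norm x ^ k *\<^sub>R \<psi> x))"
      by (simp add: algebra_simps)
    also have "\<dots> \<le> 2 ^ k * (B0 + B1)" by (intro mult_left_mono add_mono B0 B1) auto
    finally show ?thesis .
  qed
  then show "\<exists>C. \<forall>x. (1 + norm x) ^ k * cmod (\<psi> x) \<le> C" by blast
qed

lemma lborel_integral_translate:
  fixes f :: "'a::euclidean_space \<Rightarrow> complex"
  assumes [measurable]: "f \<in> borel_measurable borel"
  shows "(LINT x|lborel. f (x + t)) = (LINT x|lborel. f x)"
  using lborel_integral_affine[of 1 f t] by (simp add: add.commute)

lemma lborel_integrable_translate:
  fixes f :: "'a::euclidean_space \<Rightarrow> complex"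
  assumes f: "integrable lborel f"
  shows "integrable lborel (\<lambda>x. f (x + t))"
proof -
  note [measurable] = borel_measurable_integrable[OF f]
  have "integrable (distr lborel borel (\<lambda>x. t + x)) f"
    using f by (simp only: lborel_distr_plus)
  then show ?thesis by (subst (asm) integrable_distr_eq) (auto simp: add.commute)
qed

text \<open>Writing \<open>h (x + v) - h x\<close> as an integral of the derivative along the segment, both
  sides integrate to translates of one and the same integral.\<close>

lemma integral_derivative_zero:
  fixes h :: "'a::euclidean_space \<Rightarrow> complex"
  assumes D: "\<And>x. (h has_derivative D x) (at x)" and hi: "integrable lborel h"
    and Di: "integrable lborel (\<lambda>x. D x v)" and Dc: "continuous_on UNIV (\<lambda>x. D x v)"
  shows "(LINT x|lborel. D x v) = 0"
proof -
  let ?g = "\<lambda>t g x. indicator {0..1::real} t *\<^sub>R g (x + t *\<^sub>R v)"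
  let ?f = "\<lambda>t x g. case (t, x) of (t, x) \<Rightarrow> indicator {0..1::real} t *\<^sub>R g (x + t *\<^sub>R v)"
  note [measurable] = borel_measurable_integrable[OF hi] borel_measurable_integrable[OF Di]
  define g where "g x = D x v" for x
  have [measurable]: "g \<in> borel_measurable borel" and gi: "integrable lborel g" using Di by (auto simp: g_def[abs_def])
  have ftc: "(LINT t|lborel. indicator {0..1} t *\<^sub>R g (x + t *\<^sub>R v)) = h (x + v) - h x" for x
  proof -
    have "(LINT t|lborel. indicator {0..1} t *\<^sub>R g (x + t *\<^sub>R v)) = h (x + 1 *\<^sub>R v) - h (x + 0 *\<^sub>R v)"
    proof (rule integral_FTC_Icc)
      fix t :: real
      have "((\<lambda>t. h (x + t *\<^sub>R v)) has_derivative (\<lambda>s. D (x + t *\<^sub>R v) (s *\<^sub>R v))) (at t within {0..1})"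
        by (rule has_derivative_compose[OF _ D, of "\<lambda>t. x + t *\<^sub>R v"]) (auto intro!: derivative_eq_intros)
      moreover have "D (x + t *\<^sub>R v) (s *\<^sub>R v) = s *\<^sub>R g (x + t *\<^sub>R v)" for s
        unfolding g_def using has_derivative_bounded_linear[OF D] by (simp add: linear_simps)
      ultimately show "((\<lambda>t. h (x + t *\<^sub>R v)) has_vector_derivative g (x + t *\<^sub>R v)) (at t within {0..1})"
        by (simp add: has_vector_derivative_def)
    next
      have "continuous_on {0..1} (\<lambda>t. g (x + t *\<^sub>R v))"
        by (rule continuous_on_compose2[OF Dc[folded g_def]]) (auto intro!: continuous_intros)
      then show "continuous_on {0..1} (\<lambda>t. g (x + t *\<^sub>R v))" .
    qed simp
    then show ?thesis by simp
  qed
  have i: "integrable (lborel \<Otimes>\<^sub>M lborel) (\<lambda>(t, x). ?g t g x)"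
  proof (rule lborel_pair.Fubini_integrable)
    show "AE t in lborel. integrable lborel (\<lambda>x. ?f t x g)"
      using lborel_integrable_translate[OF gi] by auto
    have "(LINT x|lborel. norm (?f t x g)) =
        indicator {0..1} t * (LINT x|lborel. cmod (g x))" for t
    proof -
      have "complex_of_real (LINT x|lborel. cmod (g (x + t *\<^sub>R v))) = complex_of_real (LINT x|lborel. cmod (g x))"
        using lborel_integral_translate[of "\<lambda>x. complex_of_real (cmod (g x))" "t *\<^sub>R v"] by simp
      then show ?thesis by (simp only: of_real_eq_iff) simp
    qed
    then show "integrable lborel (\<lambda>t. LINT x|lborel. norm (?f t x g))"
      by (simp only:) (intro integrable_mult_left integrable_real_indicator; simp)
  qed measurable
  have "(LINT x|lborel. g x) = (LINT t|lborel. indicator {0..1::real} t *\<^sub>R (LINT x|lborel. g x))"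
    by simp
  also have "\<dots> = (LINT t|lborel. LINT x|lborel. ?g t g x)"
    by (simp add: lborel_integral_translate)
  also have "\<dots> = (LINT x|lborel. LINT t|lborel. ?g t g x)"
    by (rule lborel_pair.Fubini_integral[OF i, symmetric])
  also have "\<dots> = (LINT x|lborel. h (x + v)) - (LINT x|lborel. h x)"
    unfolding ftc by (rule Bochner_Integration.integral_diff[OF lborel_integrable_translate[OF hi] hi])
  also have "\<dots> = 0" by (simp add: lborel_integral_translate)
  finally show ?thesis by (simp add: g_def)
qed

lemma has_derivative_cexp:
  fixes g :: "'a::real_normed_vector \<Rightarrow> complex"
  assumes "(g has_derivative g') (at x)"
  shows "((\<lambda>x. exp (g x)) has_derivative (\<lambda>u. g' u * exp (g x))) (at x)"
  using has_derivative_compose[OF assms has_field_derivative_imp_has_derivative[OF DERIV_exp]]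
  by (simp add: mult.commute)

text \<open>Integration by parts, in the form that the derivative of the product of \<psi> with the
  exponential has integral 0.\<close>

lemma fourier_integral_derivative:
  fixes \<psi> :: "'a::euclidean_space \<Rightarrow> complex"
  assumes D: "\<And>x. (\<psi> has_derivative D x) (at x)" and i: "integrable lborel \<psi>"
    and Di: "integrable lborel (\<lambda>x. D x v)" and Dc: "continuous_on UNIV (\<lambda>x. D x v)"
  shows "fourier_integral (\<lambda>x. D x v) \<xi> = \<i> * of_real (\<xi> \<bullet> v) * fourier_integral \<psi> \<xi>"
proof -
  let ?f = "\<lambda>u. complex_of_real (u \<bullet> \<xi>)"
  let ?e = "\<lambda>x. exp (- (\<i> * of_real (x \<bullet> \<xi>)))"
  have ct: "continuous_on UNIV \<psi>"
    by (meson D continuous_at_imp_continuous_on has_derivative_continuous)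
  have e: "(?e has_derivative (\<lambda>u. - (\<i> * ?f u) * ?e x)) (at x)" for x
    by (rule has_derivative_cexp) (auto intro!: derivative_eq_intros)
  have "(LINT x|lborel. (\<lambda>u. ?e x * D x u - \<i> * ?f u * (?e x * \<psi> x)) v) = 0"
  proof (rule integral_derivative_zero[where h = "\<lambda>x. ?e x * \<psi> x" and
        D = "\<lambda>x u. ?e x * D x u - \<i> * ?f u * (?e x * \<psi> x)"])
    show "integrable lborel (\<lambda>x. ?e x * \<psi> x)" by (rule integrable_exp_i_mult[OF i])
    show "((\<lambda>x. ?e x * \<psi> x) has_derivative (\<lambda>u. ?e x * D x u - \<i> * ?f u * (?e x * \<psi> x))) (at x)" for x
      by (rule has_derivative_eq_rhs[OF has_derivative_mult[OF e D]]) (auto simp: algebra_simps)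
    show "integrable lborel (\<lambda>x. ?e x * D x v - \<i> * of_real (v \<bullet> \<xi>) * (?e x * \<psi> x))"
      by (intro Bochner_Integration.integrable_diff integrable_exp_i_mult[OF Di] integrable_mult_right integrable_exp_i_mult[OF i])
    show "continuous_on UNIV (\<lambda>x. ?e x * D x v - \<i> * of_real (v \<bullet> \<xi>) * (?e x * \<psi> x))"
      by (intro continuous_intros Dc ct)
  qed
  then have "(LINT x|lborel. ?e x * D x v) - (LINT x|lborel. \<i> * of_real (v \<bullet> \<xi>) * (?e x * \<psi> x)) = 0"
    by (subst (asm) Bochner_Integration.integral_diff) (auto intro: integrable_exp_i_mult[OF Di] integrable_mult_right integrable_exp_i_mult[OF i])
  then show ?thesis by (simp add: fourier_integral_def inner_commute)
qed

text \<open>Each power of a coordinate is paid for by one derivative of \<psi>. Partial derivatives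
  of Schwartz functions are Schwartz, hence the induction over all \<psi> at once.\<close>

lemma schwartz_fourier_coordinate_decay:
  fixes \<psi> :: "'a::euclidean_space \<Rightarrow> complex"
  assumes "schwartz \<psi>" and b: "b \<in> Basis"
  shows "\<exists>C. \<forall>\<xi>. \<bar>\<xi> \<bullet> b\<bar> ^ k * cmod (fourier_integral \<psi> \<xi>) \<le> C"
  using assms(1)
proof (induction k arbitrary: \<psi>)
  case 0
  then show ?case using cmod_fourier_integral_le[OF rapid_integrable[OF schwartz_rapid]] by auto
next
  case (Suc k)
  obtain D where D: "\<And>x. (\<psi> has_derivative D x) (at x)" and s: "schwartz (\<lambda>x. D x b)"
    using schwartzD[OF Suc.prems] b by metis
  have "fourier_integral (\<lambda>x. D x b) \<xi> = \<i> * of_real (\<xi> \<bullet> b) * fourier_integral \<psi> \<xi>" for \<xi>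
    by (rule fourier_integral_derivative[OF D])
       (use Suc.prems s in \<open>auto intro: rapid_integrable schwartz_rapid schwartz_continuous\<close>)
  then have "\<bar>\<xi> \<bullet> b\<bar> ^ Suc k * cmod (fourier_integral \<psi> \<xi>) = \<bar>\<xi> \<bullet> b\<bar> ^ k * cmod (fourier_integral (\<lambda>x. D x b) \<xi>)" for \<xi>
    by (simp add: norm_mult)
  then show ?case using Suc.IH[OF s] by (simp only:)
qed

text \<open>Rapid decay of the transform is all that its pairings with tempered functions ask for;
  its differentiability is not claimed.\<close>

lemma schwartz_fourier_rapid:
  fixes \<psi> :: "'a::euclidean_space \<Rightarrow> complex"
  assumes s: "schwartz \<psi>"
  shows "rapid (fourier_integral \<psi>)"
  unfolding rapid_def
proof (intro conjI allI)
  let ?f = "\<lambda>\<xi>. cmod (fourier_integral \<psi> \<xi>)"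
  note [measurable] = rapid_measurable[OF schwartz_rapid[OF s]]
  show "fourier_integral \<psi> \<in> borel_measurable borel" by measurable
  fix k :: nat
  obtain C0 where C0: "\<And>\<xi>. ?f \<xi> \<le> C0"
    using cmod_fourier_integral_le[OF rapid_integrable[OF schwartz_rapid[OF s]]] by blast
  obtain C where C: "\<And>b \<xi>. b \<in> Basis \<Longrightarrow> \<bar>\<xi> \<bullet> b\<bar> ^ k * ?f \<xi> \<le> C b"
    using schwartz_fourier_coordinate_decay[OF s, of _ k] by metis
  let ?n = "real DIM('a)"
  have "(1 + norm \<xi>) ^ k * ?f \<xi> \<le> 2 ^ k * (C0 + ?n ^ k * (\<Sum>b\<in>Basis. C b))" for \<xi>
  proof -
    \<comment> \<open>The largest coordinate carries at least the fraction 1/d of the norm, so decay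
      in the coordinates yields decay in the norm.\<close>
    have "\<exists>b\<in>Basis. norm \<xi> \<le> ?n * \<bar>\<xi> \<bullet> b\<bar>"
    proof (rule ccontr)
      assume "\<not> (\<exists>b\<in>Basis. norm \<xi> \<le> ?n * \<bar>\<xi> \<bullet> b\<bar>)"
      then have "\<bar>\<xi> \<bullet> b\<bar> < norm \<xi> / ?n" if "b \<in> Basis" for b using that by (auto simp: field_simps not_le)
      then have "(\<Sum>b\<in>Basis. \<bar>\<xi> \<bullet> b\<bar>) < (\<Sum>b\<in>(Basis::'a set). norm \<xi> / ?n)" by (intro sum_strict_mono) auto
      then show False using norm_le_l1[of \<xi>] by simp
    qed
    then obtain b where b: "b \<in> Basis" "norm \<xi> \<le> ?n * \<bar>\<xi> \<bullet> b\<bar>" by blast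
    have "(1 + norm \<xi>) ^ k \<le> (2 * max 1 (norm \<xi>)) ^ k" by (intro power_mono) auto
    also have "\<dots> \<le> 2 ^ k * (1 + norm \<xi> ^ k)"
      unfolding power_mult_distrib by (intro mult_left_mono) (auto simp: max_def)
    also have "\<dots> \<le> 2 ^ k * (1 + (?n * \<bar>\<xi> \<bullet> b\<bar>) ^ k)" by (intro mult_left_mono add_left_mono power_mono b) auto
    finally have "(1 + norm \<xi>) ^ k * ?f \<xi> \<le> 2 ^ k * (1 + (?n * \<bar>\<xi> \<bullet> b\<bar>) ^ k) * ?f \<xi>"
      by (rule mult_right_mono) simp
    also have "\<dots> = 2 ^ k * (?f \<xi> + ?n ^ k * (\<bar>\<xi> \<bullet> b\<bar> ^ k * ?f \<xi>))"
      by (simp add: algebra_simps power_mult_distrib)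
    also have "\<dots> \<le> 2 ^ k * (C0 + ?n ^ k * C b)"
      by (intro mult_left_mono add_mono C0 C b) auto
    also have "\<dots> \<le> 2 ^ k * (C0 + ?n ^ k * (\<Sum>b\<in>Basis. C b))"
    proof (intro mult_left_mono add_left_mono)
      have "C b \<ge> 0" if "b \<in> Basis" for b
        using C[OF that, of 0] by (meson norm_ge_zero order_trans zero_le_mult_iff zero_le_power_abs)
      then show "C b \<le> (\<Sum>b\<in>Basis. C b)" using b by (intro member_le_sum) auto
    qed auto
    finally show ?thesis .
  qed
  then show "\<exists>C. \<forall>\<xi>. (1 + norm \<xi>) ^ k * ?f \<xi> \<le> C" by blast
qed

text \<open>The factors that differentiation of a Gaussian produces: together with the Gaussian they
  form the invariant class of the coinduction that establishes the Schwartz property.\<close>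

inductive polyfun :: "('a::euclidean_space \<Rightarrow> complex) \<Rightarrow> bool" where
  const: "polyfun (\<lambda>_. c)"
| coord: "polyfun (\<lambda>x. complex_of_real (x \<bullet> v))"
| add: "polyfun p \<Longrightarrow> polyfun q \<Longrightarrow> polyfun (\<lambda>x. p x + q x)"
| mult: "polyfun p \<Longrightarrow> polyfun q \<Longrightarrow> polyfun (\<lambda>x. p x * q x)"

lemma polyfun_derivative:
  "polyfun p \<Longrightarrow> \<exists>D. (\<forall>x. (p has_derivative D x) (at x)) \<and> (\<forall>v. polyfun (\<lambda>x. D x v))"
proof (induction rule: polyfun.induct)
  case (const c)
  then show ?case by (intro exI[of _ "\<lambda>x v. 0"]) (auto intro: polyfun.const)
next
  case (coord v)
  then show ?case by (intro exI[of _ "\<lambda>x u. complex_of_real (u \<bullet> v)"]) (auto intro!: polyfun.const derivative_eq_intros)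
next
  case (add p q)
  then obtain D E where "(\<forall>x. (p has_derivative D x) (at x)) \<and> (\<forall>v. polyfun (\<lambda>x. D x v))"
    "(\<forall>x. (q has_derivative E x) (at x)) \<and> (\<forall>v. polyfun (\<lambda>x. E x v))" by blast
  then show ?case by (intro exI[of _ "\<lambda>x v. D x v + E x v"]) (auto intro!: polyfun.add derivative_eq_intros)
next
  case (mult p q)
  then obtain D E where "(\<forall>x. (p has_derivative D x) (at x)) \<and> (\<forall>v. polyfun (\<lambda>x. D x v))"
    "(\<forall>x. (q has_derivative E x) (at x)) \<and> (\<forall>v. polyfun (\<lambda>x. E x v))" by blast
  with mult.hyps show ?case
    by (intro exI[of _ "\<lambda>x v. p x * E x v + D x v * q x"]) (auto intro!: polyfun.add polyfun.mult has_derivative_mult)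
qed

lemma polyfun_growth: "polyfun p \<Longrightarrow> \<exists>C N. \<forall>x. cmod (p x) \<le> C * (1 + norm x) ^ N"
proof (induction rule: polyfun.induct)
  case (const c)
  then show ?case by (intro exI[of _ "cmod c"] exI[of _ 0]) auto
next
  case (coord v)
  have "\<bar>x \<bullet> v\<bar> \<le> norm v * (1 + norm x)" for x
    using Cauchy_Schwarz_ineq2[of x v] norm_ge_zero[of v] by (simp add: algebra_simps del: norm_ge_zero)
  then show ?case by (intro exI[of _ "norm v"] exI[of _ 1]) auto
next
  case (add p q)
  then obtain C N C' N' where p: "\<And>x. cmod (p x) \<le> C * (1 + norm x) ^ N" and q: "\<And>x. cmod (q x) \<le> C' * (1 + norm x) ^ N'" by blast
  have "cmod (p x + q x) \<le> (\<bar>C\<bar> + \<bar>C'\<bar>) * (1 + norm x) ^ (N + N')" for x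
  proof -
    have "C * (1 + norm x) ^ N \<le> \<bar>C\<bar> * (1 + norm x) ^ (N + N')"
      "C' * (1 + norm x) ^ N' \<le> \<bar>C'\<bar> * (1 + norm x) ^ (N + N')"
      by (intro mult_mono power_increasing; simp)+
    then show ?thesis using norm_triangle_ineq[of "p x" "q x"] p[of x] q[of x] by (simp add: algebra_simps)
  qed
  then show ?case by blast
next
  case (mult p q)
  then obtain C N C' N' where p: "\<And>x. cmod (p x) \<le> C * (1 + norm x) ^ N" and q: "\<And>x. cmod (q x) \<le> C' * (1 + norm x) ^ N'" by blast
  have "cmod (p x * q x) \<le> (C * C') * (1 + norm x) ^ (N + N')" for x
    using mult_mono[OF p[of x] q[of x]] order_trans[OF norm_ge_zero p[of x]] by (simp add: norm_mult power_add mult_ac)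
  then show ?case by blast
qed

text \<open>The parameter a translates the Gaussian up to a constant factor, and c modulates it.
  Modulated Gaussians test the transform side of \<open>has_fourier\<close>, translated ones the
  other side.\<close>

lemma schwartz_poly_gauss:
  fixes a c :: "'a::euclidean_space"
  assumes "polyfun q"
  shows "schwartz (\<lambda>x. q x * exp (complex_of_real (- (x \<bullet> x) / 2 + x \<bullet> a) + \<i> * of_real (x \<bullet> c)))"
proof -
  let ?f = "\<lambda>x. complex_of_real (- (x \<bullet> x) / 2 + x \<bullet> a) + \<i> * of_real (x \<bullet> c)"
  define g where "g x = exp (?f x)" for x
  let ?D = "\<lambda>x u. complex_of_real (u \<bullet> (- x + a)) + \<i> * of_real (u \<bullet> c)"
  have pd: "polyfun (\<lambda>x. ?D x v)" for v
  proof -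
    have "(\<lambda>x. ?D x v) = (\<lambda>x. complex_of_real (v \<bullet> a) + \<i> * of_real (v \<bullet> c) + (-1) * complex_of_real (x \<bullet> v))"
      by (auto simp: inner_diff_right inner_add_right inner_commute)
    then show ?thesis by (simp only:) (intro polyfun.intros)
  qed
  have gd: "(g has_derivative (\<lambda>u. ?D x u * g x)) (at x)" for x
  proof -
    have "((\<lambda>x. - (x \<bullet> x) / 2 + x \<bullet> a) has_derivative (\<lambda>u. u \<bullet> (- x + a))) (at x)"
      by (auto intro!: derivative_eq_intros simp: inner_commute inner_diff_right inner_add_right)
    then have "((\<lambda>x. ?f x) has_derivative ?D x) (at x)"
      by (intro has_derivative_add has_derivative_of_real has_derivative_mult_right) (auto intro!: derivative_eq_intros)
    from has_derivative_cexp[OF this] show ?thesis unfolding g_def .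
  qed
  have gb: "bounded (range (\<lambda>x. norm x ^ k *\<^sub>R (q x * g x)))" if pq: "polyfun q" for q k
  proof -
    obtain C N where C: "\<And>x. cmod (q x) \<le> C * (1 + norm x) ^ N" using polyfun_growth[OF pq] by blast
    have "cmod (norm x ^ k *\<^sub>R (q x * g x)) \<le> \<bar>C\<bar> * exp ((real (N + k) + norm a)\<^sup>2 / 2)" for x
    proof -
      have cg: "cmod (g x) = exp (- (norm x)\<^sup>2 / 2 + x \<bullet> a)"
        unfolding g_def norm_exp_eq_Re by (simp add: power2_norm_eq_inner)
      \<comment> \<open>Polynomial growth is absorbed into the exponential of a multiple of the norm
        through 1 + r \<le> exp r; completing the square then bounds the whole exponent.\<close>
      have "norm x ^ k * cmod (q x) \<le> (1 + norm x) ^ k * (\<bar>C\<bar> * (1 + norm x) ^ N)"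
      proof (intro mult_mono power_mono)
        have "C * (1 + norm x) ^ N \<le> \<bar>C\<bar> * (1 + norm x) ^ N" by (intro mult_right_mono) auto
        then show "cmod (q x) \<le> \<bar>C\<bar> * (1 + norm x) ^ N" using C[of x] by linarith
      qed auto
      also have "\<dots> = \<bar>C\<bar> * (1 + norm x) ^ (N + k)" by (simp add: power_add)
      also have "\<dots> \<le> \<bar>C\<bar> * (exp (norm x)) ^ (N + k)"
        by (intro mult_left_mono power_mono exp_ge_add_one_self) auto
      finally have 1: "norm x ^ k * cmod (q x) \<le> \<bar>C\<bar> * exp (real (N + k) * norm x)"
        by (simp only: exp_of_nat_mult)
      have 2: "cmod (g x) \<le> exp (- (norm x)\<^sup>2 / 2 + norm x * norm a)"
        unfolding cg using norm_cauchy_schwarz[of x a] by simp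
      have "cmod (norm x ^ k *\<^sub>R (q x * g x)) = (norm x ^ k * cmod (q x)) * cmod (g x)"
        by (simp add: norm_mult)
      also have "\<dots> \<le> (\<bar>C\<bar> * exp (real (N + k) * norm x)) * exp (- (norm x)\<^sup>2 / 2 + norm x * norm a)"
        by (rule mult_mono[OF 1 2]) auto
      also have "\<dots> = \<bar>C\<bar> * exp (real (N + k) * norm x - (norm x)\<^sup>2 / 2 + norm x * norm a)"
        by (subst mult.assoc, subst mult_exp_exp) (simp add: algebra_simps)
      also have "\<dots> \<le> \<bar>C\<bar> * exp ((real (N + k) + norm a)\<^sup>2 / 2)"
      proof -
        have "0 \<le> (norm x - (real (N + k) + norm a))\<^sup>2" by simp
        then have "real (N + k) * norm x - (norm x)\<^sup>2 / 2 + norm x * norm a \<le> (real (N + k) + norm a)\<^sup>2 / 2"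
          unfolding power2_diff by (simp add: field_simps)
        then show ?thesis by (intro mult_left_mono) auto
      qed
      finally show ?thesis .
    qed
    then show ?thesis unfolding bounded_iff by blast
  qed
  have "\<exists>q'. (\<lambda>x. q x * g x) = (\<lambda>x. q' x * g x) \<and> polyfun q'" using assms by blast
  then have "schwartz (\<lambda>x. q x * g x)"
  proof (coinduct rule: schwartz.coinduct[of "\<lambda>\<psi>. \<exists>q. \<psi> = (\<lambda>x. q x * g x) \<and> polyfun q"])
    case (schwartz \<psi>)
    then obtain q where q: "\<psi> = (\<lambda>x. q x * g x)" "polyfun q" by blast
    obtain E where E: "\<And>x. (q has_derivative E x) (at x)" "\<And>v. polyfun (\<lambda>x. E x v)"
      using polyfun_derivative[OF q(2)] by blast
    show ?case
    proof (intro exI conjI allI ballI disjI1)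
      show "\<psi> = \<psi>" ..
      show "(\<psi> has_derivative (\<lambda>u. (q x * ?D x u + E x u) * g x)) (at x)" for x
        unfolding q(1) by (rule has_derivative_eq_rhs[OF has_derivative_mult[OF E(1) gd]]) (auto simp: algebra_simps)
      show "bounded (range (\<lambda>x. norm x ^ k *\<^sub>R \<psi> x))" for k using gb[OF q(2)] q(1) by simp
      show "(\<lambda>x. (q x * ?D x b + E x b) * g x) = (\<lambda>x. (q x * ?D x b + E x b) * g x)" for b ..
      show "polyfun (\<lambda>x. q x * ?D x b + E x b)" for b
        by (intro polyfun.add polyfun.mult E(2) q(2) pd)
    qed
  qed
  then show ?thesis by (simp add: g_def)
qed

section \<open>Tempered functions and Plancherel\<close>

lemma L2_mult_integrable:
  assumes "f \<in> L2" "g \<in> L2" shows "integrable lborel (\<lambda>x. f x * g x)"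
proof -
  note [measurable] = L2_measurable[OF assms(1)] L2_measurable[OF assms(2)]
  have "integrable lborel (\<lambda>x. (cmod (f x))\<^sup>2 + (cmod (g x))\<^sup>2)"
    using assms by (auto simp: L2_def)
  then show ?thesis
  proof (rule Bochner_Integration.integrable_bound, goal_cases)
    case 2
    have "cmod (f x) * cmod (g x) \<le> (cmod (f x))\<^sup>2 + (cmod (g x))\<^sup>2" for x
    proof -
      have "0 \<le> cmod (f x) * cmod (g x)" by simp
      then show ?thesis using sum_squares_bound[of "cmod (f x)" "cmod (g x)"] by linarith
    qed
    then show ?case by (auto simp: norm_mult)
  qed measurable
qed

lemma L2_bounded_by:
  assumes f: "f \<in> L2" and [measurable]: "g \<in> borel_measurable borel" and le: "AE x in lborel. cmod (g x) \<le> B * cmod (f x)"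
  shows "g \<in> L2"
proof -
  have "integrable lborel (\<lambda>x. B\<^sup>2 * (cmod (f x))\<^sup>2)" using f by (auto simp: L2_def)
  then have "integrable lborel (\<lambda>x. (cmod (g x))\<^sup>2)"
  proof (rule Bochner_Integration.integrable_bound)
    show "AE x in lborel. norm ((cmod (g x))\<^sup>2) \<le> norm (B\<^sup>2 * (cmod (f x))\<^sup>2)"
      using le
    proof eventually_elim
      case (elim x)
      have "(cmod (g x))\<^sup>2 \<le> (B * cmod (f x))\<^sup>2" using elim by (intro power_mono) auto
      then show ?case by (simp add: power_mult_distrib abs_mult)
    qed
  qed measurable
  then show ?thesis by (simp add: L2_def)
qed

lemma L2_scale: "f \<in> L2 \<Longrightarrow> (\<lambda>x. c * f x) \<in> L2"
  by (rule L2_bounded_by[where B = "cmod c"]) (auto simp: norm_mult dest: L2_measurable)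

lemma L2_add:
  assumes "f \<in> L2" "g \<in> L2" shows "(\<lambda>x. f x + g x) \<in> L2"
proof -
  note [measurable] = L2_measurable[OF assms(1)] L2_measurable[OF assms(2)]
  have "integrable lborel (\<lambda>x. 2 * ((cmod (f x))\<^sup>2 + (cmod (g x))\<^sup>2))"
    using assms by (auto simp: L2_def)
  then have "integrable lborel (\<lambda>x. (cmod (f x + g x))\<^sup>2)"
  proof (rule Bochner_Integration.integrable_bound, goal_cases)
    case 2
    have "(cmod (f x + g x))\<^sup>2 \<le> 2 * ((cmod (f x))\<^sup>2 + (cmod (g x))\<^sup>2)" for x
    proof -
      have "(cmod (f x + g x))\<^sup>2 \<le> (cmod (f x) + cmod (g x))\<^sup>2"
        by (intro power_mono norm_triangle_ineq) auto
      then show ?thesis using sum_squares_bound[of "cmod (f x)" "cmod (g x)"] by (simp add: power2_sum)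
    qed
    then show ?case by auto
  qed measurable
  then show ?thesis by (simp add: L2_def)
qed

lemma L2_diff:
  assumes "f \<in> L2" "g \<in> L2" shows "(\<lambda>x. f x - g x) \<in> L2"
  using L2_add[OF assms(1) L2_scale[OF assms(2), of "-1"]] by simp

lemma L2_cnj: "f \<in> L2 \<Longrightarrow> (\<lambda>x. cnj (f x)) \<in> L2"
  by (auto simp: L2_def)

lemma cmod_integral_L2_le:
  assumes "f \<in> L2" "g \<in> L2"
  shows "ennreal ((cmod (LINT x|lborel. f x * g x))\<^sup>2) \<le> sqnorm lborel f * sqnorm lborel g"
proof -
  let ?f = "\<integral>\<^sup>+x. ennreal (cmod (f x)) * ennreal (cmod (g x)) \<partial>lborel"
  note [measurable] = L2_measurable[OF assms(1)] L2_measurable[OF assms(2)]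
  have "ennreal (cmod (LINT x|lborel. f x * g x)) \<le> (\<integral>\<^sup>+x. ennreal (cmod (f x * g x)) \<partial>lborel)"
    by (rule integral_norm_bound_ennreal[OF L2_mult_integrable[OF assms]])
  also have "\<dots> = ?f"
    by (simp add: norm_mult ennreal_mult')
  finally have "(ennreal (cmod (LINT x|lborel. f x * g x)))\<^sup>2 \<le> ?f\<^sup>2"
    by (rule power_mono) simp
  also have "\<dots> \<le> (\<integral>\<^sup>+x. (ennreal (cmod (f x)))\<^sup>2 \<partial>lborel) * (\<integral>\<^sup>+x. (ennreal (cmod (g x)))\<^sup>2 \<partial>lborel)"
    by (rule Cauchy_Schwarz_nn_integral) auto
  finally show ?thesis by (simp add: ennreal_power)
qed

lemma L2_tendsto_integral:
  assumes h: "\<And>j. h j \<in> L2" "H \<in> L2" and g: "g \<in> L2"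
    and lim: "(\<lambda>j. sqnorm lborel (\<lambda>x. h j x - H x)) \<longlonglongrightarrow> 0"
  shows "(\<lambda>j. LINT x|lborel. h j x * g x) \<longlonglongrightarrow> (LINT x|lborel. H x * g x)"
proof -
  let ?d = "\<lambda>j. (LINT x|lborel. h j x * g x) - (LINT x|lborel. H x * g x)"
  have d: "?d j = (LINT x|lborel. (h j x - H x) * g x)" for j
    using Bochner_Integration.integral_diff[OF L2_mult_integrable[OF h(1) g] L2_mult_integrable[OF h(2) g], of j]
    by (simp add: left_diff_distrib)
  have "(\<lambda>j. sqnorm lborel (\<lambda>x. h j x - H x) * sqnorm lborel g) \<longlonglongrightarrow> 0 * sqnorm lborel g"
    using g by (intro tendsto_mult_ennreal lim tendsto_const) (auto simp: L2_iff)
  then have U: "(\<lambda>j. sqnorm lborel (\<lambda>x. h j x - H x) * sqnorm lborel g) \<longlonglongrightarrow> 0" by simp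
  have "(\<lambda>j. ennreal ((cmod (?d j))\<^sup>2)) \<longlonglongrightarrow> 0"
    by (rule tendsto_sandwich[OF _ _ tendsto_const U])
       (auto simp: d intro!: always_eventually cmod_integral_L2_le L2_diff h g)
  then have "(\<lambda>j. (cmod (?d j))\<^sup>2) \<longlonglongrightarrow> 0"
    by (subst (asm) ennreal_0[symmetric], subst (asm) tendsto_ennreal_iff) auto
  then have "(\<lambda>j. sqrt ((cmod (?d j))\<^sup>2)) \<longlonglongrightarrow> sqrt 0" by (intro tendsto_intros)
  then have "(\<lambda>j. cmod (?d j)) \<longlonglongrightarrow> 0" by simp
  then show ?thesis using tendsto_norm_zero_iff LIM_zero_cancel by blast
qed

text \<open>The weight is integrable and at most 1, hence itself square integrable, and a product of
  two square integrable functions is integrable.\<close>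

lemma tempered_L2: assumes "f \<in> L2" shows "tempered_function f"
  unfolding tempered_function_def
proof (intro conjI exI)
  show [measurable]: "f \<in> borel_measurable borel" using assms by (rule L2_measurable)
  let ?k = "\<lambda>x::'a. complex_of_real (1 / (1 + norm x) ^ (2 * DIM('a)))"
  have "?k \<in> L2"
  proof -
    have "integrable lborel (\<lambda>x. (cmod (?k x))\<^sup>2)"
    proof (rule Bochner_Integration.integrable_bound[OF integrable_inverse_poly[where 'a='a]])
      show "AE x in lborel. norm ((cmod (?k x))\<^sup>2) \<le> norm (1 / (1 + norm (x::'a)) ^ (2 * DIM('a)))"
      proof (rule AE_I2)
        fix x :: 'a
        define y where "y = 1 / (1 + norm x) ^ (2 * DIM('a))"
        have "0 < (1 + norm x) ^ (2 * DIM('a))" by (intro zero_less_power add_pos_nonneg) auto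
        then have "0 \<le> y" "y \<le> 1" unfolding y_def by (auto simp: divide_le_eq_1 intro!: one_le_power)
        moreover have "cmod (?k x) = y" using \<open>0 \<le> y\<close> by (simp add: y_def norm_divide norm_power flip: of_real_add)
        ultimately show "norm ((cmod (?k x))\<^sup>2) \<le> norm (1 / (1 + norm x) ^ (2 * DIM('a)))"
          unfolding y_def[symmetric] by (simp add: power2_eq_square mult_left_le)
      qed
    qed measurable
    then show ?thesis by (simp add: L2_def)
  qed
  from L2_mult_integrable[OF assms this]
  show "integrable lborel (\<lambda>x. f x /\<^sub>R (1 + norm x) ^ (2 * DIM('a)))"
    by (simp add: scaleR_conv_of_real inverse_eq_divide mult.commute)
qed

lemma tempered_measurable [measurable_dest]: "tempered_function f \<Longrightarrow> f \<in> borel_measurable borel"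
  by (simp add: tempered_function_def)

lemma tempered_diff:
  assumes "tempered_function f" "tempered_function g"
  shows "tempered_function (\<lambda>x. f x - g x)"
proof -
  note [measurable] = tempered_measurable[OF assms(1)] tempered_measurable[OF assms(2)]
  obtain N M where N: "integrable lborel (\<lambda>x. f x /\<^sub>R (1 + norm x) ^ N)" and M: "integrable lborel (\<lambda>x. g x /\<^sub>R (1 + norm x) ^ M)"
    using assms unfolding tempered_function_def by blast
  have *: "integrable lborel (\<lambda>x. h x /\<^sub>R (1 + norm x) ^ (N + M))"
    if i: "integrable lborel (\<lambda>x. h x /\<^sub>R (1 + norm x) ^ K)" and [measurable]: "h \<in> borel_measurable borel" and K: "K \<le> N + M"
    for h :: "'a \<Rightarrow> complex" and K
  proof (rule Bochner_Integration.integrable_bound[OF i])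
    show "AE x in lborel. norm (h x /\<^sub>R (1 + norm x) ^ (N + M)) \<le> norm (h x /\<^sub>R (1 + norm x) ^ K)"
    proof (rule AE_I2)
      fix x :: 'a
      have "0 < (1 + norm x) ^ K" by (intro zero_less_power add_pos_nonneg) auto
      moreover have "(1 + norm x) ^ K \<le> (1 + norm x) ^ (N + M)" using K by (intro power_increasing) auto
      ultimately have "inverse ((1 + norm x) ^ (N + M)) \<le> inverse ((1 + norm x) ^ K)" by (intro le_imp_inverse_le)
      moreover have "0 \<le> (1 + norm x) ^ j" for j by simp
      ultimately show "norm (h x /\<^sub>R (1 + norm x) ^ (N + M)) \<le> norm (h x /\<^sub>R (1 + norm x) ^ K)"
        by (simp add: mult_right_mono)
    qed
  qed measurable
  show ?thesis unfolding tempered_function_def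
    using Bochner_Integration.integrable_diff[OF *[OF N] *[OF M]]
    by (auto simp: scaleR_diff_right intro!: exI[of _ "N + M"])
qed

lemma rapid_gauss: "rapid (gauss 1 :: 'a::euclidean_space \<Rightarrow> complex)"
proof -
  have "(\<lambda>x::'a. 1 * exp (complex_of_real (- (x \<bullet> x) / 2 + x \<bullet> 0) + \<i> * of_real (x \<bullet> 0))) = gauss 1"
    by (auto simp: gauss_def power2_norm_eq_inner exp_of_real fun_eq_iff simp flip: exp_of_real)
  then show ?thesis
    using schwartz_rapid[OF schwartz_poly_gauss[OF polyfun.const[of 1]], of "0::'a" 0] by simp
qed

text \<open>A Gaussian factor makes the difference F - F' integrable. Its ordinary Fourier integral
  at y is then the pairing with a modulated Gaussian, a Schwartz function, so that
  \<open>fourier_integral_unique\<close> applies.\<close>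

lemma has_fourier_unique_right:
  assumes "has_fourier f F" "has_fourier f F'"
  shows "AE x in lborel. F x = F' x"
proof -
  have t: "tempered_function F" "tempered_function F'" using assms by (auto simp: has_fourier_def)
  note [measurable] = tempered_measurable[OF t(1)] tempered_measurable[OF t(2)]
  define G where "G x = (F x - F' x) * gauss 1 x" for x
  have Gi: "integrable lborel G" unfolding G_def by (intro tempered_rapid_integrable tempered_diff t rapid_gauss)
  have "AE x in lborel. G x = 0"
  proof (rule fourier_integral_unique[OF Gi])
    fix y :: 'a
    define \<psi> where "\<psi> x = 1 * exp (complex_of_real (- (x \<bullet> x) / 2 + x \<bullet> 0) + \<i> * of_real (x \<bullet> (- y)))" for x
    have \<psi>: "schwartz \<psi>" unfolding \<psi>_def by (rule schwartz_poly_gauss[OF polyfun.const])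
    have e: "\<psi> x = exp (- (\<i> * of_real (x \<bullet> y))) * gauss 1 x" for x
      unfolding \<psi>_def gauss_def by (simp add: power2_norm_eq_inner exp_add[symmetric] algebra_simps flip: exp_of_real)
    have "fourier_integral G y = (LINT x|lborel. F x * \<psi> x - F' x * \<psi> x)"
      unfolding fourier_integral_def by (intro Bochner_Integration.integral_cong) (auto simp: G_def e algebra_simps)
    also have "\<dots> = (LINT x|lborel. F x * \<psi> x) - (LINT x|lborel. F' x * \<psi> x)"
      by (intro Bochner_Integration.integral_diff tempered_rapid_integrable t schwartz_rapid \<psi>)
    also have "\<dots> = 0" using assms \<psi> unfolding has_fourier_def by (metis cancel_comm_monoid_add_class.diff_cancel)
    finally show "fourier_integral G y = 0" .
  qed
  then show ?thesis by eventually_elim (auto simp: G_def gauss_def)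
qed

text \<open>The dual argument: the test functions are Gaussians centred at y, whose transforms are
  modulated Gaussians, so the pairings are again Fourier integrals of an integrable
  function.\<close>

lemma has_fourier_unique_left:
  assumes "has_fourier f F" "has_fourier f' F"
  shows "AE x in lborel. f x = f' x"
proof -
  have t: "tempered_function f" "tempered_function f'" using assms by (auto simp: has_fourier_def)
  note [measurable] = tempered_measurable[OF t(1)] tempered_measurable[OF t(2)]
  define G where "G x = (f x - f' x) * gauss 1 x" for x
  have Gi: "integrable lborel G" unfolding G_def by (intro tempered_rapid_integrable tempered_diff t rapid_gauss)
  have "AE x in lborel. G x = 0"
  proof (rule fourier_integral_unique[OF Gi])
    fix y :: 'a
    \<comment> \<open>The constant that completes exp (- |x|^2 / 2 + x . y) to the Gaussian centred
      at y.\<close>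
    define q where "q = complex_of_real (exp (- (y \<bullet> y) / 2))"
    define \<psi> where "\<psi> x = q * exp (complex_of_real (- (x \<bullet> x) / 2 + x \<bullet> y) + \<i> * of_real (x \<bullet> 0))" for x
    have \<psi>: "schwartz \<psi>" unfolding \<psi>_def by (rule schwartz_poly_gauss[OF polyfun.const])
    have e: "\<psi> x = gauss 1 (x - y)" for x
      unfolding \<psi>_def q_def gauss_def power2_norm_eq_inner
      by (simp add: exp_add[symmetric] inner_diff_left inner_diff_right inner_commute add_divide_distrib diff_divide_distrib diff_diff_eq add.commute flip: exp_of_real)
    let ?s = "complex_of_real (sqrt (2 * pi / 1) ^ DIM('a))"
    have Fp: "fourier_integral \<psi> x = ?s * (exp (- (\<i> * of_real (x \<bullet> y))) * gauss 1 x)" for x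
    proof -
      have "fourier_integral \<psi> x = (LINT z|lborel. exp (- (\<i> * of_real ((z + y) \<bullet> x))) * gauss 1 (z + y - y))"
        unfolding fourier_integral_def e by (rule lborel_integral_translate[symmetric]) measurable
      also have "\<dots> = exp (- (\<i> * of_real (x \<bullet> y))) * fourier_integral (gauss 1) x"
        unfolding fourier_integral_def
        by (subst integral_mult_right_zero[symmetric], intro Bochner_Integration.integral_cong)
           (auto simp: inner_add_left inner_commute exp_add[symmetric] algebra_simps)
      also have "\<dots> = ?s * (exp (- (\<i> * of_real (x \<bullet> y))) * gauss 1 x)"
        by (subst gauss_fourier) auto
      finally show ?thesis .
    qed
    have r: "rapid (fourier_integral \<psi>)" by (rule schwartz_fourier_rapid[OF \<psi>])
    have "?s * fourier_integral G y = (LINT x|lborel. f x * fourier_integral \<psi> x - f' x * fourier_integral \<psi> x)"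
      unfolding fourier_integral_def[of G]
      by (subst integral_mult_right_zero[symmetric], intro Bochner_Integration.integral_cong) (auto simp: G_def Fp algebra_simps)
    also have "\<dots> = (LINT x|lborel. f x * fourier_integral \<psi> x) - (LINT x|lborel. f' x * fourier_integral \<psi> x)"
      by (intro Bochner_Integration.integral_diff tempered_rapid_integrable t r)
    also have "\<dots> = 0" using assms \<psi> unfolding has_fourier_def by (metis cancel_comm_monoid_add_class.diff_cancel)
    finally show "fourier_integral G y = 0" by simp
  qed
  then show ?thesis by eventually_elim (auto simp: G_def gauss_def)
qed

lemma has_fourier_AE_cong:
  assumes hf: "has_fourier f F" and [measurable]: "f' \<in> borel_measurable borel" "F' \<in> borel_measurable borel"
    and f: "AE x in lborel. f x = f' x" and F: "AE x in lborel. F x = F' x"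
  shows "has_fourier f' F'"
proof -
  note t = hf[unfolded has_fourier_def]
  have [measurable]: "f \<in> borel_measurable borel" "F \<in> borel_measurable borel" using t by (auto simp: tempered_function_def)
  have tc: "tempered_function h'" if h: "tempered_function h" and [measurable]: "h' \<in> borel_measurable borel" and hh: "AE x in lborel. h x = h' x" for h h' :: "'a \<Rightarrow> complex"
  proof -
    note [measurable] = tempered_measurable[OF h]
    obtain N where N: "integrable lborel (\<lambda>x. h x /\<^sub>R (1 + norm x) ^ N)" using h unfolding tempered_function_def by blast
    have "integrable lborel (\<lambda>x. h x /\<^sub>R (1 + norm x) ^ N) \<longleftrightarrow> integrable lborel (\<lambda>x. h' x /\<^sub>R (1 + norm x) ^ N)"
      by (rule Bochner_Integration.integrable_cong_AE) (use hh in auto)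
    then show ?thesis using N unfolding tempered_function_def by auto
  qed
  have "(LINT x|lborel. f' x * fourier_integral \<psi> x) = (LINT x|lborel. F' x * \<psi> x)" if \<psi>: "schwartz \<psi>" for \<psi>
  proof -
    note [measurable] = rapid_measurable[OF schwartz_rapid[OF \<psi>]]
    have "(LINT x|lborel. f' x * fourier_integral \<psi> x) = (LINT x|lborel. f x * fourier_integral \<psi> x)"
      by (rule integral_cong_AE) (use f in auto)
    also have "\<dots> = (LINT x|lborel. F x * \<psi> x)" using t \<psi> by blast
    also have "\<dots> = (LINT x|lborel. F' x * \<psi> x)"
      by (rule integral_cong_AE) (use F in auto)
    finally show ?thesis .
  qed
  then show ?thesis unfolding has_fourier_def using t tc[OF _ _ f] tc[OF _ _ F] by auto
qed

text \<open>The truncation radii depend on \<open>f\<close> only through \<open>\<lambda>x. cmod (f x)\<close>, so that one choice serves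
  all functions \<open>e f\<close> with unimodular \<open>e\<close>.\<close>

definition L2_cut :: "('a::euclidean_space \<Rightarrow> complex) \<Rightarrow> nat \<Rightarrow> nat" where
  "L2_cut f j = (SOME k. (\<integral>\<^sup>+x. ennreal ((cmod (f x))\<^sup>2) * indicator {x. real k \<le> norm x} x \<partial>lborel) \<le> ennreal ((1 / 8) ^ j))"

definition trunc :: "('a::euclidean_space \<Rightarrow> complex) \<Rightarrow> nat \<Rightarrow> 'a \<Rightarrow> complex" where
  "trunc f j x = (if norm x < real (L2_cut f j) then f x else 0)"

text \<open>A pointwise limit instead of a chosen limit in mean square. Measurability in additional
  parameters passes to it, and identities between the truncated transforms, such as radial symmetry,
  hold for it at every point, also where the sequence diverges.\<close>

definition L2_fourier :: "('a::euclidean_space \<Rightarrow> complex) \<Rightarrow> 'a \<Rightarrow> complex" where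
  "L2_fourier f x = lim (\<lambda>j. fourier_integral (trunc f j) x)"

definition inv_fourier :: "('a::euclidean_space \<Rightarrow> complex) \<Rightarrow> 'a \<Rightarrow> complex" where
  "inv_fourier f x = L2_fourier f (- x) / (2 * pi) ^ DIM('a)"

lemma L2_cut_cong: "(\<And>x. cmod (f x) = cmod (g x)) \<Longrightarrow> L2_cut f = L2_cut g"
  by (auto simp: L2_cut_def fun_eq_iff)

lemma trunc_measurable [measurable]:
  assumes [measurable]: "f \<in> borel_measurable borel"
  shows "trunc f j \<in> borel_measurable borel"
  unfolding trunc_def[abs_def] by measurable

lemma L2_cut_le:
  fixes f :: "'a::euclidean_space \<Rightarrow> complex"
  assumes f: "f \<in> L2"
  shows "(\<integral>\<^sup>+x. ennreal ((cmod (f x))\<^sup>2) * indicator {x. real (L2_cut f j) \<le> norm x} x \<partial>lborel) \<le> ennreal ((1 / 8) ^ j)"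
proof -
  let ?f = "\<lambda>x k. ennreal ((cmod (f x))\<^sup>2) * indicator {x. real k \<le> norm x} x"
  note [measurable] = L2_measurable[OF f]
  have "(\<lambda>k. \<integral>\<^sup>+x. ?f x k \<partial>lborel) \<longlonglongrightarrow> integral\<^sup>N lborel (\<lambda>x::'a. 0)"
  proof (rule nn_integral_dominated_convergence[where w = "\<lambda>x. ennreal ((cmod (f x))\<^sup>2)"])
    show "AE x in lborel. (\<lambda>k. ?f x k) \<longlonglongrightarrow> 0"
    proof (rule AE_I2)
      fix x :: 'a
      obtain N where N: "norm x < real N" using reals_Archimedean2 by blast
      have "eventually (\<lambda>k. ?f x k = 0) sequentially"
        using eventually_ge_at_top[of N] by eventually_elim (use N in auto)
      then show "(\<lambda>k. ?f x k) \<longlonglongrightarrow> 0" by (rule tendsto_eventually)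
    qed
    show "(\<integral>\<^sup>+x. ennreal ((cmod (f x))\<^sup>2) \<partial>lborel) < \<infinity>" using f by (simp add: L2_iff)
    show "AE x in lborel. ?f x k \<le> ennreal ((cmod (f x))\<^sup>2)" for k
      by (auto simp: indicator_def)
  qed measurable
  then have "(\<lambda>k. \<integral>\<^sup>+x. ?f x k \<partial>lborel) \<longlonglongrightarrow> 0" by simp
  then have "eventually (\<lambda>k. (\<integral>\<^sup>+x. ?f x k \<partial>lborel) < ennreal ((1 / 8) ^ j)) sequentially"
    by (rule order_tendstoD) simp
  then have "\<exists>k. (\<integral>\<^sup>+x. ?f x k \<partial>lborel) \<le> ennreal ((1 / 8) ^ j)"
    by (meson eventually_sequentially less_imp_le order_refl)
  then show ?thesis unfolding L2_cut_def by (rule someI_ex)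
qed

lemma trunc_L2: "f \<in> L2 \<Longrightarrow> trunc f j \<in> L2"
  by (rule L2_bounded_by[where B = 1 and f = f]) (auto simp: trunc_def dest: L2_measurable)

lemma trunc_integrable:
  fixes f :: "'a::euclidean_space \<Rightarrow> complex"
  assumes f: "f \<in> L2"
  shows "integrable lborel (trunc f j)"
proof -
  note [measurable] = L2_measurable[OF f]
  let ?i = "\<lambda>x::'a. complex_of_real (indicator (ball 0 (real (L2_cut f j))) x)"
  have ii: "integrable lborel ?i"
    by (intro integrable_of_real integrable_real_indicator) (use emeasure_bounded_finite[OF bounded_ball] in auto)
  have "(\<lambda>x. (cmod (?i x))\<^sup>2) = (\<lambda>x. indicat_real (ball 0 (real (L2_cut f j))) x)"
    by (auto simp: indicator_def fun_eq_iff)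
  moreover have "?i \<in> borel_measurable borel"
    using borel_measurable_integrable[OF ii] by simp
  ultimately have "?i \<in> L2" using ii unfolding L2_def by (simp only: complex_of_real_integrable_eq mem_Collect_eq)
  from L2_mult_integrable[OF this f]
  show ?thesis by (rule back_subst[of "integrable lborel"]) (auto simp: trunc_def fun_eq_iff)
qed

text \<open>The rate 8^-j is the one that \<open>L2_fast_convergence\<close> requires.\<close>

lemma trunc_error:
  assumes f: "f \<in> L2"
  shows "sqnorm lborel (\<lambda>x. trunc f j x - f x) \<le> ennreal ((1 / 8) ^ j)"
    "sqnorm lborel (\<lambda>x. trunc f (Suc j) x - trunc f j x) \<le> 2 * ennreal ((1 / 8) ^ j)"
proof -
  note [measurable] = L2_measurable[OF f]
  let ?e = "\<lambda>j x. ennreal ((cmod (f x))\<^sup>2) * indicator {x. real (L2_cut f j) \<le> norm x} x"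
  have "sqnorm lborel (\<lambda>x. trunc f j x - f x) = (\<integral>\<^sup>+x. ?e j x \<partial>lborel)"
    by (intro nn_integral_cong) (auto simp: trunc_def indicator_def)
  then show "sqnorm lborel (\<lambda>x. trunc f j x - f x) \<le> ennreal ((1 / 8) ^ j)" using L2_cut_le[OF f] by simp
  have "sqnorm lborel (\<lambda>x. trunc f (Suc j) x - trunc f j x) \<le> (\<integral>\<^sup>+x. ?e j x + ?e (Suc j) x \<partial>lborel)"
    by (intro nn_integral_mono) (auto simp: trunc_def indicator_def)
  also have "\<dots> = (\<integral>\<^sup>+x. ?e j x \<partial>lborel) + (\<integral>\<^sup>+x. ?e (Suc j) x \<partial>lborel)"
    by (intro nn_integral_add) auto
  also have "\<dots> \<le> ennreal ((1 / 8) ^ j) + ennreal ((1 / 8) ^ Suc j)"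
    by (intro add_mono L2_cut_le f)
  also have "\<dots> \<le> ennreal ((1 / 8) ^ j) + ennreal ((1 / 8) ^ j)"
    by (intro add_left_mono ennreal_leI) simp
  finally show "sqnorm lborel (\<lambda>x. trunc f (Suc j) x - trunc f j x) \<le> 2 * ennreal ((1 / 8) ^ j)" by (simp add: mult_2)
qed

lemma fourier_integral_diff:
  assumes "integrable lborel f" "integrable lborel g"
  shows "fourier_integral (\<lambda>x. f x - g x) y = fourier_integral f y - fourier_integral g y"
  unfolding fourier_integral_def
  by (simp add: right_diff_distrib Bochner_Integration.integral_diff integrable_exp_i_mult assms)

lemma L2_fourier_measurable [measurable]:
  assumes [measurable]: "f \<in> borel_measurable borel"
  shows "L2_fourier f \<in> borel_measurable borel"
  unfolding L2_fourier_def[abs_def] by measurable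

lemma inv_fourier_measurable [measurable]:
  assumes [measurable]: "f \<in> borel_measurable borel"
  shows "inv_fourier f \<in> borel_measurable borel"
  unfolding inv_fourier_def[abs_def] by measurable

lemma
  fixes f :: "'a::euclidean_space \<Rightarrow> complex"
  assumes f: "f \<in> L2"
  shows L2_fourier_AE_convergent: "AE x in lborel. convergent (\<lambda>j. fourier_integral (trunc f j) x)"
    and L2_fourier_tendsto: "(\<lambda>j. sqnorm lborel (\<lambda>x. fourier_integral (trunc f j) x - L2_fourier f x)) \<longlonglongrightarrow> 0"
proof -
  let ?f = "\<lambda>j. sqnorm lborel (\<lambda>x. fourier_integral (trunc f (Suc j)) x - fourier_integral (trunc f j) x)"
  note [measurable] = L2_measurable[OF f]
  have "?f j
      \<le> (ennreal ((2 * pi) ^ DIM('a)) * 2) * ennreal ((1 / 8) ^ j)" for j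
  proof -
    have "?f j
      = sqnorm lborel (fourier_integral (\<lambda>x. trunc f (Suc j) x - trunc f j x))"
      by (simp add: fourier_integral_diff trunc_integrable f)
    also have "\<dots> \<le> ennreal ((2 * pi) ^ DIM('a)) * sqnorm lborel (\<lambda>x. trunc f (Suc j) x - trunc f j x)"
      by (intro plancherel_bound Bochner_Integration.integrable_diff trunc_integrable f)
    also have "\<dots> \<le> ennreal ((2 * pi) ^ DIM('a)) * (2 * ennreal ((1 / 8) ^ j))"
      by (intro mult_left_mono trunc_error f) auto
    finally show ?thesis by (simp add: mult.assoc)
  qed
  from L2_fast_convergence[OF _ _ this]
  show "AE x in lborel. convergent (\<lambda>j. fourier_integral (trunc f j) x)"
    "(\<lambda>j. sqnorm lborel (\<lambda>x. fourier_integral (trunc f j) x - L2_fourier f x)) \<longlonglongrightarrow> 0"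
    unfolding L2_fourier_def by (auto simp: ennreal_mult_less_top)
qed

text \<open>Fatou's lemma along the truncations, each of which is integrable and falls under
  \<open>plancherel_bound\<close>.\<close>

lemma L2_fourier_bound:
  fixes f :: "'a::euclidean_space \<Rightarrow> complex"
  assumes f: "f \<in> L2"
  shows "sqnorm lborel (L2_fourier f) \<le> ennreal ((2 * pi) ^ DIM('a)) * sqnorm lborel f"
proof -
  let ?g = "ennreal ((2 * pi) ^ DIM('a)) * sqnorm lborel f"
  let ?f = "\<lambda>j. sqnorm lborel (fourier_integral (trunc f j))"
  note [measurable] = L2_measurable[OF f]
  have "sqnorm lborel (L2_fourier f) = (\<integral>\<^sup>+x. liminf (\<lambda>j. ennreal ((cmod (fourier_integral (trunc f j) x))\<^sup>2)) \<partial>lborel)"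
    using L2_fourier_AE_convergent[OF f]
  proof (intro nn_integral_cong_AE, eventually_elim)
    case (elim x)
    then have "(\<lambda>j. fourier_integral (trunc f j) x) \<longlonglongrightarrow> L2_fourier f x"
      unfolding L2_fourier_def by (simp add: convergent_LIMSEQ_iff)
    then have "(\<lambda>j. ennreal ((cmod (fourier_integral (trunc f j) x))\<^sup>2)) \<longlonglongrightarrow> ennreal ((cmod (L2_fourier f x))\<^sup>2)"
      by (intro tendsto_intros tendsto_ennrealI)
    then show ?case by (intro lim_imp_Liminf[symmetric]) auto
  qed
  also have "\<dots> \<le> liminf (\<lambda>j. ?f j)"
    by (rule nn_integral_liminf) measurable
  also have "\<dots> \<le> limsup (\<lambda>j. ?f j)" by (rule Liminf_le_Limsup) simp
  also have "\<dots> \<le> ?g"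
  proof (rule Limsup_bounded, intro always_eventually allI)
    fix j
    have "?f j \<le> ennreal ((2 * pi) ^ DIM('a)) * sqnorm lborel (trunc f j)"
      by (rule plancherel_bound[OF trunc_integrable[OF f]])
    also have "\<dots> \<le> ?g"
      by (intro mult_left_mono nn_integral_mono) (auto simp: trunc_def)
    finally show "?f j \<le> ?g" .
  qed
  finally show ?thesis .
qed

lemma L2_fourier_L2: assumes f: "f \<in> L2" shows "L2_fourier f \<in> L2"
proof -
  note [measurable] = L2_measurable[OF f]
  have "ennreal ((2 * pi) ^ DIM('a)) * sqnorm lborel f < \<infinity>"
    using f by (auto simp: L2_iff ennreal_mult_less_top)
  with L2_fourier_bound[OF f] show ?thesis unfolding L2_iff by (auto intro: le_less_trans)
qed

lemma fourier_integral_L2: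
  fixes f :: "'a::euclidean_space \<Rightarrow> complex"
  assumes f: "f \<in> L2" "integrable lborel f" shows "fourier_integral f \<in> L2"
proof -
  note [measurable] = L2_measurable[OF f(1)]
  have "ennreal ((2 * pi) ^ DIM('a)) * sqnorm lborel f < \<infinity>"
    using f by (auto simp: L2_iff ennreal_mult_less_top)
  with plancherel_bound[OF f(2)] show ?thesis unfolding L2_iff by (auto intro: le_less_trans)
qed

lemma lborel_integral_reflect:
  fixes f :: "'a::euclidean_space \<Rightarrow> complex"
  assumes [measurable]: "f \<in> borel_measurable borel"
  shows "(LINT x|lborel. f (- x)) = (LINT x|lborel. f x)"
  using lborel_integral_affine[of "-1" f 0] by simp

lemma sqnorm_reflect:
  fixes f :: "'a::euclidean_space \<Rightarrow> complex"
  assumes [measurable]: "f \<in> borel_measurable borel"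
  shows "sqnorm lborel (\<lambda>x. f (- x)) = sqnorm lborel f"
proof -
  have "(lborel :: 'a measure) = density (distr lborel borel (\<lambda>x. - x)) (\<lambda>_. 1)"
    using lborel_affine[of "-1" "0::'a"] by simp
  then have "sqnorm lborel f = sqnorm (density (distr lborel borel (\<lambda>x. - x)) (\<lambda>_. 1)) f"
    by (rule arg_cong)
  also have "\<dots> = sqnorm lborel (\<lambda>x. f (- x))"
    by (subst nn_integral_density) (auto simp: nn_integral_distr)
  finally show ?thesis by simp
qed

lemma trunc_tendsto:
  assumes f: "f \<in> L2"
  shows "(\<lambda>j. sqnorm lborel (\<lambda>x. trunc f j x - f x)) \<longlonglongrightarrow> 0"
proof -
  have "(\<lambda>j. ennreal ((1 / 8) ^ j)) \<longlonglongrightarrow> ennreal 0"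
    by (intro tendsto_ennrealI LIMSEQ_power_zero) auto
  then have U: "(\<lambda>j. ennreal ((1 / 8) ^ j)) \<longlonglongrightarrow> 0" by simp
  show ?thesis
    by (rule tendsto_sandwich[OF _ _ tendsto_const U]) (intro always_eventually allI zero_le trunc_error f)+
qed

theorem has_fourier_L2_fourier:
  assumes f: "f \<in> L2"
  shows "has_fourier f (L2_fourier f)"
  unfolding has_fourier_def
proof (intro conjI allI impI)
  show "tempered_function f" "tempered_function (L2_fourier f)"
    by (intro tempered_L2 L2_fourier_L2 f)+
  fix \<psi> :: "'a \<Rightarrow> complex" assume \<psi>: "schwartz \<psi>"
  have "(\<lambda>j. LINT x|lborel. trunc f j x * fourier_integral \<psi> x) \<longlonglongrightarrow> (LINT x|lborel. f x * fourier_integral \<psi> x)"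
    by (intro L2_tendsto_integral trunc_L2 f rapid_L2 schwartz_fourier_rapid \<psi> trunc_tendsto)
  moreover have "(\<lambda>j. LINT x|lborel. fourier_integral (trunc f j) x * \<psi> x) \<longlonglongrightarrow> (LINT x|lborel. L2_fourier f x * \<psi> x)"
    by (intro L2_tendsto_integral L2_fourier_L2 fourier_integral_L2 trunc_L2 trunc_integrable f rapid_L2 schwartz_rapid \<psi> L2_fourier_tendsto)
  moreover have "(LINT x|lborel. trunc f j x * fourier_integral \<psi> x) = (LINT x|lborel. fourier_integral (trunc f j) x * \<psi> x)" for j
    by (intro fourier_multiplication_formula[symmetric] trunc_integrable f rapid_integrable schwartz_rapid \<psi>)
  ultimately show "(LINT x|lborel. f x * fourier_integral \<psi> x) = (LINT x|lborel. L2_fourier f x * \<psi> x)"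
    using LIMSEQ_unique by simp
qed

lemma inv_fourier_bound:
  fixes f :: "'a::euclidean_space \<Rightarrow> complex"
  assumes f: "f \<in> L2"
  shows "sqnorm lborel (inv_fourier f) \<le> ennreal (1 / (2 * pi) ^ DIM('a)) * sqnorm lborel f"
proof -
  note [measurable] = L2_measurable[OF f]
  let ?c = "(2 * pi) ^ DIM('a)"
  have "sqnorm lborel (inv_fourier f) = ennreal (1 / ?c\<^sup>2) * sqnorm lborel (\<lambda>x. L2_fourier f (- x))"
    unfolding inv_fourier_def
    by (subst nn_integral_cmult[symmetric]) (auto simp: norm_divide norm_power norm_mult power_divide ennreal_mult'[symmetric] intro!: nn_integral_cong)
  also have "\<dots> = ennreal (1 / ?c\<^sup>2) * sqnorm lborel (L2_fourier f)"
    by (subst sqnorm_reflect) auto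
  also have "\<dots> \<le> ennreal (1 / ?c\<^sup>2) * (ennreal ?c * sqnorm lborel f)"
    by (intro mult_left_mono L2_fourier_bound f) auto
  also have "\<dots> = ennreal (1 / ?c\<^sup>2 * ?c) * sqnorm lborel f"
    by (subst ennreal_mult) (auto simp: mult.assoc)
  also have "1 / ?c\<^sup>2 * ?c = 1 / ?c" by (simp add: power2_eq_square)
  finally show ?thesis .
qed

lemma inv_fourier_L2: assumes f: "f \<in> L2" shows "inv_fourier f \<in> L2"
proof -
  note [measurable] = L2_measurable[OF f]
  have "ennreal (1 / (2 * pi) ^ DIM('a)) * sqnorm lborel f < \<infinity>"
    using f by (auto simp: L2_iff ennreal_mult_less_top)
  with inv_fourier_bound[OF f] show ?thesis unfolding L2_iff by (auto intro: le_less_trans)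
qed

text \<open>Inversion is needed for test functions only: pairing the transform of a truncation of f
  with the reflected transform of \<psi> gives \<open>(2 * pi) ^ DIM('a)\<close> times the pairing
  of the truncation with \<psi>. The reflection and the division in \<open>inv_fourier\<close> undo
  these two changes.\<close>

theorem has_fourier_inv_fourier:
  fixes f :: "'a::euclidean_space \<Rightarrow> complex"
  assumes f: "f \<in> L2"
  shows "has_fourier (inv_fourier f) f"
  unfolding has_fourier_def
proof (intro conjI allI impI)
  note [measurable] = L2_measurable[OF f]
  show "tempered_function f" "tempered_function (inv_fourier f)"
    by (intro tempered_L2 inv_fourier_L2 f)+
  fix \<psi> :: "'a \<Rightarrow> complex" assume \<psi>: "schwartz \<psi>"
  note r = schwartz_fourier_rapid[OF \<psi>]
  note [measurable] = rapid_measurable[OF r] rapid_measurable[OF schwartz_rapid[OF \<psi>]]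
  let ?p = "\<lambda>x. fourier_integral \<psi> (- x)" and ?c = "complex_of_real ((2 * pi) ^ DIM('a))"
  have rp: "rapid ?p"
    unfolding rapid_def
  proof (intro conjI allI)
    fix k
    obtain C where "\<And>x. (1 + norm x) ^ k * cmod (fourier_integral \<psi> x) \<le> C" using r unfolding rapid_def by blast
    then show "\<exists>C. \<forall>x. (1 + norm x) ^ k * cmod (?p x) \<le> C" by (metis norm_minus_cancel)
  qed measurable
  have Fp: "fourier_integral ?p y = ?c * \<psi> y" for y
  proof -
    obtain B where B: "\<And>x. cmod (\<psi> x) \<le> B" using rapid_bounded[OF schwartz_rapid[OF \<psi>]] by blast
    have "fourier_integral ?p y = (LINT x|lborel. exp (- (\<i> * of_real (- x \<bullet> y))) * ?p (- x))"
      unfolding fourier_integral_def[of ?p] by (rule lborel_integral_reflect[symmetric]) measurable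
    also have "\<dots> = (LINT x|lborel. fourier_integral \<psi> x * exp (\<i> * of_real (x \<bullet> y)))"
      by (simp add: mult.commute)
    also have "\<dots> = (2 * pi) ^ DIM('a) * \<psi> y"
      by (rule fourier_inversion[OF _ B])
         (use \<psi> schwartz_continuous[OF \<psi>] in \<open>auto intro: rapid_integrable schwartz_rapid r simp: continuous_on_eq_continuous_at\<close>)
    finally show ?thesis by simp
  qed
  have A: "(\<lambda>j. LINT x|lborel. fourier_integral (trunc f j) x * ?p x) \<longlonglongrightarrow> (LINT x|lborel. L2_fourier f x * ?p x)"
    by (intro L2_tendsto_integral L2_fourier_L2 fourier_integral_L2 trunc_L2 trunc_integrable f rapid_L2 rp L2_fourier_tendsto)
  have E: "(LINT x|lborel. fourier_integral (trunc f j) x * ?p x) = ?c * (LINT x|lborel. trunc f j x * \<psi> x)" for j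
  proof -
    have "(LINT x|lborel. fourier_integral (trunc f j) x * ?p x) = (LINT x|lborel. trunc f j x * fourier_integral ?p x)"
      by (intro fourier_multiplication_formula trunc_integrable f rapid_integrable rp)
    then show ?thesis by (simp add: Fp mult.left_commute[of "trunc f j _"])
  qed
  have B: "(\<lambda>j. ?c * (LINT x|lborel. trunc f j x * \<psi> x)) \<longlonglongrightarrow> ?c * (LINT x|lborel. f x * \<psi> x)"
    by (intro tendsto_mult tendsto_const L2_tendsto_integral trunc_L2 f rapid_L2 schwartz_rapid \<psi> trunc_tendsto)
  have e: "(LINT x|lborel. L2_fourier f x * ?p x) = ?c * (LINT x|lborel. f x * \<psi> x)"
    by (rule LIMSEQ_unique[OF A[unfolded E] B])
  have "(LINT x|lborel. inv_fourier f x * fourier_integral \<psi> x) = (LINT x|lborel. (\<lambda>x. L2_fourier f x * ?p x / ?c) (- x))"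
    by (simp add: inv_fourier_def)
  also have "\<dots> = (LINT x|lborel. L2_fourier f x * ?p x / ?c)"
    by (rule lborel_integral_reflect) measurable
  also have "\<dots> = (LINT x|lborel. f x * \<psi> x)" using e by simp
  finally show "(LINT x|lborel. inv_fourier f x * fourier_integral \<psi> x) = (LINT x|lborel. f x * \<psi> x)" .
qed

lemma has_fourier_L2_right: "has_fourier f F \<Longrightarrow> f \<in> L2 \<Longrightarrow> AE x in lborel. F x = L2_fourier f x"
  by (rule has_fourier_unique_right[OF _ has_fourier_L2_fourier])

lemma has_fourier_L2_left: "has_fourier f F \<Longrightarrow> F \<in> L2 \<Longrightarrow> AE x in lborel. f x = inv_fourier F x"
  by (rule has_fourier_unique_left[OF _ has_fourier_inv_fourier])

lemma sqnorm_cong_AE: "AE x in M. f x = g x \<Longrightarrow> sqnorm M f = sqnorm M g"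
  by (rule nn_integral_cong_AE) auto

text \<open>The reverse inequality is the same bound for the inverse transform, since by uniqueness
  \<open>inv_fourier\<close> after \<open>L2_fourier\<close> gives back f almost everywhere.\<close>

theorem plancherel:
  fixes f :: "'a::euclidean_space \<Rightarrow> complex"
  assumes f: "f \<in> L2"
  shows "sqnorm lborel (L2_fourier f) = ennreal ((2 * pi) ^ DIM('a)) * sqnorm lborel f"
proof (rule antisym)
  let ?g = "ennreal ((2 * pi) ^ DIM('a)) * sqnorm lborel f"
  let ?f = "sqnorm lborel (L2_fourier f)"
  show "?f \<le> ?g" by (rule L2_fourier_bound[OF f])
  have "AE x in lborel. f x = inv_fourier (L2_fourier f) x"
    by (rule has_fourier_L2_left[OF has_fourier_L2_fourier[OF f] L2_fourier_L2[OF f]])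
  then have "sqnorm lborel f = sqnorm lborel (inv_fourier (L2_fourier f))" by (rule sqnorm_cong_AE)
  also have "\<dots> \<le> ennreal (1 / (2 * pi) ^ DIM('a)) * ?f"
    by (rule inv_fourier_bound[OF L2_fourier_L2[OF f]])
  finally have "?g \<le> ennreal ((2 * pi) ^ DIM('a)) * (ennreal (1 / (2 * pi) ^ DIM('a)) * ?f)"
    by (intro mult_left_mono) auto
  also have "\<dots> = ennreal ((2 * pi) ^ DIM('a) * (1 / (2 * pi) ^ DIM('a))) * ?f"
    by (subst ennreal_mult) (auto simp: mult.assoc)
  also have "\<dots> = ?f" by simp
  finally show "?g \<le> ?f" .
qed

text \<open>Stated almost everywhere, since the truncation radii of u, v and the combination may
  differ; it follows from uniqueness of the distributional transform.\<close>

lemma has_fourier_L2_lincomb: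
  assumes "u \<in> L2" "v \<in> L2"
  shows "AE x in lborel. L2_fourier (\<lambda>x. a * u x + b * v x) x = a * L2_fourier u x + b * L2_fourier v x"
proof -
  have l: "(\<lambda>x. a * u x + b * v x) \<in> L2" by (intro L2_add L2_scale assms)
  have "has_fourier (\<lambda>x. a * u x + b * v x) (\<lambda>x. a * L2_fourier u x + b * L2_fourier v x)"
    unfolding has_fourier_def
  proof (intro conjI allI impI)
    show "tempered_function (\<lambda>x. a * u x + b * v x)" "tempered_function (\<lambda>x. a * L2_fourier u x + b * L2_fourier v x)"
      by (intro tempered_L2 L2_add L2_scale L2_fourier_L2 assms)+
    fix \<psi> :: "'a \<Rightarrow> complex" assume \<psi>: "schwartz \<psi>"
    have e: "(LINT x|lborel. (a * f x + b * g x) * h x) = a * (LINT x|lborel. f x * h x) + b * (LINT x|lborel. g x * h x)"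
      if "f \<in> L2" "g \<in> L2" "h \<in> L2" for f g h :: "'a \<Rightarrow> complex"
      using L2_mult_integrable[OF that(1,3)] L2_mult_integrable[OF that(2,3)]
      by (simp add: distrib_right mult.assoc)
    have r: "rapid (fourier_integral \<psi>)" "rapid \<psi>" by (intro schwartz_fourier_rapid schwartz_rapid \<psi>)+
    show "(LINT x|lborel. (a * u x + b * v x) * fourier_integral \<psi> x) = (LINT x|lborel. (a * L2_fourier u x + b * L2_fourier v x) * \<psi> x)"
      using has_fourier_L2_fourier[OF assms(1)] has_fourier_L2_fourier[OF assms(2)] \<psi>
      by (simp add: e assms L2_fourier_L2 rapid_L2 r has_fourier_def)
  qed
  from has_fourier_L2_right[OF this l] show ?thesis by (auto elim: eventually_mono)
qed

lemma integral_cmod_sq: "f \<in> L2 \<Longrightarrow> complex_of_real ((L2_norm f)\<^sup>2) = (LINT x|lborel. f x * cnj (f x))"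
  unfolding L2_norm_def by (simp add: integral_nonneg_AE complex_norm_square[symmetric] del: of_real_power)

lemma L2_norm_fourier:
  fixes f :: "'a::euclidean_space \<Rightarrow> complex"
  assumes f: "f \<in> L2"
  shows "(L2_norm (L2_fourier f))\<^sup>2 = (2 * pi) ^ DIM('a) * (L2_norm f)\<^sup>2"
proof -
  have "ennreal ((L2_norm (L2_fourier f))\<^sup>2) = ennreal ((2 * pi) ^ DIM('a) * (L2_norm f)\<^sup>2)"
    using plancherel[OF f] unfolding sqnorm_eq_L2_norm[OF f] sqnorm_eq_L2_norm[OF L2_fourier_L2[OF f]]
    by (simp add: ennreal_mult)
  then show ?thesis by simp
qed

lemma L2_norm_cong_AE:
  assumes "f \<in> L2" "g \<in> L2" "AE x in lborel. f x = g x" shows "L2_norm f = L2_norm g"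
proof -
  note [measurable] = L2_measurable[OF assms(1)] L2_measurable[OF assms(2)]
  show ?thesis unfolding L2_norm_def by (intro arg_cong[of _ _ sqrt] integral_cong_AE) (use assms(3) in auto)
qed

text \<open>Polarisation of \<open>L2_norm_fourier\<close>: the sum of the functions gives the real
  part, and replacing v by i v gives the imaginary part.\<close>

theorem parseval:
  fixes u v :: "'a::euclidean_space \<Rightarrow> complex"
  assumes u: "u \<in> L2" and v: "v \<in> L2"
  shows "(LINT x|lborel. L2_fourier u x * cnj (L2_fourier v x)) = complex_of_real ((2 * pi) ^ DIM('a)) * (LINT x|lborel. u x * cnj (v x))"
proof -
  let ?h = "(LINT x|lborel. L2_fourier u x * cnj (L2_fourier (\<lambda>x. \<i> * v x) x))"
  let ?g = "LINT x|lborel. L2_fourier u x * cnj (L2_fourier v x)"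
  let ?f = "\<lambda>f g. LINT x|lborel. f x * cnj (g x)"
  let ?c = "(2 * pi) ^ DIM('a)"
  have pol: "(L2_norm (\<lambda>x. f x + g x))\<^sup>2 = (L2_norm f)\<^sup>2 + (L2_norm g)\<^sup>2 + 2 * Re (?f f g)"
    if f: "f \<in> L2" and g: "g \<in> L2" for f g :: "'a \<Rightarrow> complex"
  proof -
    note i = L2_mult_integrable[OF f L2_cnj[OF f]] L2_mult_integrable[OF f L2_cnj[OF g]] L2_mult_integrable[OF g L2_cnj[OF f]] L2_mult_integrable[OF g L2_cnj[OF g]]
    have "(LINT x|lborel. g x * cnj (f x)) = (LINT x|lborel. cnj (f x * cnj (g x)))" by (simp add: mult.commute)
    then have c: "(LINT x|lborel. g x * cnj (f x)) = cnj (?f f g)"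
      by (simp only: Bochner_Integration.integral_cnj)
    have "complex_of_real ((L2_norm (\<lambda>x. f x + g x))\<^sup>2) = (LINT x|lborel. (f x * cnj (f x) + f x * cnj (g x)) + (g x * cnj (f x) + g x * cnj (g x)))"
      by (subst integral_cmod_sq[OF L2_add[OF f g]]) (simp add: algebra_simps)
    also have "\<dots> = complex_of_real ((L2_norm f)\<^sup>2) + (?f f g) + cnj (?f f g) + complex_of_real ((L2_norm g)\<^sup>2)"
      using i by (simp add: integral_cmod_sq[OF f] integral_cmod_sq[OF g] c del: of_real_power)
    finally have "complex_of_real ((L2_norm (\<lambda>x. f x + g x))\<^sup>2) = complex_of_real ((L2_norm f)\<^sup>2 + (L2_norm g)\<^sup>2 + 2 * Re (?f f g))"
      using complex_add_cnj[of "?f f g"] by (simp add: algebra_simps)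
    then show ?thesis by (simp only: of_real_eq_iff)
  qed
  have re: "Re (LINT x|lborel. L2_fourier f x * cnj (L2_fourier g x)) = ?c * Re (?f f g)"
    if f: "f \<in> L2" and g: "g \<in> L2" for f g :: "'a \<Rightarrow> complex"
  proof -
    have "AE x in lborel. L2_fourier (\<lambda>x. f x + g x) x = L2_fourier f x + L2_fourier g x"
      using has_fourier_L2_lincomb[OF f g, of 1 1] by simp
    then have "L2_norm (L2_fourier (\<lambda>x. f x + g x)) = L2_norm (\<lambda>x. L2_fourier f x + L2_fourier g x)"
      by (intro L2_norm_cong_AE L2_fourier_L2 L2_add f g)
    then have "(L2_norm (\<lambda>x. L2_fourier f x + L2_fourier g x))\<^sup>2 = ?c * (L2_norm (\<lambda>x. f x + g x))\<^sup>2"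
      using L2_norm_fourier[OF L2_add[OF f g]] by simp
    then show ?thesis
      unfolding pol[OF f g] pol[OF L2_fourier_L2[OF f] L2_fourier_L2[OF g]] L2_norm_fourier[OF f] L2_norm_fourier[OF g]
      by (simp add: algebra_simps)
  qed
  have im: "Im ?g = ?c * Im (LINT x|lborel. u x * cnj (v x))"
  proof -
    have iv: "(\<lambda>x. \<i> * v x) \<in> L2" by (rule L2_scale[OF v])
    note [measurable] = L2_measurable[OF u] L2_measurable[OF v]
    have "AE x in lborel. L2_fourier (\<lambda>x. \<i> * v x) x = \<i> * L2_fourier v x"
      using has_fourier_L2_lincomb[OF v v, of \<i> 0] by simp
    then have "?h = (LINT x|lborel. L2_fourier u x * cnj (\<i> * L2_fourier v x))"
      by (intro integral_cong_AE) auto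
    also have "\<dots> = - \<i> * ?g"
      by (subst integral_mult_right_zero[symmetric], intro Bochner_Integration.integral_cong) auto
    finally have 1: "?h = - \<i> * ?g" .
    have "(LINT x|lborel. u x * cnj (\<i> * v x)) = - \<i> * (LINT x|lborel. u x * cnj (v x))"
      by (subst integral_mult_right_zero[symmetric], intro Bochner_Integration.integral_cong) auto
    with re[OF u iv] 1 show ?thesis by simp
  qed
  show ?thesis using re[OF u v] im by (intro complex_eqI) auto
qed

section \<open>Radial functions and bipolar coordinates\<close>

lemma nn_integral_lborel_translate:
  fixes f :: "'a::euclidean_space \<Rightarrow> ennreal"
  assumes [measurable]: "f \<in> borel_measurable borel"
  shows "(\<integral>\<^sup>+x. f (x + t) \<partial>lborel) = (\<integral>\<^sup>+x. f x \<partial>lborel)"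
proof -
  have "(\<integral>\<^sup>+x. f x \<partial>lborel) = (\<integral>\<^sup>+x. f x \<partial>distr lborel borel (\<lambda>x. t + x))"
    by (simp only: lborel_distr_plus)
  also have "\<dots> = (\<integral>\<^sup>+x. f (x + t) \<partial>lborel)" by (subst nn_integral_distr) (auto simp: add.commute)
  finally show ?thesis by simp
qed

lemma nn_integral_lborel_reflect:
  fixes f :: "'a::euclidean_space \<Rightarrow> ennreal"
  assumes [measurable]: "f \<in> borel_measurable borel"
  shows "(\<integral>\<^sup>+x. f (- x) \<partial>lborel) = (\<integral>\<^sup>+x. f x \<partial>lborel)"
proof -
  have "(lborel :: 'a measure) = density (distr lborel borel (\<lambda>x. - x)) (\<lambda>_. 1)"
    using lborel_affine[of "-1" "0::'a"] by simp
  then have "(\<integral>\<^sup>+x. f x \<partial>lborel) = integral\<^sup>N (density (distr lborel borel (\<lambda>x. - x)) (\<lambda>_. 1)) f"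
    by (rule arg_cong)
  also have "\<dots> = (\<integral>\<^sup>+x. f (- x) \<partial>lborel)"
    by (subst nn_integral_density) (auto simp: nn_integral_distr)
  finally show ?thesis by simp
qed

section \<open>Linear isometries and radial symmetry\<close>

definition isom :: "('a::euclidean_space \<Rightarrow> 'a) \<Rightarrow> bool" where
  "isom R \<longleftrightarrow> linear R \<and> (\<forall>x. norm (R x) = norm x)"

lemma isom_measurable: "isom R \<Longrightarrow> R \<in> borel_measurable borel"
  unfolding isom_def by (intro borel_measurable_continuous_onI linear_continuous_on) (simp add: linear_conv_bounded_linear)

lemma isom_inner:
  assumes "isom R" shows "R x \<bullet> R y = x \<bullet> y"
proof -
  have l: "R (x + y) = R x + R y" "\<And>x. norm (R x) = norm x" using assms by (auto simp: isom_def linear_add)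
  have "(norm (R x + R y))\<^sup>2 = (norm (x + y))\<^sup>2" by (simp add: l(1)[symmetric] l(2))
  then show ?thesis using l(2)[of x] l(2)[of y] by (simp add: power2_norm_eq_inner algebra_simps inner_commute norm_eq)
qed

text \<open>Both sides multiplied with \<open>\<integral> exp (- |y|\<^sup>2 / 2) dy\<close> are the same double integral: the
  uniqueness proof for Haar measure.\<close>

lemma nn_integral_isom:
  fixes f :: "'a::euclidean_space \<Rightarrow> ennreal"
  assumes R: "isom R" and [measurable]: "f \<in> borel_measurable borel"
  shows "(\<integral>\<^sup>+x. f (R x) \<partial>lborel) = (\<integral>\<^sup>+x. f x \<partial>lborel)"
proof -
  let ?g = "\<integral>\<^sup>+x. f (R x) \<partial>lborel"
  let ?f = "\<lambda>g. integral\<^sup>N lborel g"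
  note [measurable] = isom_measurable[OF R]
  have lin: "linear R" and nR: "\<And>x. norm (R x) = norm x" using R by (auto simp: isom_def)
  have "inj R" using lin nR by (metis linear_injective_0 norm_eq_zero)
  then have surj: "surj R" using lin linear_injective_imp_surjective by blast
  define g where "g x = ennreal (cmod (gauss 1 x))" for x :: 'a
  have [measurable]: "g \<in> borel_measurable borel" unfolding g_def[abs_def] by measurable
  have gR: "g (R x) = g x" for x by (simp add: g_def cmod_gauss nR)
  have g0: "?f g \<noteq> 0"
  proof
    assume "?f g = 0"
    then have "AE x in lborel. g x = 0" by (subst (asm) nn_integral_0_iff_AE) auto
    then have "AE x in (lborel :: 'a measure). False" by eventually_elim (simp add: g_def cmod_gauss)
    then show False by (simp add: ae_filter_eq_bot_iff trivial_limit_def[symmetric])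
  qed
  have gfin: "?f g < \<infinity>"
    unfolding g_def using integrable_gauss[of 1, where 'a='a] by (simp add: integrable_iff_bounded)
  have tr: "(\<integral>\<^sup>+x. f (R x + y) \<partial>lborel) = ?g" for y
  proof -
    obtain u where u: "y = R u" using surj by auto
    have "(\<integral>\<^sup>+x. f (R x + y) \<partial>lborel) = (\<integral>\<^sup>+x. f (R (x + u)) \<partial>lborel)" by (simp add: u linear_add[OF lin])
    also have "\<dots> = ?g"
      by (rule nn_integral_lborel_translate[of "\<lambda>x. f (R x)"]) measurable
    finally show ?thesis .
  qed
  have gt: "(\<integral>\<^sup>+x. g (y - R x) \<partial>lborel) = ?f g" for y
  proof -
    obtain u where u: "y = R u" using surj by auto
    have "(\<integral>\<^sup>+x. g (y - R x) \<partial>lborel) = (\<integral>\<^sup>+x. g (u + - x) \<partial>lborel)"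
      by (simp add: u linear_diff[OF lin, symmetric] gR)
    also have "\<dots> = (\<integral>\<^sup>+x. g (u + x) \<partial>lborel)"
      by (rule nn_integral_lborel_reflect[of "\<lambda>x. g (u + x)"]) measurable
    also have "\<dots> = ?f g" using nn_integral_lborel_translate[of g u] by (simp add: add.commute)
    finally show ?thesis .
  qed
  have "?g * integral\<^sup>N lborel g = (\<integral>\<^sup>+y. \<integral>\<^sup>+x. f (R x + y) * g y \<partial>lborel \<partial>lborel)"
    by (subst nn_integral_cmult[symmetric]) (auto simp: nn_integral_multc tr)
  also have "\<dots> = (\<integral>\<^sup>+x. \<integral>\<^sup>+y. f (R x + y) * g y \<partial>lborel \<partial>lborel)"
    by (rule lborel_pair.Fubini') measurable
  also have "\<dots> = (\<integral>\<^sup>+x. \<integral>\<^sup>+y. f y * g (y - R x) \<partial>lborel \<partial>lborel)"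
    using nn_integral_lborel_translate[of "\<lambda>y. f (R x + y) * g y" "- R x" for x] by (simp add: algebra_simps)
  also have "\<dots> = (\<integral>\<^sup>+y. \<integral>\<^sup>+x. f y * g (y - R x) \<partial>lborel \<partial>lborel)"
    by (rule lborel_pair.Fubini') measurable
  also have "\<dots> = (\<integral>\<^sup>+x. f x \<partial>lborel) * integral\<^sup>N lborel g"
    by (subst nn_integral_cmult) (auto simp: gt nn_integral_multc)
  finally show ?thesis using g0 gfin[THEN less_imp_neq] by (simp add: ennreal_mult_cancel_left mult.commute[of _ "?f g"])
qed

lemma distr_isom: assumes R: "isom R" shows "distr lborel borel R = lborel"
proof (rule measure_eqI)
  note [measurable] = isom_measurable[OF R]
  fix A assume "A \<in> sets (distr lborel borel R)"
  then have [measurable]: "A \<in> sets borel" by simp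
  have "emeasure (distr lborel borel R) A = (\<integral>\<^sup>+x. indicator A x \<partial>distr lborel borel R)" by simp
  also have "\<dots> = (\<integral>\<^sup>+x. indicator A (R x) \<partial>lborel)" by (rule nn_integral_distr) auto
  also have "\<dots> = (\<integral>\<^sup>+x. indicator A x \<partial>lborel)" by (rule nn_integral_isom[OF R]) auto
  finally show "emeasure (distr lborel borel R) A = emeasure lborel A" by simp
qed simp

text \<open>The reflection in the hyperplane orthogonal to a - b. If a = b, division by 0 gives 0
  and R is the identity.\<close>

lemma isom_exists:
  fixes a b :: "'a::euclidean_space"
  assumes "norm a = norm b"
  obtains R where "isom R" "R a = b"
proof
  define v where "v = a - b"
  define R where "R x = x - (2 * (v \<bullet> x) / (v \<bullet> v)) *\<^sub>R v" for x
  have "linear R" unfolding R_def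
    by (rule linearI) (auto simp: algebra_simps add_divide_distrib)
  moreover have "norm (R x) = norm x" for x
  proof (cases "v = 0")
    case False
    have "R x \<bullet> R x = x \<bullet> x"
      unfolding R_def using False by (simp add: inner_diff_left inner_diff_right inner_commute field_simps)
    then show ?thesis by (simp add: norm_eq)
  qed (simp add: R_def)
  ultimately show "isom R" by (simp add: isom_def)
  show "R a = b"
  proof (cases "v = 0")
    case False
    have "a \<bullet> a = b \<bullet> b" using assms by (simp add: norm_eq)
    then have "2 * (v \<bullet> a) = v \<bullet> v" by (simp add: v_def inner_diff_left inner_diff_right inner_commute)
    then show ?thesis using False by (simp add: R_def v_def)
  qed (simp add: R_def v_def)
qed

lemma radial_isom: "radial f \<Longrightarrow> isom R \<Longrightarrow> f (R x) = f x"
  unfolding radial_def isom_def by blast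

lemma radial_fourier_integral:
  assumes f: "radial f" and [measurable]: "f \<in> borel_measurable borel"
  shows "radial (fourier_integral f)"
  unfolding radial_def
proof (intro allI impI)
  fix x y :: 'a assume "norm x = norm y"
  then obtain R where R: "isom R" "R x = y" by (rule isom_exists)
  note [measurable] = isom_measurable[OF R(1)]
  have "fourier_integral f y = (LINT z|distr lborel borel R. exp (- (\<i> * of_real (z \<bullet> y))) * f z)"
    by (simp add: fourier_integral_def distr_isom[OF R(1)])
  also have "\<dots> = (LINT z|lborel. exp (- (\<i> * of_real (R z \<bullet> R x))) * f (R z))"
    by (subst integral_distr) (auto simp: R)
  also have "\<dots> = fourier_integral f x"
    by (simp add: fourier_integral_def isom_inner[OF R(1)] radial_isom[OF f R(1)])
  finally show "fourier_integral f x = fourier_integral f y" by simp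
qed

lemma radial_trunc: "radial f \<Longrightarrow> radial (trunc f j)"
  unfolding radial_def trunc_def by (metis (no_types))

lemma radial_L2_fourier:
  assumes "radial f" and [measurable]: "f \<in> borel_measurable borel"
  shows "radial (L2_fourier f)"
  unfolding radial_def
proof (intro allI impI)
  fix x y :: 'a assume n: "norm x = norm y"
  have "fourier_integral (trunc f j) x = fourier_integral (trunc f j) y" for j
    using n radial_fourier_integral[OF radial_trunc[OF assms(1)] trunc_measurable[OF assms(2)], of j] unfolding radial_def by blast
  then show "L2_fourier f x = L2_fourier f y" by (simp only: L2_fourier_def)
qed

lemma radial_inv_fourier:
  assumes "radial f" and [measurable]: "f \<in> borel_measurable borel"
  shows "radial (inv_fourier f)"
  unfolding radial_def
proof (intro allI impI)
  fix x y :: 'a assume "norm x = norm y"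
  then have "L2_fourier f (- x) = L2_fourier f (- y)"
    using radial_L2_fourier[OF assms] unfolding radial_def by (metis norm_minus_cancel)
  then show "inv_fourier f x = inv_fourier f y" by (simp add: inv_fourier_def)
qed

text \<open>Substitution on compact intervals, which then exhaust the half line by monotone
  convergence.\<close>

lemma nn_integral_square:
  fixes f :: "real \<Rightarrow> ennreal"
  assumes [measurable]: "f \<in> borel_measurable borel"
  shows "(\<integral>\<^sup>+u. f u * indicator {0<..} u \<partial>lborel) = (\<integral>\<^sup>+x. f (x\<^sup>2) * ennreal (2 * x) * indicator {0<..} x \<partial>lborel)"
proof -
  let ?f = "\<lambda>x n. f (x\<^sup>2) * ennreal (2 * x) * indicator {0..real (Suc n)} x"
  have S: "(SUP n. c * indicator {0..g n} x) = c * indicator {0..} x" if "\<And>n. real n \<le> g n" for c :: ennreal and x :: real and g :: "nat \<Rightarrow> real"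
  proof (cases "x \<ge> 0")
    case True
    obtain n where "x \<le> real n" using real_arch_simple by blast
    then have "x \<le> g n" using that[of n] by simp
    with True show ?thesis by (intro antisym SUP_least SUP_upper2[of n]) (auto simp: indicator_def)
  qed simp
  have I: "incseq (\<lambda>n x. h x * indicator {0..g n} x)" if "\<And>n. g n \<le> g (Suc n)" for h :: "real \<Rightarrow> ennreal" and g :: "nat \<Rightarrow> real"
  proof (intro incseq_SucI le_funI)
    fix n x
    show "h x * indicator {0..g n} x \<le> h x * indicator {0..g (Suc n)} x"
      using that[of n] by (intro mult_left_mono) (auto simp: indicator_def)
  qed
  have "(\<integral>\<^sup>+u. f u * indicator {0<..} u \<partial>lborel) = (\<integral>\<^sup>+u. f u * indicator {0..} u \<partial>lborel)"
    by (intro nn_integral_cong_AE AE_I[of _ _ "{0}"]) (auto simp: indicator_def)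
  also have "\<dots> = (\<integral>\<^sup>+u. (SUP n. f u * indicator {0..(real (Suc n))\<^sup>2} u) \<partial>lborel)"
    by (intro nn_integral_cong S[symmetric]) (auto simp: power2_eq_square algebra_simps)
  also have "\<dots> = (SUP n. \<integral>\<^sup>+u. f u * indicator {0..(real (Suc n))\<^sup>2} u \<partial>lborel)"
    by (intro nn_integral_monotone_convergence_SUP I) (auto intro: power_mono)
  also have "\<dots> = (SUP n. \<integral>\<^sup>+x. ?f x n \<partial>lborel)"
  proof (intro SUP_cong refl)
    fix n
    have "(\<integral>\<^sup>+u. f u * indicator {0\<^sup>2..(real (Suc n))\<^sup>2} u \<partial>lborel) = (\<integral>\<^sup>+x. ?f x n \<partial>lborel)"
      by (rule nn_integral_substitution_aux) (auto intro!: derivative_eq_intros continuous_intros)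
    then show "(\<integral>\<^sup>+u. f u * indicator {0..(real (Suc n))\<^sup>2} u \<partial>lborel) = (\<integral>\<^sup>+x. ?f x n \<partial>lborel)" by simp
  qed
  also have "\<dots> = (\<integral>\<^sup>+x. (SUP n. f (x\<^sup>2) * ennreal (2 * x) * indicator {0..real (Suc n)} x) \<partial>lborel)"
    by (intro nn_integral_monotone_convergence_SUP[symmetric] I) auto
  also have "\<dots> = (\<integral>\<^sup>+x. f (x\<^sup>2) * ennreal (2 * x) * indicator {0..} x \<partial>lborel)"
    by (intro nn_integral_cong S) auto
  also have "\<dots> = (\<integral>\<^sup>+x. f (x\<^sup>2) * ennreal (2 * x) * indicator {0<..} x \<partial>lborel)"
    by (intro nn_integral_cong) (auto simp: indicator_def)
  finally show ?thesis .
qed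

lemma nn_integral_square_real:
  fixes f :: "real \<Rightarrow> ennreal"
  assumes [measurable]: "f \<in> borel_measurable borel"
  shows "(\<integral>\<^sup>+x. f (x\<^sup>2) \<partial>lborel) = (\<integral>\<^sup>+t. f t * ennreal (t powr (-1 / 2)) * indicator {0<..} t \<partial>lborel)"
proof -
  let ?k = "\<integral>\<^sup>+x. f ((- x)\<^sup>2) * indicator {0<..} (- x) \<partial>lborel"
  let ?h = "(\<integral>\<^sup>+x. f (x\<^sup>2) * ennreal ((x\<^sup>2) powr (-1 / 2)) * ennreal (2 * x) * indicator {0<..} x \<partial>lborel)"
  let ?g = "\<integral>\<^sup>+x. f (x\<^sup>2) * indicator {0<..} x \<partial>lborel"
  let ?f = "\<integral>\<^sup>+x. f (x\<^sup>2) * indicator {0<..} x \<partial>(lborel :: real measure)"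
  have "(\<integral>\<^sup>+x. f (x\<^sup>2) \<partial>lborel) = (\<integral>\<^sup>+x. f (x\<^sup>2) * indicator {0<..} x + f ((- x)\<^sup>2) * indicator {0<..} (- x) \<partial>lborel)"
    by (intro nn_integral_cong_AE AE_I[of _ _ "{0}"]) (auto simp: indicator_def)
  also have "\<dots> = ?g + ?k"
    by (intro nn_integral_add) auto
  also have "?k = ?f"
    by (rule nn_integral_lborel_reflect[of "\<lambda>x. f (x\<^sup>2) * indicator {0<..} x"]) measurable
  also have "?g + ?f =
    ?h"
  proof -
    have "?g + ?f =
      (\<integral>\<^sup>+x. f (x\<^sup>2) * indicator {0<..} x + f (x\<^sup>2) * indicator {0<..} x \<partial>lborel)"
      by (rule nn_integral_add[symmetric]) auto
    also have "\<dots> = ?h"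
    proof (intro nn_integral_cong)
      fix x :: real
      have "ennreal ((x\<^sup>2) powr (-1 / 2)) * ennreal (2 * x) = 2" if "x > 0"
      proof -
        have "(x\<^sup>2) powr (-1 / 2) = 1 / x" using that powr_minus[of "x\<^sup>2" "1 / 2"] by (simp add: powr_half_sqrt inverse_eq_divide)
        then show ?thesis using that by (simp flip: ennreal_mult)
      qed
      then show "f (x\<^sup>2) * indicator {0<..} x + f (x\<^sup>2) * indicator {0<..} x = f (x\<^sup>2) * ennreal (x\<^sup>2 powr (- 1 / 2)) * ennreal (2 * x) * indicator {0<..} x"
        by (cases "x > 0") (simp_all only: mult.assoc, simp_all add: mult_2_right)
    qed
    finally show ?thesis .
  qed
  also have "\<dots> = (\<integral>\<^sup>+t. f t * ennreal (t powr (-1 / 2)) * indicator {0<..} t \<partial>lborel)"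
    by (rule nn_integral_square[symmetric]) measurable
  finally show ?thesis .
qed

section \<open>Spherical, cylindrical and bipolar coordinates\<close>

lemma nn_integral_Beta:
  fixes a b w :: real
  assumes a: "a > 0" and b: "b > 0" and w: "w > 0"
  shows "(\<integral>\<^sup>+u. ennreal (u powr (a - 1) * (w - u) powr (b - 1)) * indicator {0<..<w} u \<partial>lborel) = ennreal (Beta a b * w powr (a + b - 1))"
proof -
  let ?f = "w powr (a + b - 2)"
  have "(\<integral>\<^sup>+u. ennreal (u powr (a - 1) * (w - u) powr (b - 1)) * indicator {0<..<w} u \<partial>lborel) =
     \<bar>w\<bar> * (\<integral>\<^sup>+t. ennreal ((0 + w * t) powr (a - 1) * (w - (0 + w * t)) powr (b - 1)) * indicator {0<..<w} (0 + w * t) \<partial>lborel)"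
    using w by (intro nn_integral_real_affine) auto
  also have "\<dots> = \<bar>w\<bar> * (\<integral>\<^sup>+t. ennreal ?f * ennreal ((t powr (a - 1) * (1 - t) powr (b - 1)) * indicator {0..1} t) \<partial>lborel)"
  proof (intro arg_cong2[of _ _ _ _ "(*)"] refl nn_integral_cong_AE AE_I[of _ _ "{0, 1}"])
    show "{x \<in> space lborel. ennreal ((0 + w * x) powr (a - 1) * (w - (0 + w * x)) powr (b - 1)) * indicator {0<..<w} (0 + w * x) \<noteq>
        ennreal ?f * ennreal ((x powr (a - 1) * (1 - x) powr (b - 1)) * indicator {0..1} x)} \<subseteq> {0, 1}"
    proof (clarify, goal_cases)
      case (1 x)
      have "ennreal ((0 + w * x) powr (a - 1) * (w - (0 + w * x)) powr (b - 1)) * indicator {0<..<w} (0 + w * x) =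
        ennreal ?f * ennreal ((x powr (a - 1) * (1 - x) powr (b - 1)) * indicator {0..1} x)" if x: "x \<noteq> 0" "x \<noteq> 1"
      proof (cases "0 < x \<and> x < 1")
        case True
        have "w - w * x = w * (1 - x)" by (simp add: algebra_simps)
        moreover have "?f = w powr (a - 1) * w powr (b - 1)" by (simp flip: powr_add)
        ultimately show ?thesis using True w
          by (simp add: powr_mult ennreal_mult'[symmetric] mult_ac)
      next
        case False
        then have "\<not> (0 < w * x \<and> w * x < w)" "x \<notin> {0..1}" using w x
          by (auto simp: zero_less_mult_iff mult_less_cancel_left1)
        then show ?thesis by (auto simp: indicator_def)
      qed
      with 1 show ?case by auto
    qed
  qed (auto simp: emeasure_lborel_countable)
  also have "\<dots> = \<bar>w\<bar> * (ennreal ?f * ennreal (Beta a b))"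
  proof -
    have "(\<integral>\<^sup>+t. ennreal ((t powr (a - 1) * (1 - t) powr (b - 1)) * indicator {0..1} t) \<partial>lborel) = ennreal (Beta a b)"
      using nn_integral_has_integral_lebesgue[OF _ has_integral_Beta_real[OF a b]] by (simp add: mult.commute)
    then show ?thesis by (subst nn_integral_cmult) auto
  qed
  also have "\<dots> = ennreal (w * ?f * Beta a b)"
    using w a b by (simp add: ennreal_mult'[symmetric] mult.assoc)
  also have "w * ?f = w powr (a + b - 1)"
    using w powr_add[of w 1 "a + b - 2"] by simp
  finally show ?thesis by (simp add: mult.commute)
qed

text \<open>Half the area of the unit sphere of n-dimensional space. The half is the Jacobian of t =
  |x|^2: the squared norm carries the density
  \<open>half_sphere n * t powr (n / 2 - 1)\<close>.\<close>

definition half_sphere :: "real \<Rightarrow> real" where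
  "half_sphere n = pi powr (n / 2) / Gamma (n / 2)"

lemma half_sphere_pos: "n > 0 \<Longrightarrow> half_sphere n > 0"
  by (simp add: half_sphere_def Gamma_real_pos)

lemma half_sphere_Suc: "n > 0 \<Longrightarrow> half_sphere n * Beta (1 / 2) (n / 2) = half_sphere (n + 1)"
proof -
  assume n: "n > 0"
  have "pi powr ((n + 1) / 2) = pi powr (n / 2) * sqrt pi"
    by (simp add: add_divide_distrib powr_add powr_half_sqrt)
  moreover have "Gamma (1 / 2 + n / 2) = Gamma ((n + 1) / 2)" by (simp add: add_divide_distrib add.commute)
  moreover have "Gamma (n / 2) > 0" using n by (intro Gamma_real_pos) simp
  ultimately show ?thesis
    by (simp add: half_sphere_def Beta_def Gamma_one_half_real)
qed

lemma half_sphere_1: "half_sphere 1 = 1"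
  by (simp add: half_sphere_def Gamma_one_half_real powr_half_sqrt)

text \<open>Induction over the coordinates: adding one squared coordinate convolves the density with
  \<open>u powr (- 1 / 2)\<close>, and a Beta integral raises the exponent by one half. This takes
  the place of polar coordinates.\<close>

lemma nn_integral_sum_squares:
  fixes g :: "real \<Rightarrow> ennreal"
  assumes "finite J" "J \<noteq> {}" and [measurable]: "g \<in> borel_measurable borel"
  shows "(\<integral>\<^sup>+x. g (\<Sum>b\<in>J. (x b)\<^sup>2) \<partial>Pi\<^sub>M J (\<lambda>_. lborel)) =
    (\<integral>\<^sup>+t. g t * ennreal (half_sphere (card J) * t powr (card J / 2 - 1)) * indicator {0<..} t \<partial>lborel)"
  using assms
proof (induction J arbitrary: g rule: finite_ne_induct)
  case (singleton i)
  note [measurable] = singleton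
  interpret product_sigma_finite "\<lambda>_. lborel :: real measure" ..
  have "(\<integral>\<^sup>+x. g (\<Sum>b\<in>{i}. (x b)\<^sup>2) \<partial>Pi\<^sub>M {i} (\<lambda>_. lborel)) = (\<integral>\<^sup>+x. g (x\<^sup>2) \<partial>lborel)"
    by (simp, subst product_nn_integral_singleton[of "\<lambda>y. g (y\<^sup>2)"]) simp_all
  then show ?case by (simp add: nn_integral_square_real half_sphere_1)
next
  case (insert i J)
  note [measurable] = insert.prems
  interpret product_sigma_finite "\<lambda>_. lborel :: real measure" ..
  define n where "n = real (card J)"
  have n: "n > 0" using insert by (simp add: n_def card_gt_0_iff)
  let ?k = "\<lambda>t. ennreal (half_sphere n * t powr (n / 2 - 1)) * indicator {0<..} t"
  let ?f = "\<lambda>w u. g w * ?k (w - u) * (ennreal (u powr (- 1 / 2)) * indicator {0<..} u)"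
  have "(\<integral>\<^sup>+x. g (\<Sum>b\<in>insert i J. (x b)\<^sup>2) \<partial>Pi\<^sub>M (insert i J) (\<lambda>_. lborel)) =
     (\<integral>\<^sup>+y. \<integral>\<^sup>+x. g (\<Sum>b\<in>insert i J. ((x(i := y)) b)\<^sup>2) \<partial>Pi\<^sub>M J (\<lambda>_. lborel) \<partial>lborel)"
    using insert.hyps by (intro product_nn_integral_insert_rev) auto
  also have "\<dots> = (\<integral>\<^sup>+y. \<integral>\<^sup>+x. g (y\<^sup>2 + (\<Sum>b\<in>J. (x b)\<^sup>2)) \<partial>Pi\<^sub>M J (\<lambda>_. lborel) \<partial>lborel)"
  proof (intro nn_integral_cong arg_cong[of _ _ g])
    fix y :: real and x :: "'a \<Rightarrow> real"
    have "(\<Sum>b\<in>J. ((x(i := y)) b)\<^sup>2) = (\<Sum>b\<in>J. (x b)\<^sup>2)" using insert.hyps by (intro sum.cong) auto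
    then show "(\<Sum>b\<in>insert i J. ((x(i := y)) b)\<^sup>2) = y\<^sup>2 + (\<Sum>b\<in>J. (x b)\<^sup>2)" using insert.hyps by simp
  qed
  also have "\<dots> = (\<integral>\<^sup>+y. \<integral>\<^sup>+t. g (y\<^sup>2 + t) * ?k t \<partial>lborel \<partial>lborel)"
    by (intro nn_integral_cong) (subst insert.IH, auto simp: n_def mult.assoc)
  also have "\<dots> = (\<integral>\<^sup>+u. (\<integral>\<^sup>+t. g (u + t) * ?k t \<partial>lborel) * ennreal (u powr (- 1 / 2)) * indicator {0<..} u \<partial>lborel)"
    by (rule nn_integral_square_real) measurable
  also have "\<dots> = (\<integral>\<^sup>+u. \<integral>\<^sup>+w. ?f w u \<partial>lborel \<partial>lborel)"
  proof (intro nn_integral_cong)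
    fix u :: real
    have "(\<integral>\<^sup>+t. g (u + t) * ?k t \<partial>lborel) = (\<integral>\<^sup>+w. g w * ?k (w - u) \<partial>lborel)"
      using nn_integral_lborel_translate[of "\<lambda>t. g (u + t) * ?k t" "- u"] by simp
    then show "(\<integral>\<^sup>+t. g (u + t) * ?k t \<partial>lborel) * ennreal (u powr (- 1 / 2)) * indicator {0<..} u =
       (\<integral>\<^sup>+w. ?f w u \<partial>lborel)"
      by (subst nn_integral_multc) (auto simp: mult.assoc)
  qed
  also have "\<dots> = (\<integral>\<^sup>+w. \<integral>\<^sup>+u. ?f w u \<partial>lborel \<partial>lborel)"
    by (rule lborel_pair.Fubini') measurable
  also have "\<dots> = (\<integral>\<^sup>+w. g w * (ennreal (half_sphere (n + 1) * w powr ((n + 1) / 2 - 1)) * indicator {0<..} w) \<partial>lborel)"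
  proof (intro nn_integral_cong)
    fix w :: real
    have "(\<integral>\<^sup>+u. ?f w u \<partial>lborel) =
      (\<integral>\<^sup>+u. (g w * ennreal (half_sphere n)) * (ennreal (u powr (1 / 2 - 1) * (w - u) powr (n / 2 - 1)) * indicator {0<..<w} u) \<partial>lborel)"
      using half_sphere_pos[OF n] by (intro nn_integral_cong) (auto simp: indicator_def ennreal_mult' mult_ac)
    also have "\<dots> = (g w * ennreal (half_sphere n)) * (\<integral>\<^sup>+u. ennreal (u powr (1 / 2 - 1) * (w - u) powr (n / 2 - 1)) * indicator {0<..<w} u \<partial>lborel)"
      by (rule nn_integral_cmult) measurable
    also have "(\<integral>\<^sup>+u. ennreal (u powr (1 / 2 - 1) * (w - u) powr (n / 2 - 1)) * indicator {0<..<w} u \<partial>lborel)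
       = ennreal (Beta (1 / 2) (n / 2) * w powr ((n + 1) / 2 - 1)) * indicator {0<..} w"
    proof (cases "w > 0")
      case True
      have e: "1 / 2 + n / 2 - 1 = (n + 1) / 2 - 1" by (simp add: add_divide_distrib)
      show ?thesis using True n nn_integral_Beta[of "1 / 2" "n / 2" w] unfolding e by simp
    next
      case False then show ?thesis by (simp add: indicator_def)
    qed
    finally show "(\<integral>\<^sup>+u. ?f w u \<partial>lborel) =
      g w * (ennreal (half_sphere (n + 1) * w powr ((n + 1) / 2 - 1)) * indicator {0<..} w)"
      using half_sphere_pos[OF n] by (simp add: half_sphere_Suc[OF n, symmetric] ennreal_mult' mult.assoc)
  qed
  finally show ?case using insert.hyps by (simp add: n_def mult.assoc add.commute)
qed

lemma nn_integral_norm: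
  fixes g :: "real \<Rightarrow> ennreal"
  assumes [measurable]: "g \<in> borel_measurable borel"
  shows "(\<integral>\<^sup>+x. g ((norm (x::'a::euclidean_space))\<^sup>2) \<partial>lborel) =
    (\<integral>\<^sup>+t. g t * ennreal (half_sphere DIM('a) * t powr (DIM('a) / 2 - 1)) * indicator {0<..} t \<partial>lborel)"
proof -
  have "(\<integral>\<^sup>+x. g ((norm (x::'a))\<^sup>2) \<partial>lborel) = (\<integral>\<^sup>+x. g (\<Sum>b\<in>Basis. (x b)\<^sup>2) \<partial>(\<Pi>\<^sub>M b\<in>(Basis :: 'a set). lborel))"
    by (subst lborel_eq, subst nn_integral_distr)
       (auto simp: norm_sq_Basis inner_sum_left inner_Basis if_distrib cong: if_cong intro!: nn_integral_cong arg_cong[of _ _ g] sum.cong)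
  also have "\<dots> = (\<integral>\<^sup>+t. g t * ennreal (half_sphere DIM('a) * t powr (DIM('a) / 2 - 1)) * indicator {0<..} t \<partial>lborel)"
    by (rule nn_integral_sum_squares) auto
  finally show ?thesis .
qed

text \<open>Cylindrical coordinates: z runs along the axis and t is the squared distance from it,
  which carries the density of a squared norm in dimension d - 1; at least one transverse coordinate
  must exist, whence d \<ge> 2.\<close>

lemma nn_integral_axis_Basis:
  fixes g :: "real \<Rightarrow> real \<Rightarrow> ennreal" and e :: "'a::euclidean_space"
  assumes [measurable]: "(\<lambda>(z, t). g z t) \<in> borel_measurable (borel \<Otimes>\<^sub>M borel)" and e: "e \<in> Basis" and d: "DIM('a) \<ge> 2"
  shows "(\<integral>\<^sup>+x. g (x \<bullet> e) ((norm x)\<^sup>2 - (x \<bullet> e)\<^sup>2) \<partial>lborel) =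
    (\<integral>\<^sup>+z. \<integral>\<^sup>+t. g z t * ennreal (half_sphere (DIM('a) - 1) * t powr ((DIM('a) - 1) / 2 - 1)) * indicator {0<..} t \<partial>lborel \<partial>lborel)"
proof -
  define J where "J = (Basis :: 'a set) - {e}"
  have J: "finite J" "e \<notin> J" "Basis = insert e J" using e by (auto simp: J_def)
  have cJ: "card J = DIM('a) - 1" using e by (simp add: J_def)
  then have "card J \<noteq> 0" using d by simp
  then have J0: "J \<noteq> {}" by auto
  interpret product_sigma_finite "\<lambda>_::'a. lborel :: real measure" ..
  have *: "(\<Sum>b'\<in>Basis. x b' *\<^sub>R b') \<bullet> b = x b" if "b \<in> Basis" for x :: "'a \<Rightarrow> real" and b
    using that by (simp add: inner_sum_left inner_Basis if_distrib cong: if_cong)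
  have "(\<integral>\<^sup>+x. g (x \<bullet> e) ((norm x)\<^sup>2 - (x \<bullet> e)\<^sup>2) \<partial>lborel) =
     (\<integral>\<^sup>+x. g (x e) ((\<Sum>b\<in>Basis. (x b)\<^sup>2) - (x e)\<^sup>2) \<partial>(\<Pi>\<^sub>M b\<in>(Basis :: 'a set). lborel))"
    by (subst lborel_eq, subst nn_integral_distr) (auto simp: norm_sq_Basis * e intro!: nn_integral_cong)
  also have "\<dots> = (\<integral>\<^sup>+x. g (x e) (\<Sum>b\<in>J. (x b)\<^sup>2) \<partial>Pi\<^sub>M (insert e J) (\<lambda>_. lborel))"
    using J by (simp add: J(3))
  also have "\<dots> = (\<integral>\<^sup>+z. \<integral>\<^sup>+x. g ((x(e := z)) e) (\<Sum>b\<in>J. ((x(e := z)) b)\<^sup>2) \<partial>Pi\<^sub>M J (\<lambda>_. lborel) \<partial>lborel)"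
    by (intro product_nn_integral_insert_rev J) measurable
  also have "\<dots> = (\<integral>\<^sup>+z. \<integral>\<^sup>+x. g z (\<Sum>b\<in>J. (x b)\<^sup>2) \<partial>Pi\<^sub>M J (\<lambda>_. lborel) \<partial>lborel)"
    using J by (intro nn_integral_cong arg_cong2[of _ _ _ _ g] sum.cong) auto
  also have "\<dots> = (\<integral>\<^sup>+z. \<integral>\<^sup>+t. g z t * ennreal (half_sphere (card J) * t powr (card J / 2 - 1)) * indicator {0<..} t \<partial>lborel \<partial>lborel)"
    by (intro nn_integral_cong nn_integral_sum_squares J J0) measurable
  finally show ?thesis by (simp add: cJ)
qed

lemma nn_integral_axis:
  fixes g :: "real \<Rightarrow> real \<Rightarrow> ennreal" and e :: "'a::euclidean_space"
  assumes [measurable]: "(\<lambda>(z, t). g z t) \<in> borel_measurable (borel \<Otimes>\<^sub>M borel)" and e: "norm e = 1" and d: "DIM('a) \<ge> 2"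
  shows "(\<integral>\<^sup>+x. g (x \<bullet> e) ((norm x)\<^sup>2 - (x \<bullet> e)\<^sup>2) \<partial>lborel) =
    (\<integral>\<^sup>+z. \<integral>\<^sup>+t. g z t * ennreal (half_sphere (DIM('a) - 1) * t powr ((DIM('a) - 1) / 2 - 1)) * indicator {0<..} t \<partial>lborel \<partial>lborel)"
proof -
  obtain b :: 'a where b: "b \<in> Basis" using nonempty_Basis by blast
  then obtain R where R: "isom R" "R b = e" using isom_exists[of b e] e by auto
  have nR: "norm (R x) = norm x" for x using R by (simp add: isom_def)
  have "(\<integral>\<^sup>+x. g (x \<bullet> e) ((norm x)\<^sup>2 - (x \<bullet> e)\<^sup>2) \<partial>lborel) = (\<integral>\<^sup>+x. g (R x \<bullet> R b) ((norm (R x))\<^sup>2 - (R x \<bullet> R b)\<^sup>2) \<partial>lborel)"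
    unfolding R(2) by (rule nn_integral_isom[OF R(1), symmetric]) measurable
  also have "\<dots> = (\<integral>\<^sup>+x. g (x \<bullet> b) ((norm x)\<^sup>2 - (x \<bullet> b)\<^sup>2) \<partial>lborel)" by (simp add: isom_inner[OF R(1)] nR)
  also note nn_integral_axis_Basis[OF assms(1) b d]
  finally show ?thesis .
qed

text \<open>\<open>heron\<close> is sixteen times the squared area of a triangle, with its sides given
  by two energies and one length.\<close>

definition heron :: "real \<Rightarrow> real \<Rightarrow> real \<Rightarrow> real \<Rightarrow> real" where
  "heron s E E' \<rho> = 4 * \<rho>\<^sup>2 * (E\<^sup>2 - s\<^sup>2) - (E\<^sup>2 - E'\<^sup>2 + \<rho>\<^sup>2)\<^sup>2"

text \<open>Supported where a nondegenerate triangle with these sides exists. The signs of the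
  energies are prescribed separately because \<open>heron\<close> sees E and E' only through their
  squares.\<close>

definition qw :: "real \<Rightarrow> real \<Rightarrow> real \<Rightarrow> real \<Rightarrow> real \<Rightarrow> real" where
  "qw p s E E' \<rho> = (if 0 < E \<and> 0 < E' \<and> 0 < heron s E E' \<rho> then heron s E E' \<rho> powr p else 0)"

lemma qw_nonneg [simp]: "qw p s E E' \<rho> \<ge> 0"
  by (simp add: qw_def)

lemma heron_sym: "heron s E E' \<rho> = heron s E' E \<rho>"
  unfolding heron_def by (simp add: power2_eq_square algebra_simps)

lemma qw_sym: "qw p s E E' \<rho> = qw p s E' E \<rho>"
  unfolding qw_def by (auto simp: heron_sym)

lemma qw_measurable [measurable]:
  assumes [measurable]: "f \<in> borel_measurable M" "g \<in> borel_measurable M" "h \<in> borel_measurable M"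
  shows "(\<lambda>x. qw p s (f x) (g x) (h x)) \<in> borel_measurable M"
  unfolding qw_def heron_def by measurable

lemma phi_measurable [measurable]: "f \<in> borel_measurable M \<Longrightarrow> (\<lambda>x. phi s (f x)) \<in> borel_measurable M"
  unfolding phi_def by measurable

text \<open>In cylindrical coordinates around \<xi>, the first squared energy u is a translate of
  the squared distance from the axis for fixed z, and the second squared energy v is affine in z for
  fixed u. Two affine substitutions and two square roots therefore suffice. At \<xi> = 0 both
  energies coincide and there is no density.\<close>

theorem nn_integral_bipolar:
  fixes H :: "real \<Rightarrow> real \<Rightarrow> ennreal" and \<xi> :: "'a::euclidean_space"
  assumes [measurable]: "(\<lambda>(z, t). H z t) \<in> borel_measurable (borel \<Otimes>\<^sub>M borel)" and \<xi>: "\<xi> \<noteq> 0" and d: "DIM('a) \<ge> 2"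
  defines "p \<equiv> (real DIM('a) - 3) / 2"
  shows "(\<integral>\<^sup>+x. H (phi s (norm x)) (phi s (norm (x - \<xi>))) \<partial>lborel) =
    (\<integral>\<^sup>+E. \<integral>\<^sup>+E'. H E E' * ennreal (4 * half_sphere (real DIM('a) - 1) * (2 * norm \<xi>) powr (2 - real DIM('a)) * E * E' * qw p s E E' (norm \<xi>)) \<partial>lborel \<partial>lborel)"
proof -
  let ?H = "\<lambda>x e. (norm x)\<^sup>2 - (x \<bullet> e)\<^sup>2"
  let ?E = "\<lambda>G z c. \<integral>\<^sup>+t. G z t * ennreal (c * t powr p) * indicator {0<..} t \<partial>lborel"
  let ?D = "\<lambda>c \<rho> E E'. ennreal (4 * c * (2 * \<rho>) powr (2 - real DIM('a)) * E * E' * qw p s E E' \<rho>)"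
  let ?B = "\<lambda>E E' c \<rho>. H (sqrt (E\<^sup>2)) (sqrt (E'\<^sup>2)) * ennreal (2 * c * (2 * \<rho>) powr (2 - real DIM('a)) / 2 * qw p s (sqrt (E\<^sup>2)) (sqrt (E'\<^sup>2)) \<rho>) * ennreal (2 * E') * indicator {0<..} E' * (ennreal (2 * E) * indicator {0<..} E)"
  let ?A = "\<lambda>c \<rho> u v. ennreal (2 * c * (2 * \<rho>) powr (2 - real DIM('a)) / 2 * qw p s (sqrt u) (sqrt v) \<rho>)"
  let ?L = "\<lambda>u c \<rho>. (\<integral>\<^sup>+v. H (sqrt u) (sqrt v) * ?A c \<rho> u v * indicator {0<..} v \<partial>lborel) * indicator {0<..} u"
  let ?g = "\<lambda>E c \<rho>. (\<integral>\<^sup>+E'. H (sqrt (E\<^sup>2)) (sqrt (E'\<^sup>2)) * ennreal (2 * c * (2 * \<rho>) powr (2 - real DIM('a)) / 2 * qw p s (sqrt (E\<^sup>2)) (sqrt (E'\<^sup>2)) \<rho>) * ennreal (2 * E') * indicator {0<..} E' \<partial>lborel) * ennreal (2 * E) * indicator {0<..} E"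
  define \<rho> where "\<rho> = norm \<xi>"
  have \<rho>: "\<rho> > 0" using \<xi> by (simp add: \<rho>_def)
  define e where "e = \<xi> /\<^sub>R \<rho>"
  have e: "norm e = 1" "\<xi> = \<rho> *\<^sub>R e" using \<rho> by (auto simp: e_def \<rho>_def)
  define c where "c = half_sphere (real DIM('a) - 1)"
  have c: "c > 0" unfolding c_def using d by (intro half_sphere_pos) auto
  define G where "G z t = H (sqrt (s\<^sup>2 + z\<^sup>2 + t)) (sqrt (s\<^sup>2 + z\<^sup>2 + t - 2 * \<rho> * z + \<rho>\<^sup>2))" for z t
  have [measurable]: "(\<lambda>(z, t). G z t) \<in> borel_measurable (borel \<Otimes>\<^sub>M borel)"
    unfolding G_def[abs_def] by measurable
  have dim: "real (DIM('a) - 1) = real DIM('a) - 1" using d by simp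
  have p: "(real DIM('a) - 1) / 2 - 1 = p" by (simp add: p_def field_simps)
  let ?k = "\<lambda>t. ennreal (c * t powr p) * indicator {0<..} t"
  let ?h = "\<lambda>u \<rho> z. H (sqrt u) (sqrt (u - 2 * \<rho> * z + \<rho>\<^sup>2)) * ?k (u - s\<^sup>2 - z\<^sup>2)"
  let ?f = "\<lambda>\<rho> u v. ennreal (1 / (2 * \<rho>)) * (H (sqrt u) (sqrt v) * ?k (u - s\<^sup>2 - ((u + \<rho>\<^sup>2 - v) / (2 * \<rho>))\<^sup>2))"
  let ?G = "\<lambda>\<rho> u. \<integral>\<^sup>+v. ?f \<rho> u v \<partial>lborel"
  have "(\<integral>\<^sup>+x. H (phi s (norm x)) (phi s (norm (x - \<xi>))) \<partial>lborel) = (\<integral>\<^sup>+x. G (x \<bullet> e) (?H x e) \<partial>lborel)"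
  proof (rule nn_integral_cong)
    fix x
    have "e \<bullet> e = 1" using e(1) by (simp add: norm_eq_1)
    then have "(norm (x - \<xi>))\<^sup>2 = (norm x)\<^sup>2 - 2 * \<rho> * (x \<bullet> e) + \<rho>\<^sup>2"
      unfolding e(2) power2_norm_eq_inner by (simp add: inner_diff_left inner_diff_right inner_commute power2_eq_square)
    then have "s\<^sup>2 + (norm (x - \<xi>))\<^sup>2 = s\<^sup>2 + (x \<bullet> e)\<^sup>2 + (?H x e) - 2 * \<rho> * (x \<bullet> e) + \<rho>\<^sup>2"
      "s\<^sup>2 + (norm x)\<^sup>2 = s\<^sup>2 + (x \<bullet> e)\<^sup>2 + (?H x e)" by simp_all
    then show "H (phi s (norm x)) (phi s (norm (x - \<xi>))) = G (x \<bullet> e) (?H x e)"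
      unfolding G_def phi_def by (simp only:)
  qed
  also have "\<dots> = (\<integral>\<^sup>+z. ?E G z c \<partial>lborel)"
    using nn_integral_axis[OF _ e(1) d, of G] unfolding dim p c_def[symmetric] by simp
  also have "\<dots> = (\<integral>\<^sup>+z. \<integral>\<^sup>+u. ?h u \<rho> z \<partial>lborel \<partial>lborel)"
  proof (rule nn_integral_cong)
    fix z
    let ?K = "\<lambda>u. ?h u \<rho> z"
    have "(?E G z c) = (\<integral>\<^sup>+t. ?K (t + (s\<^sup>2 + z\<^sup>2)) \<partial>lborel)"
    proof (rule nn_integral_cong)
      fix t
      have "t + (s\<^sup>2 + z\<^sup>2) - s\<^sup>2 - z\<^sup>2 = t" "s\<^sup>2 + z\<^sup>2 + t = t + (s\<^sup>2 + z\<^sup>2)" by simp_all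
      then show "G z t * ennreal (c * t powr p) * indicator {0<..} t = ?K (t + (s\<^sup>2 + z\<^sup>2))"
        unfolding G_def by (simp only: mult.assoc)
    qed
    also have "\<dots> = (\<integral>\<^sup>+u. ?K u \<partial>lborel)" by (rule nn_integral_lborel_translate) measurable
    finally show "(?E G z c) = (\<integral>\<^sup>+u. ?K u \<partial>lborel)" .
  qed
  also have "\<dots> = (\<integral>\<^sup>+u. \<integral>\<^sup>+z. ?h u \<rho> z \<partial>lborel \<partial>lborel)"
    by (rule lborel_pair.Fubini') measurable
  also have "\<dots> = (\<integral>\<^sup>+u. ?G \<rho> u \<partial>lborel)"
  proof (rule nn_integral_cong)
    fix u
    let ?c = "- (1 / (2 * \<rho>))" and ?t = "(u + \<rho>\<^sup>2) / (2 * \<rho>)"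
    have c0: "?c \<noteq> 0" using \<rho> by simp
    have "(\<integral>\<^sup>+z. ?h u \<rho> z \<partial>lborel)
       = \<bar>?c\<bar> * (\<integral>\<^sup>+v. H (sqrt u) (sqrt (u - 2 * \<rho> * (?t + ?c * v) + \<rho>\<^sup>2)) * ?k (u - s\<^sup>2 - (?t + ?c * v)\<^sup>2) \<partial>lborel)"
      by (rule nn_integral_real_affine[OF _ c0]) measurable
    also have "\<dots> = (\<integral>\<^sup>+v. \<bar>?c\<bar> * (H (sqrt u) (sqrt (u - 2 * \<rho> * (?t + ?c * v) + \<rho>\<^sup>2)) * ?k (u - s\<^sup>2 - (?t + ?c * v)\<^sup>2)) \<partial>lborel)"
      by (rule nn_integral_cmult[symmetric]) measurable
    also have "\<dots> = (?G \<rho> u)"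
    proof (rule nn_integral_cong)
      fix v
      have "u - 2 * \<rho> * (?t + ?c * v) + \<rho>\<^sup>2 = v" using \<rho> by (simp add: field_simps)
      moreover have "?t + ?c * v = (u + \<rho>\<^sup>2 - v) / (2 * \<rho>)" using \<rho> by (simp add: field_simps)
      moreover have "\<bar>?c\<bar> = 1 / (2 * \<rho>)" using \<rho> by simp
      ultimately show "\<bar>?c\<bar> * (H (sqrt u) (sqrt (u - 2 * \<rho> * (?t + ?c * v) + \<rho>\<^sup>2)) * ?k (u - s\<^sup>2 - (?t + ?c * v)\<^sup>2)) =
         ?f \<rho> u v" by simp
    qed
    finally show "(\<integral>\<^sup>+z. ?h u \<rho> z \<partial>lborel) = \<dots>" .
  qed
  also have "\<dots> = (\<integral>\<^sup>+u. ?L u c \<rho> \<partial>lborel)"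
  proof (rule nn_integral_cong)
    fix u
    have "(?G \<rho> u) =
     (\<integral>\<^sup>+v. H (sqrt u) (sqrt v) * ?A c \<rho> u v * indicator {0<..} v * indicator {0<..} u \<partial>lborel)"
    proof (rule nn_integral_cong)
      fix v
      \<comment> \<open>T is the squared distance from the axis, Q is \<open>heron\<close> at the
        square roots of u and v, and \<open>TQ\<close> is the height of a triangle expressed through
        its area.\<close>
      define T where "T = u - s\<^sup>2 - ((u + \<rho>\<^sup>2 - v) / (2 * \<rho>))\<^sup>2"
      define Q where "Q = 4 * \<rho>\<^sup>2 * (u - s\<^sup>2) - (u - v + \<rho>\<^sup>2)\<^sup>2"
      have TQ: "T = Q / (2 * \<rho>)\<^sup>2" unfolding T_def Q_def using \<rho> by (simp add: field_simps power_divide)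
      have Q': "Q = 4 * \<rho>\<^sup>2 * (v - s\<^sup>2) - (v - u + \<rho>\<^sup>2)\<^sup>2"
        unfolding Q_def by (simp add: power2_eq_square algebra_simps)
      \<comment> \<open>Q > 0 forces both squared energies above s^2, so the restriction to positive
        u and v cuts nothing off.\<close>
      have pos: "u > 0" "v > 0" if "Q > 0"
      proof -
        have "0 < 4 * \<rho>\<^sup>2 * (u - s\<^sup>2)" using that unfolding Q_def by (smt (verit) zero_le_power2)
        then have "u - s\<^sup>2 > 0" using \<rho> by (simp add: zero_less_mult_iff)
        then show "u > 0" by (smt (verit) zero_le_power2)
        have "0 < 4 * \<rho>\<^sup>2 * (v - s\<^sup>2)" using that unfolding Q' by (smt (verit) zero_le_power2)
        then have "v - s\<^sup>2 > 0" using \<rho> by (simp add: zero_less_mult_iff)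
        then show "v > 0" by (smt (verit) zero_le_power2)
      qed
      show "?f \<rho> u v =
         H (sqrt u) (sqrt v) * ?A c \<rho> u v * indicator {0<..} v * indicator {0<..} u"
      proof (cases "Q > 0")
        case True
        have qw: "qw p s (sqrt u) (sqrt v) \<rho> = Q powr p"
          using True pos[OF True] unfolding qw_def heron_def Q_def by simp
        have "T > 0" using True \<rho> by (simp add: TQ)
        have "1 / (2 * \<rho>) * (c * T powr p) = c * (2 * \<rho>) powr (2 - real DIM('a)) * Q powr p"
        proof -
          have "T powr p = Q powr p / (2 * \<rho>) powr (2 * p)"
          proof -
            have "(2 * \<rho>)\<^sup>2 = (2 * \<rho>) powr 2" using \<rho> by simp
            then have "(2 * \<rho>)\<^sup>2 powr p = (2 * \<rho>) powr (2 * p)" by (simp only: powr_powr)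
            then show ?thesis unfolding TQ using True \<rho> by (subst powr_divide) auto
          qed
          moreover have "(2 * \<rho>) powr (2 - real DIM('a)) = 1 / (2 * \<rho> * (2 * \<rho>) powr (2 * p))"
          proof -
            have "2 - real DIM('a) = - (1 + 2 * p)" by (simp add: p_def field_simps)
            then show ?thesis using \<rho> by (simp only: powr_minus_divide powr_add) simp
          qed
          ultimately show ?thesis by simp
        qed
        then have "ennreal (1 / (2 * \<rho>)) * ennreal (c * T powr p) = ennreal (c * (2 * \<rho>) powr (2 - real DIM('a)) * Q powr p)"
          using c \<rho> by (subst ennreal_mult[symmetric]) auto
        then show ?thesis using pos[OF True] \<open>T > 0\<close> unfolding T_def[symmetric] qw by (simp add: mult.left_commute)
      next
        case False
        then have "T \<le> 0" using \<rho> by (simp add: TQ divide_le_0_iff not_less)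
        moreover have "qw p s (sqrt u) (sqrt v) \<rho> = 0 \<or> u \<le> 0 \<or> v \<le> 0"
          using False unfolding qw_def heron_def Q_def by auto
        ultimately show ?thesis unfolding T_def[symmetric] by (auto simp: indicator_def)
      qed
    qed
    also have "\<dots> = ?L u c \<rho>"
      by (rule nn_integral_multc) measurable
    finally show "(?G \<rho> u) = \<dots>" .
  qed
  also have "\<dots> = (\<integral>\<^sup>+E. (\<integral>\<^sup>+v. H (sqrt (E\<^sup>2)) (sqrt v) * ennreal (2 * c * (2 * \<rho>) powr (2 - real DIM('a)) / 2 * qw p s (sqrt (E\<^sup>2)) (sqrt v) \<rho>) * indicator {0<..} v \<partial>lborel) * ennreal (2 * E) * indicator {0<..} E \<partial>lborel)"
    by (rule nn_integral_square) measurable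
  also have "\<dots> = (\<integral>\<^sup>+E. ?g E c \<rho> \<partial>lborel)"
    by (subst nn_integral_square) auto
  also have "\<dots> = (\<integral>\<^sup>+E. \<integral>\<^sup>+E'. H E E' * ?D c \<rho> E E' \<partial>lborel \<partial>lborel)"
  proof (rule nn_integral_cong)
    fix E
    have "?g E c \<rho>
       = (\<integral>\<^sup>+E'. ?B E E' c \<rho> \<partial>lborel)"
      by (subst nn_integral_multc) (auto simp: mult.assoc)
    also have "\<dots> = (\<integral>\<^sup>+E'. H E E' * ?D c \<rho> E E' \<partial>lborel)"
    proof (rule nn_integral_cong)
      fix E'
      show "?B E E' c \<rho>
        = H E E' * ?D c \<rho> E E'"
      proof (cases "E > 0 \<and> E' > 0")
        case True
        then have "ennreal (2 * c * (2 * \<rho>) powr (2 - real DIM('a)) / 2 * qw p s E E' \<rho>) * ennreal (2 * E') * ennreal (2 * E)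
          = ?D c \<rho> E E'"
          using c by (simp add: ennreal_mult[symmetric] mult_ac)
        then show ?thesis using True by (simp add: mult.assoc)
      next
        case False
        then show ?thesis by (auto simp: qw_def)
      qed
    qed
    finally show "?g E c \<rho> = \<dots>" .
  qed
  finally show ?thesis by (simp add: c_def \<rho>_def)
qed

section \<open>The radial kernel\<close>

text \<open>Only the maximum M and the leading coefficient of the parabola enter, not the position
  of its vertex. The integral over the angle and the one over \<tau> both have this form, with q = p
  - 1/2.\<close>

lemma nn_integral_quadratic:
  fixes q A M x0 :: real
  assumes q: "q > -1" and A: "A > 0"
  shows "(\<integral>\<^sup>+x. ennreal ((M - A * (x - x0)\<^sup>2) powr q) * indicator {x. 0 < M - A * (x - x0)\<^sup>2} x \<partial>lborel) =
    ennreal (Beta (q + 1) (q + 1) * 2 powr (2 * q + 1) * M powr (q + 1 / 2) / sqrt A) * indicator {0<..} M"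
proof (cases "M > 0")
  case False
  then have "M - A * (x - x0)\<^sup>2 \<le> 0" for x using A by (smt (verit) mult_nonneg_nonneg zero_le_power2)
  then have "indicator {x. 0 < M - A * (x - x0)\<^sup>2} x = (0 :: ennreal)" for x by (auto simp: indicator_def not_less)
  then show ?thesis using False by simp
next
  case True
  define R where "R = sqrt (M / A)"
  have R: "R > 0" "A * R\<^sup>2 = M" using True A by (auto simp: R_def)
  have "(\<integral>\<^sup>+x. ennreal ((M - A * (x - x0)\<^sup>2) powr q) * indicator {x. 0 < M - A * (x - x0)\<^sup>2} x \<partial>lborel)
    = (\<integral>\<^sup>+u. ennreal ((M - A * (u + (x0 - R) - x0)\<^sup>2) powr q) * indicator {x. 0 < M - A * (x - x0)\<^sup>2} (u + (x0 - R)) \<partial>lborel)"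
    by (rule nn_integral_lborel_translate[symmetric]) measurable
  also have "\<dots> = (\<integral>\<^sup>+u. ennreal (A powr q) * (ennreal (u powr (q + 1 - 1) * (2 * R - u) powr (q + 1 - 1)) * indicator {0<..<2 * R} u) \<partial>lborel)"
  proof (rule nn_integral_cong)
    fix u :: real
    have e: "M - A * (u + (x0 - R) - x0)\<^sup>2 = A * (u * (2 * R - u))"
      unfolding R(2)[symmetric] by (simp add: power2_eq_square algebra_simps)
    have "0 < A * (u * (2 * R - u)) \<longleftrightarrow> 0 < u \<and> u < 2 * R"
      using A R by (auto simp: zero_less_mult_iff)
    then show "ennreal ((M - A * (u + (x0 - R) - x0)\<^sup>2) powr q) * indicator {x. 0 < M - A * (x - x0)\<^sup>2} (u + (x0 - R)) =
      ennreal (A powr q) * (ennreal (u powr (q + 1 - 1) * (2 * R - u) powr (q + 1 - 1)) * indicator {0<..<2 * R} u)"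
      unfolding indicator_def mem_Collect_eq e using A by (auto simp: powr_mult ennreal_mult)
  qed
  also have "\<dots> = ennreal (A powr q) * ennreal (Beta (q + 1) (q + 1) * (2 * R) powr (q + 1 + (q + 1) - 1))"
    using q R by (subst nn_integral_cmult, simp, subst nn_integral_Beta) auto
  also have "\<dots> = ennreal (A powr q * (Beta (q + 1) (q + 1) * (2 * R) powr (q + 1 + (q + 1) - 1)))"
    by (rule ennreal_mult'[symmetric]) simp
  also have "A powr q * (Beta (q + 1) (q + 1) * (2 * R) powr (q + 1 + (q + 1) - 1)) =
    Beta (q + 1) (q + 1) * 2 powr (2 * q + 1) * M powr (q + 1 / 2) / sqrt A"
  proof -
    have "R powr (2 * q + 1) = (M / A) powr (q + 1 / 2)"
      unfolding R_def powr_half_sqrt[symmetric, OF less_imp_le[OF divide_pos_pos[OF True A]]] powr_powr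
      by (simp add: field_simps)
    also have "\<dots> = M powr (q + 1 / 2) / (A powr q * sqrt A)"
      using True A by (simp add: powr_divide powr_add powr_half_sqrt)
    finally have RR: "R powr (2 * q + 1) = M powr (q + 1 / 2) / (A powr q * sqrt A)" .
    have "q + 1 + (q + 1) - 1 = 2 * q + 1" by simp
    then have "(2 * R) powr (q + 1 + (q + 1) - 1) = 2 powr (2 * q + 1) * R powr (2 * q + 1)"
      using R by (simp only:) (simp add: powr_mult)
    then show ?thesis using A unfolding RR by simp
  qed
  finally show ?thesis using True by simp
qed

text \<open>A quarter of \<open>heron\<close> in the variables \<tau> and K = \<rho>^2 - \<tau>^2,
  in which the symbol of the wave operator is a pure power of K.\<close>

definition heron4 :: "real \<Rightarrow> real \<Rightarrow> real \<Rightarrow> real \<Rightarrow> real" where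
  "heron4 s a K \<tau> = K * a * (a - \<tau>) - s\<^sup>2 * (K + \<tau>\<^sup>2) - K\<^sup>2 / 4"

lemma heron_heron4:
  assumes "K + \<tau>\<^sup>2 \<ge> 0"
  shows "heron s a (a - \<tau>) (sqrt (K + \<tau>\<^sup>2)) = 4 * heron4 s a K \<tau>"
proof -
  have "(sqrt (K + \<tau>\<^sup>2))\<^sup>2 = K + \<tau>\<^sup>2" using assms by simp
  then show ?thesis unfolding heron_def heron4_def by (simp only:) (simp add: power2_eq_square field_simps)
qed

text \<open>The difference of two energy-momentum vectors on the mass shell is spacelike: on the
  support of the kernel K is positive, and for K > 0 the second energy is automatically positive. So
  the absolute value in the symbol and the sign conditions in \<open>qw\<close> reduce to K >
  0.\<close>

lemma heron4_pos:
  assumes s: "s > 0" and a: "a > 0" and N: "heron4 s a K \<tau> > 0"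
  shows "K + \<tau>\<^sup>2 > 0 \<Longrightarrow> a - \<tau> > 0 \<Longrightarrow> K > 0" "K > 0 \<Longrightarrow> a - \<tau> > 0"
proof -
  { assume "K + \<tau>\<^sup>2 \<ge> 0"
    then have "s\<^sup>2 * (K + \<tau>\<^sup>2) \<ge> 0" by simp
    then have "K * a * (a - \<tau>) > 0" using N unfolding heron4_def by (smt (verit) zero_le_power2 divide_nonneg_pos)
    then have "0 < (K * (a - \<tau>)) * a" by (simp add: mult_ac)
    then have "0 < K * (a - \<tau>)" using a by (rule zero_less_mult_pos2) }
  note * = this
  show "K > 0" if "K + \<tau>\<^sup>2 > 0" "a - \<tau> > 0" using *[OF less_imp_le[OF that(1)]] that by (simp add: zero_less_mult_iff)
  show "a - \<tau> > 0" if "K > 0"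
  proof -
    have "K + \<tau>\<^sup>2 \<ge> 0" using that by simp
    from *[OF this] that show ?thesis by (simp add: zero_less_mult_iff)
  qed
qed

lemma qw_heron4:
  assumes s: "s > 0" and a: "a > 0" and K: "K + \<tau>\<^sup>2 > 0"
  shows "qw p s a (a - \<tau>) (sqrt (K + \<tau>\<^sup>2)) = (if 0 < K \<and> 0 < heron4 s a K \<tau> then (4 * heron4 s a K \<tau>) powr p else 0)"
proof -
  have h: "heron s a (a - \<tau>) (sqrt (K + \<tau>\<^sup>2)) = 4 * heron4 s a K \<tau>" using K by (intro heron_heron4) simp
  show ?thesis unfolding qw_def h using heron4_pos[OF s a, of K \<tau>] a K by auto
qed

text \<open>With \<open>K = \<rho>\<^sup>2 - \<tau>\<^sup>2\<close>, \<open>gram\<close> is the Gram determinant of three vectors of \<open>\<real>\<^sup>d\<close>: two momenta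
  of energies \<open>a\<close>, \<open>b\<close> at angle \<open>arccos u\<close> and the momentum transfer. It is quadratic in \<open>u\<close> for
  fixed \<open>\<tau>\<close>, and quadratic in \<open>\<tau>\<close> for fixed \<open>u\<close>.\<close>

definition gram :: "real \<Rightarrow> real \<Rightarrow> real \<Rightarrow> real \<Rightarrow> real \<Rightarrow> real \<Rightarrow> real" where
  "gram s a b u K \<tau> = (let A = a\<^sup>2 - s\<^sup>2; B = b\<^sup>2 - s\<^sup>2; c = sqrt A * sqrt B * u; x = a * \<tau> + K / 2; y = b * \<tau> - K / 2
     in (A * B - c\<^sup>2) * (K + \<tau>\<^sup>2) - B * x\<^sup>2 - A * y\<^sup>2 + 2 * c * x * y)"

lemma gram_measurable [measurable]:
  assumes [measurable]: "f \<in> borel_measurable M" "g \<in> borel_measurable M" "h \<in> borel_measurable M"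
  shows "(\<lambda>x. gram s a b (f x) (g x) (h x)) \<in> borel_measurable M"
  unfolding gram_def Let_def by measurable

definition mom :: "real \<Rightarrow> real \<Rightarrow> real" where
  "mom s E = sqrt (E\<^sup>2 - s\<^sup>2)"

text \<open>The Minkowski product of two energy-momentum vectors on the mass shell whose momenta
  enclose an angle of cosine u.\<close>

definition mprod :: "real \<Rightarrow> real \<Rightarrow> real \<Rightarrow> real \<Rightarrow> real" where
  "mprod s a b u = a * b - mom s a * mom s b * u"

lemma Beta_pos: "a > 0 \<Longrightarrow> b > 0 \<Longrightarrow> Beta a b > (0 :: real)"
  by (simp add: Beta_def Gamma_real_pos)

context
  fixes s a b :: real
  assumes s: "s > 0" and a: "a > s" and b: "b > s"
begin

lemma mom_a: "mom s a > 0" "(mom s a)\<^sup>2 = a\<^sup>2 - s\<^sup>2" and mom_b: "mom s b > 0" "(mom s b)\<^sup>2 = b\<^sup>2 - s\<^sup>2"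
proof -
  have "s\<^sup>2 < a\<^sup>2" "s\<^sup>2 < b\<^sup>2" using s a b by (auto intro: power_strict_mono)
  then show "mom s a > 0" "(mom s a)\<^sup>2 = a\<^sup>2 - s\<^sup>2" "mom s b > 0" "(mom s b)\<^sup>2 = b\<^sup>2 - s\<^sup>2" by (auto simp: mom_def)
qed

text \<open>The reversed Cauchy-Schwarz inequality on the mass shell: (a b - s^2)^2 exceeds the
  squared product of the momenta by exactly s^2 (a - b)^2.\<close>

lemma mprod_gt: assumes "\<bar>u\<bar> \<le> 1" shows "mprod s a b u > 0" "mprod s a b u \<ge> s\<^sup>2" "\<bar>u\<bar> < 1 \<Longrightarrow> mprod s a b u > s\<^sup>2"
proof -
  have ab: "a * b - s\<^sup>2 > 0" using s a b by (simp add: power2_eq_square mult_strict_mono)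
  have "(mom s a * mom s b)\<^sup>2 \<le> (a * b - s\<^sup>2)\<^sup>2"
  proof -
    have "(a * b - s\<^sup>2)\<^sup>2 - (mom s a * mom s b)\<^sup>2 = s\<^sup>2 * (a - b)\<^sup>2"
      unfolding power_mult_distrib mom_a(2) mom_b(2) by (simp add: power2_eq_square algebra_simps)
    then show ?thesis by (smt (verit) mult_nonneg_nonneg zero_le_power2)
  qed
  then have m: "mom s a * mom s b \<le> a * b - s\<^sup>2" using ab by (simp add: abs_le_square_iff[symmetric])
  have m0: "mom s a * mom s b > 0" using mom_a mom_b by simp
  have "mom s a * mom s b * u \<le> (mom s a) * mom s b * 1" using assms m0 by (intro mult_left_mono) auto
  then show ge: "mprod s a b u \<ge> s\<^sup>2" using m unfolding mprod_def by simp
  then show "mprod s a b u > 0" using s by (smt (verit) zero_less_power)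
  assume "\<bar>u\<bar> < 1"
  then have "mom s a * mom s b * u < (mom s a) * mom s b * 1" using m0 by (intro mult_strict_left_mono) auto
  then show "mprod s a b u > s\<^sup>2" using m unfolding mprod_def by simp
qed

text \<open>Completing the square in u. The maximum over u is the product of the two Heron factors
  divided by \<rho>^2 = K + \<tau>^2, which is why the determinant can represent that
  product.\<close>

lemma gram_u:
  assumes K: "K + \<tau>\<^sup>2 > 0"
  shows "gram s a b u K \<tau> = heron4 s a K \<tau> * heron4 s b K (- \<tau>) / (K + \<tau>\<^sup>2) -
     ((mom s a)\<^sup>2 * (mom s b)\<^sup>2 * (K + \<tau>\<^sup>2)) * (u - (a * \<tau> + K / 2) * (b * \<tau> - K / 2) / (mom s a * mom s b * (K + \<tau>\<^sup>2)))\<^sup>2"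
proof -
  define r where "r = K + \<tau>\<^sup>2"
  define x where "x = a * \<tau> + K / 2"
  define y where "y = b * \<tau> - K / 2"
  have r: "r > 0" using K by (simp add: r_def)
  have Na: "heron4 s a K \<tau> = (mom s a)\<^sup>2 * r - x\<^sup>2" unfolding heron4_def mom_a(2) x_def r_def by (simp add: power2_eq_square field_simps)
  have Nb: "heron4 s b K (- \<tau>) = (mom s b)\<^sup>2 * r - y\<^sup>2" unfolding heron4_def mom_b(2) y_def r_def by (simp add: power2_eq_square field_simps)
  have g: "gram s a b u K \<tau> = ((mom s a)\<^sup>2 * (mom s b)\<^sup>2 - (mom s a * mom s b * u)\<^sup>2) * r - (mom s b)\<^sup>2 * x\<^sup>2 - (mom s a)\<^sup>2 * y\<^sup>2 + 2 * (mom s a * mom s b * u) * x * y"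
    unfolding gram_def Let_def mom_def[symmetric] mom_a(2)[symmetric] mom_b(2)[symmetric] x_def y_def r_def
    using mom_a(1) mom_b(1) by simp
  show ?thesis unfolding g Na Nb r_def[symmetric] x_def[symmetric] y_def[symmetric]
    using r mom_a(1) mom_b(1) by (simp add: field_simps power2_eq_square)
qed

text \<open>Where the determinant is positive, |u| < 1 is equivalent to positivity of both Heron
  factors. So the integral over u may run over the whole parabola once the factors are positive, and
  the factors can be forgotten once |u| < 1 is imposed; this is what makes the interchange of
  integrations possible.\<close>

lemma gram_pos_u:
  assumes K: "K > 0"
  shows "\<bar>u\<bar> < 1 \<and> gram s a b u K \<tau> > 0 \<longleftrightarrow> heron4 s a K \<tau> > 0 \<and> heron4 s b K (- \<tau>) > 0 \<and> gram s a b u K \<tau> > 0"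
proof -
  let ?h = "gram s a b u K \<tau>"
  let ?g = "(mom s a)\<^sup>2 * (mom s b)\<^sup>2 * (1 - u\<^sup>2)"
  let ?f = "heron4 s b K (- \<tau>)"
  define r where "r = K + \<tau>\<^sup>2"
  define x where "x = a * \<tau> + K / 2"
  define y where "y = b * \<tau> - K / 2"
  have r: "r > 0" using K by (simp add: r_def add_pos_nonneg)
  have Na: "heron4 s a K \<tau> = (mom s a)\<^sup>2 * r - x\<^sup>2" unfolding heron4_def mom_a(2) x_def r_def by (simp add: power2_eq_square field_simps)
  have Nb: "?f = (mom s b)\<^sup>2 * r - y\<^sup>2" unfolding heron4_def mom_b(2) y_def r_def by (simp add: power2_eq_square field_simps)
  have g: "?h = ((mom s a)\<^sup>2 * (mom s b)\<^sup>2 - (mom s a * mom s b * u)\<^sup>2) * r - (mom s b)\<^sup>2 * x\<^sup>2 - (mom s a)\<^sup>2 * y\<^sup>2 + 2 * (mom s a * mom s b * u) * x * y"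
    unfolding gram_def Let_def mom_def[symmetric] mom_a(2)[symmetric] mom_b(2)[symmetric] x_def y_def r_def
    using mom_a(1) mom_b(1) by simp
  have 1: "heron4 s a K \<tau> > 0 \<and> ?f > 0" if u: "\<bar>u\<bar> < 1" and G: "?h > 0"
  proof -
    have u1: "1 - u\<^sup>2 > 0" using u by (simp add: abs_square_less_1)
    \<comment> \<open>Sylvester's identity for the 3 x 3 Gram matrix: a diagonal entry times the
      determinant is a product of two principal 2 x 2 minors minus a square.\<close>
    have "(mom s a)\<^sup>2 * ?h = heron4 s a K \<tau> * ?g - ((mom s a)\<^sup>2 * y - (mom s a) * mom s b * u * x)\<^sup>2"
      unfolding g Na by (simp add: power2_eq_square algebra_simps)
    moreover have "(mom s a)\<^sup>2 * ?h > 0" using G mom_a(1) by simp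
    ultimately have "heron4 s a K \<tau> * ?g > 0" by (smt (verit) zero_le_power2)
    moreover have m: "(mom s a)\<^sup>2 * (mom s b)\<^sup>2 * (1 - u\<^sup>2) > 0" using mom_a(1) mom_b(1) u1 by simp
    ultimately have A: "heron4 s a K \<tau> > 0" by (simp add: zero_less_mult_iff)
    have "(mom s b)\<^sup>2 * ?h = ?f * ?g - ((mom s b)\<^sup>2 * x - (mom s a) * mom s b * u * y)\<^sup>2"
      unfolding g Nb by (simp add: power2_eq_square algebra_simps)
    moreover have "(mom s b)\<^sup>2 * ?h > 0" using G mom_b(1) by simp
    ultimately have "?f * ?g > 0" by (smt (verit) zero_le_power2)
    then have "?f > 0" using m by (simp add: zero_less_mult_iff)
    with A show ?thesis by simp
  qed
  have 2: "\<bar>u\<bar> < 1" if A: "heron4 s a K \<tau> > 0" and B: "?f > 0" and G: "?h > 0"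
  proof -
    \<comment> \<open>r times the determinant is the product of the Heron factors minus w^2.
      Bounding the mixed term in (x y + w)^2 by the arithmetic-geometric mean then leaves u^2 <
      1.\<close>
    define w where "w = (mom s a) * mom s b * r * u - x * y"
    have "r * ?h = heron4 s a K \<tau> * ?f - w\<^sup>2"
      unfolding g Na Nb w_def by (simp add: power2_eq_square algebra_simps)
    then have w: "w\<^sup>2 < heron4 s a K \<tau> * ?f" using G r by (smt (verit) mult_pos_pos)
    have am: "2 * \<bar>x * y * w\<bar> \<le> x\<^sup>2 * ?f + y\<^sup>2 * heron4 s a K \<tau>"
    proof -
      define \<alpha> where "\<alpha> = sqrt (heron4 s a K \<tau>)"
      define \<gamma> where "\<gamma> = sqrt ?f"
      have ag: "\<alpha> > 0" "\<gamma> > 0" "\<alpha>\<^sup>2 = heron4 s a K \<tau>" "\<gamma>\<^sup>2 = ?f" using A B by (auto simp: \<alpha>_def \<gamma>_def)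
      have "w\<^sup>2 \<le> (\<alpha> * \<gamma>)\<^sup>2" using w by (simp add: power_mult_distrib ag)
      then have "\<bar>w\<bar> \<le> \<bar>\<alpha> * \<gamma>\<bar>" by (simp only: abs_le_square_iff)
      then have "\<bar>w\<bar> \<le> \<alpha> * \<gamma>" using ag by simp
      then have "2 * \<bar>x * y * w\<bar> \<le> 2 * (\<bar>x * y\<bar> * (\<alpha> * \<gamma>))"
        unfolding abs_mult by (intro mult_left_mono) auto
      also have "\<dots> = 2 * (\<bar>x\<bar> * \<gamma>) * (\<bar>y\<bar> * \<alpha>)" by (simp add: abs_mult)
      also have "\<dots> \<le> (\<bar>x\<bar> * \<gamma>)\<^sup>2 + (\<bar>y\<bar> * \<alpha>)\<^sup>2" by (rule sum_squares_bound)
      finally show ?thesis by (simp add: power_mult_distrib ag)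
    qed
    have "(mom s a * mom s b * r * u)\<^sup>2 = (x * y + w)\<^sup>2" by (simp add: w_def)
    also have "\<dots> = x\<^sup>2 * y\<^sup>2 + 2 * (x * y * w) + w\<^sup>2" by (simp add: power2_sum power_mult_distrib)
    also have "\<dots> < x\<^sup>2 * y\<^sup>2 + (x\<^sup>2 * ?f + y\<^sup>2 * heron4 s a K \<tau>) + heron4 s a K \<tau> * ?f"
      using am w by linarith
    also have "\<dots> = (mom s a * mom s b * r)\<^sup>2" unfolding Na Nb by (simp add: power2_eq_square algebra_simps)
    finally have "(mom s a * mom s b * r)\<^sup>2 * u\<^sup>2 < (mom s a * mom s b * r)\<^sup>2 * 1" by (simp add: power_mult_distrib)
    then have "u\<^sup>2 < 1" using mom_a(1) mom_b(1) r by simp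
    then show ?thesis by (simp add: abs_square_less_1)
  qed
  show ?thesis using 1 2 by blast
qed

text \<open>Completing the square in \<tau> at fixed u and K. The coefficient of the square is
  positive for |u| < 1, and for K > 0 the maximum is positive exactly when K stays below 2 (mprod -
  s^2): this becomes the range of the Beta integral over K.\<close>

lemma gram_tau:
  assumes u: "\<bar>u\<bar> < 1"
  shows "gram s a b u K \<tau> = (mom s a)\<^sup>2 * (mom s b)\<^sup>2 * (1 - u\<^sup>2) * K * (mprod s a b u - s\<^sup>2 - K / 2) / (mprod s a b u - s\<^sup>2) -
     ((mprod s a b u)\<^sup>2 - s ^ 4) * (\<tau> - K * ((mom s a)\<^sup>2 * b - (mom s b)\<^sup>2 * a + (mom s a) * mom s b * u * (b - a)) / (2 * ((mprod s a b u)\<^sup>2 - s ^ 4)))\<^sup>2"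
proof -
  let ?h = "a\<^sup>2 - s\<^sup>2"
  let ?g = "b\<^sup>2 - s\<^sup>2"
  let ?f = "\<lambda>P c. P * K - K\<^sup>2 / 4 * (?g + ?h + 2 * c)"
  define c where "c = (mom s a) * mom s b * u"
  define X where "X = a * b - c"
  have XX: "mprod s a b u = X" by (simp add: mprod_def X_def c_def)
  have X: "X > s\<^sup>2" "X + s\<^sup>2 > 0" using mprod_gt[of u] u by (auto simp: XX add_pos_nonneg)
  define D where "D = X\<^sup>2 - s ^ 4"
  have D: "D = (X - s\<^sup>2) * (X + s\<^sup>2)" by (simp add: D_def power2_eq_square algebra_simps power4_eq_xxxx)
  have D0: "D > 0" using X by (simp add: D)
  define L where "L = ?h * b - ?g * a + c * (b - a)"
  define P where "P = ?h * ?g - c\<^sup>2"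
  have cc: "(mom s a)\<^sup>2 * (mom s b)\<^sup>2 * (1 - u\<^sup>2) = P" unfolding P_def mom_a(2)[symmetric] mom_b(2)[symmetric] c_def by (simp add: power_mult_distrib algebra_simps)
  have g: "gram s a b u K \<tau> = P * (K + \<tau>\<^sup>2) - ?g * (a * \<tau> + K / 2)\<^sup>2 - ?h * (b * \<tau> - K / 2)\<^sup>2 + 2 * c * (a * \<tau> + K / 2) * (b * \<tau> - K / 2)"
    unfolding gram_def Let_def mom_def[symmetric] P_def c_def by simp
  have DP: "D = - (P - ?g * a\<^sup>2 - ?h * b\<^sup>2 + 2 * c * a * b)"
    unfolding D_def P_def X_def by (simp add: power2_eq_square algebra_simps power4_eq_xxxx)
  have g2: "gram s a b u K \<tau> = - D * \<tau>\<^sup>2 + K * L * \<tau> + (?f P c)"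
    unfolding g DP L_def by (simp add: power2_eq_square field_simps)
  \<comment> \<open>The discriminant in \<tau> factorises; this polynomial identity is the whole
    content of the completed square.\<close>
  have key: "4 * D * (?f P c) + K\<^sup>2 * L\<^sup>2 = 4 * (P * K * (X - s\<^sup>2 - K / 2) * (X + s\<^sup>2))"
    unfolding D_def P_def L_def X_def by (simp add: power2_eq_square power4_eq_xxxx field_simps)
  have "P * K * (X - s\<^sup>2 - K / 2) / (X - s\<^sup>2) = P * K * (X - s\<^sup>2 - K / 2) * (X + s\<^sup>2) / D"
    unfolding D using X by simp
  also have "\<dots> = (?f P c) + K\<^sup>2 * L\<^sup>2 / (4 * D)"
  proof -
    have "U / D = V + W / (4 * D)" if "4 * D * V + W = 4 * U" for U V W
      using that D0 by (simp add: field_simps)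
    from this[OF key] show ?thesis .
  qed
  finally have e: "P * K * (X - s\<^sup>2 - K / 2) / (X - s\<^sup>2) = (?f P c) + K\<^sup>2 * L\<^sup>2 / (4 * D)" .
  have "gram s a b u K \<tau> = P * K * (X - s\<^sup>2 - K / 2) / (X - s\<^sup>2) - D * (\<tau> - K * L / (2 * D))\<^sup>2"
    unfolding g2 e using D0 by (simp add: field_simps power2_eq_square)
  moreover have "(mom s a)\<^sup>2 * b - (mom s b)\<^sup>2 * a + c * (b - a) = L" by (simp add: L_def mom_a(2) mom_b(2))
  ultimately show ?thesis unfolding cc XX D_def[symmetric] c_def[symmetric] by simp
qed

text \<open>\<open>nn_integral_quadratic\<close> read backwards: the power p of the product of Heron
  factors is an integral over u of the power p - 1/2 of the determinant, convergent because p >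
  -1/2.\<close>

lemma transverse_integral:
  assumes p: "p > -1/2" and K: "K > 0"
  shows "ennreal ((heron4 s a K \<tau> * heron4 s b K (- \<tau>)) powr p * (K + \<tau>\<^sup>2) powr (- p - 1 / 2)) *
      indicator {K. 0 < heron4 s a K \<tau> \<and> 0 < heron4 s b K (- \<tau>)} K =
    ennreal (mom s a * mom s b / (Beta (p + 1 / 2) (p + 1 / 2) * 2 powr (2 * p))) *
     (\<integral>\<^sup>+u. ennreal (gram s a b u K \<tau> powr (p - 1 / 2)) * indicator {u. \<bar>u\<bar> < 1 \<and> 0 < gram s a b u K \<tau>} u \<partial>lborel)"
proof (cases "0 < heron4 s a K \<tau> \<and> 0 < heron4 s b K (- \<tau>)")
  case False
  then have "indicator {u. \<bar>u\<bar> < 1 \<and> 0 < gram s a b u K \<tau>} u = (0 :: ennreal)" for u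
    using gram_pos_u[OF K] by (auto simp: indicator_def)
  then show ?thesis using False by simp
next
  case True
  define r where "r = K + \<tau>\<^sup>2"
  have r: "r > 0" using K by (simp add: r_def add_pos_nonneg)
  define Mc where "Mc = heron4 s a K \<tau> * heron4 s b K (- \<tau>) / r"
  define A where "A = (mom s a)\<^sup>2 * (mom s b)\<^sup>2 * r"
  define u0 where "u0 = (a * \<tau> + K / 2) * (b * \<tau> - K / 2) / (mom s a * mom s b * r)"
  define \<kappa> where "\<kappa> = Beta (p + 1 / 2) (p + 1 / 2) * 2 powr (2 * p)"
  have A: "A > 0" using r mom_a(1) mom_b(1) by (simp add: A_def)
  have Mc: "Mc > 0" using True r by (simp add: Mc_def)
  have k: "\<kappa> > 0" using p unfolding \<kappa>_def by (intro mult_pos_pos Beta_pos) auto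
  have g: "gram s a b u K \<tau> = Mc - A * (u - u0)\<^sup>2" for u
    unfolding Mc_def A_def u0_def r_def by (rule gram_u) (use r r_def in simp)
  have i: "(indicator {u. \<bar>u\<bar> < 1 \<and> 0 < gram s a b u K \<tau>} u :: ennreal) = indicator {u. 0 < gram s a b u K \<tau>} u" for u
    using gram_pos_u[OF K, of u \<tau>] True by (auto simp: indicator_def)
  have "(\<integral>\<^sup>+u. ennreal (gram s a b u K \<tau> powr (p - 1 / 2)) * indicator {u. \<bar>u\<bar> < 1 \<and> 0 < gram s a b u K \<tau>} u \<partial>lborel)
     = ennreal (Beta (p - 1 / 2 + 1) (p - 1 / 2 + 1) * 2 powr (2 * (p - 1 / 2) + 1) * Mc powr (p - 1 / 2 + 1 / 2) / sqrt A) * indicator {0<..} Mc"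
    unfolding i unfolding g by (rule nn_integral_quadratic) (use p A in auto)
  also have "\<dots> = ennreal (\<kappa> * Mc powr p / sqrt A)"
    using Mc by (simp add: \<kappa>_def add.commute)
  finally have e: "(\<integral>\<^sup>+u. ennreal (gram s a b u K \<tau> powr (p - 1 / 2)) * indicator {u. \<bar>u\<bar> < 1 \<and> 0 < gram s a b u K \<tau>} u \<partial>lborel) = ennreal (\<kappa> * Mc powr p / sqrt A)" .
  have "mom s a * mom s b / \<kappa> * (\<kappa> * Mc powr p / sqrt A) = (heron4 s a K \<tau> * heron4 s b K (- \<tau>)) powr p * r powr (- p - 1 / 2)"
  proof -
    have "sqrt A = (mom s a) * mom s b * r powr (1 / 2)" using mom_a(1) mom_b(1) r by (simp add: A_def real_sqrt_mult powr_half_sqrt)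
    moreover have "Mc powr p = (heron4 s a K \<tau> * heron4 s b K (- \<tau>)) powr p * r powr (- p)"
      using True r unfolding Mc_def by (subst powr_divide) (auto simp: powr_minus_divide)
    moreover have "r powr (- p - 1 / 2) = r powr (- p) / r powr (1 / 2)" by (rule powr_diff)
    ultimately show ?thesis using k mom_a(1) mom_b(1) r by simp
  qed
  then show ?thesis unfolding e \<kappa>_def[symmetric] r_def[symmetric] using True k mom_a(1) mom_b(1) A
    by (simp add: ennreal_mult'[symmetric])
qed

text \<open>The same quadratic integral, now in \<tau>. It produces the same Beta factor, which
  cancels against the one divided out in \<open>transverse_integral\<close>.\<close>

lemma longitudinal_integral:
  assumes p: "p > -1/2" and K: "K > 0" and u: "\<bar>u\<bar> < 1"
  shows "(\<integral>\<^sup>+\<tau>. ennreal (gram s a b u K \<tau> powr (p - 1 / 2)) * indicator {\<tau>. 0 < gram s a b u K \<tau>} \<tau> \<partial>lborel) =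
     ennreal ((Beta (p + 1 / 2) (p + 1 / 2) * 2 powr (2 * p)) * ((mom s a * mom s b) powr (2 * p) * (1 - u\<^sup>2) powr p * (2 * (mprod s a b u - s\<^sup>2)) powr (- p) / sqrt ((mprod s a b u)\<^sup>2 - s ^ 4)) *
        (K powr p * (2 * (mprod s a b u - s\<^sup>2) - K) powr p)) * indicator {0<..<2 * (mprod s a b u - s\<^sup>2)} K"
proof -
  let ?f = "mom s a * mom s b"
  define D where "D = (mprod s a b u)\<^sup>2 - s ^ 4"
  define Y where "Y = 2 * (mprod s a b u - s\<^sup>2)"
  define P where "P = (mom s a)\<^sup>2 * (mom s b)\<^sup>2 * (1 - u\<^sup>2)"
  define Mc where "Mc = P * K * (mprod s a b u - s\<^sup>2 - K / 2) / (mprod s a b u - s\<^sup>2)"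
  have u1: "1 - u\<^sup>2 > 0" using u by (simp add: abs_square_less_1)
  have P: "P > 0" using mom_a(1) mom_b(1) u1 by (simp add: P_def)
  have X: "mprod s a b u > s\<^sup>2" using mprod_gt(3)[of u] u by simp
  have Y: "Y > 0" using X by (simp add: Y_def)
  have D: "D > 0"
  proof -
    have "D = (mprod s a b u - s\<^sup>2) * (mprod s a b u + s\<^sup>2)" by (simp add: D_def power2_eq_square algebra_simps power4_eq_xxxx)
    then show ?thesis using X by (simp add: add_pos_nonneg mprod_gt(1) u less_imp_le)
  qed
  have Mc: "Mc = P * (K * (Y - K) / Y)" unfolding Mc_def Y_def using X by (simp add: field_simps)
  have Mpos: "Mc > 0 \<longleftrightarrow> K < Y" unfolding Mc using P K Y by (simp add: zero_less_mult_iff zero_less_divide_iff)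
  have "(\<integral>\<^sup>+\<tau>. ennreal (gram s a b u K \<tau> powr (p - 1 / 2)) * indicator {\<tau>. 0 < gram s a b u K \<tau>} \<tau> \<partial>lborel)
     = ennreal (Beta (p - 1 / 2 + 1) (p - 1 / 2 + 1) * 2 powr (2 * (p - 1 / 2) + 1) * Mc powr (p - 1 / 2 + 1 / 2) / sqrt D) * indicator {0<..} Mc"
    unfolding gram_tau[OF u] Mc_def P_def D_def by (rule nn_integral_quadratic) (use p D D_def in auto)
  also have "\<dots> = ennreal ((Beta (p + 1 / 2) (p + 1 / 2) * 2 powr (2 * p)) * (?f powr (2 * p) * (1 - u\<^sup>2) powr p * Y powr (- p) / sqrt D) *
        (K powr p * (Y - K) powr p)) * indicator {0<..<Y} K"
  proof (cases "K < Y")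
    case False then show ?thesis using Mpos by simp
  next
    case True
    have m2: "?f powr (2 * p) = ((mom s a)\<^sup>2 * (mom s b)\<^sup>2) powr p"
    proof -
      have "?f\<^sup>2 = ?f powr 2" using mom_a(1) mom_b(1) by simp
      then show ?thesis by (simp only: powr_powr power_mult_distrib[symmetric])
    qed
    have "Mc powr p = ?f powr (2 * p) * (1 - u\<^sup>2) powr p * Y powr (- p) * (K powr p * (Y - K) powr p)"
      unfolding Mc P_def m2 using mom_a(1) mom_b(1) u1 K True Y
      by (simp add: powr_mult powr_divide powr_minus_divide)
    then show ?thesis using Mpos True K by (simp add: add.commute mult.assoc)
  qed
  finally show ?thesis unfolding D_def Y_def .
qed

end

text \<open>The kernel of the diagonalised form: a and b are the energies that stay with the first
  and the second profile, while a - \<tau> and b + \<tau> belong to their partners and are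
  integrated out. The exponent of \<rho> collects two bipolar Jacobians and the radial volume
  element: 2 (2 - d) + (d - 1) = - 2 p.\<close>

definition Jrad :: "real \<Rightarrow> real \<Rightarrow> real \<Rightarrow> real \<Rightarrow> real \<Rightarrow> ennreal" where
  "Jrad p s \<beta> a b = (\<integral>\<^sup>+\<tau>. \<integral>\<^sup>+\<rho>. ennreal (\<rho> powr (- 2 * p) * \<bar>\<rho>\<^sup>2 - \<tau>\<^sup>2\<bar> powr (2 * \<beta>) *
     qw p s a (a - \<tau>) \<rho> * qw p s (b + \<tau>) b \<rho>) * indicator {0<..} \<rho> \<partial>lborel \<partial>lborel)"

text \<open>The substitution K = \<rho>^2 - \<tau>^2. The factor 16 to the power p undoes the two
  quarters in \<open>heron4\<close>, and 1/2 is the Jacobian of the square root.\<close>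

lemma Jrad_K:
  assumes s: "s > 0" and a: "a > 0" and b: "b > 0"
  shows "Jrad p s \<beta> a b = ennreal (16 powr p / 2) * (\<integral>\<^sup>+\<tau>. \<integral>\<^sup>+K.
     ennreal (K powr (2 * \<beta>)) * (ennreal ((heron4 s a K \<tau> * heron4 s b K (- \<tau>)) powr p * (K + \<tau>\<^sup>2) powr (- p - 1 / 2)) *
      indicator {K. 0 < heron4 s a K \<tau> \<and> 0 < heron4 s b K (- \<tau>)} K) * indicator {0<..} K \<partial>lborel \<partial>lborel)"
proof -
  let ?g = "\<lambda>\<rho> \<tau>. ennreal (\<rho> powr (- 2 * p) * \<bar>\<rho>\<^sup>2 - \<tau>\<^sup>2\<bar> powr (2 * \<beta>) * qw p s a (a - \<tau>) \<rho> * qw p s (b + \<tau>) b \<rho>)"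
  let ?f = "\<lambda>K \<tau>. ennreal (K powr (2 * \<beta>)) * (ennreal ((heron4 s a K \<tau> * heron4 s b K (- \<tau>)) powr p * (K + \<tau>\<^sup>2) powr (- p - 1 / 2)) *
      indicator {K. 0 < heron4 s a K \<tau> \<and> 0 < heron4 s b K (- \<tau>)} K) * indicator {0<..} K"
  have "(\<integral>\<^sup>+\<rho>. ?g \<rho> \<tau> * indicator {0<..} \<rho> \<partial>lborel)
   = ennreal (16 powr p / 2) * (\<integral>\<^sup>+K. ?f K \<tau> \<partial>lborel)" for \<tau>
  proof -
    define F where "F v = ennreal (1 / 2 * v powr (- p - 1 / 2) * \<bar>v - \<tau>\<^sup>2\<bar> powr (2 * \<beta>) * qw p s a (a - \<tau>) (sqrt v) * qw p s (b + \<tau>) b (sqrt v))" for v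
    have [measurable]: "F \<in> borel_measurable borel" unfolding F_def[abs_def] by measurable
    have "(\<integral>\<^sup>+\<rho>. ?g \<rho> \<tau> * indicator {0<..} \<rho> \<partial>lborel)
       = (\<integral>\<^sup>+\<rho>. F (\<rho>\<^sup>2) * ennreal (2 * \<rho>) * indicator {0<..} \<rho> \<partial>lborel)"
    proof (rule nn_integral_cong)
      fix \<rho> :: real
      show "?g \<rho> \<tau> * indicator {0<..} \<rho> =
        F (\<rho>\<^sup>2) * ennreal (2 * \<rho>) * indicator {0<..} \<rho>"
      proof (cases "\<rho> > 0")
        case True
        have "(\<rho>\<^sup>2) powr (- p - 1 / 2) = \<rho> powr (- 2 * p) / \<rho>"
        proof -
          have "\<rho>\<^sup>2 = \<rho> powr 2" using True by simp
          then have "(\<rho>\<^sup>2) powr (- p - 1 / 2) = \<rho> powr (2 * (- p - 1 / 2))" by (simp only: powr_powr)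
          also have "2 * (- p - 1 / 2) = - 2 * p - 1" by simp
          also have "\<rho> powr (- 2 * p - 1) = \<rho> powr (- 2 * p) / \<rho>" using True by (subst powr_diff) simp
          finally show ?thesis .
        qed
        then have "F (\<rho>\<^sup>2) * ennreal (2 * \<rho>) = ?g \<rho> \<tau>"
          using True unfolding F_def by (simp add: ennreal_mult'[symmetric])
        then show ?thesis by simp
      qed simp
    qed
    also have "\<dots> = (\<integral>\<^sup>+v. F v * indicator {0<..} v \<partial>lborel)"
      by (rule nn_integral_square[symmetric]) measurable
    also have "\<dots> = (\<integral>\<^sup>+K. F (K + \<tau>\<^sup>2) * indicator {0<..} (K + \<tau>\<^sup>2) \<partial>lborel)"
      by (rule nn_integral_lborel_translate[symmetric]) measurable
    also have "\<dots> = (\<integral>\<^sup>+K. ennreal (16 powr p / 2) * (?f K \<tau>) \<partial>lborel)"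
    proof (rule nn_integral_cong)
      fix K :: real
      show "F (K + \<tau>\<^sup>2) * indicator {0<..} (K + \<tau>\<^sup>2) = ennreal (16 powr p / 2) * (?f K \<tau>)"
      proof (cases "K + \<tau>\<^sup>2 > 0")
        case False
        then have "\<not> K > 0" by (smt (verit) zero_le_power2)
        then show ?thesis using False by simp
      next
        case True
        have 1: "qw p s a (a - \<tau>) (sqrt (K + \<tau>\<^sup>2)) = (if 0 < K \<and> 0 < heron4 s a K \<tau> then (4 * heron4 s a K \<tau>) powr p else 0)"
          by (rule qw_heron4[OF s a True])
        have "qw p s b (b - (- \<tau>)) (sqrt (K + (- \<tau>)\<^sup>2)) = (if 0 < K \<and> 0 < heron4 s b K (- \<tau>) then (4 * heron4 s b K (- \<tau>)) powr p else 0)"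
          by (rule qw_heron4[OF s b]) (use True in simp)
        then have 2: "qw p s (b + \<tau>) b (sqrt (K + \<tau>\<^sup>2)) = (if 0 < K \<and> 0 < heron4 s b K (- \<tau>) then (4 * heron4 s b K (- \<tau>)) powr p else 0)"
          by (subst qw_sym) simp
        show ?thesis
        proof (cases "0 < K \<and> 0 < heron4 s a K \<tau> \<and> 0 < heron4 s b K (- \<tau>)")
          case T: True
          have "(4 * heron4 s a K \<tau>) powr p * (4 * heron4 s b K (- \<tau>)) powr p = 16 powr p * (heron4 s a K \<tau> * heron4 s b K (- \<tau>)) powr p"
            using T by (simp flip: powr_mult add: mult_ac)
          then have "1 / 2 * (K + \<tau>\<^sup>2) powr (- p - 1 / 2) * K powr (2 * \<beta>) * (4 * heron4 s a K \<tau>) powr p * (4 * heron4 s b K (- \<tau>)) powr p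
             = 16 powr p / 2 * (K powr (2 * \<beta>) * ((heron4 s a K \<tau> * heron4 s b K (- \<tau>)) powr p * (K + \<tau>\<^sup>2) powr (- p - 1 / 2)))"
            by (simp add: mult_ac)
          then show ?thesis using T True unfolding F_def 1 2 by (simp add: ennreal_mult'[symmetric])
        next
          case F: False
          then show ?thesis unfolding F_def 1 2 by (auto simp: indicator_def)
        qed
      qed
    qed
    finally show ?thesis by (subst (asm) nn_integral_cmult) (auto simp: heron4_def)
  qed
  then show ?thesis unfolding Jrad_def by (simp add: nn_integral_cmult heron4_def)
qed

definition Jang :: "real \<Rightarrow> real \<Rightarrow> real \<Rightarrow> real \<Rightarrow> real \<Rightarrow> ennreal" where
  "Jang p s \<beta> a b = (\<integral>\<^sup>+u. ennreal ((1 - u\<^sup>2) powr p * (2 * (mprod s a b u - s\<^sup>2)) powr (2 * \<beta> + p + 1) / sqrt ((mprod s a b u)\<^sup>2 - s ^ 4)) * indicator {-1<..<1} u \<partial>lborel)"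

lemma mprod_measurable [measurable]: "f \<in> borel_measurable M \<Longrightarrow> (\<lambda>x. mprod s a b (f x)) \<in> borel_measurable M"
  unfolding mprod_def by measurable

text \<open>Everything is nonnegative, so the three variables can be opened at once and integrated
  in the order \<tau>, K, u. The integral over K is a Beta integral over (0, Y) with Y =
  \<open>2 * (mprod s a b u - s\<^sup>2)\<close>.\<close>

theorem Jrad_eq_strict:
  assumes s: "s > 0" and a: "a > s" and b: "b > s" and p: "p > - 1 / 2" and \<beta>: "2 * \<beta> + p + 1 > 0"
  shows "Jrad p s \<beta> a b = ennreal (16 powr p / 2 * Beta (2 * \<beta> + p + 1) (p + 1) * (mom s a * mom s b) powr (2 * p + 1)) * Jang p s \<beta> a b"
proof -
  let ?K = "\<lambda>\<kappa>. ennreal (mom s a * mom s b / \<kappa>)"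
  let ?G = "\<lambda>K. ennreal (K powr (2 * \<beta>))"
  let ?E = "\<lambda>u K. \<integral>\<^sup>+\<tau>. ennreal (gram s a b u K \<tau> powr (p - 1 / 2)) * indicator {\<tau>. 0 < gram s a b u K \<tau>} \<tau> \<partial>lborel"
  let ?D = "2 * \<beta> + p + 1 + (p + 1) - 1"
  let ?A = "2 * \<beta> + p + 1"
  let ?k = "\<lambda>K Y. K powr (2 * \<beta> + p + 1 - 1) * (Y - K) powr (p + 1 - 1)"
  let ?H = "\<lambda>K Y. ennreal (?k K Y) * indicator {0<..<Y} K"
  let ?f = "Beta ?A (p + 1) * (mom s a * mom s b) powr (2 * p)"
  let ?B = "\<lambda>\<kappa> u. ennreal (\<kappa> * ?f) * (ennreal ((1 - u\<^sup>2) powr p * (2 * (mprod s a b u - s\<^sup>2)) powr ?A / sqrt ((mprod s a b u)\<^sup>2 - s ^ 4)) * indicator {-1<..<1} u)"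
  have a0: "a > 0" "b > 0" using s a b by auto
  have p': "p > - 1 / 2" using p by simp
  define \<kappa> where "\<kappa> = Beta (p + 1 / 2) (p + 1 / 2) * 2 powr (2 * p)"
  have k: "\<kappa> > 0" using p unfolding \<kappa>_def by (intro mult_pos_pos Beta_pos) auto
  have m: "mom s a > 0" "mom s b > 0" using mom_a(1)[OF s a b] mom_b(1)[OF s a b] by auto
  let ?g = "\<lambda>\<tau> K u. ennreal (gram s a b u K \<tau> powr (p - 1 / 2)) * indicator {u. \<bar>u\<bar> < 1 \<and> 0 < gram s a b u K \<tau>} u"
  let ?h = "\<lambda>\<tau> K u. ?G K * indicator {0<..} K * ?g \<tau> K u"
  have hm[measurable]: "(\<lambda>x. ?h (f x) (g x) (h x)) \<in> borel_measurable M"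
    if [measurable]: "f \<in> borel_measurable M" "g \<in> borel_measurable M" "h \<in> borel_measurable M" for f g h and M :: "'m measure"
    by measurable
  have "Jrad p s \<beta> a b = ennreal (16 powr p / 2) * (\<integral>\<^sup>+\<tau>. \<integral>\<^sup>+K. ?K \<kappa> * (\<integral>\<^sup>+u. ?h \<tau> K u \<partial>lborel) \<partial>lborel \<partial>lborel)"
    unfolding Jrad_K[OF s a0]
  proof (rule arg_cong2[of _ _ _ _ "(*)"], rule refl, rule nn_integral_cong, rule nn_integral_cong)
    fix \<tau> K :: real
    show "?G K * (ennreal ((heron4 s a K \<tau> * heron4 s b K (- \<tau>)) powr p * (K + \<tau>\<^sup>2) powr (- p - 1 / 2)) *
      indicator {K. 0 < heron4 s a K \<tau> \<and> 0 < heron4 s b K (- \<tau>)} K) * indicator {0<..} K = ?K \<kappa> * (\<integral>\<^sup>+u. ?h \<tau> K u \<partial>lborel)"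
    proof (cases "K > 0")
      case True
      have "(\<integral>\<^sup>+u. ?h \<tau> K u \<partial>lborel) = (?G K * indicator {0<..} K) * (\<integral>\<^sup>+u. ?g \<tau> K u \<partial>lborel)"
        by (rule nn_integral_cmult) measurable
      then show ?thesis unfolding transverse_integral[OF s a b p' True] \<kappa>_def using True by (simp add: mult_ac)
    qed simp
  qed
  also have "\<dots> = ennreal (16 powr p / 2) * (?K \<kappa> * (\<integral>\<^sup>+\<tau>. \<integral>\<^sup>+K. \<integral>\<^sup>+u. ?h \<tau> K u \<partial>lborel \<partial>lborel \<partial>lborel))"
  proof -
    let ?c = "?K \<kappa>"
    have "(\<integral>\<^sup>+K. ?c * (\<integral>\<^sup>+u. ?h \<tau> K u \<partial>lborel) \<partial>lborel) = ?c * (\<integral>\<^sup>+K. \<integral>\<^sup>+u. ?h \<tau> K u \<partial>lborel \<partial>lborel)" for \<tau>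
      by (rule nn_integral_cmult) measurable
    moreover have "(\<integral>\<^sup>+\<tau>. ?c * (\<integral>\<^sup>+K. \<integral>\<^sup>+u. ?h \<tau> K u \<partial>lborel \<partial>lborel) \<partial>lborel) = ?c * (\<integral>\<^sup>+\<tau>. \<integral>\<^sup>+K. \<integral>\<^sup>+u. ?h \<tau> K u \<partial>lborel \<partial>lborel \<partial>lborel)"
      by (rule nn_integral_cmult) measurable
    ultimately show ?thesis by (simp only:)
  qed
  also have "(\<integral>\<^sup>+\<tau>. \<integral>\<^sup>+K. \<integral>\<^sup>+u. ?h \<tau> K u \<partial>lborel \<partial>lborel \<partial>lborel) = (\<integral>\<^sup>+\<tau>. \<integral>\<^sup>+u. \<integral>\<^sup>+K. ?h \<tau> K u \<partial>lborel \<partial>lborel \<partial>lborel)"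
    by (intro nn_integral_cong lborel_pair.Fubini') measurable
  also have "\<dots> = (\<integral>\<^sup>+u. \<integral>\<^sup>+\<tau>. \<integral>\<^sup>+K. ?h \<tau> K u \<partial>lborel \<partial>lborel \<partial>lborel)"
    by (intro lborel_pair.Fubini') measurable
  also have "\<dots> = (\<integral>\<^sup>+u. \<integral>\<^sup>+K. \<integral>\<^sup>+\<tau>. ?h \<tau> K u \<partial>lborel \<partial>lborel \<partial>lborel)"
    by (intro nn_integral_cong lborel_pair.Fubini') measurable
  also have "\<dots> = (\<integral>\<^sup>+u. ?B \<kappa> u \<partial>lborel)"
  proof (rule nn_integral_cong)
    fix u :: real
    define Y where "Y = 2 * (mprod s a b u - s\<^sup>2)"
    define D where "D = (mprod s a b u)\<^sup>2 - s ^ 4"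
    show "(\<integral>\<^sup>+K. \<integral>\<^sup>+\<tau>. ?h \<tau> K u \<partial>lborel \<partial>lborel) = ?B \<kappa> u"
    proof (cases "\<bar>u\<bar> < 1")
      case False
      then have "u \<notin> {-1<..<1}" by auto
      then show ?thesis using False by simp
    next
      case True
      have Y: "Y > 0" using mprod_gt(3)[OF s a b, of u] True by (simp add: Y_def)
      define C where "C = \<kappa> * ((mom s a * mom s b) powr (2 * p) * (1 - u\<^sup>2) powr p * Y powr (- p) / sqrt D)"
      have C: "C \<ge> 0"
      proof -
        have "D = (mprod s a b u - s\<^sup>2) * (mprod s a b u + s\<^sup>2)" by (simp add: D_def power2_eq_square algebra_simps power4_eq_xxxx)
        then have "D \<ge> 0" using mprod_gt[OF s a b, of u] True by simp
        then show ?thesis using k by (simp add: C_def)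
      qed
      have "(\<integral>\<^sup>+K. \<integral>\<^sup>+\<tau>. ?h \<tau> K u \<partial>lborel \<partial>lborel) = (\<integral>\<^sup>+K. ennreal C * (?H K Y) \<partial>lborel)"
      proof (rule nn_integral_cong)
        fix K :: real
        have "(\<integral>\<^sup>+\<tau>. ?h \<tau> K u \<partial>lborel) = (?G K * indicator {0<..} K) * (\<integral>\<^sup>+\<tau>. ?g \<tau> K u \<partial>lborel)"
          by (rule nn_integral_cmult) measurable
        also have "(\<integral>\<^sup>+\<tau>. ?g \<tau> K u \<partial>lborel) = (?E u K)"
          using True by (intro nn_integral_cong) (auto simp: indicator_def)
        finally have e: "(\<integral>\<^sup>+\<tau>. ?h \<tau> K u \<partial>lborel) = (?G K * indicator {0<..} K) * (?E u K)" .
        show "(\<integral>\<^sup>+\<tau>. ?h \<tau> K u \<partial>lborel) = ennreal C * (?H K Y)"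
        proof (cases "0 < K \<and> K < Y")
          case T: True
          then have K: "K > 0" by simp
          have "K powr (2 * \<beta> + p + 1 - 1) = K powr (2 * \<beta>) * K powr p" by (simp flip: powr_add)
          then have "K powr (2 * \<beta>) * (C * (K powr p * (Y - K) powr p)) = C * (?k K Y)" by simp
          then have "?G K * ennreal (C * (K powr p * (Y - K) powr p)) = ennreal C * ennreal (?k K Y)"
            using C by (simp only: ennreal_mult'[symmetric] powr_ge_zero)
          then show ?thesis unfolding e longitudinal_integral[OF s a b p' K True] \<kappa>_def[symmetric] Y_def[symmetric] D_def[symmetric] C_def[symmetric]
            using T by simp
        next
          case F: False
          then show ?thesis
          proof (cases "K > 0")
            case True
            then show ?thesis unfolding e longitudinal_integral[OF s a b p' True \<open>\<bar>u\<bar> < 1\<close>] Y_def[symmetric] using F by simp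
          qed (auto simp: e)
        qed
      qed
      also have "\<dots> = ennreal C * (\<integral>\<^sup>+K. ?H K Y \<partial>lborel)"
        by (rule nn_integral_cmult) measurable
      also have "(\<integral>\<^sup>+K. ?H K Y \<partial>lborel) = ennreal (Beta ?A (p + 1) * Y powr ?D)"
        using p Y \<beta> by (intro nn_integral_Beta) auto
      also have "ennreal C * \<dots> = ennreal (C * (Beta ?A (p + 1) * Y powr ?D))"
        using C by (simp only: ennreal_mult')
      also have "C * (Beta ?A (p + 1) * Y powr ?D) =
         (\<kappa> * ?f) * ((1 - u\<^sup>2) powr p * Y powr ?A / sqrt D)"
      proof -
        have "- p + ?D = ?A" by simp
        then have "Y powr (- p) * Y powr ?D = Y powr ?A"
          by (simp only: powr_add[symmetric])
        then show ?thesis by (simp add: C_def mult_ac)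
      qed
      also have "ennreal \<dots> = ennreal (\<kappa> * ?f) * ennreal ((1 - u\<^sup>2) powr p * Y powr ?A / sqrt D)"
        using k Beta_pos[OF \<beta>, of "p + 1"] p by (intro ennreal_mult') (auto intro!: mult_nonneg_nonneg less_imp_le)
      finally have fin: "(\<integral>\<^sup>+K. \<integral>\<^sup>+\<tau>. ?h \<tau> K u \<partial>lborel \<partial>lborel) =
        ennreal (\<kappa> * ?f) * ennreal ((1 - u\<^sup>2) powr p * Y powr ?A / sqrt D)" .
      have "u \<in> {-1<..<1}" using True by auto
      then show ?thesis unfolding fin Y_def D_def by simp
    qed
  qed
  also have "\<dots> = ennreal (\<kappa> * ?f) * Jang p s \<beta> a b"
    unfolding Jang_def by (rule nn_integral_cmult) measurable
  also have "ennreal (16 powr p / 2) * (?K \<kappa> * \<dots>) =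
    ennreal (16 powr p / 2 * (mom s a * mom s b / \<kappa>) * (\<kappa> * ?f)) * Jang p s \<beta> a b"
  proof -
    have "ennreal x * (ennreal y * (ennreal z * J)) = ennreal (x * y * z) * J" if "x \<ge> 0" "y \<ge> 0" "z \<ge> 0" for x y z J
      using that by (simp add: ennreal_mult mult.assoc)
    then show ?thesis using k m Beta_pos[OF \<beta>, of "p + 1"] p by (simp add: less_imp_le del: times_divide_eq_left times_divide_eq_right)
  qed
  also have "16 powr p / 2 * (mom s a * mom s b / \<kappa>) * (\<kappa> * ?f) =
     16 powr p / 2 * Beta ?A (p + 1) * (mom s a * mom s b) powr (2 * p + 1)"
    using k m by (simp add: powr_add)
  finally show ?thesis .
qed

text \<open>Bases in (0, 1] make the powers increase as the exponent decreases to p, so monotone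
  convergence applies without an integrable majorant.\<close>

lemma nn_integral_powr_limit:
  fixes w :: "'a \<Rightarrow> ennreal" and y :: "'a \<Rightarrow> real"
  assumes [measurable]: "w \<in> borel_measurable M" "y \<in> borel_measurable M" and y: "\<And>x. w x \<noteq> 0 \<Longrightarrow> 0 < y x \<and> y x \<le> 1"
  shows "(\<lambda>n. \<integral>\<^sup>+x. w x * ennreal (y x powr (p + 1 / real (Suc n))) \<partial>M) \<longlonglongrightarrow> (\<integral>\<^sup>+x. w x * ennreal (y x powr p) \<partial>M)"
proof (rule nn_integral_LIMSEQ)
  let ?f = "\<lambda>x n. y x powr (p + 1 / real (Suc n))"
  show "incseq (\<lambda>n x. w x * ennreal (?f x n))"
  proof (intro incseq_SucI le_funI)
    fix n x
    show "w x * ennreal (?f x n) \<le> w x * ennreal (y x powr (p + 1 / real (Suc (Suc n))))"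
    proof (cases "w x = 0")
      case False
      then have "0 < y x" "y x \<le> 1" using y by auto
      then have "?f x n \<le> y x powr (p + 1 / real (Suc (Suc n)))"
        by (intro powr_mono') (auto intro!: frac_le)
      then show ?thesis by (intro mult_left_mono ennreal_leI) auto
    qed simp
  qed
  fix x
  show "(\<lambda>n. w x * ennreal (?f x n)) \<longlonglongrightarrow> w x * ennreal (y x powr p)"
  proof (cases "w x = 0")
    case False
    then have y0: "0 < y x" using y by auto
    have "(\<lambda>n. ?f x n) \<longlonglongrightarrow> y x powr (p + 0)"
      using y0 by (intro tendsto_intros LIMSEQ_Suc[OF lim_1_over_n]) auto
    then have "(\<lambda>n. ennreal (?f x n)) \<longlonglongrightarrow> ennreal (y x powr p)" by (intro tendsto_ennrealI) simp
    then show ?thesis using y0 by (intro tendsto_mult_ennreal tendsto_const) auto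
  qed simp
qed measurable

text \<open>Any bound uniform in \<tau> and K serves: dividing by it puts the base of the p-th power
  into (0, 1], as the monotone limit requires.\<close>

lemma heron4_bound:
  assumes s: "s > 0" and a: "a > s" and b: "b > s" and K: "K > 0" and Na: "heron4 s a K \<tau> > 0" and Nb: "heron4 s b K (- \<tau>) > 0"
  shows "heron4 s a K \<tau> * heron4 s b K (- \<tau>) / (K + \<tau>\<^sup>2) \<le> 4 * (a + b) ^ 6"
proof -
  have t: "a - \<tau> > 0" "b + \<tau> > 0" using heron4_pos(2)[OF s _ Na K] heron4_pos(2)[OF s _ Nb K] s a b by auto
  have ab: "a > 0" "b > 0" using s a b by auto
  have r: "K + \<tau>\<^sup>2 > 0" using K by (simp add: add_pos_nonneg)
  have sr: "s\<^sup>2 * (K + \<tau>\<^sup>2) > 0" using s r by simp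
  have "a * (a - \<tau>) \<le> (a + b) * (a + b)" using ab t by (intro mult_mono) auto
  then have Na1: "heron4 s a K \<tau> \<le> K * (a + b)\<^sup>2"
    unfolding heron4_def using sr K by (smt (verit) mult_left_mono mult.assoc power2_eq_square zero_le_power2 divide_nonneg_pos)
  have "b * (b + \<tau>) \<le> (a + b) * (a + b)" using ab t by (intro mult_mono) auto
  then have Nb1: "heron4 s b K (- \<tau>) \<le> K * (a + b)\<^sup>2"
    unfolding heron4_def using sr K by (smt (verit) mult_left_mono mult.assoc power2_eq_square zero_le_power2 divide_nonneg_pos power2_minus)
  have "K\<^sup>2 / 4 < K * a * (a - \<tau>)" using Na sr unfolding heron4_def by linarith
  then have "K / 4 < a * (a - \<tau>)" using K by (simp add: power2_eq_square mult.assoc)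
  also have "\<dots> \<le> a * (a + b)" using ab t by (intro mult_left_mono) auto
  also have "\<dots> \<le> (a + b) * (a + b)" using ab by (intro mult_right_mono) auto
  finally have K1: "K \<le> 4 * (a + b)\<^sup>2" by (simp add: power2_eq_square)
  have "heron4 s a K \<tau> * heron4 s b K (- \<tau>) / (K + \<tau>\<^sup>2) \<le> (K * (a + b)\<^sup>2) * (K * (a + b)\<^sup>2) / K"
    using Na Nb K by (intro frac_le mult_mono Na1 Nb1) auto
  also have "\<dots> = K * (a + b) ^ 4" using K by (simp add: power2_eq_square power4_eq_xxxx)
  also have "\<dots> \<le> 4 * (a + b)\<^sup>2 * (a + b) ^ 4" by (intro mult_right_mono K1) auto
  also have "\<dots> = 4 * (a + b) ^ 6" by (simp flip: power_add)
  finally show ?thesis .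
qed

text \<open>Separates a weight that is free of p from a p-th power with normalised base, the shape
  of \<open>nn_integral_powr_limit\<close>.\<close>

lemma Jrad_normalised:
  fixes p \<beta> :: real
  assumes s: "s > 0" and a: "a > s" and b: "b > s"
  defines "Z \<equiv> 4 * (a + b) ^ 6"
  shows "Jrad p s \<beta> a b = ennreal (16 powr p / 2 * Z powr p) * (\<integral>\<^sup>+x. (case x of (\<tau>, K) \<Rightarrow>
      ennreal (K powr (2 * \<beta>) * (K + \<tau>\<^sup>2) powr (- 1 / 2)) * indicator {K. 0 < K \<and> 0 < heron4 s a K \<tau> \<and> 0 < heron4 s b K (- \<tau>)} K) *
      ennreal ((case x of (\<tau>, K) \<Rightarrow> heron4 s a K \<tau> * heron4 s b K (- \<tau>) / (K + \<tau>\<^sup>2) / Z) powr p) \<partial>(lborel \<Otimes>\<^sub>M lborel))"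
proof -
  let ?B = "ennreal (Z powr p)"
  let ?A = "lborel \<Otimes>\<^sub>M lborel"
  let ?k = "\<lambda>K \<tau>. (heron4 s a K \<tau> * heron4 s b K (- \<tau>)) powr p * (K + \<tau>\<^sup>2) powr (- p - 1 / 2)"
  let ?h = "\<lambda>K \<tau>. heron4 s a K \<tau> * heron4 s b K (- \<tau>) / (K + \<tau>\<^sup>2) / Z"
  have Z: "Z > 0" using s a b by (simp add: Z_def)
  let ?f = "\<lambda>\<tau> K. ennreal (K powr (2 * \<beta>)) * (ennreal (?k K \<tau>) *
      indicator {K. 0 < heron4 s a K \<tau> \<and> 0 < heron4 s b K (- \<tau>)} K) * indicator {0<..} K"
  let ?g = "\<lambda>\<tau> K. ennreal (K powr (2 * \<beta>) * (K + \<tau>\<^sup>2) powr (- 1 / 2)) * indicator {K. 0 < K \<and> 0 < heron4 s a K \<tau> \<and> 0 < heron4 s b K (- \<tau>)} K *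
      ennreal ((?h K \<tau>) powr p)"
  have e: "?f \<tau> K = ?B * ?g \<tau> K" for \<tau> K
  proof (cases "0 < K \<and> 0 < heron4 s a K \<tau> \<and> 0 < heron4 s b K (- \<tau>)")
    case True
    have r: "K + \<tau>\<^sup>2 > 0" using True by (simp add: add_pos_nonneg)
    have "(?h K \<tau>) powr p = (heron4 s a K \<tau> * heron4 s b K (- \<tau>)) powr p / (K + \<tau>\<^sup>2) powr p / Z powr p"
      using True r Z less_imp_le[OF r] by (simp add: powr_divide powr_mult)
    moreover have "(K + \<tau>\<^sup>2) powr (- p - 1 / 2) = (K + \<tau>\<^sup>2) powr (- 1 / 2) / (K + \<tau>\<^sup>2) powr p"
    proof -
      have "- p - 1 / 2 = - 1 / 2 - p" by simp
      then show ?thesis by (simp only: powr_diff)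
    qed
    ultimately have "K powr (2 * \<beta>) * (?k K \<tau>) =
      Z powr p * (K powr (2 * \<beta>) * (K + \<tau>\<^sup>2) powr (- 1 / 2) * (?h K \<tau>) powr p)"
      using Z by simp
    then have "ennreal (K powr (2 * \<beta>)) * ennreal (?k K \<tau>) =
      ?B * (ennreal (K powr (2 * \<beta>) * (K + \<tau>\<^sup>2) powr (- 1 / 2)) * ennreal ((?h K \<tau>) powr p))"
      by (simp only: ennreal_mult'[symmetric] powr_ge_zero mult_nonneg_nonneg)
    then show ?thesis using True by simp
  next
    case False
    then show ?thesis by (auto simp: indicator_def)
  qed
  have m1: "(\<lambda>x. case x of (\<tau>, K) \<Rightarrow> ?g \<tau> K) \<in> borel_measurable ?A"
    unfolding heron4_def by measurable
  have "Jrad p s \<beta> a b = ennreal (16 powr p / 2) * (\<integral>\<^sup>+\<tau>. \<integral>\<^sup>+K. ?f \<tau> K \<partial>lborel \<partial>lborel)"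
    by (rule Jrad_K) (use s a b in auto)
  also have "(\<integral>\<^sup>+\<tau>. \<integral>\<^sup>+K. ?f \<tau> K \<partial>lborel \<partial>lborel) = (\<integral>\<^sup>+\<tau>. \<integral>\<^sup>+K. (case (\<tau>, K) of (\<tau>, K) \<Rightarrow> ?B * ?g \<tau> K) \<partial>lborel \<partial>lborel)"
    unfolding e by simp
  also have "\<dots> = (\<integral>\<^sup>+x. (case x of (\<tau>, K) \<Rightarrow> ?B * ?g \<tau> K) \<partial>?A)"
    by (rule lborel.nn_integral_fst) (unfold heron4_def, measurable)
  also have "\<dots> = (\<integral>\<^sup>+x. ?B * (case x of (\<tau>, K) \<Rightarrow> ?g \<tau> K) \<partial>?A)"
    by (rule nn_integral_cong) auto
  also have "\<dots> = ?B * (\<integral>\<^sup>+x. (case x of (\<tau>, K) \<Rightarrow> ?g \<tau> K) \<partial>?A)"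
    by (rule nn_integral_cmult[OF m1])
  also have "ennreal (16 powr p / 2) * \<dots> = ennreal (16 powr p / 2 * Z powr p) * (\<integral>\<^sup>+x. (case x of (\<tau>, K) \<Rightarrow> ?g \<tau> K) \<partial>?A)"
    by (subst ennreal_mult) (auto simp: mult.assoc)
  finally show ?thesis by (simp add: case_prod_beta')
qed

text \<open>The same separation for the angular side. The constant is twice the value of
  \<open>mprod\<close> at u = -1, its maximum over the interval.\<close>

lemma Jang_normalised:
  fixes p \<beta> :: real
  assumes s: "s > 0" and a: "a > s" and b: "b > s"
  defines "Z \<equiv> 2 * (a * b + mom s a * mom s b)"
  shows "Jang p s \<beta> a b = ennreal (Z powr p) * (\<integral>\<^sup>+u. (ennreal ((2 * (mprod s a b u - s\<^sup>2)) powr (2 * \<beta> + 1) / sqrt ((mprod s a b u)\<^sup>2 - s ^ 4)) * indicator {-1<..<1} u) *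
      ennreal (((1 - u\<^sup>2) * (2 * (mprod s a b u - s\<^sup>2)) / Z) powr p) \<partial>lborel)"
    and "u \<in> {-1<..<1} \<Longrightarrow> 0 < (1 - u\<^sup>2) * (2 * (mprod s a b u - s\<^sup>2)) / Z \<and> (1 - u\<^sup>2) * (2 * (mprod s a b u - s\<^sup>2)) / Z \<le> 1"
proof -
  let ?g = "\<lambda>u. (mprod s a b u)\<^sup>2 - s ^ 4"
  let ?f = "\<lambda>u. 2 * (mprod s a b u - s\<^sup>2)"
  have m: "mom s a > 0" "mom s b > 0" using mom_a(1)[OF s a b] mom_b(1)[OF s a b] by auto
  have Z: "Z > 0" using s a b m by (simp add: Z_def add_pos_pos)
  have u1: "1 - u\<^sup>2 > 0" "2 * (mprod s a b u - s\<^sup>2) > 0" if "u \<in> {-1<..<1}" for u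
    using that mprod_gt(3)[OF s a b, of u] by (auto simp: abs_square_less_1 abs_if)
  have e: "(1 - u\<^sup>2) powr p * (?f u) powr (2 * \<beta> + p + 1) =
     Z powr p * ((?f u) powr (2 * \<beta> + 1) * ((1 - u\<^sup>2) * (?f u) / Z) powr p)"
    if u: "u \<in> {-1<..<1}" for u
  proof -
    define Y where "Y = ?f u"
    have Y: "Y > 0" using u1[OF u] by (simp add: Y_def)
    have "((1 - u\<^sup>2) * Y / Z) powr p = (1 - u\<^sup>2) powr p * Y powr p / Z powr p"
      using u1[OF u] Y Z by (simp add: powr_divide powr_mult)
    moreover have "Y powr (2 * \<beta> + p + 1) = Y powr (2 * \<beta> + 1) * Y powr p" by (simp flip: powr_add add: add_ac)
    ultimately show ?thesis unfolding Y_def[symmetric] using Z by simp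
  qed
  show "Jang p s \<beta> a b = ennreal (Z powr p) * (\<integral>\<^sup>+u. (ennreal ((?f u) powr (2 * \<beta> + 1) / sqrt (?g u)) * indicator {-1<..<1} u) *
      ennreal (((1 - u\<^sup>2) * (?f u) / Z) powr p) \<partial>lborel)"
    unfolding Jang_def
  proof (subst nn_integral_cmult[symmetric], measurable, rule nn_integral_cong)
    fix u :: real
    show "ennreal ((1 - u\<^sup>2) powr p * (?f u) powr (2 * \<beta> + p + 1) / sqrt (?g u)) * indicator {-1<..<1} u
      = ennreal (Z powr p) * (ennreal ((?f u) powr (2 * \<beta> + 1) / sqrt (?g u)) * indicator {-1<..<1} u *
      ennreal (((1 - u\<^sup>2) * (?f u) / Z) powr p))"
    proof (cases "u \<in> {-1<..<1}")
      case True
      define D where "D = sqrt (?g u)"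
      have D: "D \<ge> 0"
      proof -
        have "?g u = (mprod s a b u - s\<^sup>2) * (mprod s a b u + s\<^sup>2)" by (simp add: power2_eq_square algebra_simps power4_eq_xxxx)
        moreover have "\<bar>u\<bar> \<le> 1" using True by auto
        ultimately show ?thesis using mprod_gt(1,2)[OF s a b, of u] by (simp add: D_def)
      qed
      have "(1 - u\<^sup>2) powr p * (?f u) powr (2 * \<beta> + p + 1) / D =
        Z powr p * ((?f u) powr (2 * \<beta> + 1) / D * ((1 - u\<^sup>2) * (?f u) / Z) powr p)"
        unfolding e[OF True] by simp
      then have "ennreal ((1 - u\<^sup>2) powr p * (?f u) powr (2 * \<beta> + p + 1) / D) =
        ennreal (Z powr p) * (ennreal ((?f u) powr (2 * \<beta> + 1) / D) * ennreal (((1 - u\<^sup>2) * (?f u) / Z) powr p))"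
        using D by (simp only: ennreal_mult'[symmetric] powr_ge_zero divide_nonneg_nonneg)
      then show ?thesis using True unfolding D_def by simp
    qed simp
  qed
  assume u: "u \<in> {-1<..<1}"
  have "mom s a * mom s b * (- u) \<le> mom s a * mom s b * 1" using u m by (intro mult_left_mono) auto
  then have "- (mom s a * mom s b * u) \<le> mom s a * mom s b" by simp
  moreover have "0 \<le> s\<^sup>2" by simp
  ultimately have "a * b - mom s a * mom s b * u - s\<^sup>2 \<le> a * b + mom s a * mom s b" by linarith
  then have "?f u \<le> Z" unfolding mprod_def Z_def by (rule mult_left_mono) simp
  then have "(1 - u\<^sup>2) * (?f u) \<le> 1 * Z" using u1[OF u] by (intro mult_mono) auto
  then show "0 < (1 - u\<^sup>2) * (?f u) / Z \<and> (1 - u\<^sup>2) * (?f u) / Z \<le> 1"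
    using u1[OF u] Z by simp
qed

text \<open>For \<open>p = - 1 / 2\<close>, the case \<open>d = 2\<close>, the powers of the Gram determinant are not integrable; this
  case is the limit \<open>p \<rightarrow> - 1 / 2\<close> from above, monotone after normalisation.\<close>

theorem Jrad_eq:
  assumes s: "s > 0" and a: "a > s" and b: "b > s" and p: "p \<ge> - 1 / 2" and \<beta>: "2 * \<beta> + p + 1 > 0"
  shows "Jrad p s \<beta> a b = ennreal (16 powr p / 2 * Beta (2 * \<beta> + p + 1) (p + 1) * (mom s a * mom s b) powr (2 * p + 1)) * Jang p s \<beta> a b"
proof (cases "p > - 1 / 2")
  case True
  then show ?thesis using Jrad_eq_strict[OF s a b True \<beta>] by simp
next
  case False
  have m: "mom s a > 0" "mom s b > 0" using mom_a(1)[OF s a b] mom_b(1)[OF s a b] by auto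
  define Z where "Z = 4 * (a + b) ^ 6"
  define Z' where "Z' = 2 * (a * b + mom s a * mom s b)"
  have Z: "Z > 0" "Z' > 0" using s a b m by (auto simp: Z_def Z'_def intro!: add_pos_pos)
  define q where "q n = p + 1 / real (Suc n)" for n
  have q: "q n > - 1 / 2" "q n > p" for n
  proof -
    have "1 / real (Suc n) > 0" by simp
    then show "q n > - 1 / 2" "q n > p" using p unfolding q_def by linarith+
  qed
  have ql: "q \<longlonglongrightarrow> p"
  proof -
    have "(\<lambda>n. p + 1 / real (Suc n)) \<longlonglongrightarrow> p + 0" by (intro tendsto_intros LIMSEQ_Suc[OF lim_1_over_n])
    then show ?thesis by (simp add: q_def[abs_def])
  qed
  let ?w = "\<lambda>x. case x of (\<tau>, K) \<Rightarrow>
      ennreal (K powr (2 * \<beta>) * (K + \<tau>\<^sup>2) powr (- 1 / 2)) * indicator {K. 0 < K \<and> 0 < heron4 s a K \<tau> \<and> 0 < heron4 s b K (- \<tau>)} K"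
  let ?y = "\<lambda>x. case x of (\<tau>, K) \<Rightarrow> heron4 s a K \<tau> * heron4 s b K (- \<tau>) / (K + \<tau>\<^sup>2) / Z"
  let ?f = "\<lambda>p. \<integral>\<^sup>+x. ?w x * ennreal (?y x powr p) \<partial>(lborel \<Otimes>\<^sub>M lborel)"
  let ?w' = "\<lambda>u. ennreal ((2 * (mprod s a b u - s\<^sup>2)) powr (2 * \<beta> + 1) / sqrt ((mprod s a b u)\<^sup>2 - s ^ 4)) * indicator {-1<..<1} u"
  let ?y' = "\<lambda>u. (1 - u\<^sup>2) * (2 * (mprod s a b u - s\<^sup>2)) / Z'"
  have L: "(\<lambda>n. Jrad (q n) s \<beta> a b) \<longlonglongrightarrow> Jrad p s \<beta> a b"
    unfolding Jrad_normalised[OF s a b, folded Z_def]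
  proof (rule tendsto_mult_ennreal)
    show "(\<lambda>n. ennreal (16 powr q n / 2 * Z powr q n)) \<longlonglongrightarrow> ennreal (16 powr p / 2 * Z powr p)"
      using Z by (intro tendsto_ennrealI tendsto_intros ql) auto
    show "(\<lambda>n. \<integral>\<^sup>+x. ?w x * ennreal (?y x powr q n) \<partial>(lborel \<Otimes>\<^sub>M lborel)) \<longlonglongrightarrow> (?f p)"
      unfolding q_def
    proof (rule nn_integral_powr_limit)
      show "?w \<in> borel_measurable (lborel \<Otimes>\<^sub>M lborel)" "?y \<in> borel_measurable (lborel \<Otimes>\<^sub>M lborel)"
        unfolding heron4_def by measurable
      fix x assume "?w x \<noteq> 0"
      then obtain \<tau> K where x: "x = (\<tau>, K)" "K > 0" "heron4 s a K \<tau> > 0" "heron4 s b K (- \<tau>) > 0"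
        by (cases x) (auto simp: indicator_def split: if_splits)
      have "K + \<tau>\<^sup>2 > 0" using x by (simp add: add_pos_nonneg)
      then show "0 < ?y x \<and> ?y x \<le> 1"
        using heron4_bound[OF s a b x(2-4), folded Z_def] x Z by (simp add: pos_divide_le_eq mult.commute)
    qed
    show "\<not> (ennreal (16 powr p / 2 * Z powr p) = 0 \<and> (?f p) = \<infinity> \<or>
       ennreal (16 powr p / 2 * Z powr p) = \<infinity> \<and> (?f p) = 0)"
      using Z by simp
  qed
  let ?c = "\<lambda>p. 16 powr p / 2 * Beta (2 * \<beta> + p + 1) (p + 1) * (mom s a * mom s b) powr (2 * p + 1)"
  have cl: "(\<lambda>n. ?c (q n)) \<longlonglongrightarrow> ?c p"
  proof -
    have "2 * \<beta> + p + 1 \<notin> \<int>\<^sub>\<le>\<^sub>0" "p + 1 \<notin> \<int>\<^sub>\<le>\<^sub>0" "2 * \<beta> + p + 1 + (p + 1) \<notin> \<int>\<^sub>\<le>\<^sub>0"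
      using \<beta> p by (auto elim!: nonpos_Ints_cases)
    moreover have "Gamma (2 * \<beta> + p + 1 + (p + 1)) > 0" using \<beta> p by (intro Gamma_real_pos) linarith
    then have "Gamma (2 * \<beta> + p + 1 + (p + 1)) \<noteq> 0" by linarith
    ultimately show ?thesis using m unfolding Beta_def by (intro tendsto_intros ql) auto
  qed
  have "(\<lambda>n. Jang (q n) s \<beta> a b) \<longlonglongrightarrow> Jang p s \<beta> a b"
    unfolding Jang_normalised[OF s a b, folded Z'_def]
  proof (rule tendsto_mult_ennreal)
    show "(\<lambda>n. ennreal (Z' powr q n)) \<longlonglongrightarrow> ennreal (Z' powr p)"
      using Z by (intro tendsto_ennrealI tendsto_intros ql) auto
    show "(\<lambda>n. \<integral>\<^sup>+u. ?w' u * ennreal (?y' u powr q n) \<partial>lborel) \<longlonglongrightarrow> (\<integral>\<^sup>+u. ?w' u * ennreal (?y' u powr p) \<partial>lborel)"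
      unfolding q_def
    proof (rule nn_integral_powr_limit)
      fix u assume "?w' u \<noteq> 0"
      then have "u \<in> {-1<..<1}" by (auto simp: indicator_def split: if_splits)
      then show "0 < ?y' u \<and> ?y' u \<le> 1" using Jang_normalised(2)[OF s a b] unfolding Z'_def by blast
    qed measurable
    show "\<not> (ennreal (Z' powr p) = 0 \<and> (\<integral>\<^sup>+u. ?w' u * ennreal (?y' u powr p) \<partial>lborel) = \<infinity> \<or>
       ennreal (Z' powr p) = \<infinity> \<and> (\<integral>\<^sup>+u. ?w' u * ennreal (?y' u powr p) \<partial>lborel) = 0)" using Z by simp
  qed
  then have "(\<lambda>n. ennreal (?c (q n)) * Jang (q n) s \<beta> a b) \<longlonglongrightarrow> ennreal (?c p) * Jang p s \<beta> a b"
  proof (intro tendsto_mult_ennreal tendsto_ennrealI cl)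
    have "?c p > 0" using m \<beta> p by (intro mult_pos_pos Beta_pos) auto
    then have "ennreal (?c p) \<noteq> 0" by (simp only: ennreal_eq_0_iff not_le)
    then show "\<not> (ennreal (?c p) = 0 \<and> Jang p s \<beta> a b = \<infinity> \<or> ennreal (?c p) = \<infinity> \<and> Jang p s \<beta> a b = 0)"
      by (simp only: infinity_ennreal_def ennreal_neq_top simp_thms)
  qed
  moreover have "Jrad (q n) s \<beta> a b = ennreal (?c (q n)) * Jang (q n) s \<beta> a b" for n
    by (rule Jrad_eq_strict[OF s a b q(1)]) (use \<beta> q(2)[of n] in simp)
  ultimately show ?thesis using L LIMSEQ_unique by simp
qed

section \<open>Strict bounds and limit of the kernel\<close>

lemma convex_on_powr:
  fixes \<gamma> :: real
  assumes "\<gamma> \<le> 0 \<or> 1 \<le> \<gamma>"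
  shows "convex_on {0<..} (\<lambda>x. x powr \<gamma>)"
proof (rule f''_ge0_imp_convex)
  show "convex {0::real<..}" by simp
  fix x :: real assume x: "x \<in> {0<..}"
  show "DERIV (\<lambda>x. x powr \<gamma>) x :> \<gamma> * x powr (\<gamma> - 1)" using x by (auto intro!: derivative_eq_intros)
  show "DERIV (\<lambda>x. \<gamma> * x powr (\<gamma> - 1)) x :> \<gamma> * (\<gamma> - 1) * x powr (\<gamma> - 2)"
    using x by (auto intro!: derivative_eq_intros)
  have "\<gamma> * (\<gamma> - 1) \<ge> 0" using assms by (auto intro: mult_nonneg_nonneg mult_nonpos_nonpos)
  then show "\<gamma> * (\<gamma> - 1) * x powr (\<gamma> - 2) \<ge> 0" by simp
qed

text \<open>The massless angular average: the integral of (1 - u^2)^p (1 - u)^\<gamma> over (-1,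
  1).\<close>

definition Jang_limit :: "real \<Rightarrow> real \<Rightarrow> real" where
  "Jang_limit p \<gamma> = 2 powr (\<gamma> + 2 * p + 1) * Beta (\<gamma> + p + 1) (p + 1)"

lemma Jang_limit_pos: "p > -1 \<Longrightarrow> \<gamma> + p + 1 > 0 \<Longrightarrow> Jang_limit p \<gamma> > 0"
  unfolding Jang_limit_def by (intro mult_pos_pos Beta_pos) auto

text \<open>Both signs are needed: the convexity argument compares with a mixture of powers of 1 - u
  and 1 + u, and the reflection u -> - u gives both the same average.\<close>

lemma nn_integral_Jang_limit:
  assumes p: "p > -1" and g: "\<gamma> + p + 1 > 0"
  shows "(\<integral>\<^sup>+u. ennreal ((1 - u\<^sup>2) powr p * (1 - u) powr \<gamma>) * indicator {-1<..<1} u \<partial>lborel) = ennreal (Jang_limit p \<gamma>)"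
    and "(\<integral>\<^sup>+u. ennreal ((1 - u\<^sup>2) powr p * (1 + u) powr \<gamma>) * indicator {-1<..<1} u \<partial>lborel) = ennreal (Jang_limit p \<gamma>)"
proof -
  let ?A = "Beta (\<gamma> + p + 1) (p + 1) * 2 powr (\<gamma> + p + 1 + (p + 1) - 1)"
  let ?h = "\<lambda>t. t powr (\<gamma> + p + 1 - 1) * (2 - t) powr (p + 1 - 1)"
  let ?g = "(\<integral>\<^sup>+u. ennreal ((1 - u\<^sup>2) powr p * (1 - u) powr \<gamma>) * indicator {-1<..<1} u \<partial>lborel)"
  let ?f = "\<lambda>u. ennreal ((1 - u\<^sup>2) powr p * (1 + u) powr \<gamma>) * indicator {-1<..<1} u"
  let ?k = "(\<integral>\<^sup>+u. ?f u \<partial>lborel)"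
  have "?k = (\<integral>\<^sup>+t. ?f (t + (- 1)) \<partial>lborel)"
    by (rule nn_integral_lborel_translate[symmetric]) measurable
  also have "\<dots> = (\<integral>\<^sup>+t. ennreal (?h t) * indicator {0<..<2} t \<partial>lborel)"
  proof (rule nn_integral_cong)
    fix t :: real
    show "?f (t + (- 1)) = ennreal (?h t) * indicator {0<..<2} t"
    proof (cases "0 < t \<and> t < 2")
      case True
      have "1 - (t + (- 1))\<^sup>2 = t * (2 - t)" by (simp add: power2_eq_square algebra_simps)
      then have "(1 - (t + (- 1))\<^sup>2) powr p * (1 + (t + (- 1))) powr \<gamma> = ?h t"
        using True by (simp add: powr_mult powr_add)
      then show ?thesis using True by simp
    qed (auto simp: indicator_def)
  qed
  also have "\<dots> = ennreal ?A"
    using p g by (intro nn_integral_Beta) auto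
  also have "?A = Jang_limit p \<gamma>"
  proof -
    have "\<gamma> + p + 1 + (p + 1) - 1 = \<gamma> + 2 * p + 1" by simp
    then show ?thesis unfolding Jang_limit_def by (simp only: mult.commute)
  qed
  finally show *: "?k = ennreal (Jang_limit p \<gamma>)" .
  have "(\<integral>\<^sup>+u. ?f (- u) \<partial>lborel) = ?k"
    by (rule nn_integral_lborel_reflect) measurable
  moreover have "?g = (\<integral>\<^sup>+u. ?f (- u) \<partial>lborel)"
    by (intro nn_integral_cong) (auto simp: indicator_def)
  ultimately show "?g = ennreal (Jang_limit p \<gamma>)"
    using * by simp
qed

text \<open>X^2 - s^4 = (X - s^2)(X + s^2). Replacing X - s^2 by X in the numerator uses \<gamma> +
  1/2 \<ge> 0; replacing X + s^2 by X under the root is strict because s > 0.\<close>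

lemma Jang_integrand_less:
  assumes s: "s > 0" and X: "X > s\<^sup>2" and g: "\<gamma> \<ge> - 1 / 2"
  shows "(2 * (X - s\<^sup>2)) powr (\<gamma> + 1) / sqrt (X\<^sup>2 - s ^ 4) < 2 powr (\<gamma> + 1) * X powr \<gamma>"
    and "(2 * (X - s\<^sup>2)) powr (\<gamma> + 1) / sqrt (X\<^sup>2 - s ^ 4) = 2 powr (\<gamma> + 1) * ((X - s\<^sup>2) powr (\<gamma> + 1 / 2) / sqrt (X + s\<^sup>2))"
proof -
  let ?f = "sqrt (X + s\<^sup>2)"
  have s2: "s\<^sup>2 > 0" using s by simp
  have X0: "X > 0" "X - s\<^sup>2 > 0" "X + s\<^sup>2 > 0" using X s2 by linarith+
  have "X\<^sup>2 - s ^ 4 = (X - s\<^sup>2) * (X + s\<^sup>2)" by (simp add: power2_eq_square algebra_simps power4_eq_xxxx)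
  then have "sqrt (X\<^sup>2 - s ^ 4) = (X - s\<^sup>2) powr (1 / 2) * ?f" using X0 by (simp add: real_sqrt_mult powr_half_sqrt)
  moreover have "(X - s\<^sup>2) powr (\<gamma> + 1) = (X - s\<^sup>2) powr (\<gamma> + 1 / 2) * (X - s\<^sup>2) powr (1 / 2)"
    by (simp flip: powr_add add: add.commute)
  moreover have "(2 * (X - s\<^sup>2)) powr (\<gamma> + 1) = 2 powr (\<gamma> + 1) * (X - s\<^sup>2) powr (\<gamma> + 1)" by (rule powr_mult)
  ultimately show e: "(2 * (X - s\<^sup>2)) powr (\<gamma> + 1) / sqrt (X\<^sup>2 - s ^ 4) = 2 powr (\<gamma> + 1) * ((X - s\<^sup>2) powr (\<gamma> + 1 / 2) / ?f)"
    using X0 by simp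
  have "(X - s\<^sup>2) powr (\<gamma> + 1 / 2) / ?f \<le> X powr (\<gamma> + 1 / 2) / ?f"
    using X0 s2 g by (intro divide_right_mono powr_mono2 real_sqrt_ge_zero) linarith+
  also have "\<dots> < X powr (\<gamma> + 1 / 2) / sqrt X"
  proof (rule divide_strict_left_mono)
    show "sqrt X < ?f" using s2 by simp
    show "0 < X powr (\<gamma> + 1 / 2)" using X0 by simp
    show "0 < ?f * sqrt X" using X0(1,3) by (intro mult_pos_pos) (auto simp only: real_sqrt_gt_0_iff)
  qed
  also have "\<dots> = X powr \<gamma>" using X0 by (simp add: powr_add powr_half_sqrt)
  finally show "(2 * (X - s\<^sup>2)) powr (\<gamma> + 1) / sqrt (X\<^sup>2 - s ^ 4) < 2 powr (\<gamma> + 1) * X powr \<gamma>"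
    unfolding e by (rule mult_strict_left_mono) simp
qed

context
  fixes s a b p \<gamma> :: real
  assumes s: "s > 0" and a: "a > s" and b: "b > s" and p: "p > - 1" and g: "\<gamma> \<ge> - 1 / 2"
begin

text \<open>\<rho> is the product of the two velocities, momentum over energy, and is below 1
  because the mass is positive.\<close>

lemma mprod_split:
  obtains \<rho> where "0 < \<rho>" "\<rho> < 1" "\<And>u. mprod s a b u = a * b * (1 - \<rho> * u)"
proof
  have m: "mom s a > 0" "mom s b > 0" using mom_a(1)[OF s a b] mom_b(1)[OF s a b] by auto
  have ab: "a * b > 0" using s a b by simp
  show "0 < mom s a * mom s b / (a * b)" using m ab by simp
  show "mprod s a b u = a * b * (1 - mom s a * mom s b / (a * b) * u)" for u
    unfolding mprod_def using s a b by (simp add: field_simps)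
  have "mprod s a b 1 > 0" using mprod_gt(1)[OF s a b, of 1] by simp
  then show "mom s a * mom s b / (a * b) < 1" using ab unfolding mprod_def by simp
qed

lemma Jang_eq: "Jang p s ((\<gamma> - p) / 2) a b = (\<integral>\<^sup>+u. ennreal ((1 - u\<^sup>2) powr p * ((2 * (mprod s a b u - s\<^sup>2)) powr (\<gamma> + 1) / sqrt ((mprod s a b u)\<^sup>2 - s ^ 4))) * indicator {-1<..<1} u \<partial>lborel)"
proof -
  have "2 * ((\<gamma> - p) / 2) + p + 1 = \<gamma> + 1" by (simp add: field_simps)
  then show ?thesis unfolding Jang_def by (simp only: times_divide_eq_right)
qed

text \<open>The integrand is strictly smaller at every point of (-1, 1), a set of positive measure,
  so a finite majorising integral is not reached.\<close>

lemma Jang_strict_bound: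
  assumes h: "\<And>u. -1 < u \<Longrightarrow> u < 1 \<Longrightarrow> 2 powr (\<gamma> + 1) * (mprod s a b u) powr \<gamma> \<le> h u" and [measurable]: "h \<in> borel_measurable borel"
    and fin: "(\<integral>\<^sup>+u. ennreal ((1 - u\<^sup>2) powr p * h u) * indicator {-1<..<1} u \<partial>lborel) < \<infinity>"
  shows "Jang p s ((\<gamma> - p) / 2) a b < (\<integral>\<^sup>+u. ennreal ((1 - u\<^sup>2) powr p * h u) * indicator {-1<..<1} u \<partial>lborel)"
proof -
  let ?h = "\<lambda>u. (2 * (mprod s a b u - s\<^sup>2)) powr (\<gamma> + 1) / sqrt ((mprod s a b u)\<^sup>2 - s ^ 4)"
  let ?g = "\<lambda>u. ennreal ((1 - u\<^sup>2) powr p * h u) * indicator {-1<..<1} u"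
  let ?f = "\<lambda>u. (1 - u\<^sup>2) powr p * (?h u)"
  let ?k = "\<lambda>u. ennreal (?f u) * indicator {-1<..<1} u"
  have less: "?f u < (1 - u\<^sup>2) powr p * h u"
    if u: "-1 < u" "u < 1" for u
  proof -
    have "mprod s a b u > s\<^sup>2" using mprod_gt(3)[OF s a b, of u] u by auto
    from Jang_integrand_less(1)[OF s this g] h[OF u]
    have "?h u < h u" by linarith
    moreover have "1 - u\<^sup>2 > 0" using u by (simp add: abs_square_less_1 abs_less_iff)
    ultimately show ?thesis by (intro mult_strict_left_mono) auto
  qed
  have hp: "h u > 0" if "-1 < u" "u < 1" for u
  proof -
    have "mprod s a b u > 0" using mprod_gt(1)[OF s a b, of u] that by auto
    then have "2 powr (\<gamma> + 1) * (mprod s a b u) powr \<gamma> > 0" by simp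
    then show ?thesis using h[OF that] by linarith
  qed
  have pt: "?k u \<le> ?g u" for u
  proof (cases "u \<in> {-1<..<1}")
    case True
    then show ?thesis by (intro mult_right_mono ennreal_leI less_imp_le[OF less]) auto
  qed simp
  have le: "(\<integral>\<^sup>+u. ?k u \<partial>lborel)
     \<le> (\<integral>\<^sup>+u. ?g u \<partial>lborel)"
    by (intro nn_integral_mono pt)
  show ?thesis unfolding Jang_eq
  proof (rule nn_integral_less)
    show "(\<integral>\<^sup>+u. ?k u \<partial>lborel) \<noteq> \<infinity>"
      using le fin by (auto simp: top_unique)
    show "AE u in lborel. ?k u \<le> ?g u"
      by (intro AE_I2 pt)
    show "\<not> (AE u in lborel. ?g u \<le> ?k u)"
    proof
      assume "AE u in lborel. ?g u \<le> ?k u"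
      then have "AE u in lborel. u \<notin> {-1<..<1::real}"
      proof eventually_elim
        case (elim u)
        show ?case
        proof
          assume u: "u \<in> {-1<..<1}"
          then have "0 < (1 - u\<^sup>2) powr p * h u" using hp[of u] by (auto simp: abs_square_eq_1)
          with elim u have "(1 - u\<^sup>2) powr p * h u \<le> ?f u"
            by (auto simp: ennreal_le_iff2)
          then show False using less[of u] u by auto
        qed
      qed
      moreover have "{x. \<not> x \<notin> {-1<..<1::real}} = {-1<..<1}" by auto
      ultimately have "emeasure lborel {-1<..<1::real} = 0" by (subst (asm) AE_iff_measurable[of "{-1<..<1}"]) auto
      then show False by simp
    qed
  qed measurable
qed

text \<open>1 - \<rho> u is the mixture of 1 - u and 1 + u with weights (1 + \<rho>)/2 and (1 -
  \<rho>)/2. Convexity bounds its power by the mixture of the powers, whose average does not depend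
  on the weights; so apart from the factor \<open>(a * b) powr \<gamma>\<close> the bound is uniform
  in the energies.\<close>

lemma Jang_less:
  assumes cv: "\<gamma> \<le> 0 \<or> 1 \<le> \<gamma>" and gp: "\<gamma> + p + 1 > 0"
  shows "Jang p s ((\<gamma> - p) / 2) a b < ennreal (2 powr (\<gamma> + 1) * (a * b) powr \<gamma> * Jang_limit p \<gamma>)"
proof -
  let ?h = "\<lambda>l u. l * (1 - u) powr \<gamma> + (1 - l) * (1 + u) powr \<gamma>"
  let ?g = "\<lambda>h. (\<integral>\<^sup>+u. ennreal ((1 - u\<^sup>2) powr p * h u) * indicator {-1<..<1} u \<partial>lborel)"
  let ?f = "\<lambda>c l u. ennreal (c * l) * (ennreal ((1 - u\<^sup>2) powr p * (1 - u) powr \<gamma>) * indicator {-1<..<1} u) +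
       ennreal (c * (1 - l)) * (ennreal ((1 - u\<^sup>2) powr p * (1 + u) powr \<gamma>) * indicator {-1<..<1} u)"
  obtain \<rho> where \<rho>: "0 < \<rho>" "\<rho> < 1" "\<And>u. mprod s a b u = a * b * (1 - \<rho> * u)" using mprod_split by blast
  define c where "c = 2 powr (\<gamma> + 1) * (a * b) powr \<gamma>"
  have ab: "a * b > 0" using s a b by simp
  have c: "c > 0" unfolding c_def using ab s a b by (intro mult_pos_pos) auto
  define l where "l = (1 + \<rho>) / 2"
  have l: "0 \<le> l" "l \<le> 1" "0 \<le> 1 - l" using \<rho> by (auto simp: l_def)
  define h where "h u = c * (?h l u)" for u
  have [measurable]: "h \<in> borel_measurable borel" unfolding h_def[abs_def] by measurable
  have "?g h =
    (\<integral>\<^sup>+u. ?f c l u \<partial>lborel)"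
  proof (rule nn_integral_cong)
    fix u :: real
    have "(1 - u\<^sup>2) powr p * h u = (c * l) * ((1 - u\<^sup>2) powr p * (1 - u) powr \<gamma>) + (c * (1 - l)) * ((1 - u\<^sup>2) powr p * (1 + u) powr \<gamma>)"
      unfolding h_def by (simp add: algebra_simps)
    moreover have "0 \<le> c * l" "0 \<le> c * (1 - l)" using c l by auto
    ultimately have "ennreal ((1 - u\<^sup>2) powr p * h u) = ennreal (c * l) * ennreal ((1 - u\<^sup>2) powr p * (1 - u) powr \<gamma>) + ennreal (c * (1 - l)) * ennreal ((1 - u\<^sup>2) powr p * (1 + u) powr \<gamma>)"
      by (simp only: ennreal_mult'[symmetric] ennreal_plus[symmetric] mult_nonneg_nonneg powr_ge_zero)
    then show "ennreal ((1 - u\<^sup>2) powr p * h u) * indicator {-1<..<1} u = ?f c l u"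
      by (simp add: distrib_right mult.assoc)
  qed
  also have "\<dots> = ennreal (c * l) * ennreal (Jang_limit p \<gamma>) + ennreal (c * (1 - l)) * ennreal (Jang_limit p \<gamma>)"
    by (subst nn_integral_add, measurable, subst nn_integral_cmult, measurable, subst nn_integral_cmult, measurable)
       (simp only: nn_integral_Jang_limit[OF p gp])
  also have "\<dots> = ennreal (c * Jang_limit p \<gamma>)"
    using c l Jang_limit_pos[OF p gp] by (simp add: ennreal_mult[symmetric] ennreal_plus[symmetric] algebra_simps del: ennreal_plus)
  finally have e: "?g h = ennreal (c * Jang_limit p \<gamma>)" .
  have "Jang p s ((\<gamma> - p) / 2) a b < ?g h"
  proof (rule Jang_strict_bound)
    fix u :: real assume u: "-1 < u" "u < 1"
    have "(l * (1 - u) + (1 - l) * (1 + u)) powr \<gamma> \<le> ?h l u"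
      using convex_onD[OF convex_on_powr[OF cv], of "1 - l" "1 - u" "1 + u"] u l by simp
    moreover have "l * (1 - u) + (1 - l) * (1 + u) = 1 - \<rho> * u" by (simp add: l_def field_simps)
    ultimately have "(1 - \<rho> * u) powr \<gamma> \<le> ?h l u" by simp
    moreover have "0 \<le> 1 - \<rho> * u"
    proof -
      have "mprod s a b u > 0" using mprod_gt(1)[OF s a b, of u] u by auto
      then show ?thesis unfolding \<rho>(3) using ab by (simp add: zero_less_mult_iff)
    qed
    ultimately show "2 powr (\<gamma> + 1) * mprod s a b u powr \<gamma> \<le> h u"
      unfolding \<rho>(3) h_def c_def using ab s a b by (subst powr_mult) (auto simp: mult.assoc)
  qed (use e in auto)
  then show ?thesis unfolding e c_def .
qed

text \<open>Between \<gamma> = 0 and \<gamma> = 1, where convexity fails, the crude bound mprod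
  \<le> 2 a b still provides some constant.\<close>

lemma Jang_le_pos:
  assumes g0: "\<gamma> \<ge> 0"
  shows "Jang p s ((\<gamma> - p) / 2) a b \<le> ennreal (2 powr (\<gamma> + 1) * (a * b) powr \<gamma> * (2 powr \<gamma> * Jang_limit p 0))"
proof -
  let ?f = "\<lambda>c. (\<integral>\<^sup>+u. ennreal ((1 - u\<^sup>2) powr p * c) * indicator {-1<..<1} u \<partial>lborel)"
  obtain \<rho> where \<rho>: "0 < \<rho>" "\<rho> < 1" "\<And>u. mprod s a b u = a * b * (1 - \<rho> * u)" using mprod_split by blast
  define c where "c = 2 powr (\<gamma> + 1) * (a * b) powr \<gamma> * 2 powr \<gamma>"
  have ab: "a * b > 0" using s a b by simp
  have c: "c \<ge> 0" by (simp add: c_def)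
  have "?f c =
    (\<integral>\<^sup>+u. ennreal c * (ennreal ((1 - u\<^sup>2) powr p * (1 - u) powr 0) * indicator {-1<..<1} u) \<partial>lborel)"
    using c by (intro nn_integral_cong) (auto simp: indicator_def ennreal_mult mult.commute)
  also have "\<dots> = ennreal c * ennreal (Jang_limit p 0)"
    using p by (subst nn_integral_cmult, measurable) (subst nn_integral_Jang_limit, auto)
  also have "\<dots> = ennreal (c * Jang_limit p 0)" using c by (simp add: ennreal_mult')
  finally have e: "?f c = ennreal (c * Jang_limit p 0)" .
  have "Jang p s ((\<gamma> - p) / 2) a b < ?f c"
  proof (rule Jang_strict_bound)
    fix u :: real assume u: "-1 < u" "u < 1"
    have "mprod s a b u > 0" using mprod_gt(1)[OF s a b, of u] u by auto
    moreover have "mprod s a b u \<le> a * b * 2"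
    proof -
      have "\<rho> * (- u) \<le> \<rho> * 1" using \<rho> u by (intro mult_left_mono) auto
      then have "\<rho> * (- u) \<le> 1" using \<rho> by linarith
      then show ?thesis unfolding \<rho>(3) using ab by (intro mult_left_mono) auto
    qed
    ultimately have "mprod s a b u powr \<gamma> \<le> (a * b * 2) powr \<gamma>" using g0 by (intro powr_mono2) auto
    also have "\<dots> = (a * b) powr \<gamma> * 2 powr \<gamma>" using ab by (subst powr_mult) auto
    finally show "2 powr (\<gamma> + 1) * mprod s a b u powr \<gamma> \<le> c" unfolding c_def by (simp add: mult.assoc)
  qed (use e in auto)
  then show ?thesis unfolding e unfolding c_def by (simp add: less_imp_le mult.assoc)
qed

end

text \<open>Fatou's lemma along a hypothetical sequence of pairs of energies that violate the bound.
  The two energies must be allowed to grow independently, since nothing but their size is known in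
  the double integral over the test profile.\<close>

lemma Jang_lower:
  fixes s p \<gamma> \<delta> :: real
  assumes s: "s > 0" and p: "p > - 1" and g: "\<gamma> \<ge> - 1 / 2" and gp: "\<gamma> + p + 1 > 0" and \<delta>: "\<delta> > 0"
  shows "\<exists>R>s. \<forall>a\<ge>R. \<forall>b\<ge>R. ennreal ((1 - \<delta>) * (2 powr (\<gamma> + 1) * (a * b) powr \<gamma> * Jang_limit p \<gamma>)) \<le> Jang p s ((\<gamma> - p) / 2) a b"
proof (rule ccontr)
  let ?k = "(1 - \<delta>) * Jang_limit p \<gamma>"
  let ?h = "\<lambda>T n u. ennreal (T n u) * indicator {-1<..<1} u"
  let ?g = "\<lambda>u x n y. (1 - u\<^sup>2) powr p * ((1 - sqrt (1 - (x n)\<^sup>2) * sqrt (1 - (y n)\<^sup>2) * u - x n * y n) powr (\<gamma> + 1 / 2) /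
        sqrt (1 - sqrt (1 - (x n)\<^sup>2) * sqrt (1 - (y n)\<^sup>2) * u + x n * y n))"
  let ?f = "\<lambda>A n B. (1 - \<delta>) * (2 powr (\<gamma> + 1) * (A n * B n) powr \<gamma> * Jang_limit p \<gamma>)"
  assume neg: "\<not> ?thesis"
  have "\<exists>a b. a \<ge> s + real (Suc n) \<and> b \<ge> s + real (Suc n) \<and> Jang p s ((\<gamma> - p) / 2) a b < ennreal ((1 - \<delta>) * (2 powr (\<gamma> + 1) * (a * b) powr \<gamma> * Jang_limit p \<gamma>))" for n
  proof -
    have "s + real (Suc n) > s" by simp
    then show ?thesis using neg by (meson not_le)
  qed
  then obtain A B where AB: "\<And>n. A n \<ge> s + real (Suc n)" "\<And>n. B n \<ge> s + real (Suc n)"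
      and J: "\<And>n. Jang p s ((\<gamma> - p) / 2) (A n) (B n) < ennreal (?f A n B)"
    by metis
  have As: "A n > s" "B n > s" for n using AB[of n] by auto
  have A0: "A n > 0" "B n > 0" for n using As[of n] s by auto
  define c where "c n = 2 powr (\<gamma> + 1) * (A n * B n) powr \<gamma>" for n
  have c: "c n > 0" for n using A0[of n] by (simp add: c_def)
  \<comment> \<open>The integrand divided by its scaling factor; after the division it depends on
    the energies only through the ratios s / A n and s / B n, which tend to 0.\<close>
  define T where "T n u = (1 - u\<^sup>2) powr p * ((2 * (mprod s (A n) (B n) u - s\<^sup>2)) powr (\<gamma> + 1) / sqrt ((mprod s (A n) (B n) u)\<^sup>2 - s ^ 4)) / c n" for n u
  have Ai: "Jang_limit p \<gamma> > 0" by (rule Jang_limit_pos[OF p gp])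
  have to0: "(\<lambda>n. s / X n) \<longlonglongrightarrow> 0" if "\<And>n. X n \<ge> s + real (Suc n)" for X
  proof -
    have "(\<lambda>n. s * (1 / real (Suc n))) \<longlonglongrightarrow> s * 0" by (intro tendsto_intros LIMSEQ_Suc[OF lim_1_over_n])
    then have U: "(\<lambda>n. s * (1 / real (Suc n))) \<longlonglongrightarrow> 0" by simp
    show ?thesis
    proof (rule tendsto_sandwich[OF _ _ tendsto_const U]; intro always_eventually allI)
      fix n
      have x: "real (Suc n) \<le> X n" using that[of n] s by simp
      moreover have x0: "X n > 0" using x by (smt (verit) of_nat_0_less_iff zero_less_Suc)
      ultimately show "s / X n \<le> s * (1 / real (Suc n))" using s by (simp add: frac_le del: of_nat_Suc)
      show "0 \<le> s / X n" using s x0 by simp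
    qed
  qed
  have mom: "mom s (X n) / X n = sqrt (1 - (s / X n)\<^sup>2)" if "X n > 0" for X :: "nat \<Rightarrow> real" and n
  proof -
    have "mom s (X n) / X n = sqrt ((X n)\<^sup>2 - s\<^sup>2) / sqrt ((X n)\<^sup>2)" using that by (simp add: mom_def)
    also have "\<dots> = sqrt (((X n)\<^sup>2 - s\<^sup>2) / (X n)\<^sup>2)" by (simp add: real_sqrt_divide)
    also have "((X n)\<^sup>2 - s\<^sup>2) / (X n)\<^sup>2 = 1 - (s / X n)\<^sup>2" using that by (simp add: diff_divide_distrib power_divide)
    finally show ?thesis .
  qed
  have Tlim: "(\<lambda>n. T n u) \<longlonglongrightarrow> (1 - u\<^sup>2) powr p * (1 - u) powr \<gamma>" if u: "-1 < u" "u < 1" for u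
  proof -
    define x where "x n = s / A n" for n
    define y where "y n = s / B n" for n
    have xl: "x \<longlonglongrightarrow> 0" and yl: "y \<longlonglongrightarrow> 0" unfolding x_def[abs_def] y_def[abs_def] by (intro to0 AB)+
    have Te: "T n u = ?g u x n y" for n
    proof -
      define P where "P = A n * B n"
      define m where "m = mprod s (A n) (B n) u"
      have P: "P > 0" using A0[of n] by (simp add: P_def)
      have X: "m > s\<^sup>2" using mprod_gt(3)[OF s As, of u n n] u by (auto simp: m_def)
      have s2: "s\<^sup>2 > 0" using s by simp
      have xy: "x n * y n = s\<^sup>2 / P" by (simp add: x_def y_def P_def power2_eq_square)
      have mm: "m = P * (1 - sqrt (1 - (x n)\<^sup>2) * sqrt (1 - (y n)\<^sup>2) * u)"
        unfolding m_def mprod_def P_def x_def y_def mom[of A, OF A0(1), symmetric] mom[of B, OF A0(2), symmetric]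
        using A0[of n] by (simp add: field_simps)
      define r where "r = 1 - sqrt (1 - (x n)\<^sup>2) * sqrt (1 - (y n)\<^sup>2) * u"
      have 1: "m - s\<^sup>2 = P * (r - x n * y n)" "m + s\<^sup>2 = P * (r + x n * y n)" unfolding mm xy r_def using P by (simp_all add: field_simps)
      have r1: "r - x n * y n > 0" "r + x n * y n > 0" using X s2 P 1 by (smt (verit) zero_less_mult_pos)+
      have "T n u = (1 - u\<^sup>2) powr p * (2 powr (\<gamma> + 1) * ((m - s\<^sup>2) powr (\<gamma> + 1 / 2) / sqrt (m + s\<^sup>2))) / c n"
        unfolding T_def m_def[symmetric] Jang_integrand_less(2)[OF s X g] ..
      also have "\<dots> = (1 - u\<^sup>2) powr p * ((r - x n * y n) powr (\<gamma> + 1 / 2) / sqrt (r + x n * y n))"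
      proof -
        have "(m - s\<^sup>2) powr (\<gamma> + 1 / 2) = P powr \<gamma> * sqrt P * (r - x n * y n) powr (\<gamma> + 1 / 2)"
          unfolding 1 using P by (simp add: powr_mult powr_add powr_half_sqrt)
        moreover have "sqrt (m + s\<^sup>2) = sqrt P * sqrt (r + x n * y n)" unfolding 1 by (rule real_sqrt_mult)
        ultimately show ?thesis unfolding c_def P_def[symmetric] using P by simp
      qed
      finally show ?thesis unfolding r_def .
    qed
    have "(\<lambda>n. ?g u x n y) \<longlonglongrightarrow>
      (1 - u\<^sup>2) powr p * ((1 - sqrt (1 - 0\<^sup>2) * sqrt (1 - 0\<^sup>2) * u - 0 * 0) powr (\<gamma> + 1 / 2) / sqrt (1 - sqrt (1 - 0\<^sup>2) * sqrt (1 - 0\<^sup>2) * u + 0 * 0))"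
      using u by (intro tendsto_intros xl yl) auto
    then show ?thesis unfolding Te using u by (simp add: powr_add powr_half_sqrt)
  qed
  have T0: "T n u \<ge> 0" if "-1 < u" "u < 1" for n u
  proof -
    have X: "mprod s (A n) (B n) u > s\<^sup>2" using mprod_gt(3)[OF s As, of u n n] that by auto
    then have "mprod s (A n) (B n) u + s\<^sup>2 > 0" using s by (smt (verit) zero_le_power2)
    then show ?thesis unfolding T_def Jang_integrand_less(2)[OF s X g] using c[of n] by simp
  qed
  have IT: "(\<integral>\<^sup>+u. ?h T n u \<partial>lborel) \<le> ennreal ?k" for n
  proof -
    have "(\<integral>\<^sup>+u. ?h T n u \<partial>lborel) = ennreal (1 / c n) * Jang p s ((\<gamma> - p) / 2) (A n) (B n)"
      unfolding Jang_eq[OF s As p g]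
    proof (subst nn_integral_cmult[symmetric], measurable, rule nn_integral_cong)
      fix u :: real
      let ?X = "(1 - u\<^sup>2) powr p * ((2 * (mprod s (A n) (B n) u - s\<^sup>2)) powr (\<gamma> + 1) / sqrt ((mprod s (A n) (B n) u)\<^sup>2 - s ^ 4))"
      have "T n u = 1 / c n * ?X" by (simp add: T_def)
      moreover have "ennreal (1 / c n * ?X) = ennreal (1 / c n) * ennreal ?X" by (rule ennreal_mult') (use c[of n] in simp)
      ultimately show "?h T n u = ennreal (1 / c n) * (ennreal ?X * indicator {-1<..<1} u)"
        by (simp only: mult.assoc)
    qed
    also have "\<dots> \<le> ennreal (1 / c n) * ennreal (?f A n B)"
      by (rule mult_left_mono[OF less_imp_le[OF J]]) simp
    also have "\<dots> = ennreal (1 / c n * (?f A n B))"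
      by (rule ennreal_mult'[symmetric]) (use c[of n] in simp)
    also have "1 / c n * (?f A n B) = ?k"
      using c[of n] A0[of n] unfolding c_def by simp
    finally show ?thesis .
  qed
  have "ennreal (Jang_limit p \<gamma>) = (\<integral>\<^sup>+u. liminf (\<lambda>n. ?h T n u) \<partial>lborel)"
    unfolding nn_integral_Jang_limit(1)[OF p gp, symmetric]
  proof (rule nn_integral_cong)
    fix u :: real
    show "ennreal ((1 - u\<^sup>2) powr p * (1 - u) powr \<gamma>) * indicator {-1<..<1} u = liminf (\<lambda>n. ?h T n u)"
    proof (cases "u \<in> {-1<..<1}")
      case True
      then have "(\<lambda>n. ennreal (T n u)) \<longlonglongrightarrow> ennreal ((1 - u\<^sup>2) powr p * (1 - u) powr \<gamma>)"
        by (intro tendsto_ennrealI Tlim) auto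
      from lim_imp_Liminf[OF _ this] True show ?thesis by simp
    qed (simp add: Liminf_const)
  qed
  also have "\<dots> \<le> liminf (\<lambda>n. \<integral>\<^sup>+u. ?h T n u \<partial>lborel)"
    by (rule nn_integral_liminf) (unfold T_def, measurable)
  also have "\<dots> \<le> ennreal ?k"
    by (rule order_trans[OF Liminf_le_Limsup Limsup_bounded]) (auto intro: always_eventually IT)
  finally have "Jang_limit p \<gamma> \<le> ?k"
    using Ai by (simp add: ennreal_le_iff2 not_le[symmetric])
  then have "\<delta> * Jang_limit p \<gamma> \<le> 0" by (simp add: algebra_simps)
  then show False using mult_pos_pos[OF \<delta> Ai] by linarith
qed

section \<open>Space-time Fourier transforms\<close>

lemma measurable_pair_lborel:
  fixes f :: "'a::euclidean_space \<times> 'b::euclidean_space \<Rightarrow> complex"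
  assumes "f \<in> borel_measurable borel"
  shows "(\<lambda>(x, y). f (x, y)) \<in> borel_measurable (lborel \<Otimes>\<^sub>M lborel)"
proof -
  have "(\<lambda>(x, y). f (x, y)) = f" by (rule ext) (rule case_prod_beta[of "\<lambda>x y. f (x, y)", unfolded prod.collapse])
  then show ?thesis using assms unfolding lborel_prod by (simp only: measurable_lborel2)
qed

lemma rapid_slice:
  fixes \<psi> :: "real \<times> 'a::euclidean_space \<Rightarrow> complex"
  assumes "rapid \<psi>" shows "rapid (\<lambda>\<tau>. \<psi> (\<tau>, \<xi>))"
  unfolding rapid_def
proof (intro conjI allI)
  note [measurable] = rapid_measurable[OF assms]
  have [measurable]: "(\<lambda>\<tau>. (\<tau>, \<xi>)) \<in> borel_measurable borel"
    by (intro borel_measurable_continuous_onI continuous_intros)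
  show "(\<lambda>\<tau>. \<psi> (\<tau>, \<xi>)) \<in> borel_measurable borel" by measurable
  fix k
  obtain C where C: "\<And>x. (1 + norm x) ^ k * cmod (\<psi> x) \<le> C" using assms unfolding rapid_def by blast
  have "(1 + norm \<tau>) ^ k * cmod (\<psi> (\<tau>, \<xi>)) \<le> (1 + norm (\<tau>, \<xi>)) ^ k * cmod (\<psi> (\<tau>, \<xi>))" for \<tau>
    by (intro mult_right_mono power_mono add_left_mono) (auto simp: norm_Pair)
  then show "\<exists>C. \<forall>\<tau>. (1 + norm \<tau>) ^ k * cmod (\<psi> (\<tau>, \<xi>)) \<le> C" using C order_trans by blast
qed

text \<open>\<psi>' is the partial derivative in the time variable, so multiplication by t of the
  sliced transform stays inside the Schwartz class.\<close>

lemma schwartz_slice_fourier: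
  fixes \<psi> :: "real \<times> 'a::euclidean_space \<Rightarrow> complex"
  assumes \<psi>: "schwartz \<psi>"
  shows "\<exists>\<psi>'. schwartz \<psi>' \<and> (\<forall>t \<xi>. fourier_integral (\<lambda>\<tau>. \<psi>' (\<tau>, \<xi>)) t = \<i> * of_real t * fourier_integral (\<lambda>\<tau>. \<psi> (\<tau>, \<xi>)) t)"
proof -
  have b: "(1, 0) \<in> (Basis :: (real \<times> 'a) set)" by (simp add: Basis_prod_def)
  obtain D where D: "\<And>x. (\<psi> has_derivative D x) (at x)" "\<And>b. b \<in> Basis \<Longrightarrow> schwartz (\<lambda>x. D x b)"
    using schwartzD[OF \<psi>] by metis
  define \<psi>' where "\<psi>' x = D x (1, 0)" for x
  have s: "schwartz \<psi>'" unfolding \<psi>'_def by (rule D(2)[OF b])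
  have "fourier_integral (\<lambda>\<tau>. (\<lambda>h. D (\<tau>, \<xi>) (h, 0)) 1) t = \<i> * of_real (t \<bullet> 1) * fourier_integral (\<lambda>\<tau>. \<psi> (\<tau>, \<xi>)) t" for t \<xi>
  proof (rule fourier_integral_derivative[where D = "\<lambda>\<tau> h. D (\<tau>, \<xi>) (h, 0)"])
    show "((\<lambda>\<tau>. \<psi> (\<tau>, \<xi>)) has_derivative (\<lambda>h. D (\<tau>, \<xi>) (h, 0))) (at \<tau>)" for \<tau>
      by (rule has_derivative_compose[OF _ D(1), of "\<lambda>\<tau>. (\<tau>, \<xi>)"]) (auto intro!: derivative_eq_intros)
    show "integrable lborel (\<lambda>\<tau>. \<psi> (\<tau>, \<xi>))" by (intro rapid_integrable rapid_slice schwartz_rapid \<psi>)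
    show "integrable lborel (\<lambda>\<tau>. D (\<tau>, \<xi>) (1, 0))"
      using rapid_integrable[OF rapid_slice[OF schwartz_rapid[OF s]], of \<xi>] by (simp add: \<psi>'_def)
    have "continuous_on UNIV (\<lambda>\<tau>. \<psi>' (\<tau>, \<xi>))"
      by (rule continuous_on_compose2[OF schwartz_continuous[OF s]]) (auto intro!: continuous_intros)
    then show "continuous_on UNIV (\<lambda>\<tau>. D (\<tau>, \<xi>) (1, 0))" by (simp add: \<psi>'_def)
  qed
  then show ?thesis using s by (intro exI[of _ \<psi>']) (auto simp: \<psi>'_def)
qed

text \<open>Splits the joint decay into a factor integrable in \<tau> and a factor integrable in
  \<xi>.\<close>

lemma rapid_product_bound:
  fixes \<psi> :: "real \<times> 'a::euclidean_space \<Rightarrow> complex"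
  assumes "rapid \<psi>"
  obtains C where "C \<ge> 0" "\<And>\<tau> \<xi>. cmod (\<psi> (\<tau>, \<xi>)) \<le> C * (1 / (1 + \<tau>\<^sup>2)) * (1 / (1 + norm \<xi>) ^ (2 * DIM('a)))"
proof -
  obtain C where C: "C \<ge> 0" "\<And>x. cmod (\<psi> x) \<le> C / (1 + norm x) ^ (2 + 2 * DIM('a))" using rapidE[OF assms] by blast
  have "cmod (\<psi> (\<tau>, \<xi>)) \<le> C * (1 / (1 + \<tau>\<^sup>2)) * (1 / (1 + norm \<xi>) ^ (2 * DIM('a)))" for \<tau> \<xi>
  proof -
    have n: "norm \<tau> \<le> norm (\<tau>, \<xi>)" "norm \<xi> \<le> norm (\<tau>, \<xi>)" by (auto simp: norm_Pair)
    have "1 + \<tau>\<^sup>2 \<le> (1 + norm \<tau>)\<^sup>2" by (simp add: power2_sum)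
    also have "\<dots> \<le> (1 + norm (\<tau>, \<xi>))\<^sup>2" using n by (intro power_mono) auto
    finally have 1: "1 + \<tau>\<^sup>2 \<le> (1 + norm (\<tau>, \<xi>))\<^sup>2" .
    have 2: "(1 + norm \<xi>) ^ (2 * DIM('a)) \<le> (1 + norm (\<tau>, \<xi>)) ^ (2 * DIM('a))" using n by (intro power_mono) auto
    have p: "0 < (1 + norm \<xi>) ^ (2 * DIM('a))" by (intro zero_less_power add_pos_nonneg) auto
    have "(1 + \<tau>\<^sup>2) * (1 + norm \<xi>) ^ (2 * DIM('a)) \<le> (1 + norm (\<tau>, \<xi>)) ^ (2 + 2 * DIM('a))"
      unfolding power_add by (intro mult_mono 1 2) auto
    then have "C / (1 + norm (\<tau>, \<xi>)) ^ (2 + 2 * DIM('a)) \<le> C / ((1 + \<tau>\<^sup>2) * (1 + norm \<xi>) ^ (2 * DIM('a)))"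
      using C(1) p by (intro divide_left_mono mult_pos_pos zero_less_power) (auto simp: add_pos_nonneg)
    then show ?thesis using C(2)[of "(\<tau>, \<xi>)"] by simp
  qed
  with C(1) show ?thesis using that by blast
qed

text \<open>Two uses of the slice identity bound t^2 times the transform, enough for integrability
  in t; the decay in \<xi> is inherited from \<psi> and its second time derivative.\<close>

lemma schwartz_partial_fourier_bound:
  fixes \<psi> :: "real \<times> 'a::euclidean_space \<Rightarrow> complex"
  assumes \<psi>: "schwartz \<psi>"
  obtains C where "C \<ge> 0" "\<And>t \<xi>. cmod (fourier_integral (\<lambda>\<tau>. \<psi> (\<tau>, \<xi>)) t) \<le> C * (1 / (1 + t\<^sup>2)) * (1 / (1 + norm \<xi>) ^ (2 * DIM('a)))"
proof -
  let ?g = "\<lambda>\<xi>. 1 / (1 + norm \<xi>) ^ (2 * DIM('a))"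
  let ?f = "\<lambda>\<psi> \<xi> t. fourier_integral (\<lambda>\<tau>. \<psi> (\<tau>, \<xi>)) t"
  obtain \<psi>1 where s1: "schwartz \<psi>1" and 1: "\<And>t \<xi>. fourier_integral (\<lambda>\<tau>. \<psi>1 (\<tau>, \<xi>)) t = \<i> * of_real t * ?f \<psi> \<xi> t"
    using schwartz_slice_fourier[OF \<psi>] by blast
  obtain \<psi>2 where s2: "schwartz \<psi>2" and 2: "\<And>t \<xi>. fourier_integral (\<lambda>\<tau>. \<psi>2 (\<tau>, \<xi>)) t = \<i> * of_real t * fourier_integral (\<lambda>\<tau>. \<psi>1 (\<tau>, \<xi>)) t"
    using schwartz_slice_fourier[OF s1] by blast
  define J where "J = (LINT \<tau>|lborel. 1 / (1 + \<tau>\<^sup>2 :: real))"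
  have J: "J \<ge> 0" unfolding J_def by (intro integral_nonneg_AE AE_I2) (auto intro!: divide_nonneg_nonneg)
  have sl: "\<exists>C\<ge>0. \<forall>t \<xi>. cmod (?f \<psi> \<xi> t) \<le> C * (?g \<xi>)"
    if s: "schwartz \<psi>" for \<psi> :: "real \<times> 'a \<Rightarrow> complex"
  proof -
    obtain C where C: "C \<ge> 0" "\<And>\<tau> \<xi>. cmod (\<psi> (\<tau>, \<xi>)) \<le> C * (1 / (1 + \<tau>\<^sup>2)) * (?g \<xi>)"
      using rapid_product_bound[OF schwartz_rapid[OF s]] by blast
    have "cmod (?f \<psi> \<xi> t) \<le> (C * J) * (?g \<xi>)" for t \<xi>
    proof -
      have i: "integrable lborel (\<lambda>\<tau>. \<psi> (\<tau>, \<xi>))" by (intro rapid_integrable rapid_slice schwartz_rapid s)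
      have "cmod (?f \<psi> \<xi> t) \<le> (LINT \<tau>|lborel. cmod (\<psi> (\<tau>, \<xi>)))" by (rule cmod_fourier_integral_le[OF i])
      also have "\<dots> \<le> (LINT \<tau>|lborel. C * (1 / (1 + \<tau>\<^sup>2)) * (?g \<xi>))"
        by (intro integral_mono integrable_norm i C integrable_mult_left integrable_mult_right integrable_inverse_one_plus_sq)
      also have "\<dots> = (C * J) * (?g \<xi>)"
        unfolding J_def by (simp only: integral_mult_left_zero integral_mult_right_zero)
      finally show ?thesis .
    qed
    then show ?thesis using C(1) J by (intro exI[of _ "C * J"]) auto
  qed
  obtain C0 where C0: "C0 \<ge> 0" "\<And>t \<xi>. cmod (?f \<psi> \<xi> t) \<le> C0 * (?g \<xi>)" using sl[OF \<psi>] by blast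
  obtain C2 where C2: "C2 \<ge> 0" "\<And>t \<xi>. cmod (fourier_integral (\<lambda>\<tau>. \<psi>2 (\<tau>, \<xi>)) t) \<le> C2 * (?g \<xi>)" using sl[OF s2] by blast
  have "cmod (?f \<psi> \<xi> t) \<le> (C0 + C2) * (1 / (1 + t\<^sup>2)) * (?g \<xi>)" for t \<xi>
  proof -
    define z where "z = cmod (?f \<psi> \<xi> t)"
    define k where "k = ?g \<xi>"
    have "t\<^sup>2 * z = cmod (fourier_integral (\<lambda>\<tau>. \<psi>2 (\<tau>, \<xi>)) t)"
      unfolding 2 1 z_def by (simp add: norm_mult power2_eq_square)
    then have "t\<^sup>2 * z \<le> C2 * k" using C2(2)[of \<xi> t] unfolding k_def by simp
    moreover have "z \<le> C0 * k" using C0(2)[of \<xi> t] unfolding k_def z_def by simp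
    ultimately have "(1 + t\<^sup>2) * z \<le> (C0 + C2) * k" by (simp add: algebra_simps)
    then have "z \<le> (C0 + C2) * k / (1 + t\<^sup>2)" by (simp add: pos_le_divide_eq add_pos_nonneg mult.commute)
    then show ?thesis unfolding z_def k_def by (simp add: mult_ac)
  qed
  then show ?thesis using C0(1) C2(1) that[of "C0 + C2"] by auto
qed

text \<open>Neither w nor W need be integrable on space-time: only their slices in x and in \<tau>
  are, with uniform bounds. Transforming the test function in time alone gives a mixed function A(t,
  \<xi>) with enough decay for Fubini; it meets w through the spatial transform and W through
  inversion in time. The point \<xi> = 0 is exempted because bipolar coordinates degenerate
  there.\<close>

theorem has_fourier_spacetime:
  fixes w W :: "real \<times> 'a::euclidean_space \<Rightarrow> complex"
  assumes wm[measurable]: "w \<in> borel_measurable borel" and Wm[measurable]: "W \<in> borel_measurable borel"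
    and w: "\<And>t. integrable lborel (\<lambda>x. w (t, x))" "\<And>t. (LINT x|lborel. cmod (w (t, x))) \<le> C1"
    and W: "\<And>\<xi>. \<xi> \<noteq> 0 \<Longrightarrow> integrable lborel (\<lambda>\<tau>. W (\<tau>, \<xi>))" "\<And>\<xi>. \<xi> \<noteq> 0 \<Longrightarrow> (LINT \<tau>|lborel. cmod (W (\<tau>, \<xi>))) \<le> C2"
    and eq: "\<And>t \<xi>. \<xi> \<noteq> 0 \<Longrightarrow> (LINT \<tau>|lborel. exp (\<i> * of_real (t * \<tau>)) * W (\<tau>, \<xi>)) = 2 * pi * fourier_integral (\<lambda>x. w (t, x)) \<xi>"
  shows "has_fourier w W"
proof -
  let ?D = "\<lambda>\<xi> \<psi>. LINT \<tau>|lborel. (2 * pi) * (W (\<tau>, \<xi>) * \<psi> (\<tau>, \<xi>))"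
  let ?g = "\<lambda>t \<tau>. exp (\<i> * of_real (t * \<tau>))"
  let ?f = "lborel \<Otimes>\<^sub>M lborel"
  let ?E = "borel_measurable ?f"
  let ?h = "\<lambda>t::real. 1 / (1 + t\<^sup>2)" and ?k = "\<lambda>\<xi>::'a. 1 / (1 + norm \<xi>) ^ (2 * DIM('a))"
  let ?G = "\<lambda>z. norm (W z /\<^sub>R (1 + norm z) ^ (2 * DIM('a))) \<le> norm (complex_of_real (?k (snd z)) * W z)"
  let ?B = "\<lambda>\<xi> \<tau>. case (\<xi>, \<tau>) of (\<xi>, \<tau>) \<Rightarrow> complex_of_real (?k \<xi>) * W (\<tau>, \<xi>)"
  let ?A = "\<lambda>t x. case (t, x) of (t, x) \<Rightarrow> complex_of_real (?h t) * w (t, x)"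
  have hi: "integrable lborel ?h" by (rule integrable_inverse_one_plus_sq)
  have ki: "integrable lborel ?k" by (rule integrable_inverse_poly)
  have n0: "AE \<xi> in (lborel :: 'a measure). \<xi> \<noteq> 0"
    by (rule AE_I[of _ _ "{0}"]) auto
  have [measurable]: "(\<lambda>(t, x). w (t, x)) \<in> ?E"
    "(\<lambda>(t, x). W (t, x)) \<in> ?E"
    using wm Wm by (simp_all only: measurable_pair_lborel)
  have C2: "C2 \<ge> 0"
  proof -
    obtain b :: 'a where "b \<in> Basis" using nonempty_Basis by blast
    then have "b \<noteq> 0" by auto
    from W(2)[OF this] show ?thesis by (rule order_trans[rotated]) simp
  qed
  have wi: "integrable ?f (\<lambda>(t, x). complex_of_real (?h t) * w (t, x))"
  proof (rule lborel_pair.Fubini_integrable)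
    show "integrable lborel (\<lambda>t. LINT x|lborel. norm (?A t x))"
    proof (rule Bochner_Integration.integrable_bound[OF integrable_mult_left[OF hi, of C1]])
      show "AE t in lborel. norm (LINT x|lborel. norm (?A t x)) \<le> norm (?h t * C1)"
      proof (rule AE_I2)
        fix t :: real
        have "0 \<le> (LINT x|lborel. cmod (w (t, x)))" by simp
        then have "(LINT x|lborel. cmod (w (t, x))) \<le> \<bar>C1\<bar>" using w(2)[of t] by linarith
        moreover have h0: "?h t \<ge> 0" by (auto intro!: divide_nonneg_nonneg)
        ultimately have "?h t * (LINT x|lborel. cmod (w (t, x))) \<le> ?h t * \<bar>C1\<bar>" by (intro mult_left_mono)
        then show "norm (LINT x|lborel. norm (?A t x)) \<le> norm (?h t * C1)"
          using h0 by (simp add: norm_mult abs_mult del: of_real_divide)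
      qed
    qed measurable
    show "AE t in lborel. integrable lborel (\<lambda>x. ?A t x)"
      using w(1) by (intro AE_I2) (auto intro!: integrable_mult_right)
  qed measurable
  have tw: "tempered_function w"
    unfolding tempered_function_def
  proof (intro conjI exI)
    have "integrable lborel (\<lambda>z. complex_of_real (?h (fst z)) * w z)" using wi by (simp add: lborel_prod case_prod_beta')
    then show "integrable lborel (\<lambda>z. w z /\<^sub>R (1 + norm z) ^ 2)"
    proof (rule Bochner_Integration.integrable_bound)
      show "AE z in lborel. norm (w z /\<^sub>R (1 + norm z) ^ 2) \<le> norm (complex_of_real (?h (fst z)) * w z)"
      proof (rule AE_I2)
        fix z :: "real \<times> 'a"
        have n: "norm (fst z) \<le> norm z" using norm_fst_le[of "fst z" "snd z"] by simp
        have "1 + (fst z)\<^sup>2 \<le> (1 + norm (fst z))\<^sup>2" by (simp add: power2_sum)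
        also have "\<dots> \<le> (1 + norm z)\<^sup>2" using n by (intro power_mono) auto
        finally have "inverse ((1 + norm z) ^ 2) \<le> inverse (1 + (fst z)\<^sup>2)"
          by (intro le_imp_inverse_le) (auto simp: add_pos_nonneg)
        then have "inverse ((1 + norm z) ^ 2) * cmod (w z) \<le> inverse (1 + (fst z)\<^sup>2) * cmod (w z)" by (rule mult_right_mono) simp
        moreover have "0 \<le> 1 / (1 + (fst z)\<^sup>2)" by (auto intro!: divide_nonneg_nonneg)
        ultimately show "norm (w z /\<^sub>R (1 + norm z) ^ 2) \<le> norm (complex_of_real (?h (fst z)) * w z)"
          by (simp add: norm_mult inverse_eq_divide del: of_real_divide)
      qed
    qed measurable
  qed simp
  have Wi: "integrable ?f (\<lambda>(\<xi>, \<tau>). complex_of_real (?k \<xi>) * W (\<tau>, \<xi>))"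
  proof (rule lborel_pair.Fubini_integrable)
    show "integrable lborel (\<lambda>\<xi>. LINT \<tau>|lborel. norm (?B \<xi> \<tau>))"
    proof (rule Bochner_Integration.integrable_bound[OF integrable_mult_left[OF ki, of C2]])
      show "AE \<xi> in lborel. norm (LINT \<tau>|lborel. norm (?B \<xi> \<tau>)) \<le> norm (?k \<xi> * C2)"
        using n0
      proof eventually_elim
        case (elim \<xi>)
        have k0: "?k \<xi> \<ge> 0" by simp
        then have "?k \<xi> * (LINT \<tau>|lborel. cmod (W (\<tau>, \<xi>))) \<le> ?k \<xi> * C2" by (intro mult_left_mono W elim)
        then show ?case using k0 C2 by (simp add: norm_mult abs_mult del: of_real_divide of_real_power)
      qed
    qed measurable
    show "AE \<xi> in lborel. integrable lborel (\<lambda>\<tau>. ?B \<xi> \<tau>)"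
      using n0 by eventually_elim (use W(1) in \<open>auto intro!: integrable_mult_right\<close>)
  qed measurable
  have tW: "tempered_function W"
    unfolding tempered_function_def
  proof (intro conjI exI)
    have "integrable ?f (\<lambda>(\<tau>, \<xi>). complex_of_real (?k \<xi>) * W (\<tau>, \<xi>))"
      using lborel_pair.integrable_product_swap[OF Wi] by (simp add: case_prod_beta')
    then have "integrable lborel (\<lambda>z. complex_of_real (?k (snd z)) * W z)" by (simp add: lborel_prod case_prod_beta')
    then show "integrable lborel (\<lambda>z. W z /\<^sub>R (1 + norm z) ^ (2 * DIM('a)))"
    proof (rule Bochner_Integration.integrable_bound)
      show "AE z in lborel. ?G z"
      proof (rule AE_I2)
        fix z :: "real \<times> 'a"
        have n: "norm (snd z) \<le> norm z" using norm_snd_le[of "snd z" "fst z"] by simp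
        have "0 < (1 + norm (snd z)) ^ (2 * DIM('a))" by (intro zero_less_power add_pos_nonneg) auto
        moreover have "(1 + norm (snd z)) ^ (2 * DIM('a)) \<le> (1 + norm z) ^ (2 * DIM('a))" using n by (intro power_mono) auto
        ultimately have "inverse ((1 + norm z) ^ (2 * DIM('a))) \<le> ?k (snd z)"
          unfolding inverse_eq_divide by (intro divide_left_mono mult_pos_pos) linarith+
        then have "inverse ((1 + norm z) ^ (2 * DIM('a))) * cmod (W z) \<le> ?k (snd z) * cmod (W z)" by (rule mult_right_mono) simp
        moreover have "0 \<le> inverse ((1 + norm z) ^ (2 * DIM('a)))" "0 \<le> ?k (snd z)" by simp_all
        ultimately show "?G z"
          by (simp only: norm_mult norm_scaleR norm_of_real abs_of_nonneg)
      qed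
    qed measurable
  qed simp
  have "(LINT z|lborel. w z * fourier_integral \<psi> z) = (LINT z|lborel. W z * \<psi> z)" if \<psi>: "schwartz \<psi>" for \<psi>
  proof -
    define A where "A t \<xi> = fourier_integral (\<lambda>\<tau>. \<psi> (\<tau>, \<xi>)) t" for t \<xi>
    note r = schwartz_rapid[OF \<psi>]
    note r' = schwartz_fourier_rapid[OF \<psi>]
    note [measurable] = rapid_measurable[OF r] rapid_measurable[OF r']
    have [measurable]: "(\<lambda>(\<tau>, \<xi>). \<psi> (\<tau>, \<xi>)) \<in> ?E"
      "(\<lambda>(\<tau>, \<xi>). fourier_integral \<psi> (\<tau>, \<xi>)) \<in> ?E"
      using rapid_measurable[OF r] rapid_measurable[OF r'] by (simp_all only: measurable_pair_lborel)
    have Am[measurable]: "(\<lambda>(t, \<xi>). A t \<xi>) \<in> ?E"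
      unfolding A_def fourier_integral_def by measurable
    obtain C where C: "C \<ge> 0" "\<And>t \<xi>. cmod (A t \<xi>) \<le> C * ?h t * ?k \<xi>"
      unfolding A_def using schwartz_partial_fourier_bound[OF \<psi>] by blast
    have Aix: "integrable lborel (A t)" for t
    proof (rule Bochner_Integration.integrable_bound[OF integrable_mult_right[OF ki, of "C * ?h t"]])
      show "AE \<xi> in lborel. norm (A t \<xi>) \<le> norm (C * ?h t * ?k \<xi>)"
        by (intro AE_I2 order_trans[OF C(2)]) (use C(1) in simp)
    qed measurable
    have Ait: "integrable lborel (\<lambda>t. A t \<xi>)" for \<xi>
    proof (rule Bochner_Integration.integrable_bound[OF integrable_mult_left[OF integrable_mult_right[OF hi, of C], of "?k \<xi>"]])
      show "AE t in lborel. norm (A t \<xi>) \<le> norm (C * ?h t * ?k \<xi>)"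
        by (intro AE_I2 order_trans[OF C(2)]) (use C(1) in simp)
    qed measurable
    have \<psi>i: "integrable ?f (\<lambda>(\<tau>, \<xi>). exp (- (\<i> * of_real ((\<tau>, \<xi>) \<bullet> (t, x)))) * \<psi> (\<tau>, \<xi>))" for t x
      using integrable_exp_i_mult[OF rapid_integrable[OF r], of "(t, x)"] unfolding lborel_prod case_prod_beta' prod.collapse .
    have FA: "fourier_integral \<psi> (t, x) = fourier_integral (A t) x" for t x
    proof -
      have "fourier_integral \<psi> (t, x) = (LINT z|?f. exp (- (\<i> * of_real (z \<bullet> (t, x)))) * \<psi> z)"
        unfolding fourier_integral_def by (simp add: lborel_prod)
      also have "\<dots> = (LINT \<xi>|lborel. LINT \<tau>|lborel. exp (- (\<i> * of_real ((\<tau>, \<xi>) \<bullet> (t, x)))) * \<psi> (\<tau>, \<xi>))"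
        by (rule lborel_pair.integral_snd[OF \<psi>i[of t x], symmetric, unfolded case_prod_beta' prod.collapse])
      also have "\<dots> = (LINT \<xi>|lborel. LINT \<tau>|lborel. exp (- (\<i> * of_real (\<xi> \<bullet> x))) * (exp (- (\<i> * of_real (\<tau> \<bullet> t))) * \<psi> (\<tau>, \<xi>)))"
        by (simp add: exp_add exp_diff exp_minus field_simps)
      also have "\<dots> = fourier_integral (A t) x" unfolding A_def fourier_integral_def by simp
      finally show ?thesis .
    qed
    have wp: "integrable ?f (\<lambda>(t, x). w (t, x) * fourier_integral \<psi> (t, x))"
      using tempered_rapid_integrable(1)[OF tw r'] by (simp add: lborel_prod case_prod_beta')
    have Wp: "integrable ?f (\<lambda>(\<tau>, \<xi>). W (\<tau>, \<xi>) * \<psi> (\<tau>, \<xi>))"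
      using tempered_rapid_integrable(1)[OF tW r] by (simp add: lborel_prod case_prod_beta')
    define B where "B t \<xi> = (LINT \<tau>|lborel. ?g t \<tau> * W (\<tau>, \<xi>))" for t \<xi>
    have Bm[measurable]: "(\<lambda>(t, \<xi>). B t \<xi>) \<in> ?E" unfolding B_def by measurable
    have Bb: "cmod (B t \<xi>) \<le> C2" if "\<xi> \<noteq> 0" for t \<xi>
      unfolding B_def by (rule order_trans[OF integral_norm_bound]) (use W(2)[OF that] in \<open>simp add: norm_mult\<close>)
    \<comment> \<open>A decays in both variables and B is bounded for \<xi> \<noteq> 0, so t and
      \<xi> can be interchanged although w itself does not decay in t.\<close>
    have ABi: "integrable ?f (\<lambda>(t, \<xi>). A t \<xi> * B t \<xi>)"
    proof -
      have kC: "integrable lborel (\<lambda>\<xi>. complex_of_real (?k \<xi>))" and hC: "integrable lborel (\<lambda>t. complex_of_real (?h t))"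
        by (intro integrable_of_real ki hi)+
      have "integrable ?f (\<lambda>(t, \<xi>). complex_of_real (C * C2) * complex_of_real (?h t) * complex_of_real (?k \<xi>))"
        by (rule integrable_pair_mult[OF hC kC, where B = "\<bar>C * C2\<bar>"]) (auto simp: norm_mult abs_mult)
      then show ?thesis
      proof (rule Bochner_Integration.integrable_bound)
        have ms: "{z \<in> space (lborel \<Otimes>\<^sub>M (lborel :: 'a measure)). snd z \<noteq> 0} \<in> sets ((lborel :: real measure) \<Otimes>\<^sub>M lborel)"
          by measurable
        have "AE z in (lborel :: real measure) \<Otimes>\<^sub>M (lborel :: 'a measure). snd z \<noteq> 0"
          by (rule lborel_pair.AE_pair_measure[OF ms]) (use n0 in simp)
        then show "AE z in lborel \<Otimes>\<^sub>M lborel. norm (case z of (t, \<xi>) \<Rightarrow> A t \<xi> * B t \<xi>) \<le> norm (case z of (t, \<xi>) \<Rightarrow> complex_of_real (C * C2) * complex_of_real (?h t) * complex_of_real (?k \<xi>))"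
        proof eventually_elim
          case (elim z)
          obtain t \<xi> where z: "z = (t, \<xi>)" by (cases z)
          have h0: "?h t \<ge> 0" by (auto intro!: divide_nonneg_nonneg)
          have k0: "?k \<xi> \<ge> 0" by simp
          have "cmod (A t \<xi>) * cmod (B t \<xi>) \<le> (C * ?h t * ?k \<xi>) * C2"
            using elim C2 C(1) h0 k0 by (intro mult_mono C Bb) (auto simp: z)
          then show ?case unfolding z using C(1) C2 h0 k0
            by (simp add: norm_mult mult_ac del: of_real_divide of_real_power)
        qed
      qed measurable
    qed
    have "(LINT z|lborel. w z * fourier_integral \<psi> z) = (LINT z|?f. (case z of (t, x) \<Rightarrow> w (t, x) * fourier_integral \<psi> (t, x)))"
      by (simp add: lborel_prod case_prod_beta')
    also have "\<dots> = (LINT t|lborel. LINT x|lborel. w (t, x) * fourier_integral \<psi> (t, x))"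
      by (rule lborel_pair.integral_fst[OF wp, symmetric])
    also have "\<dots> = (LINT t|lborel. LINT \<xi>|lborel. fourier_integral (\<lambda>x. w (t, x)) \<xi> * A t \<xi>)"
      unfolding FA by (intro Bochner_Integration.integral_cong refl fourier_multiplication_formula[symmetric] w(1) Aix)
    also have "\<dots> = (LINT t|lborel. LINT \<xi>|lborel. A t \<xi> * B t \<xi> / (2 * pi))"
    proof (rule Bochner_Integration.integral_cong, rule refl, rule integral_cong_AE)
      show "AE \<xi> in lborel. fourier_integral (\<lambda>x. w (t, x)) \<xi> * A t \<xi> = A t \<xi> * B t \<xi> / (2 * pi)" for t
        using n0 by eventually_elim (use eq in \<open>simp add: B_def\<close>)
    qed measurable
    also have "\<dots> = (LINT t|lborel. LINT \<xi>|lborel. A t \<xi> * B t \<xi>) / (2 * pi)" by simp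
    also have "(LINT t|lborel. LINT \<xi>|lborel. A t \<xi> * B t \<xi>) = (LINT \<xi>|lborel. LINT t|lborel. A t \<xi> * B t \<xi>)"
      using lborel_pair.Fubini_integral[OF ABi] by simp
    also have "\<dots> = (LINT \<xi>|lborel. ?D \<xi> \<psi>)"
    proof (intro integral_cong_AE)
      show "AE \<xi> in lborel. (LINT t|lborel. A t \<xi> * B t \<xi>) = (?D \<xi> \<psi>)"
        using n0
      proof eventually_elim
        case (elim \<xi>)
        have i: "integrable ?f (\<lambda>(t, \<tau>). ?g t \<tau> * A t \<xi> * W (\<tau>, \<xi>))"
          by (rule integrable_pair_mult[OF Ait W(1)[OF elim], where B = 1]) auto
        have "(LINT t|lborel. A t \<xi> * B t \<xi>) = (LINT t|lborel. LINT \<tau>|lborel. ?g t \<tau> * A t \<xi> * W (\<tau>, \<xi>))"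
          unfolding B_def by (subst integral_mult_right_zero[symmetric]) (simp add: mult_ac)
        also have "\<dots> = (LINT \<tau>|lborel. LINT t|lborel. ?g t \<tau> * A t \<xi> * W (\<tau>, \<xi>))"
          using lborel_pair.Fubini_integral[OF i] by simp
        also have "\<dots> = (?D \<xi> \<psi>)"
        proof (intro Bochner_Integration.integral_cong refl)
          fix \<tau>
          obtain K where K: "\<And>x. cmod (\<psi> x) \<le> K" using rapid_bounded[OF r] by blast
          have ct: "continuous_on UNIV (\<lambda>\<tau>. \<psi> (\<tau>, \<xi>))"
            by (rule continuous_on_compose2[OF schwartz_continuous[OF \<psi>]]) (auto intro!: continuous_intros)
          have "(LINT t|lborel. fourier_integral (\<lambda>\<tau>. \<psi> (\<tau>, \<xi>)) t * exp (\<i> * of_real (t \<bullet> \<tau>))) = (2 * pi) ^ DIM(real) * \<psi> (\<tau>, \<xi>)"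
            by (rule fourier_inversion[OF _ K])
               (use ct Ait[of \<xi>] in \<open>auto intro!: rapid_integrable rapid_slice r simp: continuous_on_eq_continuous_at A_def\<close>)
          then have e: "(LINT t|lborel. ?g t \<tau> * A t \<xi>) = 2 * pi * \<psi> (\<tau>, \<xi>)" by (simp add: A_def mult.commute)
          have "(LINT t|lborel. ?g t \<tau> * A t \<xi> * W (\<tau>, \<xi>)) = (LINT t|lborel. ?g t \<tau> * A t \<xi>) * W (\<tau>, \<xi>)"
            by simp
          also have "\<dots> = (2 * pi) * (W (\<tau>, \<xi>) * \<psi> (\<tau>, \<xi>))"
            unfolding e by (simp only: mult_ac)
          finally show "(LINT t|lborel. ?g t \<tau> * A t \<xi> * W (\<tau>, \<xi>)) = (2 * pi) * (W (\<tau>, \<xi>) * \<psi> (\<tau>, \<xi>))" .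
        qed
        finally show ?case .
      qed
    qed measurable
    also have "\<dots> / (2 * pi) = (LINT \<xi>|lborel. LINT \<tau>|lborel. W (\<tau>, \<xi>) * \<psi> (\<tau>, \<xi>))" by simp
    also have "\<dots> = (LINT z|?f. (case z of (\<tau>, \<xi>) \<Rightarrow> W (\<tau>, \<xi>) * \<psi> (\<tau>, \<xi>)))"
      by (rule lborel_pair.integral_snd[OF Wp])
    also have "\<dots> = (LINT z|lborel. W z * \<psi> z)" by (simp add: lborel_prod case_prod_beta')
    finally show ?thesis .
  qed
  with tw tW show ?thesis unfolding has_fourier_def by blast
qed

section \<open>Products of two propagated functions\<close>

lemma L2_translate:
  fixes f :: "'a::euclidean_space \<Rightarrow> complex"
  assumes f: "f \<in> L2" shows "(\<lambda>x. f (x - t)) \<in> L2" "L2_norm (\<lambda>x. f (x - t)) = L2_norm f"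
proof -
  note [measurable] = L2_measurable[OF f]
  have n: "sqnorm lborel (\<lambda>x. f (x - t)) = sqnorm lborel f"
    using nn_integral_lborel_translate[of "\<lambda>x. ennreal ((cmod (f x))\<^sup>2)" "- t"] by simp
  then show l: "(\<lambda>x. f (x - t)) \<in> L2" using f unfolding L2_iff by simp
  have "0 \<le> L2_norm f" "0 \<le> L2_norm (\<lambda>x. f (x - t))" by (simp_all add: L2_norm_def)
  then show "L2_norm (\<lambda>x. f (x - t)) = L2_norm f"
    using n unfolding sqnorm_eq_L2_norm[OF f] sqnorm_eq_L2_norm[OF l] by simp
qed

lemma L2_norm_nonneg: "L2_norm f \<ge> 0"
  by (simp add: L2_norm_def)

lemma L2_mult_bound:
  assumes f: "f \<in> L2" and g: "g \<in> L2"
  shows "(LINT x|lborel. cmod (f x * g x)) \<le> (L2_norm f)\<^sup>2 + (L2_norm g)\<^sup>2"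
proof -
  let ?f = "\<lambda>x. (cmod (f x))\<^sup>2 + (cmod (g x))\<^sup>2"
  have e: "(L2_norm h)\<^sup>2 = (LINT x|lborel. (cmod (h x))\<^sup>2)" for h :: "'a \<Rightarrow> complex"
    by (simp add: L2_norm_def)
  have i: "integrable lborel (\<lambda>x. (cmod (f x))\<^sup>2)" "integrable lborel (\<lambda>x. (cmod (g x))\<^sup>2)"
    using f g by (auto simp: L2_def)
  have "(LINT x|lborel. cmod (f x * g x)) \<le> (LINT x|lborel. ?f x)"
  proof (rule integral_mono)
    show "integrable lborel (\<lambda>x. cmod (f x * g x))" using L2_mult_integrable[OF f g] by (rule integrable_norm)
    show "integrable lborel (\<lambda>x. ?f x)" using i by (rule Bochner_Integration.integrable_add)
    show "cmod (f x * g x) \<le> ?f x" for x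
    proof -
      have "2 * (cmod (f x) * cmod (g x)) \<le> ?f x"
        using sum_squares_bound[of "cmod (f x)" "cmod (g x)"] by (simp add: mult.assoc)
      moreover have "0 \<le> cmod (f x) * cmod (g x)" by simp
      ultimately show ?thesis unfolding norm_mult by linarith
    qed
  qed
  then show ?thesis using i by (simp add: e)
qed

text \<open>Exact at every \<eta>: the cut radii depend on the modulus alone, which modulation does
  not change.\<close>

lemma L2_fourier_modulate:
  fixes v :: "'a::euclidean_space \<Rightarrow> complex"
  shows "L2_fourier (\<lambda>x. exp (\<i> * of_real (x \<bullet> \<xi>)) * v x) \<eta> = L2_fourier v (\<eta> - \<xi>)"
proof -
  have c: "L2_cut (\<lambda>x. exp (\<i> * of_real (x \<bullet> \<xi>)) * v x) = L2_cut v"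
    by (rule L2_cut_cong) (simp add: norm_mult)
  have "fourier_integral (trunc (\<lambda>x. exp (\<i> * of_real (x \<bullet> \<xi>)) * v x) j) \<eta> = fourier_integral (trunc v j) (\<eta> - \<xi>)" for j
    unfolding fourier_integral_def trunc_def c
    by (intro Bochner_Integration.integral_cong refl) (simp add: inner_diff_right right_diff_distrib exp_diff exp_minus field_simps)
  then show ?thesis unfolding L2_fourier_def by simp
qed

text \<open>Parseval with v modulated by \<xi>, whose transform is that of v translated by \<xi>:
  the transform of a product with a conjugate is a correlation.\<close>

lemma has_fourier_product:
  fixes u v :: "'a::euclidean_space \<Rightarrow> complex"
  assumes u: "has_fourier u A" "A \<in> L2" and v: "has_fourier v B" "B \<in> L2" and uv: "u \<in> L2" "v \<in> L2"
  shows "complex_of_real ((2 * pi) ^ DIM('a)) * fourier_integral (\<lambda>x. u x * cnj (v x)) \<xi> = (LINT \<eta>|lborel. A \<eta> * cnj (B (\<eta> - \<xi>)))"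
proof -
  let ?f = "borel_measurable borel"
  let ?v = "\<lambda>x. exp (\<i> * of_real (x \<bullet> \<xi>)) * v x"
  have [measurable]: "u \<in> ?f" "v \<in> ?f" "A \<in> ?f" "B \<in> ?f"
    using u v uv by (auto dest: L2_measurable)
  have [measurable]: "L2_fourier u \<in> ?f" "L2_fourier v \<in> ?f"
    using uv by (auto intro: L2_measurable L2_fourier_L2)
  have m: "?v \<in> L2" by (rule L2_bounded_by[where B = 1 and f = v]) (use uv in \<open>auto simp: norm_mult\<close>)
  have A: "AE x in lborel. A x = L2_fourier u x" and B: "AE x in lborel. B x = L2_fourier v x"
    using has_fourier_L2_right[OF u(1) uv(1)] has_fourier_L2_right[OF v(1) uv(2)] by auto
  have "AE x in distr lborel borel ((+) (- \<xi>)). B x = L2_fourier v x" unfolding lborel_distr_plus by (rule B)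
  then have B': "AE x in lborel. B (x - \<xi>) = L2_fourier v (x - \<xi>)" by (subst (asm) AE_distr_iff) auto
  have "fourier_integral (\<lambda>x. u x * cnj (v x)) \<xi> = (LINT x|lborel. u x * cnj (?v x))"
    unfolding fourier_integral_def by (intro Bochner_Integration.integral_cong refl) (simp add: exp_cnj mult_ac)
  then have "complex_of_real ((2 * pi) ^ DIM('a)) * fourier_integral (\<lambda>x. u x * cnj (v x)) \<xi> = (LINT \<eta>|lborel. L2_fourier u \<eta> * cnj (L2_fourier ?v \<eta>))"
    using parseval[OF uv(1) m] by simp
  also have "\<dots> = (LINT \<eta>|lborel. A \<eta> * cnj (B (\<eta> - \<xi>)))"
    unfolding L2_fourier_modulate by (rule integral_cong_AE) (measurable, use A B' in eventually_elim, simp)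
  finally show ?thesis .
qed

abbreviation evolve :: "real \<Rightarrow> real \<Rightarrow> ('a::euclidean_space \<Rightarrow> complex) \<Rightarrow> 'a \<Rightarrow> complex" where
  "evolve s t F \<equiv> (\<lambda>\<xi>. exp (\<i> * of_real (t * phi s (norm \<xi>))) * F \<xi>)"

lemma evolve_L2:
  fixes F :: "'a::euclidean_space \<Rightarrow> complex"
  assumes F: "F \<in> L2" shows "evolve s t F \<in> L2" "L2_norm (evolve s t F) = L2_norm F"
proof -
  note [measurable] = L2_measurable[OF F]
  show "evolve s t F \<in> L2" by (rule L2_bounded_by[where B = 1 and f = F]) (auto simp: norm_mult F)
  show "L2_norm (evolve s t F) = L2_norm F" by (simp add: L2_norm_def norm_mult)
qed

text \<open>The choice in \<open>kg_propagator\<close> is meaningful once one jointly measurable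
  solution exists. The cut radii of \<open>evolve s t F\<close> are the same for all t, so its
  inverse transform is a limit of parameter integrals and hence measurable in (t, x).\<close>

lemma kg_propagation_exists:
  fixes F :: "'a::euclidean_space \<Rightarrow> complex"
  assumes f: "has_fourier f F" and F: "F \<in> L2"
  shows "is_kg_propagation s f (kg_propagator s f)"
proof -
  note [measurable] = L2_measurable[OF F]
  define u where "u z = inv_fourier (evolve s (fst z) F) (snd z)" for z :: "real \<times> 'a"
  have c: "L2_cut (evolve s t F) = L2_cut F" for t by (rule L2_cut_cong) (simp add: norm_mult)
  have [measurable]: "(\<lambda>z::real \<times> 'a. fst z) \<in> borel_measurable borel" "(\<lambda>z::real \<times> 'a. snd z) \<in> borel_measurable borel"
    by (intro borel_measurable_continuous_onI continuous_intros)+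
  have "(\<lambda>z. L2_fourier (evolve s (fst z) F) (- snd z)) \<in> borel_measurable borel"
    unfolding L2_fourier_def fourier_integral_def trunc_def c by measurable
  then have [measurable]: "u \<in> borel_measurable borel" unfolding u_def inv_fourier_def by measurable
  have "is_kg_propagation s f u"
    unfolding is_kg_propagation_def is_multiplier_def u_def
    using f has_fourier_inv_fourier[OF evolve_L2(1)[OF F]] \<open>u \<in> _\<close>[unfolded u_def[abs_def]] by auto
  then show ?thesis unfolding kg_propagator_def by (rule someI[of "is_kg_propagation s f"])
qed

text \<open>Holds for whichever solution was chosen: the transform hidden in the definition agrees
  with F almost everywhere by uniqueness, and each slice is then determined up to a null
  set.\<close>

lemma kg_propagator_slice:
  fixes F :: "'a::euclidean_space \<Rightarrow> complex" and s t :: real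
  assumes f: "has_fourier f F" and F: "F \<in> L2"
  defines "u \<equiv> kg_propagator s f"
  shows "u \<in> borel_measurable borel" "has_fourier (\<lambda>x. u (t, x)) (evolve s t F)" "(\<lambda>x. u (t, x)) \<in> L2"
    "(L2_norm (\<lambda>x. u (t, x)))\<^sup>2 \<le> (L2_norm F)\<^sup>2 / (2 * pi) ^ DIM('a)"
proof -
  let ?f = "\<lambda>x. u (t, x)"
  note [measurable] = L2_measurable[OF F]
  note k = kg_propagation_exists[OF f F, of s, folded u_def]
  show [measurable]: "u \<in> borel_measurable borel" using k by (simp add: is_kg_propagation_def)
  have [measurable]: "(\<lambda>x. (t, x)) \<in> borel_measurable (borel :: 'a measure)"
    by (intro borel_measurable_continuous_onI continuous_intros)
  obtain F' where F': "has_fourier f F'" "has_fourier ?f (evolve s t F')"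
    using k unfolding is_kg_propagation_def is_multiplier_def by blast
  show h: "has_fourier ?f (evolve s t F)"
    by (rule has_fourier_AE_cong[OF F'(2)]) (use has_fourier_unique_right[OF F'(1) f] in auto)
  have ae: "AE x in lborel. u (t, x) = inv_fourier (evolve s t F) x"
    by (rule has_fourier_L2_left[OF h evolve_L2(1)[OF F]])
  have i: "inv_fourier (evolve s t F) \<in> L2" by (intro inv_fourier_L2 evolve_L2 F)
  show l: "?f \<in> L2"
    by (rule L2_bounded_by[OF i, where B = 1]) (use ae in auto)
  have "sqnorm lborel ?f \<le> ennreal (1 / (2 * pi) ^ DIM('a)) * sqnorm lborel (evolve s t F)"
    unfolding sqnorm_cong_AE[OF ae] by (rule inv_fourier_bound[OF evolve_L2(1)[OF F]])
  then show "(L2_norm ?f)\<^sup>2 \<le> (L2_norm F)\<^sup>2 / (2 * pi) ^ DIM('a)"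
    unfolding sqnorm_eq_L2_norm[OF l] sqnorm_eq_L2_norm[OF evolve_L2(1)[OF F]] evolve_L2(2)[OF F]
    by (simp flip: ennreal_mult)
qed

definition bipolar_weight :: "real \<Rightarrow> real \<Rightarrow> real \<Rightarrow> real \<Rightarrow> real \<Rightarrow> real" where
  "bipolar_weight n s \<rho> E E' = 4 * half_sphere (n - 1) * (2 * \<rho>) powr (2 - n) * E * E' * qw ((n - 3) / 2) s E E' \<rho>"

lemma bipolar_weight_nonneg: "n > 1 \<Longrightarrow> bipolar_weight n s \<rho> E E' \<ge> 0"
  using half_sphere_pos[of "n - 1"] by (auto simp: bipolar_weight_def qw_def)

lemma bipolar_weight_measurable [measurable]:
  assumes [measurable]: "f \<in> borel_measurable M" "g \<in> borel_measurable M" "h \<in> borel_measurable M"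
  shows "(\<lambda>x. bipolar_weight n s (h x) (f x) (g x)) \<in> borel_measurable M"
  unfolding bipolar_weight_def by measurable

text \<open>\<open>nn_integral_bipolar\<close> as an equality of measures, with the second energy
  replaced by the difference \<tau>. In this form it also transports complex integrands.\<close>

lemma distr_bipolar:
  fixes \<xi> :: "'a::euclidean_space"
  assumes \<xi>: "\<xi> \<noteq> 0" and d: "DIM('a) \<ge> 2"
  shows "distr lborel (lborel \<Otimes>\<^sub>M lborel) (\<lambda>x. (phi s (norm x) - phi s (norm (x - \<xi>)), phi s (norm x))) =
    density (lborel \<Otimes>\<^sub>M lborel) (\<lambda>(\<tau>, E). ennreal (bipolar_weight (real DIM('a)) s (norm \<xi>) E (E - \<tau>)))"
    (is "distr _ _ ?T = density _ ?k")
proof (rule measure_eqI)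
  let ?f = "lborel \<Otimes>\<^sub>M lborel"
  let ?w = "bipolar_weight (real DIM('a)) s (norm \<xi>)"
  have [measurable]: "?T \<in> borel_measurable borel" "?T \<in> lborel \<rightarrow>\<^sub>M ?f" by measurable
  fix A assume "A \<in> sets (distr lborel ?f ?T)"
  then have [measurable]: "A \<in> sets (borel \<Otimes>\<^sub>M borel)"
    unfolding borel_prod lborel_prod by simp
  have "emeasure (distr lborel ?f ?T) A = (\<integral>\<^sup>+z. indicator A z \<partial>distr lborel ?f ?T)"
    by simp
  also have "\<dots> = (\<integral>\<^sup>+x. indicator A (phi s (norm x) - phi s (norm (x - \<xi>)), phi s (norm x)) \<partial>lborel)"
    by (rule nn_integral_distr) measurable
  also have "\<dots> = (\<integral>\<^sup>+E. \<integral>\<^sup>+E'. indicator A (E - E', E) * ennreal (?w E E') \<partial>lborel \<partial>lborel)"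
    unfolding bipolar_weight_def
    by (rule nn_integral_bipolar[where H = "\<lambda>E E'. indicator A (E - E', E)"]) (use \<xi> d in measurable)
  also have "\<dots> = (\<integral>\<^sup>+E. \<integral>\<^sup>+\<tau>. indicator A (\<tau>, E) * ennreal (?w E (E - \<tau>)) \<partial>lborel \<partial>lborel)"
  proof (rule nn_integral_cong)
    fix E :: real
    have "(\<integral>\<^sup>+E'. indicator A (E - E', E) * ennreal (?w E E') \<partial>lborel) = (\<integral>\<^sup>+\<tau>. indicator A (E - (- \<tau>), E) * ennreal (?w E (- \<tau>)) \<partial>lborel)"
      by (rule nn_integral_lborel_reflect[symmetric]) measurable
    also have "\<dots> = (\<integral>\<^sup>+\<tau>. indicator A (E - (- (\<tau> + (- E))), E) * ennreal (?w E (- (\<tau> + (- E)))) \<partial>lborel)"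
      by (rule nn_integral_lborel_translate[symmetric]) measurable
    finally show "(\<integral>\<^sup>+E'. indicator A (E - E', E) * ennreal (?w E E') \<partial>lborel) = (\<integral>\<^sup>+\<tau>. indicator A (\<tau>, E) * ennreal (?w E (E - \<tau>)) \<partial>lborel)"
      by simp
  qed
  also have "\<dots> = (\<integral>\<^sup>+\<tau>. \<integral>\<^sup>+E. indicator A (\<tau>, E) * ennreal (?w E (E - \<tau>)) \<partial>lborel \<partial>lborel)"
    by (rule lborel_pair.Fubini'[of "\<lambda>\<tau> E. indicator A (\<tau>, E) * ennreal (?w E (E - \<tau>))"]) measurable
  also have "\<dots> = (\<integral>\<^sup>+z. ?k z * indicator A z \<partial>?f)"
    by (subst lborel.nn_integral_fst[symmetric]) (measurable, simp add: mult.commute)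
  also have "\<dots> = emeasure (density ?f ?k) A"
    by (rule emeasure_density[symmetric]) measurable
  finally show "emeasure (distr lborel ?f ?T) A = emeasure (density ?f ?k) A" .
qed simp

lemma integral_bipolar:
  fixes \<xi> :: "'a::euclidean_space" and H :: "real \<times> real \<Rightarrow> 'b::{banach, second_countable_topology}"
  assumes \<xi>: "\<xi> \<noteq> 0" and d: "DIM('a) \<ge> 2" and [measurable]: "H \<in> borel_measurable borel"
    and i: "integrable lborel (\<lambda>x. H (phi s (norm x) - phi s (norm (x - \<xi>)), phi s (norm x)))"
  defines "k \<equiv> (\<lambda>\<tau> E. bipolar_weight (real DIM('a)) s (norm \<xi>) E (E - \<tau>))"
  shows "integrable (lborel \<Otimes>\<^sub>M lborel) (\<lambda>(\<tau>, E). k \<tau> E *\<^sub>R H (\<tau>, E))"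
    "(LINT x|lborel. H (phi s (norm x) - phi s (norm (x - \<xi>)), phi s (norm x))) = (LINT z|(lborel \<Otimes>\<^sub>M lborel). (case z of (\<tau>, E) \<Rightarrow> k \<tau> E *\<^sub>R H (\<tau>, E)))"
proof -
  let ?f = "lborel \<Otimes>\<^sub>M lborel"
  let ?T = "\<lambda>x. (phi s (norm x) - phi s (norm (x - \<xi>)), phi s (norm x))"
  have [measurable]: "?T \<in> lborel \<rightarrow>\<^sub>M ?f" by measurable
  have Hm: "H \<in> borel_measurable ?f" unfolding lborel_prod by simp
  have km: "(\<lambda>z. k (fst z) (snd z)) \<in> borel_measurable ?f" unfolding k_def by measurable
  have k0: "AE z in lborel \<Otimes>\<^sub>M lborel. 0 \<le> k (fst z) (snd z)"
    unfolding k_def using d by (intro AE_I2 bipolar_weight_nonneg) simp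
  have D: "distr lborel ?f ?T = density ?f (\<lambda>z. ennreal (k (fst z) (snd z)))"
    using distr_bipolar[OF \<xi> d, of s] by (simp add: k_def case_prod_beta')
  have "integrable (distr lborel ?f ?T) H"
    by (subst integrable_distr_eq) (use i Hm in simp_all)
  then show "integrable ?f (\<lambda>(\<tau>, E). k \<tau> E *\<^sub>R H (\<tau>, E))"
    unfolding D using integrable_density[OF Hm km k0] by (simp add: case_prod_beta')
  have "(LINT x|lborel. H (?T x)) = integral\<^sup>L (distr lborel ?f ?T) H"
    by (rule integral_distr[symmetric]) (use Hm in simp_all)
  then show "(LINT x|lborel. H (?T x)) = (LINT z|?f. (case z of (\<tau>, E) \<Rightarrow> k \<tau> E *\<^sub>R H (\<tau>, E)))"
    unfolding D using integral_density[OF Hm km k0] by (simp add: case_prod_beta')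
qed

text \<open>Up to a constant, the space-time transform of the product of one solution with the
  conjugate of another, for radial profiles F and G; \<tau> is the difference of their
  energies.\<close>

definition spectral_density :: "real \<Rightarrow> (real \<Rightarrow> complex) \<Rightarrow> (real \<Rightarrow> complex) \<Rightarrow> real \<times> 'a::euclidean_space \<Rightarrow> complex" where
  "spectral_density s F G z = (LINT E|lborel. bipolar_weight (real DIM('a)) s (norm (snd z)) E (E - fst z) *\<^sub>R (F E * cnj (G (E - fst z))))"

lemma spectral_density_measurable [measurable]:
  assumes [measurable]: "F \<in> borel_measurable borel" "G \<in> borel_measurable borel"
  shows "spectral_density s F G \<in> borel_measurable borel"
proof -
  have [measurable]: "(\<lambda>z::real \<times> 'a. fst z) \<in> borel_measurable borel" "(\<lambda>z::real \<times> 'a. snd z) \<in> borel_measurable borel"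
    by (intro borel_measurable_continuous_onI continuous_intros)+
  show ?thesis unfolding spectral_density_def[abs_def] by measurable
qed

context
  fixes F G :: "real \<Rightarrow> complex" and s :: real and \<xi> :: "'a::euclidean_space"
  assumes Fm[measurable]: "F \<in> borel_measurable borel" and Gm[measurable]: "G \<in> borel_measurable borel"
    and F2: "(\<lambda>\<eta>::'a. F (phi s (norm \<eta>))) \<in> L2" and G2: "(\<lambda>\<eta>::'a. G (phi s (norm \<eta>))) \<in> L2"
    and \<xi>: "\<xi> \<noteq> 0" and d: "DIM('a) \<ge> 2"
begin

lemma spectral_integrable:
  fixes t :: real
  defines "H \<equiv> (\<lambda>z. exp (\<i> * of_real (t * fst z)) * (F (snd z) * cnj (G (snd z - fst z))))"
  shows "integrable lborel (\<lambda>x. F (phi s (norm x)) * cnj (G (phi s (norm (x - \<xi>)))))"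
    "integrable lborel (\<lambda>x. H (phi s (norm x) - phi s (norm (x - \<xi>)), phi s (norm x)))"
    "integrable (lborel \<Otimes>\<^sub>M lborel) (\<lambda>(\<tau>, E). bipolar_weight (real DIM('a)) s (norm \<xi>) E (E - \<tau>) *\<^sub>R H (\<tau>, E))"
proof -
  note [measurable] = L2_measurable[OF F2] L2_measurable[OF G2]
  have "(\<lambda>x. G (phi s (norm (x - \<xi>)))) \<in> L2" by (rule L2_translate(1)[OF G2])
  from L2_mult_integrable[OF F2 L2_cnj[OF this]]
  show i0: "integrable lborel (\<lambda>x. F (phi s (norm x)) * cnj (G (phi s (norm (x - \<xi>)))))" .
  show i: "integrable lborel (\<lambda>x. H (phi s (norm x) - phi s (norm (x - \<xi>)), phi s (norm x)))"
    by (rule Bochner_Integration.integrable_bound[OF i0]) (auto simp: H_def norm_mult)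
  have Hm: "H \<in> borel_measurable borel"
    unfolding H_def borel_prod[symmetric] by measurable
  show "integrable (lborel \<Otimes>\<^sub>M lborel) (\<lambda>(\<tau>, E). bipolar_weight (real DIM('a)) s (norm \<xi>) E (E - \<tau>) *\<^sub>R H (\<tau>, E))"
    by (rule integral_bipolar(1)[OF \<xi> d Hm i])
qed

lemma spectral_pair_integrable:
  "integrable (lborel \<Otimes>\<^sub>M lborel) (\<lambda>(\<tau>, E). bipolar_weight (real DIM('a)) s (norm \<xi>) E (E - \<tau>) *\<^sub>R (F E * cnj (G (E - \<tau>))))"
  using spectral_integrable(3)[of 0] by simp

lemma spectral_density_integrable: "integrable lborel (\<lambda>\<tau>. spectral_density s F G (\<tau>, \<xi>))"
  using lborel_pair.integrable_fst[OF spectral_pair_integrable] by (simp add: spectral_density_def)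

lemma spectral_density_bound:
  "(LINT \<tau>|lborel. cmod (spectral_density s F G (\<tau>, \<xi>))) \<le> (L2_norm (\<lambda>\<eta>::'a. F (phi s (norm \<eta>))))\<^sup>2 + (L2_norm (\<lambda>\<eta>::'a. G (phi s (norm \<eta>))))\<^sup>2"
proof -
  note l = L2_translate[OF G2, of \<xi>]
  let ?k = "\<lambda>\<tau> E. bipolar_weight (real DIM('a)) s (norm \<xi>) E (E - \<tau>)"
  define H where "H = (\<lambda>z. cmod (F (snd z) * cnj (G (snd z - fst z))))"
  have Hm: "H \<in> borel_measurable borel"
    unfolding H_def borel_prod[symmetric] by measurable
  have i: "integrable lborel (\<lambda>x. H (phi s (norm x) - phi s (norm (x - \<xi>)), phi s (norm x)))"
    using spectral_integrable(1)[THEN integrable_norm] by (simp add: H_def)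
  note b = integral_bipolar[OF \<xi> d Hm i]
  have k0: "?k \<tau> E \<ge> 0" for \<tau> E using d by (intro bipolar_weight_nonneg) simp
  have "(LINT \<tau>|lborel. cmod (spectral_density s F G (\<tau>, \<xi>))) \<le> (LINT \<tau>|lborel. LINT E|lborel. ?k \<tau> E *\<^sub>R H (\<tau>, E))"
  proof (rule integral_mono)
    show "integrable lborel (\<lambda>\<tau>. cmod (spectral_density s F G (\<tau>, \<xi>)))" by (rule integrable_norm[OF spectral_density_integrable])
    show "integrable lborel (\<lambda>\<tau>. LINT E|lborel. ?k \<tau> E *\<^sub>R H (\<tau>, E))"
      by (rule lborel_pair.integrable_fst[OF b(1)])
    show "cmod (spectral_density s F G (\<tau>, \<xi>)) \<le> (LINT E|lborel. ?k \<tau> E *\<^sub>R H (\<tau>, E))" for \<tau>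
      using integral_norm_bound[of lborel "\<lambda>E. ?k \<tau> E *\<^sub>R (F E * cnj (G (E - \<tau>)))"] k0
      by (simp add: spectral_density_def H_def)
  qed
  also have "\<dots> = (LINT x|lborel. H (phi s (norm x) - phi s (norm (x - \<xi>)), phi s (norm x)))"
    unfolding b(2) by (rule lborel_pair.integral_fst[OF b(1)])
  also have "\<dots> = (LINT x|lborel. cmod (F (phi s (norm x)) * G (phi s (norm (x - \<xi>)))))"
    by (simp add: H_def norm_mult)
  also have "\<dots> \<le> (L2_norm (\<lambda>\<eta>::'a. F (phi s (norm \<eta>))))\<^sup>2 + (L2_norm (\<lambda>\<eta>::'a. G (phi s (norm \<eta>))))\<^sup>2"
    using L2_mult_bound[OF F2 l(1)] unfolding l(2) .
  finally show ?thesis .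
qed

text \<open>Integrating out \<tau> undoes the change of variables: the phase of the energy
  difference splits into the phases of the two propagators.\<close>

lemma spectral_density_fourier:
  "(LINT \<tau>|lborel. exp (\<i> * of_real (t * \<tau>)) * spectral_density s F G (\<tau>, \<xi>)) =
   (LINT \<eta>|lborel. exp (\<i> * of_real (t * phi s (norm \<eta>))) * F (phi s (norm \<eta>)) * cnj (exp (\<i> * of_real (t * phi s (norm (\<eta> - \<xi>)))) * G (phi s (norm (\<eta> - \<xi>)))))"
proof -
  define H where "H = (\<lambda>z. exp (\<i> * of_real (t * fst z)) * (F (snd z) * cnj (G (snd z - fst z))))"
  have Hm: "H \<in> borel_measurable borel"
    unfolding H_def borel_prod[symmetric] by measurable
  have i2: "integrable lborel (\<lambda>x. H (phi s (norm x) - phi s (norm (x - \<xi>)), phi s (norm x)))"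
    using spectral_integrable(2)[of t] by (simp add: H_def)
  have i3: "integrable (lborel \<Otimes>\<^sub>M lborel) (\<lambda>(\<tau>, E). bipolar_weight (real DIM('a)) s (norm \<xi>) E (E - \<tau>) *\<^sub>R H (\<tau>, E))"
    using spectral_integrable(3)[of t] by (simp add: H_def)
  have e: "exp (\<i> * of_real (t * a)) * x * cnj (exp (\<i> * of_real (t * b)) * y) = exp (\<i> * of_real (t * (a - b))) * (x * cnj y)" for a b x y
    by (simp add: exp_cnj right_diff_distrib exp_diff exp_minus field_simps)
  have "(LINT \<tau>|lborel. exp (\<i> * of_real (t * \<tau>)) * spectral_density s F G (\<tau>, \<xi>)) =
    (LINT \<tau>|lborel. LINT E|lborel. bipolar_weight (real DIM('a)) s (norm \<xi>) E (E - \<tau>) *\<^sub>R H (\<tau>, E))"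
    unfolding spectral_density_def H_def
    by (intro Bochner_Integration.integral_cong refl, subst integral_mult_right_zero[symmetric])
       (simp add: algebra_simps)
  also have "\<dots> = (LINT z|(lborel \<Otimes>\<^sub>M lborel). (case z of (\<tau>, E) \<Rightarrow> bipolar_weight (real DIM('a)) s (norm \<xi>) E (E - \<tau>) *\<^sub>R H (\<tau>, E)))"
    by (rule lborel_pair.integral_fst[OF i3])
  also have "\<dots> = (LINT x|lborel. H (phi s (norm x) - phi s (norm (x - \<xi>)), phi s (norm x)))"
    by (rule integral_bipolar(2)[OF \<xi> d Hm i2, symmetric])
  finally show ?thesis unfolding e by (simp add: H_def)
qed

end

text \<open>The constant is the 2 pi of inversion in time divided by the power
  \<open>(2 * pi) ^ DIM('a)\<close> of Parseval in space.\<close>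

theorem kg_product_fourier:
  fixes f g :: "'a::euclidean_space \<Rightarrow> complex" and F G :: "real \<Rightarrow> complex" and s :: real
  assumes [measurable]: "F \<in> borel_measurable borel" "G \<in> borel_measurable borel"
    and F2: "(\<lambda>\<eta>::'a. F (phi s (norm \<eta>))) \<in> L2" and G2: "(\<lambda>\<eta>::'a. G (phi s (norm \<eta>))) \<in> L2"
    and f: "has_fourier f (\<lambda>\<eta>. F (phi s (norm \<eta>)))" and g: "has_fourier g (\<lambda>\<eta>. G (phi s (norm \<eta>)))" and d: "DIM('a) \<ge> 2"
  shows "has_fourier (\<lambda>z. kg_propagator s f z * cnj (kg_propagator s g z))
    (\<lambda>z. complex_of_real (2 * pi / (2 * pi) ^ DIM('a)) * spectral_density s F G z)"
proof -
  let ?f = "\<lambda>t x. kg_propagator s f (t, x) * cnj (kg_propagator s g (t, x))"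
  let ?c = "complex_of_real (2 * pi / (2 * pi) ^ DIM('a))"
  note u = kg_propagator_slice[OF f F2, of s] and v = kg_propagator_slice[OF g G2, of s]
  note [measurable] = u(1) v(1)
  let ?A = "L2_norm (\<lambda>\<eta>::'a. F (phi s (norm \<eta>)))" and ?B = "L2_norm (\<lambda>\<eta>::'a. G (phi s (norm \<eta>)))"
  note sd = spectral_density_integrable[OF _ _ F2 G2 _ d] spectral_density_bound[OF _ _ F2 G2 _ d] spectral_density_fourier[OF _ _ F2 G2 _ d]
  have [measurable]: "(spectral_density s F G :: real \<times> 'a \<Rightarrow> complex) \<in> borel_measurable borel"
    by (rule spectral_density_measurable) measurable
  have c: "cmod ?c = 2 * pi / (2 * pi) ^ DIM('a)" by (simp add: norm_divide norm_mult norm_power)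
  show ?thesis
  proof (rule has_fourier_spacetime[where ?C1.0 = "?A\<^sup>2 / (2 * pi) ^ DIM('a) + ?B\<^sup>2 / (2 * pi) ^ DIM('a)" and ?C2.0 = "2 * pi / (2 * pi) ^ DIM('a) * (?A\<^sup>2 + ?B\<^sup>2)"])
    fix t :: real
    show "integrable lborel (\<lambda>x. ?f t x)"
      by (intro L2_mult_integrable L2_cnj u v)
    have "(LINT x|lborel. cmod (?f t x)) = (LINT x|lborel. cmod (kg_propagator s f (t, x) * kg_propagator s g (t, x)))"
      by (simp add: norm_mult)
    also have "\<dots> \<le> (L2_norm (\<lambda>x. kg_propagator s f (t, x)))\<^sup>2 + (L2_norm (\<lambda>x. kg_propagator s g (t, x)))\<^sup>2"
      by (intro L2_mult_bound u v)
    also have "\<dots> \<le> ?A\<^sup>2 / (2 * pi) ^ DIM('a) + ?B\<^sup>2 / (2 * pi) ^ DIM('a)"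
      by (intro add_mono u v)
    finally show "(LINT x|lborel. cmod (?f t x)) \<le> \<dots>" .
    fix \<xi> :: 'a assume \<xi>: "\<xi> \<noteq> 0"
    have "complex_of_real ((2 * pi) ^ DIM('a)) * fourier_integral (\<lambda>x. ?f t x) \<xi> =
      (LINT \<tau>|lborel. exp (\<i> * of_real (t * \<tau>)) * spectral_density s F G (\<tau>, \<xi>))"
      by (subst sd(3)[OF _ _ \<xi>], measurable)
         (rule has_fourier_product[OF u(2) evolve_L2(1)[OF F2] v(2) evolve_L2(1)[OF G2] u(3) v(3)])
    then show "(LINT \<tau>|lborel. exp (\<i> * of_real (t * \<tau>)) * (?c * spectral_density s F G (\<tau>, \<xi>))) =
      2 * pi * fourier_integral (\<lambda>x. ?f t x) \<xi>"
      by (simp add: mult.left_commute[of _ "_ / _"] field_simps)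
  next
    fix \<xi> :: 'a assume \<xi>: "\<xi> \<noteq> 0"
    show "integrable lborel (\<lambda>\<tau>. ?c * spectral_density s F G (\<tau>, \<xi>))"
      by (intro integrable_mult_right sd(1) \<xi>) measurable
    have "(LINT \<tau>|lborel. cmod (spectral_density s F G (\<tau>, \<xi>))) \<le> ?A\<^sup>2 + ?B\<^sup>2"
      by (intro sd(2) \<xi>) measurable
    then show "(LINT \<tau>|lborel. cmod (?c * spectral_density s F G (\<tau>, \<xi>))) \<le> 2 * pi / (2 * pi) ^ DIM('a) * (?A\<^sup>2 + ?B\<^sup>2)"
      unfolding norm_mult c by (subst integral_mult_right_zero) (intro mult_left_mono, auto)
  qed measurable
qed

section \<open>Multiplier norms on the transform side\<close>

lemma sqnorm_mult_const:
  assumes [measurable]: "f \<in> borel_measurable M"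
  shows "sqnorm M (\<lambda>x. c * f x) = ennreal ((cmod c)\<^sup>2) * sqnorm M f"
  by (subst nn_integral_cmult[symmetric]) (auto simp: norm_mult power_mult_distrib ennreal_mult)

text \<open>All admissible h have the same norm, so the infimum is over a single value; the inverse
  transform of the product shows that it is not over the empty set.\<close>

theorem multiplier_norm_eq:
  fixes f F m :: "'a::euclidean_space \<Rightarrow> complex"
  assumes f: "has_fourier f F" and [measurable]: "m \<in> borel_measurable borel" and mF: "(\<lambda>\<xi>. m \<xi> * F \<xi>) \<in> L2"
  shows "multiplier_norm m f = ennreal (L2_norm (\<lambda>\<xi>. m \<xi> * F \<xi>) / sqrt ((2 * pi) ^ DIM('a)))"
proof -
  let ?f = "\<lambda>\<xi>. m \<xi> * F \<xi>"
  let ?c = "(2 * pi) ^ DIM('a)"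
  have eq: "L2_norm h = L2_norm ?f / sqrt ?c" if h: "h \<in> L2" "is_multiplier m f h" for h
  proof -
    obtain F' where F': "has_fourier f F'" "has_fourier h (\<lambda>\<xi>. m \<xi> * F' \<xi>)" using h by (auto simp: is_multiplier_def)
    have "AE x in lborel. L2_fourier h x = m x * F x"
      using has_fourier_L2_right[OF F'(2) h(1)] has_fourier_unique_right[OF F'(1) f] by eventually_elim simp
    then have "(L2_norm ?f)\<^sup>2 = ?c * (L2_norm h)\<^sup>2"
      using L2_norm_fourier[OF h(1)] L2_norm_cong_AE[OF L2_fourier_L2[OF h(1)] mF] by simp
    then have "sqrt ((L2_norm ?f)\<^sup>2) = sqrt (?c * (L2_norm h)\<^sup>2)" by simp
    then show ?thesis using L2_norm_nonneg[of h] L2_norm_nonneg[of "?f"]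
      by (simp add: real_sqrt_mult)
  qed
  have "is_multiplier m f (inv_fourier ?f)"
    unfolding is_multiplier_def using f has_fourier_inv_fourier[OF mF] by blast
  with inv_fourier_L2[OF mF] have "inv_fourier ?f \<in> {h \<in> L2. is_multiplier m f h}" by simp
  then have ne: "{h \<in> L2. is_multiplier m f h} \<noteq> {}" by blast
  have "multiplier_norm m f = (INF h\<in>{h \<in> L2. is_multiplier m f h}. ennreal (L2_norm ?f / sqrt ?c))"
    unfolding multiplier_norm_def using eq by (intro INF_cong refl) auto
  then show ?thesis using ne by simp
qed

text \<open>The infimum over the empty set is \<infinity>, so a finite norm yields a
  witness.\<close>

lemma multiplier_norm_finite:
  assumes "multiplier_norm m f < \<infinity>"
  obtains F where "has_fourier f F" "(\<lambda>\<xi>. m \<xi> * F \<xi>) \<in> L2"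
proof -
  have "{h \<in> L2. is_multiplier m f h} \<noteq> {}" using assms unfolding multiplier_norm_def by (metis (no_types, lifting) INF_empty image_is_empty infinity_ennreal_def less_irrefl top.not_eq_extremum)
  then obtain h F where h: "h \<in> L2" and F: "has_fourier f F" "has_fourier h (\<lambda>\<xi>. m \<xi> * F \<xi>)"
    by (auto simp: is_multiplier_def)
  have [measurable]: "(\<lambda>\<xi>. m \<xi> * F \<xi>) \<in> borel_measurable borel"
    using F(2) by (auto simp: has_fourier_def tempered_function_def)
  have "(\<lambda>\<xi>. m \<xi> * F \<xi>) \<in> L2"
    by (rule L2_bounded_by[OF L2_fourier_L2[OF h], where B = 1]) (use has_fourier_L2_right[OF F(2) h] in auto)
  with F(1) show thesis by (rule that)
qed

lemma multiplier_norm_square: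
  fixes f F m :: "'a::euclidean_space \<Rightarrow> complex"
  assumes f: "has_fourier f F" and [measurable]: "m \<in> borel_measurable borel" and fin: "sqnorm lborel (\<lambda>\<xi>. m \<xi> * F \<xi>) < \<infinity>"
  shows "(multiplier_norm m f)\<^sup>2 = ennreal (1 / (2 * pi) ^ DIM('a)) * sqnorm lborel (\<lambda>\<xi>. m \<xi> * F \<xi>)"
proof -
  have [measurable]: "F \<in> borel_measurable borel" using f by (auto simp: has_fourier_def tempered_function_def)
  have l: "(\<lambda>\<xi>. m \<xi> * F \<xi>) \<in> L2" unfolding L2_iff using fin by simp
  show ?thesis unfolding multiplier_norm_eq[OF f _ l, simplified] sqnorm_eq_L2_norm[OF l]
    using L2_norm_nonneg[of "\<lambda>\<xi>. m \<xi> * F \<xi>"] by (simp add: ennreal_power power_divide flip: ennreal_mult)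
qed

section \<open>The quadratic form of radial profiles\<close>

lemma mom_measurable [measurable]:
  assumes "f \<in> borel_measurable M" shows "(\<lambda>x. mom s (f x)) \<in> borel_measurable M"
  unfolding mom_def
  by (rule measurable_compose[OF _ borel_measurable_sqrt]) (intro borel_measurable_diff borel_measurable_power borel_measurable_const assms)

lemma Jrad_measurable [measurable]:
  assumes [measurable]: "f \<in> borel_measurable M" "g \<in> borel_measurable M"
  shows "(\<lambda>x. Jrad p s \<beta> (f x) (g x)) \<in> borel_measurable M"
  unfolding Jrad_def by measurable

text \<open>For E^2 = s^2 + r^2 the relation E dE = r dr turns the volume element r^(n-1) dr into
  \<open>E * mom s E powr (n - 2)\<close>; at s = 0 these are polar coordinates.\<close>

lemma nn_integral_phi:
  fixes H :: "real \<Rightarrow> ennreal"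
  assumes s: "s \<ge> 0" and [measurable]: "H \<in> borel_measurable borel"
  defines "n \<equiv> real DIM('a::euclidean_space)"
  shows "(\<integral>\<^sup>+x. H (phi s (norm (x::'a))) \<partial>lborel) =
    (\<integral>\<^sup>+E. H E * ennreal (2 * half_sphere n * E * mom s E powr (n - 2)) * indicator {s<..} E \<partial>lborel)"
proof -
  let ?f = "\<lambda>s e. H (sqrt (s\<^sup>2 + (e + (- s\<^sup>2)))) * ennreal (half_sphere n * (e + (- s\<^sup>2)) powr (n / 2 - 1)) * indicator {0<..} (e + (- s\<^sup>2))"
  have h: "half_sphere n > 0" unfolding n_def by (intro half_sphere_pos) simp
  let ?k = "\<lambda>e. H (sqrt e) * ennreal (half_sphere n * (e - s\<^sup>2) powr (n / 2 - 1)) * indicator {s\<^sup>2<..} e"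
  have "(\<integral>\<^sup>+x. H (phi s (norm (x::'a))) \<partial>lborel) = (\<integral>\<^sup>+x. H (sqrt (s\<^sup>2 + (norm (x::'a))\<^sup>2)) \<partial>lborel)"
    by (simp add: phi_def)
  also have "\<dots> = (\<integral>\<^sup>+t. H (sqrt (s\<^sup>2 + t)) * ennreal (half_sphere n * t powr (n / 2 - 1)) * indicator {0<..} t \<partial>lborel)"
    unfolding n_def by (rule nn_integral_norm) measurable
  also have "\<dots> = (\<integral>\<^sup>+e. ?f s e \<partial>lborel)"
    by (rule nn_integral_lborel_translate[symmetric]) measurable
  also have "\<dots> = (\<integral>\<^sup>+e. ?k e * indicator {0<..} e \<partial>lborel)"
  proof (rule nn_integral_cong)
    have e0: "e > 0" if "s\<^sup>2 < e" for e using that zero_le_power2[of s] by linarith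
    show "?f s e = ?k e * indicator {0<..} e" for e
      using e0[of e] by (cases "s\<^sup>2 < e") (simp_all add: indicator_def)
  qed
  also have "\<dots> = (\<integral>\<^sup>+x. ?k (x\<^sup>2) * ennreal (2 * x) * indicator {0<..} x \<partial>lborel)"
    by (rule nn_integral_square) measurable
  also have "\<dots> = (\<integral>\<^sup>+E. H E * ennreal (2 * half_sphere n * E * mom s E powr (n - 2)) * indicator {s<..} E \<partial>lborel)"
  proof (rule nn_integral_cong)
    fix x :: real
    consider "x \<le> s" | "x > s" by linarith
    then show "?k (x\<^sup>2) * ennreal (2 * x) * indicator {0<..} x = H x * ennreal (2 * half_sphere n * x * mom s x powr (n - 2)) * indicator {s<..} x"
    proof cases
      case 1
      have "x\<^sup>2 \<le> s\<^sup>2" if "x > 0" using 1 that by (intro power_mono) auto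
      with 1 show ?thesis by (cases "x > 0") (simp_all add: indicator_def not_less)
    next
      case 2
      then have x: "x > 0" "x\<^sup>2 > s\<^sup>2" using s by (auto intro: power_strict_mono)
      have "mom s x powr (n - 2) = (x\<^sup>2 - s\<^sup>2) powr (n / 2 - 1)"
        using x by (simp add: mom_def powr_half_sqrt[symmetric] powr_powr diff_divide_distrib)
      then show ?thesis using x h 2 by (simp add: ennreal_mult[symmetric] mult.assoc mult_ac)
    qed
  qed
  finally show ?thesis .
qed

lemma nn_integral_radial:
  fixes H :: "real \<Rightarrow> ennreal"
  assumes [measurable]: "H \<in> borel_measurable borel"
  defines "n \<equiv> real DIM('a::euclidean_space)"
  shows "(\<integral>\<^sup>+x. H (norm (x::'a)) \<partial>lborel) = (\<integral>\<^sup>+\<rho>. H \<rho> * ennreal (2 * half_sphere n * \<rho> powr (n - 1)) * indicator {0<..} \<rho> \<partial>lborel)"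
proof -
  have "(\<integral>\<^sup>+x. H (norm (x::'a)) \<partial>lborel) = (\<integral>\<^sup>+x. H (phi 0 (norm (x::'a))) \<partial>lborel)" by (simp add: phi_def)
  also have "\<dots> = (\<integral>\<^sup>+\<rho>. H \<rho> * ennreal (2 * half_sphere n * \<rho> * mom 0 \<rho> powr (n - 2)) * indicator {0<..} \<rho> \<partial>lborel)"
    unfolding n_def by (rule nn_integral_phi) auto
  also have "\<dots> = (\<integral>\<^sup>+\<rho>. H \<rho> * ennreal (2 * half_sphere n * \<rho> powr (n - 1)) * indicator {0<..} \<rho> \<partial>lborel)"
  proof (rule nn_integral_cong)
    fix \<rho> :: real
    have "\<rho> * \<rho> powr (n - 2) = \<rho> powr (n - 1)" if "\<rho> > 0"
      using powr_add[of \<rho> 1 "n - 2"] that by simp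
    then show "H \<rho> * ennreal (2 * half_sphere n * \<rho> * mom 0 \<rho> powr (n - 2)) * indicator {0<..} \<rho> = H \<rho> * ennreal (2 * half_sphere n * \<rho> powr (n - 1)) * indicator {0<..} \<rho>"
      by (auto simp: indicator_def mom_def mult.assoc)
  qed
  finally show ?thesis .
qed

text \<open>The square is a double integral over a and b whose factors are regrouped as (X a V b)(X
  b V a). After the arithmetic-geometric mean the two squares contribute equally by symmetry, and
  equality holds when the two groups coincide on the support of q.\<close>

lemma square_nn_integral_le:
  fixes X V q :: "real \<Rightarrow> real"
  assumes [measurable]: "X \<in> borel_measurable borel" "V \<in> borel_measurable borel" "q \<in> borel_measurable borel"
    and nn: "\<And>a. X a \<ge> 0" "\<And>a. V a \<ge> 0" "\<And>a. q a \<ge> 0"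
  shows "(\<integral>\<^sup>+a. ennreal (X a * V a * q a) \<partial>lborel)\<^sup>2 \<le> (\<integral>\<^sup>+a. \<integral>\<^sup>+b. ennreal ((X a)\<^sup>2 * (V b)\<^sup>2 * (q a * q b)) \<partial>lborel \<partial>lborel)"
    and "(\<And>a b. q a \<noteq> 0 \<Longrightarrow> q b \<noteq> 0 \<Longrightarrow> X a * V b = X b * V a) \<Longrightarrow> (\<integral>\<^sup>+a. ennreal (X a * V a * q a) \<partial>lborel)\<^sup>2 = (\<integral>\<^sup>+a. \<integral>\<^sup>+b. ennreal ((X a)\<^sup>2 * (V b)\<^sup>2 * (q a * q b)) \<partial>lborel \<partial>lborel)"
proof -
  let ?h = "\<lambda>a b. (X a * V b) * (X b * V a) * (q a * q b)"
  let ?g = "\<integral>\<^sup>+a. ennreal (X a * V a * q a) \<partial>lborel"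
  let ?P = "\<lambda>a b. (X a)\<^sup>2 * (V b)\<^sup>2 * (q a * q b)"
  let ?k = "\<integral>\<^sup>+a. \<integral>\<^sup>+b. ennreal (?P b a) \<partial>lborel \<partial>lborel"
  let ?f = "\<integral>\<^sup>+a. \<integral>\<^sup>+b. ennreal (?P a b) \<partial>lborel \<partial>lborel"
  have sq: "?g\<^sup>2 = (\<integral>\<^sup>+a. \<integral>\<^sup>+b. ennreal (?h a b) \<partial>lborel \<partial>lborel)"
    unfolding power2_eq_square
    by (subst nn_integral_multc[symmetric], measurable, subst nn_integral_cmult[symmetric], measurable, simp add: ennreal_mult[symmetric] nn mult_ac)
  show "?g\<^sup>2 = ?f"
    if "\<And>a b. q a \<noteq> 0 \<Longrightarrow> q b \<noteq> 0 \<Longrightarrow> X a * V b = X b * V a"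
  proof -
    have "?h a b = ?P a b" for a b
    proof (cases "q a = 0 \<or> q b = 0")
      case False
      then have "X a * V b = X b * V a" using that by blast
      then have "?h a b = (X a * V b) * (X a * V b) * (q a * q b)" by simp
      then show ?thesis by (simp add: power2_eq_square mult_ac)
    qed auto
    then show ?thesis unfolding sq by (simp only:)
  qed
  have "2 * ?g\<^sup>2 = (\<integral>\<^sup>+a. \<integral>\<^sup>+b. 2 * ennreal (?h a b) \<partial>lborel \<partial>lborel)"
    unfolding sq by (simp add: nn_integral_cmult)
  also have "\<dots> \<le> (\<integral>\<^sup>+a. \<integral>\<^sup>+b. ennreal (?P a b) + ennreal (?P b a) \<partial>lborel \<partial>lborel)"
  proof (intro nn_integral_mono)
    fix a b
    have "2 * ((X a * V b) * (X b * V a)) * (q a * q b) \<le> ((X a * V b)\<^sup>2 + (X b * V a)\<^sup>2) * (q a * q b)"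
      by (intro mult_right_mono) (use nn sum_squares_bound[of "X a * V b" "X b * V a"] in auto)
    then have "2 * (?h a b) \<le> ?P a b + ?P b a"
      by (simp add: power_mult_distrib algebra_simps)
    then have "ennreal (2 * (?h a b)) \<le> ennreal (?P a b + ?P b a)" by (rule ennreal_leI)
    then show "2 * ennreal (?h a b) \<le> ennreal (?P a b) + ennreal (?P b a)"
      by (simp add: ennreal_mult nn)
  qed
  also have "\<dots> = (\<integral>\<^sup>+a. (\<integral>\<^sup>+b. ennreal (?P a b) \<partial>lborel) + (\<integral>\<^sup>+b. ennreal (?P b a) \<partial>lborel) \<partial>lborel)"
    by (intro nn_integral_cong nn_integral_add) measurable
  also have "\<dots> = ?f + ?k"
    by (intro nn_integral_add) measurable
  also have "?k = ?f"
    by (rule lborel_pair.Fubini') measurable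
  also have "\<dots> + \<dots> = 2 * \<dots>" by (simp add: mult_2)
  finally show "?g\<^sup>2 \<le> ?f"
    by (subst (asm) ennreal_mult_le_mult_iff) auto
qed

lemma nn_integral_cmult2:
  assumes [measurable]: "f \<in> borel_measurable (borel \<Otimes>\<^sub>M borel)"
  shows "(\<integral>\<^sup>+a. \<integral>\<^sup>+b. c * f (a, b) \<partial>lborel \<partial>lborel) = c * (\<integral>\<^sup>+a. \<integral>\<^sup>+b. f (a, b) \<partial>lborel \<partial>lborel)"
  by (simp add: nn_integral_cmult)

lemma nn_integral_swap4:
  fixes f :: "real \<times> real \<times> real \<times> real \<Rightarrow> ennreal"
  assumes [measurable]: "f \<in> borel_measurable (borel \<Otimes>\<^sub>M (borel \<Otimes>\<^sub>M (borel \<Otimes>\<^sub>M borel)))"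
  shows "(\<integral>\<^sup>+x. \<integral>\<^sup>+y. \<integral>\<^sup>+a. \<integral>\<^sup>+b. f (x, y, a, b) \<partial>lborel \<partial>lborel \<partial>lborel \<partial>lborel) =
    (\<integral>\<^sup>+a. \<integral>\<^sup>+b. \<integral>\<^sup>+x. \<integral>\<^sup>+y. f (x, y, a, b) \<partial>lborel \<partial>lborel \<partial>lborel \<partial>lborel)"
proof -
  have "(\<integral>\<^sup>+x. \<integral>\<^sup>+y. \<integral>\<^sup>+a. \<integral>\<^sup>+b. f (x, y, a, b) \<partial>lborel \<partial>lborel \<partial>lborel \<partial>lborel) =
    (\<integral>\<^sup>+x. \<integral>\<^sup>+a. \<integral>\<^sup>+y. \<integral>\<^sup>+b. f (x, y, a, b) \<partial>lborel \<partial>lborel \<partial>lborel \<partial>lborel)"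
    by (rule nn_integral_cong, rule lborel_pair.Fubini') measurable
  also have "\<dots> = (\<integral>\<^sup>+a. \<integral>\<^sup>+x. \<integral>\<^sup>+y. \<integral>\<^sup>+b. f (x, y, a, b) \<partial>lborel \<partial>lborel \<partial>lborel \<partial>lborel)"
    by (rule lborel_pair.Fubini') measurable
  also have "\<dots> = (\<integral>\<^sup>+a. \<integral>\<^sup>+x. \<integral>\<^sup>+b. \<integral>\<^sup>+y. f (x, y, a, b) \<partial>lborel \<partial>lborel \<partial>lborel \<partial>lborel)"
    by (rule nn_integral_cong, rule nn_integral_cong, rule lborel_pair.Fubini') measurable
  also have "\<dots> = (\<integral>\<^sup>+a. \<integral>\<^sup>+b. \<integral>\<^sup>+x. \<integral>\<^sup>+y. f (x, y, a, b) \<partial>lborel \<partial>lborel \<partial>lborel \<partial>lborel)"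
    by (rule nn_integral_cong, rule lborel_pair.Fubini') measurable
  finally show ?thesis .
qed

definition Qrad :: "real \<Rightarrow> real \<Rightarrow> real \<Rightarrow> (real \<Rightarrow> real) \<Rightarrow> (real \<Rightarrow> real) \<Rightarrow> ennreal" where
  "Qrad p s \<beta> X Y = (\<integral>\<^sup>+\<tau>. \<integral>\<^sup>+\<rho>. ennreal (\<rho> powr (- 2 * p) * \<bar>\<rho>\<^sup>2 - \<tau>\<^sup>2\<bar> powr (2 * \<beta>)) *
     (\<integral>\<^sup>+E. ennreal (X E * Y (E - \<tau>) * qw p s E (E - \<tau>) \<rho>) \<partial>lborel)\<^sup>2 * indicator {0<..} \<rho> \<partial>lborel \<partial>lborel)"

text \<open>The shift b -> b + \<tau> frees the profile factors from \<tau>, so that they leave the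
  inner integrals and the kernel remains.\<close>

lemma Qrad_unfold:
  fixes X Y :: "real \<Rightarrow> real"
  assumes [measurable]: "X \<in> borel_measurable borel" "Y \<in> borel_measurable borel"
  shows "(\<integral>\<^sup>+\<tau>. \<integral>\<^sup>+\<rho>. ennreal (\<rho> powr (- 2 * p) * \<bar>\<rho>\<^sup>2 - \<tau>\<^sup>2\<bar> powr (2 * \<beta>)) *
     (\<integral>\<^sup>+a. \<integral>\<^sup>+b. ennreal ((X a)\<^sup>2 * (Y (b - \<tau>))\<^sup>2 * (qw p s a (a - \<tau>) \<rho> * qw p s b (b - \<tau>) \<rho>)) \<partial>lborel \<partial>lborel) * indicator {0<..} \<rho> \<partial>lborel \<partial>lborel) =
   (\<integral>\<^sup>+a. \<integral>\<^sup>+b. ennreal ((X a)\<^sup>2 * (Y b)\<^sup>2) * Jrad p s \<beta> a b \<partial>lborel \<partial>lborel)" (is "?L = ?R")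
proof -
  let ?f = "\<lambda>a \<tau> \<rho>. \<integral>\<^sup>+b. ennreal ((X a)\<^sup>2 * (Y (b - \<tau>))\<^sup>2 * (qw p s a (a - \<tau>) \<rho> * qw p s b (b - \<tau>) \<rho>)) \<partial>lborel"
  let ?w = "\<lambda>\<tau> \<rho>. ennreal (\<rho> powr (- 2 * p) * \<bar>\<rho>\<^sup>2 - \<tau>\<^sup>2\<bar> powr (2 * \<beta>)) * indicator {0<..} \<rho>"
  let ?k = "\<lambda>\<tau> \<rho> a b. ennreal ((X a)\<^sup>2 * (Y b)\<^sup>2 * (qw p s a (a - \<tau>) \<rho> * qw p s (b + \<tau>) b \<rho>))"
  define f where "f = (\<lambda>z. ?w (fst z) (fst (snd z)) * ?k (fst z) (fst (snd z)) (fst (snd (snd z))) (snd (snd (snd z))))"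
  have m: "f \<in> borel_measurable (borel \<Otimes>\<^sub>M (borel \<Otimes>\<^sub>M (borel \<Otimes>\<^sub>M borel)))"
  proof -
    let ?M = "borel \<Otimes>\<^sub>M (borel \<Otimes>\<^sub>M (borel \<Otimes>\<^sub>M borel)) :: (real \<times> real \<times> real \<times> real) measure"
    define t r a b where "t = (\<lambda>z::real \<times> real \<times> real \<times> real. fst z)" and "r = (\<lambda>z::real \<times> real \<times> real \<times> real. fst (snd z))"
      and "a = (\<lambda>z::real \<times> real \<times> real \<times> real. fst (snd (snd z)))" and "b = (\<lambda>z::real \<times> real \<times> real \<times> real. snd (snd (snd z)))"
    have [measurable]: "t \<in> borel_measurable ?M" "r \<in> borel_measurable ?M" "a \<in> borel_measurable ?M" "b \<in> borel_measurable ?M"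
      unfolding t_def r_def a_def b_def by measurable
    have "(\<lambda>z. ?w (t z) (r z) * ?k (t z) (r z) (a z) (b z)) \<in> borel_measurable ?M" by measurable
    then show ?thesis unfolding f_def t_def r_def a_def b_def .
  qed
  have "?L = (\<integral>\<^sup>+\<tau>. \<integral>\<^sup>+\<rho>. \<integral>\<^sup>+a. \<integral>\<^sup>+b. ?w \<tau> \<rho> * ?k \<tau> \<rho> a b \<partial>lborel \<partial>lborel \<partial>lborel \<partial>lborel)"
  proof (rule nn_integral_cong, rule nn_integral_cong)
    fix \<tau> \<rho> :: real
    have "(?f a \<tau> \<rho>) =
      (\<integral>\<^sup>+b. ennreal ((X a)\<^sup>2 * (Y (b + \<tau> - \<tau>))\<^sup>2 * (qw p s a (a - \<tau>) \<rho> * qw p s (b + \<tau>) (b + \<tau> - \<tau>) \<rho>)) \<partial>lborel)" for a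
      by (rule nn_integral_lborel_translate[symmetric]) measurable
    then have e: "(?f a \<tau> \<rho>) = (\<integral>\<^sup>+b. ?k \<tau> \<rho> a b \<partial>lborel)" for a by simp
    show "ennreal (\<rho> powr (- 2 * p) * \<bar>\<rho>\<^sup>2 - \<tau>\<^sup>2\<bar> powr (2 * \<beta>)) *
     (\<integral>\<^sup>+a. ?f a \<tau> \<rho> \<partial>lborel) * indicator {0<..} \<rho> =
     (\<integral>\<^sup>+a. \<integral>\<^sup>+b. ?w \<tau> \<rho> * ?k \<tau> \<rho> a b \<partial>lborel \<partial>lborel)"
      unfolding e using nn_integral_cmult2[of "\<lambda>z. ?k \<tau> \<rho> (fst z) (snd z)" "?w \<tau> \<rho>"] by (simp add: mult.assoc mult.commute[of _ "indicator _ _"])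
  qed
  also have "\<dots> = (\<integral>\<^sup>+a. \<integral>\<^sup>+b. \<integral>\<^sup>+\<tau>. \<integral>\<^sup>+\<rho>. ?w \<tau> \<rho> * ?k \<tau> \<rho> a b \<partial>lborel \<partial>lborel \<partial>lborel \<partial>lborel)"
    using nn_integral_swap4[OF m] by (simp add: f_def)
  also have "\<dots> = ?R"
  proof (rule nn_integral_cong, rule nn_integral_cong)
    fix a b
    have "(\<integral>\<^sup>+\<tau>. \<integral>\<^sup>+\<rho>. ?w \<tau> \<rho> * ?k \<tau> \<rho> a b \<partial>lborel \<partial>lborel) = (\<integral>\<^sup>+\<tau>. \<integral>\<^sup>+\<rho>. ennreal ((X a)\<^sup>2 * (Y b)\<^sup>2) * (ennreal (\<rho> powr (- 2 * p) * \<bar>\<rho>\<^sup>2 - \<tau>\<^sup>2\<bar> powr (2 * \<beta>) *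
     qw p s a (a - \<tau>) \<rho> * qw p s (b + \<tau>) b \<rho>) * indicator {0<..} \<rho>) \<partial>lborel \<partial>lborel)"
      by (rule nn_integral_cong, rule nn_integral_cong) (auto simp: indicator_def ennreal_mult[symmetric] mult_ac)
    also have "\<dots> = ennreal ((X a)\<^sup>2 * (Y b)\<^sup>2) * Jrad p s \<beta> a b"
      unfolding Jrad_def
      using nn_integral_cmult2[of "\<lambda>z. ennreal (snd z powr (- 2 * p) * \<bar>(snd z)\<^sup>2 - (fst z)\<^sup>2\<bar> powr (2 * \<beta>) * qw p s a (a - fst z) (snd z) * qw p s (b + fst z) b (snd z)) * indicator {0<..} (snd z)"] by simp
    finally show "(\<integral>\<^sup>+\<tau>. \<integral>\<^sup>+\<rho>. ?w \<tau> \<rho> * ?k \<tau> \<rho> a b \<partial>lborel \<partial>lborel) = ennreal ((X a)\<^sup>2 * (Y b)\<^sup>2) * Jrad p s \<beta> a b" .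
  qed
  finally show ?thesis .
qed

lemma Qrad_le:
  assumes [measurable]: "X \<in> borel_measurable borel" "Y \<in> borel_measurable borel"
    and nn: "\<And>a. X a \<ge> 0" "\<And>a. Y a \<ge> 0"
  shows "Qrad p s \<beta> X Y \<le> (\<integral>\<^sup>+a. \<integral>\<^sup>+b. ennreal ((X a)\<^sup>2 * (Y b)\<^sup>2) * Jrad p s \<beta> a b \<partial>lborel \<partial>lborel)"
  unfolding Qrad_def Qrad_unfold[OF assms(1,2), symmetric]
  by (intro nn_integral_mono mult_right_mono mult_left_mono square_nn_integral_le(1)) (use nn in auto)

text \<open>Exponentials X = Y satisfy the hypothesis, since only the total a + b - \<tau> enters.
  It is demanded for positive energies only, where \<open>qw\<close> is supported; this leaves room
  for a profile that is exponential there alone.\<close>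

lemma Qrad_eq:
  assumes [measurable]: "X \<in> borel_measurable borel" "Y \<in> borel_measurable borel"
    and nn: "\<And>a. X a \<ge> 0" "\<And>a. Y a \<ge> 0"
    and prod: "\<And>a b \<tau>. a > 0 \<Longrightarrow> b > 0 \<Longrightarrow> a - \<tau> > 0 \<Longrightarrow> b - \<tau> > 0 \<Longrightarrow> X a * Y (b - \<tau>) = X b * Y (a - \<tau>)"
  shows "Qrad p s \<beta> X Y = (\<integral>\<^sup>+a. \<integral>\<^sup>+b. ennreal ((X a)\<^sup>2 * (Y b)\<^sup>2) * Jrad p s \<beta> a b \<partial>lborel \<partial>lborel)"
proof -
  have "(\<integral>\<^sup>+E. ennreal (X E * Y (E - \<tau>) * qw p s E (E - \<tau>) \<rho>) \<partial>lborel)\<^sup>2 =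
    (\<integral>\<^sup>+a. \<integral>\<^sup>+b. ennreal ((X a)\<^sup>2 * (Y (b - \<tau>))\<^sup>2 * (qw p s a (a - \<tau>) \<rho> * qw p s b (b - \<tau>) \<rho>)) \<partial>lborel \<partial>lborel)" for \<tau> \<rho>
    by (rule square_nn_integral_le(2)[where X = X], measurable) (use nn prod in \<open>auto simp: qw_def split: if_splits\<close>)
  then show ?thesis unfolding Qrad_def Qrad_unfold[OF assms(1,2), symmetric] by simp
qed

section \<open>Radial data as energy profiles\<close>

definition energy_mass :: "real \<Rightarrow> real \<Rightarrow> real \<Rightarrow> (real \<Rightarrow> real) \<Rightarrow> ennreal" where
  "energy_mass s n \<gamma> X = (\<integral>\<^sup>+a. ennreal ((X a)\<^sup>2 * (a powr \<gamma> * mom s a powr (n - 2))) * indicator {s<..} a \<partial>lborel)"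

lemma mom_phi: "r \<ge> 0 \<Longrightarrow> mom s (phi s r) = r"
  by (simp add: mom_def phi_def)

lemma phi_gt: "s > 0 \<Longrightarrow> r > 0 \<Longrightarrow> phi s r > s"
  unfolding phi_def by (rule real_less_rsqrt) auto

lemma phi_ge: "s > 0 \<Longrightarrow> phi s r \<ge> s"
  unfolding phi_def by (rule real_le_rsqrt) auto

text \<open>The volume element contributes one power of E and the profile E |F| absorbs two, which
  leaves the exponent 2 \<alpha> - 1; for the exponent of the estimate this is \<gamma>.\<close>

lemma phi_norm_integral:
  fixes F :: "real \<Rightarrow> complex"
  assumes [measurable]: "F \<in> borel_measurable borel" and s: "s > 0"
  defines "n \<equiv> real DIM('a::euclidean_space)"
  shows "sqnorm lborel (\<lambda>\<xi>::'a. complex_of_real (phi s (norm \<xi>) powr \<alpha>) * F (phi s (norm \<xi>))) =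
    ennreal (2 * half_sphere n) * energy_mass s n (2 * \<alpha> - 1) (\<lambda>E. \<bar>E\<bar> * cmod (F E))"
proof -
  let ?g = "\<lambda>E. ennreal ((E powr \<alpha> * cmod (F E))\<^sup>2) * ennreal (2 * half_sphere n * E * mom s E powr (n - 2)) * indicator {s<..} E"
  let ?f = "\<lambda>E. (\<bar>E\<bar> * cmod (F E))\<^sup>2 * (E powr (2 * \<alpha> - 1) * mom s E powr (n - 2))"
  have h: "half_sphere n > 0" unfolding n_def by (intro half_sphere_pos) simp
  have "sqnorm lborel (\<lambda>\<xi>::'a. complex_of_real (phi s (norm \<xi>) powr \<alpha>) * F (phi s (norm \<xi>))) =
    (\<integral>\<^sup>+x. ennreal ((phi s (norm (x::'a)) powr \<alpha> * cmod (F (phi s (norm x))))\<^sup>2) \<partial>lborel)"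
    by (simp add: norm_mult)
  also have "\<dots> = (\<integral>\<^sup>+E. ?g E \<partial>lborel)"
    unfolding n_def by (rule nn_integral_phi) (use s in auto)
  also have "\<dots> = (\<integral>\<^sup>+E. ennreal (2 * half_sphere n) * (ennreal (?f E) * indicator {s<..} E) \<partial>lborel)"
  proof (rule nn_integral_cong)
    fix E
    have "(E powr \<alpha>)\<^sup>2 * E = E\<^sup>2 * E powr (2 * \<alpha> - 1)" if "E > s"
    proof -
      have "E > 0" using that s by simp
      then have "(E powr \<alpha>)\<^sup>2 = E * E powr (2 * \<alpha> - 1)"
        using powr_add[of E \<alpha> \<alpha>] powr_add[of E 1 "2 * \<alpha> - 1"] by (simp add: power2_eq_square)
      then show ?thesis by (simp add: power2_eq_square)
    qed
    then have e: "(E powr \<alpha> * cmod (F E))\<^sup>2 * (2 * half_sphere n * E * mom s E powr (n - 2)) = 2 * half_sphere n * (?f E)" if "E > s"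
      using that by (simp add: power_mult_distrib algebra_simps)
    show "?g E =
      ennreal (2 * half_sphere n) * (ennreal (?f E) * indicator {s<..} E)"
    proof (cases "E > s")
      case True
      then show ?thesis using h s e by (simp add: ennreal_mult[symmetric])
    qed simp
  qed
  also have "\<dots> = ennreal (2 * half_sphere n) * energy_mass s n (2 * \<alpha> - 1) (\<lambda>E. \<bar>E\<bar> * cmod (F E))"
    unfolding energy_mass_def by (rule nn_integral_cmult) measurable
  finally show ?thesis .
qed

lemma phi_norm_square:
  fixes f :: "'a::euclidean_space \<Rightarrow> complex"
  assumes [measurable]: "F \<in> borel_measurable borel" and s: "s > 0" and f: "has_fourier f (\<lambda>\<xi>. F (phi s (norm \<xi>)))"
  defines "n \<equiv> real DIM('a)"
  assumes fin: "energy_mass s n (2 * \<alpha> - 1) (\<lambda>E. \<bar>E\<bar> * cmod (F E)) < \<infinity>"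
  shows "(phi_norm s \<alpha> f)\<^sup>2 = ennreal (2 * half_sphere n / (2 * pi) ^ DIM('a)) * energy_mass s n (2 * \<alpha> - 1) (\<lambda>E. \<bar>E\<bar> * cmod (F E))"
proof -
  have h: "half_sphere n > 0" unfolding n_def by (intro half_sphere_pos) simp
  note i = phi_norm_integral[OF assms(1) s, of \<alpha>, where 'a='a, folded n_def]
  have "(phi_norm s \<alpha> f)\<^sup>2 = ennreal (1 / (2 * pi) ^ DIM('a)) * sqnorm lborel (\<lambda>\<xi>::'a. complex_of_real (phi s (norm \<xi>) powr \<alpha>) * F (phi s (norm \<xi>)))"
    unfolding phi_norm_def by (rule multiplier_norm_square[OF f]) (use fin in \<open>auto simp: i ennreal_mult_less_top\<close>)
  then show ?thesis using h unfolding i by (simp add: mult.assoc[symmetric] ennreal_mult[symmetric])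
qed

text \<open>Since \<open>phi\<close> is at least s > 0 and the exponent is nonnegative, a finite
  norm forces the data into \<open>L2\<close>. Radial symmetry of \<open>L2_fourier\<close> at every
  point lets the profile be read off along one ray. Energies E \<le> s, attained at most at \<xi> =
  0, get the value 0.\<close>

lemma radial_data_profile:
  fixes f :: "'a::euclidean_space \<Rightarrow> complex"
  assumes s: "s > 0" and f: "f \<in> radial_data s \<beta>" and \<alpha>0: "kg_exponent TYPE('a) \<beta> \<ge> 0"
  defines "n \<equiv> real DIM('a)" and "\<alpha> \<equiv> kg_exponent TYPE('a) \<beta>"
  obtains F where "F \<in> borel_measurable borel" "(\<lambda>\<xi>::'a. F (phi s (norm \<xi>))) \<in> L2" "has_fourier f (\<lambda>\<xi>. F (phi s (norm \<xi>)))"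
    "energy_mass s n (2 * \<alpha> - 1) (\<lambda>E. \<bar>E\<bar> * cmod (F E)) < \<infinity>" "\<And>E. E \<le> s \<Longrightarrow> F E = 0"
    "\<not> (AE x in lborel. f x = 0) \<Longrightarrow> energy_mass s n (2 * \<alpha> - 1) (\<lambda>E. \<bar>E\<bar> * cmod (F E)) \<noteq> 0"
proof -
  let ?g = "\<lambda>\<xi>. complex_of_real (phi s (norm \<xi>) powr \<alpha>)"
  let ?f = "\<lambda>F. energy_mass s n (2 * \<alpha> - 1) (\<lambda>E. \<bar>E\<bar> * cmod (F E))"
  have h: "half_sphere n > 0" unfolding n_def by (intro half_sphere_pos) simp
  have rad: "radial f" and fin: "phi_norm s \<alpha> f < \<infinity>" using f by (auto simp: radial_data_def \<alpha>_def)
  obtain F' where F': "has_fourier f F'" and l: "(\<lambda>\<xi>. ?g \<xi> * F' \<xi>) \<in> L2"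
    using fin unfolding phi_norm_def by (rule multiplier_norm_finite)
  have [measurable]: "f \<in> borel_measurable borel" "F' \<in> borel_measurable borel" using F' by (auto simp: has_fourier_def tempered_function_def)
  have "cmod (F' x) \<le> (1 / s powr \<alpha>) * cmod (complex_of_real (phi s (norm x) powr \<alpha>) * F' x)" for x
  proof -
    have "s powr \<alpha> \<le> phi s (norm x) powr \<alpha>" using s \<alpha>0 phi_ge[OF s] unfolding \<alpha>_def by (intro powr_mono2) auto
    then show ?thesis using s by (simp add: norm_mult field_simps mult_left_mono)
  qed
  then have F'2: "F' \<in> L2" by (intro L2_bounded_by[OF l, where B = "1 / s powr \<alpha>"] AE_I2) auto
  have f2: "f \<in> L2" by (rule L2_bounded_by[OF inv_fourier_L2[OF F'2], where B = 1]) (use has_fourier_L2_left[OF F' F'2] in auto)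
  note [measurable] = L2_measurable[OF L2_fourier_L2[OF f2]]
  obtain e :: 'a where e: "e \<in> Basis" using nonempty_Basis by blast
  define F where "F E = (if E > s then L2_fourier f (mom s E *\<^sub>R e) else 0)" for E
  have [measurable]: "F \<in> borel_measurable borel" unfolding F_def by measurable
  have rL: "radial (L2_fourier f)" by (rule radial_L2_fourier[OF rad]) measurable
  have F_eq: "F (phi s (norm \<xi>)) = L2_fourier f \<xi>" if "\<xi> \<noteq> 0" for \<xi>
  proof -
    have "norm (norm \<xi> *\<^sub>R e) = norm \<xi>" using e by simp
    then have "L2_fourier f (norm \<xi> *\<^sub>R e) = L2_fourier f \<xi>" using rL unfolding radial_def by blast
    then show ?thesis using that s by (simp add: F_def mom_phi phi_gt)
  qed
  have ae0: "AE \<xi> in lborel. \<xi> \<noteq> (0::'a)" by (rule AE_lborel_singleton)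
  have aeF: "AE \<xi> in lborel. F' \<xi> = F (phi s (norm \<xi>))"
    using ae0 has_fourier_L2_right[OF F' f2] by eventually_elim (simp add: F_eq)
  have F2: "(\<lambda>\<xi>::'a. F (phi s (norm \<xi>))) \<in> L2"
    by (rule L2_bounded_by[OF F'2, where B = 1]) (use aeF in auto)
  have hF: "has_fourier f (\<lambda>\<xi>. F (phi s (norm \<xi>)))"
    by (rule has_fourier_AE_cong[OF F']) (use aeF in auto)
  note i = phi_norm_integral[OF \<open>F \<in> _\<close> s, of \<alpha>, where 'a='a, folded n_def]
  have c: "sqnorm lborel (\<lambda>\<xi>::'a. ?g \<xi> * F (phi s (norm \<xi>))) = sqnorm lborel (\<lambda>\<xi>::'a. ?g \<xi> * F' \<xi>)"
    by (rule sqnorm_cong_AE) (use aeF in auto)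
  have fin': "?f F < \<infinity>"
    using l h unfolding L2_iff c[symmetric] i by (auto simp: ennreal_mult_less_top)
  have nz: "?f F \<noteq> 0" if "\<not> (AE x in lborel. f x = 0)"
  proof
    assume "?f F = 0"
    then have "sqnorm lborel (\<lambda>\<xi>::'a. ?g \<xi> * F (phi s (norm \<xi>))) = 0" unfolding i by simp
    then have "AE \<xi> in lborel. ennreal ((cmod (complex_of_real (phi s (norm (\<xi>::'a)) powr \<alpha>) * F (phi s (norm \<xi>))))\<^sup>2) = 0"
      by (subst (asm) nn_integral_0_iff_AE) auto
    then have "AE \<xi> in lborel. F (phi s (norm (\<xi>::'a))) = 0"
    proof eventually_elim
      case (elim \<xi>)
      have "phi s (norm \<xi>) > 0" using phi_ge[OF s, of "norm \<xi>"] s by linarith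
      with elim show ?case by simp
    qed
    then have "has_fourier f (\<lambda>\<xi>. 0)" by (intro has_fourier_AE_cong[OF hF]) auto
    moreover have "has_fourier (\<lambda>_::'a. 0) (\<lambda>\<xi>. 0)" by (auto simp: has_fourier_def tempered_function_def)
    ultimately have "AE x in lborel. f x = 0" by (rule has_fourier_unique_left)
    with that show False by simp
  qed
  show thesis by (rule that[OF _ F2 hF fin' _ nz]) (auto simp: F_def)
qed

text \<open>For nonnegative profiles there is no cancellation in the density, and the triangle
  inequality is an equality where the integrand is integrable.\<close>

lemma spectral_density_cmod:
  fixes F G :: "real \<Rightarrow> complex" and \<xi> :: "'a::euclidean_space" and s \<tau> :: real
  defines "n \<equiv> real DIM('a)"
  assumes d: "DIM('a) \<ge> 2" and [measurable]: "F \<in> borel_measurable borel" "G \<in> borel_measurable borel"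
  defines "I \<equiv> (\<integral>\<^sup>+E. ennreal ((\<bar>E\<bar> * cmod (F E)) * (\<bar>E - \<tau>\<bar> * cmod (G (E - \<tau>))) * qw ((n - 3) / 2) s E (E - \<tau>) (norm \<xi>)) \<partial>lborel)"
    and "c \<equiv> 4 * half_sphere (n - 1) * (2 * norm \<xi>) powr (2 - n)"
  shows "ennreal (cmod (spectral_density s F G (\<tau>, \<xi>))) \<le> ennreal c * I"
    and "(\<And>E. F E = complex_of_real (cmod (F E))) \<Longrightarrow> (\<And>E. G E = complex_of_real (cmod (G E))) \<Longrightarrow>
      integrable lborel (\<lambda>E. bipolar_weight n s (norm \<xi>) E (E - \<tau>) *\<^sub>R (F E * cnj (G (E - \<tau>)))) \<Longrightarrow>
      ennreal (cmod (spectral_density s F G (\<tau>, \<xi>))) = ennreal c * I"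
proof -
  let ?f = "spectral_density s F G (\<tau>, \<xi>)"
  have n: "n \<ge> 2" using d by (simp add: n_def)
  have h: "half_sphere (n - 1) > 0" using n by (intro half_sphere_pos) simp
  let ?k = "\<lambda>E. bipolar_weight n s (norm \<xi>) E (E - \<tau>) *\<^sub>R (F E * cnj (G (E - \<tau>)))"
  have k: "cmod (?k E) = c * ((\<bar>E\<bar> * cmod (F E)) * (\<bar>E - \<tau>\<bar> * cmod (G (E - \<tau>))) * qw ((n - 3) / 2) s E (E - \<tau>) (norm \<xi>))" for E
    using h by (auto simp: bipolar_weight_def c_def norm_mult abs_mult qw_def)
  have I: "(\<integral>\<^sup>+E. ennreal (cmod (?k E)) \<partial>lborel) = ennreal c * I"
    unfolding k I_def using h by (subst nn_integral_cmult[symmetric]) (auto simp: ennreal_mult c_def)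
  have sd: "?f = (LINT E|lborel. ?k E)" by (simp add: spectral_density_def n_def)
  show "ennreal (cmod ?f) \<le> ennreal c * I"
  proof (cases "integrable lborel ?k")
    case True
    then show ?thesis unfolding sd I[symmetric] by (rule integral_norm_bound_ennreal)
  next
    \<comment> \<open>The Bochner integral takes its default value 0 here, so the inequality is
      trivial.\<close>
    case False
    then show ?thesis unfolding sd I[symmetric] by (simp add: not_integrable_integral_eq)
  qed
  assume r: "\<And>E. F E = complex_of_real (cmod (F E))" "\<And>E. G E = complex_of_real (cmod (G E))" and i: "integrable lborel ?k"
  have "?k E = complex_of_real (cmod (?k E))" for E
  proof -
    have b: "bipolar_weight n s (norm \<xi>) E (E - \<tau>) \<ge> 0" using n by (intro bipolar_weight_nonneg) simp
    show ?thesis by (subst r(1), subst (1) r(2)) (simp add: b norm_mult scaleR_conv_of_real)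
  qed
  then have "(LINT E|lborel. ?k E) = (LINT E|lborel. complex_of_real (cmod (?k E)))" by (intro Bochner_Integration.integral_cong refl)
  also have "\<dots> = complex_of_real (LINT E|lborel. cmod (?k E))" by (rule integral_complex_of_real)
  finally have "cmod (LINT E|lborel. ?k E) = (LINT E|lborel. cmod (?k E))" by simp
  also have "ennreal \<dots> = (\<integral>\<^sup>+E. ennreal (cmod (?k E)) \<partial>lborel)"
    by (rule nn_integral_eq_integral[symmetric]) (use integrable_norm[OF i] in auto)
  finally show "ennreal (cmod ?f) = ennreal c * I" unfolding sd I .
qed

lemma nn_integral_lborel_fst:
  fixes f :: "'a::euclidean_space \<times> 'b::euclidean_space \<Rightarrow> ennreal"
  assumes [measurable]: "f \<in> borel_measurable borel"
  shows "(\<integral>\<^sup>+z. f z \<partial>lborel) = (\<integral>\<^sup>+x. \<integral>\<^sup>+y. f (x, y) \<partial>lborel \<partial>lborel)"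
    "(\<integral>\<^sup>+z. f z \<partial>lborel) = (\<integral>\<^sup>+y. \<integral>\<^sup>+x. f (x, y) \<partial>lborel \<partial>lborel)"
proof -
  have [measurable]: "f \<in> borel_measurable (lborel \<Otimes>\<^sub>M lborel)" unfolding lborel_prod by simp
  show "(\<integral>\<^sup>+z. f z \<partial>lborel) = (\<integral>\<^sup>+x. \<integral>\<^sup>+y. f (x, y) \<partial>lborel \<partial>lborel)"
    by (subst lborel.nn_integral_fst) (auto simp: lborel_prod)
  show "(\<integral>\<^sup>+z. f z \<partial>lborel) = (\<integral>\<^sup>+y. \<integral>\<^sup>+x. f (x, y) \<partial>lborel \<partial>lborel)"
    by (subst lborel_pair.nn_integral_snd[of "\<lambda>z. f z"]) (auto simp: lborel_prod)
qed

text \<open>The bound on the density depends on \<xi> only through its norm, so polar coordinates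
  lead to \<open>Qrad\<close>. For equality, integrability in E is known for almost every \<tau> at
  fixed \<xi> \<noteq> 0; hence \<xi> is the outer variable there.\<close>

lemma spectral_sqnorm:
  fixes F G :: "real \<Rightarrow> complex" and s \<beta> :: real
  defines "n \<equiv> real DIM('a::euclidean_space)"
  assumes d: "DIM('a) \<ge> 2" and Fm[measurable]: "F \<in> borel_measurable borel" and Gm[measurable]: "G \<in> borel_measurable borel"
  defines "c \<equiv> 4 * half_sphere (n - 1) * 2 powr (2 - n)"
  defines "L \<equiv> sqnorm lborel (\<lambda>z::real \<times> 'a. complex_of_real (\<bar>(fst z)\<^sup>2 - (norm (snd z))\<^sup>2\<bar> powr \<beta>) * spectral_density s F G z)"
    and "R \<equiv> ennreal (2 * half_sphere n * c\<^sup>2) * Qrad ((n - 3) / 2) s \<beta> (\<lambda>E. \<bar>E\<bar> * cmod (F E)) (\<lambda>E. \<bar>E\<bar> * cmod (G E))"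
  shows "L \<le> R"
    and "(\<lambda>\<eta>::'a. F (phi s (norm \<eta>))) \<in> L2 \<Longrightarrow> (\<lambda>\<eta>::'a. G (phi s (norm \<eta>))) \<in> L2 \<Longrightarrow>
      (\<And>E. F E = complex_of_real (cmod (F E))) \<Longrightarrow> (\<And>E. G E = complex_of_real (cmod (G E))) \<Longrightarrow> L = R"
proof -
  let ?k = "borel_measurable borel"
  let ?h = "\<lambda>\<rho>. ennreal (2 * half_sphere n * \<rho> powr (n - 1))"
  let ?g = "ennreal (2 * half_sphere n * c\<^sup>2)"
  let ?f = "\<lambda>\<rho> p \<tau>. \<rho> powr (- 2 * p) * \<bar>\<rho>\<^sup>2 - \<tau>\<^sup>2\<bar> powr (2 * \<beta>)"
  have n: "n \<ge> 2" using d by (simp add: n_def)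
  have h: "half_sphere (n - 1) > 0" "half_sphere n > 0" using n by (auto intro!: half_sphere_pos)
  define p where "p = (n - 3) / 2"
  define I where "I \<tau> \<rho> = (\<integral>\<^sup>+E. ennreal ((\<bar>E\<bar> * cmod (F E)) * (\<bar>E - \<tau>\<bar> * cmod (G (E - \<tau>))) * qw p s E (E - \<tau>) \<rho>) \<partial>lborel)" for \<tau> \<rho>
  have Im[measurable]: "(\<lambda>x. I (f x) (g x)) \<in> borel_measurable M" if [measurable]: "f \<in> borel_measurable M" "g \<in> borel_measurable M" for f g and M :: "'m measure"
    unfolding I_def by measurable
  define w where "w \<rho> = 4 * half_sphere (n - 1) * (2 * \<rho>) powr (2 - n)" for \<rho>
  have wm[measurable]: "(\<lambda>x. w (f x)) \<in> borel_measurable M" if [measurable]: "f \<in> borel_measurable M" for f and M :: "'m measure"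
    unfolding w_def by measurable
  have w0: "w \<rho> \<ge> 0" for \<rho> using h by (simp add: w_def)
  let ?m = "\<lambda>\<tau> \<rho>. \<bar>\<tau>\<^sup>2 - \<rho>\<^sup>2\<bar> powr \<beta>"
  define l where "l z = ennreal ((cmod (complex_of_real (?m (fst z) (norm (snd z))) * spectral_density s F G z))\<^sup>2)" for z :: "real \<times> 'a"
  define r where "r z = (ennreal (?m (fst z) (norm (snd z))) * (ennreal (w (norm (snd z))) * I (fst z) (norm (snd z))))\<^sup>2" for z :: "real \<times> 'a"
  have [measurable]: "(spectral_density s F G :: real \<times> 'a \<Rightarrow> complex) \<in> ?k"
    by (rule spectral_density_measurable) measurable
  have [measurable]: "(\<lambda>z::real \<times> 'a. fst z) \<in> ?k" "(\<lambda>z::real \<times> 'a. snd z) \<in> ?k"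
    by (intro borel_measurable_continuous_onI continuous_intros)+
  have lm: "l \<in> ?k" unfolding l_def by measurable
  have rm: "r \<in> ?k" unfolding r_def by measurable
  have l_eq: "l (\<tau>, \<xi>) = (ennreal (?m \<tau> (norm \<xi>)) * ennreal (cmod (spectral_density s F G (\<tau>, \<xi>))))\<^sup>2" for \<tau> and \<xi> :: 'a
    by (simp add: l_def norm_mult ennreal_mult[symmetric] ennreal_power)
  have sd1: "ennreal (cmod (spectral_density s F G (\<tau>, \<xi>))) \<le> ennreal (w (norm \<xi>)) * I \<tau> (norm \<xi>)" for \<tau> and \<xi> :: 'a
    unfolding I_def w_def p_def n_def by (rule spectral_density_cmod(1)[OF d Fm Gm])
  have le: "l (\<tau>, \<xi>) \<le> r (\<tau>, \<xi>)" for \<tau> \<xi>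
    unfolding l_eq r_def fst_conv snd_conv by (intro power_mono mult_left_mono sd1) auto
  have L: "L = (\<integral>\<^sup>+z. l z \<partial>lborel)" unfolding L_def l_def ..
  have R: "R = (\<integral>\<^sup>+z. r z \<partial>lborel)"
  proof -
    have "(\<integral>\<^sup>+z. r z \<partial>lborel) = (\<integral>\<^sup>+\<tau>. \<integral>\<^sup>+\<xi>. (ennreal (?m \<tau> (norm (\<xi>::'a))) * (ennreal (w (norm \<xi>)) * I \<tau> (norm \<xi>)))\<^sup>2 \<partial>lborel \<partial>lborel)"
      unfolding nn_integral_lborel_fst(1)[OF rm] by (simp add: r_def)
    also have "\<dots> = (\<integral>\<^sup>+\<tau>. \<integral>\<^sup>+\<rho>. (ennreal (?m \<tau> \<rho>) * (ennreal (w \<rho>) * I \<tau> \<rho>))\<^sup>2 * ?h \<rho> * indicator {0<..} \<rho> \<partial>lborel \<partial>lborel)"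
      unfolding n_def by (intro nn_integral_cong nn_integral_radial) measurable
    also have "\<dots> = (\<integral>\<^sup>+\<tau>. \<integral>\<^sup>+\<rho>. ?g * (ennreal (?f \<rho> p \<tau>) * (I \<tau> \<rho>)\<^sup>2 * indicator {0<..} \<rho>) \<partial>lborel \<partial>lborel)"
    proof (rule nn_integral_cong, rule nn_integral_cong)
      fix \<tau> \<rho> :: real
      show "(ennreal (?m \<tau> \<rho>) * (ennreal (w \<rho>) * I \<tau> \<rho>))\<^sup>2 * ?h \<rho> * indicator {0<..} \<rho> =
        ?g * (ennreal (?f \<rho> p \<tau>) * (I \<tau> \<rho>)\<^sup>2 * indicator {0<..} \<rho>)"
      proof (cases "\<rho> > 0")
        case True
        have m: "(?m \<tau> \<rho>)\<^sup>2 = \<bar>\<rho>\<^sup>2 - \<tau>\<^sup>2\<bar> powr (2 * \<beta>)"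
          using powr_add[of "\<bar>\<rho>\<^sup>2 - \<tau>\<^sup>2\<bar>" \<beta> \<beta>] by (simp add: power2_eq_square abs_minus_commute)
        have "(\<rho> powr (2 - n))\<^sup>2 * \<rho> powr (n - 1) = \<rho> powr ((2 - n) + (2 - n) + (n - 1))"
          unfolding powr_add power2_eq_square ..
        also have "(2 - n) + (2 - n) + (n - 1) = - 2 * p" by (simp add: p_def field_simps)
        finally have wr: "(w \<rho>)\<^sup>2 * \<rho> powr (n - 1) = c\<^sup>2 * \<rho> powr (- 2 * p)"
          using True by (simp add: w_def c_def powr_mult power_mult_distrib mult_ac)
        have "(?m \<tau> \<rho>)\<^sup>2 * (w \<rho>)\<^sup>2 * (2 * half_sphere n * \<rho> powr (n - 1)) = 2 * half_sphere n * c\<^sup>2 * (?f \<rho> p \<tau>)"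
          using wr unfolding m by (simp add: mult_ac)
        then have "ennreal ((?m \<tau> \<rho>)\<^sup>2) * ennreal ((w \<rho>)\<^sup>2) * ?h \<rho> = ?g * ennreal (?f \<rho> p \<tau>)"
          using h by (simp add: ennreal_mult[symmetric])
        then have "ennreal ((?m \<tau> \<rho>)\<^sup>2) * ennreal ((w \<rho>)\<^sup>2) * ?h \<rho> * (I \<tau> \<rho>)\<^sup>2 = ?g * ennreal (?f \<rho> p \<tau>) * (I \<tau> \<rho>)\<^sup>2"
          by simp
        then show ?thesis using True w0[of \<rho>] by (simp add: power_mult_distrib ennreal_power mult_ac)
      qed simp
    qed
    also have "\<dots> = R"
      unfolding R_def Qrad_def I_def p_def[symmetric] by (simp add: nn_integral_cmult)
    finally show ?thesis ..
  qed
  show "L \<le> R" unfolding L R by (rule nn_integral_mono) (metis le surj_pair)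
  assume F2: "(\<lambda>\<eta>::'a. F (phi s (norm \<eta>))) \<in> L2" and G2: "(\<lambda>\<eta>::'a. G (phi s (norm \<eta>))) \<in> L2"
    and re: "\<And>E. F E = complex_of_real (cmod (F E))" "\<And>E. G E = complex_of_real (cmod (G E))"
  have "AE \<xi> in lborel. \<xi> \<noteq> (0::'a)" by (rule AE_lborel_singleton)
  then have "AE \<xi>::'a in lborel. (\<integral>\<^sup>+\<tau>. l (\<tau>, \<xi>) \<partial>lborel) = (\<integral>\<^sup>+\<tau>. r (\<tau>, \<xi>) \<partial>lborel)"
  proof eventually_elim
    case (elim \<xi>)
    have "AE \<tau> in lborel. integrable lborel (\<lambda>E. bipolar_weight n s (norm \<xi>) E (E - \<tau>) *\<^sub>R (F E * cnj (G (E - \<tau>))))"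
      using lborel_pair.AE_integrable_fst[OF spectral_pair_integrable[OF Fm Gm F2 G2 elim d]] by (simp add: n_def)
    then have "AE \<tau> in lborel. l (\<tau>, \<xi>) = r (\<tau>, \<xi>)"
    proof eventually_elim
      case (elim \<tau>)
      have "ennreal (cmod (spectral_density s F G (\<tau>, \<xi>))) = ennreal (w (norm \<xi>)) * I \<tau> (norm \<xi>)"
        unfolding I_def w_def p_def n_def by (rule spectral_density_cmod(2)[OF d Fm Gm re elim[unfolded n_def]])
      then show ?case by (simp add: l_eq r_def)
    qed
    then show ?case by (rule nn_integral_cong_AE)
  qed
  then show "L = R" unfolding L R nn_integral_lborel_fst(2)[OF lm] nn_integral_lborel_fst(2)[OF rm]
    by (rule nn_integral_cong_AE)
qed

section \<open>The quadratic form against products of energy masses\<close>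

lemma Jrad_eq_0: "\<not> (a > s \<and> b > s) \<Longrightarrow> s > 0 \<Longrightarrow> Jrad p s \<beta> a b = 0"
proof -
  assume ab: "\<not> (a > s \<and> b > s)" and s: "s > 0"
  have z: "qw p s x y \<rho> = 0" if "x \<le> s" for x y \<rho>
  proof (cases "x > 0")
    case True
    then have "x\<^sup>2 \<le> s\<^sup>2" using that by (intro power_mono) auto
    then have "4 * \<rho>\<^sup>2 * (x\<^sup>2 - s\<^sup>2) \<le> 0" by (simp add: mult_nonneg_nonpos)
    then have "heron s x y \<rho> \<le> 0" unfolding heron_def using zero_le_power2[of "x\<^sup>2 - y\<^sup>2 + \<rho>\<^sup>2"] by linarith
    then show ?thesis by (simp add: qw_def)
  qed (simp add: qw_def)
  have "qw p s a (a - \<tau>) \<rho> * qw p s (b + \<tau>) b \<rho> = 0" for \<tau> \<rho>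
    using ab z[of a] z[of b] qw_sym[of p s "b + \<tau>" b \<rho>] by (cases "a > s") auto
  then have "ennreal (\<rho> powr (- 2 * p) * \<bar>\<rho>\<^sup>2 - \<tau>\<^sup>2\<bar> powr (2 * \<beta>) * qw p s a (a - \<tau>) \<rho> * qw p s (b + \<tau>) b \<rho>) = 0" for \<rho> \<tau>
    by (simp only: mult.assoc) simp
  then show ?thesis unfolding Jrad_def by (simp only:) simp
qed

definition energy_weight :: "real \<Rightarrow> real \<Rightarrow> real \<Rightarrow> (real \<Rightarrow> real) \<Rightarrow> real \<Rightarrow> ennreal" where
  "energy_weight s n \<gamma> X a = ennreal ((X a)\<^sup>2 * (a powr \<gamma> * mom s a powr (n - 2))) * indicator {s<..} a"

lemma energy_weight_measurable [measurable]:
  assumes [measurable]: "X \<in> borel_measurable borel" shows "energy_weight s n \<gamma> X \<in> borel_measurable borel"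
  unfolding energy_weight_def[abs_def] by measurable

lemma energy_mass_weight: "energy_mass s n \<gamma> X = (\<integral>\<^sup>+a. energy_weight s n \<gamma> X a \<partial>lborel)"
  by (simp add: energy_mass_def energy_weight_def)

definition Jrad_const :: "real \<Rightarrow> real \<Rightarrow> real" where
  "Jrad_const \<gamma> p = 16 powr p / 2 * Beta (\<gamma> + 1) (p + 1)"

context
  fixes s n \<gamma> p J0 :: real
  assumes s: "s > 0" and n: "n \<ge> 2" and p: "p = (n - 3) / 2" and gp: "\<gamma> + p + 1 > 0" and g: "\<gamma> \<ge> - 1 / 2"
begin

lemma Jrad_const_pos: "Jrad_const \<gamma> p > 0"
  unfolding Jrad_const_def using n g p by (auto intro!: mult_pos_pos Beta_pos)

text \<open>\<open>Jrad_eq\<close> in the parameters \<gamma> and n. Since 2 p + 1 = n - 2, the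
  momenta enter with exactly the power of the volume element in \<open>energy_mass\<close>.\<close>

lemma Jrad_weight:
  assumes "a > s" "b > s"
  shows "Jrad p s ((\<gamma> - p) / 2) a b = ennreal (Jrad_const \<gamma> p * (mom s a * mom s b) powr (n - 2)) * Jang p s ((\<gamma> - p) / 2) a b"
proof -
  have e: "2 * ((\<gamma> - p) / 2) + p + 1 = \<gamma> + 1" "2 * p + 1 = n - 2" by (auto simp: p field_simps)
  have "Jrad p s ((\<gamma> - p) / 2) a b = ennreal (16 powr p / 2 * Beta (2 * ((\<gamma> - p) / 2) + p + 1) (p + 1) * (mom s a * mom s b) powr (2 * p + 1)) * Jang p s ((\<gamma> - p) / 2) a b"
    by (rule Jrad_eq[OF s assms]) (use n g p e(1) in auto)
  then show ?thesis unfolding e Jrad_const_def .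
qed

text \<open>The majorant of the kernel factorises in a and b; this is why the double integral
  becomes a product of two norms.\<close>

lemma weight_product:
  assumes "a > s" "b > s" and J0: "J0 \<ge> 0"
  shows "ennreal ((X a)\<^sup>2 * (Y b)\<^sup>2) * (ennreal (Jrad_const \<gamma> p * (mom s a * mom s b) powr (n - 2)) * ennreal (J0 * (a * b) powr \<gamma>)) =
    ennreal (Jrad_const \<gamma> p * J0) * (energy_weight s n \<gamma> X a * energy_weight s n \<gamma> Y b)"
  using assms s Jrad_const_pos by (simp add: energy_weight_def ennreal_mult[symmetric] powr_mult mult_ac)

lemma weight_le:
  assumes J0: "J0 \<ge> 0" and J: "\<And>a b. a > s \<Longrightarrow> b > s \<Longrightarrow> Jang p s ((\<gamma> - p) / 2) a b \<le> ennreal (J0 * (a * b) powr \<gamma>)"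
  shows "ennreal ((X a)\<^sup>2 * (Y b)\<^sup>2) * Jrad p s ((\<gamma> - p) / 2) a b \<le> ennreal (Jrad_const \<gamma> p * J0) * (energy_weight s n \<gamma> X a * energy_weight s n \<gamma> Y b)"
proof (cases "a > s \<and> b > s")
  case True
  then show ?thesis unfolding weight_product[OF _ _ J0, symmetric, of a b X Y, OF True[THEN conjunct1] True[THEN conjunct2]]
    by (subst Jrad_weight) (auto intro!: mult_left_mono J)
qed (simp add: Jrad_eq_0 s)

lemma weight_less:
  assumes J0: "J0 \<ge> 0" and J: "\<And>a b. a > s \<Longrightarrow> b > s \<Longrightarrow> Jang p s ((\<gamma> - p) / 2) a b < ennreal (J0 * (a * b) powr \<gamma>)"
    and nz: "energy_weight s n \<gamma> X a * energy_weight s n \<gamma> Y b \<noteq> 0"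
  shows "ennreal ((X a)\<^sup>2 * (Y b)\<^sup>2) * Jrad p s ((\<gamma> - p) / 2) a b < ennreal (Jrad_const \<gamma> p * J0) * (energy_weight s n \<gamma> X a * energy_weight s n \<gamma> Y b)"
proof -
  have ab: "a > s" "b > s" and XY: "X a \<noteq> 0" "Y b \<noteq> 0"
    using nz by (auto simp: energy_weight_def indicator_def split: if_splits)
  have m: "mom s a > 0" "mom s b > 0" using ab s by (auto simp: mom_def intro!: power_strict_mono)
  have "ennreal ((X a)\<^sup>2 * (Y b)\<^sup>2) * (ennreal (Jrad_const \<gamma> p * (mom s a * mom s b) powr (n - 2)) * Jang p s ((\<gamma> - p) / 2) a b) <
    ennreal ((X a)\<^sup>2 * (Y b)\<^sup>2) * (ennreal (Jrad_const \<gamma> p * (mom s a * mom s b) powr (n - 2)) * ennreal (J0 * (a * b) powr \<gamma>))"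
    by (intro ennreal_mult_strict_left_mono J ab) (use XY m Jrad_const_pos in \<open>auto simp: less_top[symmetric]\<close>)
  then show ?thesis unfolding weight_product[OF ab J0] Jrad_weight[OF ab] .
qed

lemma nn_integral_weight_product:
  assumes [measurable]: "X \<in> borel_measurable borel" "Y \<in> borel_measurable borel"
  shows "(\<integral>\<^sup>+a. \<integral>\<^sup>+b. ennreal K * (energy_weight s n \<gamma> X a * energy_weight s n \<gamma> Y b) \<partial>lborel \<partial>lborel) =
    ennreal K * (energy_mass s n \<gamma> X * energy_mass s n \<gamma> Y)"
  unfolding energy_mass_weight by (simp add: nn_integral_cmult nn_integral_multc)

lemma Qrad_mass_le:
  assumes X[measurable]: "X \<in> borel_measurable borel" and Y[measurable]: "Y \<in> borel_measurable borel"
    and nn: "\<And>a. X a \<ge> 0" "\<And>a. Y a \<ge> 0" and J0: "J0 \<ge> 0"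
    and J: "\<And>a b. a > s \<Longrightarrow> b > s \<Longrightarrow> Jang p s ((\<gamma> - p) / 2) a b \<le> ennreal (J0 * (a * b) powr \<gamma>)"
  shows "Qrad p s ((\<gamma> - p) / 2) X Y \<le> ennreal (Jrad_const \<gamma> p * J0) * (energy_mass s n \<gamma> X * energy_mass s n \<gamma> Y)"
proof -
  have "Qrad p s ((\<gamma> - p) / 2) X Y \<le> (\<integral>\<^sup>+a. \<integral>\<^sup>+b. ennreal ((X a)\<^sup>2 * (Y b)\<^sup>2) * Jrad p s ((\<gamma> - p) / 2) a b \<partial>lborel \<partial>lborel)"
    by (rule Qrad_le[OF X Y nn])
  also have "\<dots> \<le> (\<integral>\<^sup>+a. \<integral>\<^sup>+b. ennreal (Jrad_const \<gamma> p * J0) * (energy_weight s n \<gamma> X a * energy_weight s n \<gamma> Y b) \<partial>lborel \<partial>lborel)"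
    by (intro nn_integral_mono weight_le J0 J)
  finally show ?thesis unfolding nn_integral_weight_product[OF X Y] .
qed

text \<open>Strictness survives integration: were the pointwise bound an equality almost everywhere,
  the majorant would vanish almost everywhere, against the nonzero masses. Finite masses exclude the
  comparison of infinities.\<close>

lemma Qrad_mass_less:
  assumes X[measurable]: "X \<in> borel_measurable borel" and Y[measurable]: "Y \<in> borel_measurable borel"
    and nn: "\<And>a. X a \<ge> 0" "\<And>a. Y a \<ge> 0" and J0: "J0 > 0"
    and J: "\<And>a b. a > s \<Longrightarrow> b > s \<Longrightarrow> Jang p s ((\<gamma> - p) / 2) a b < ennreal (J0 * (a * b) powr \<gamma>)"
    and fin: "energy_mass s n \<gamma> X < \<infinity>" "energy_mass s n \<gamma> Y < \<infinity>" and nz: "energy_mass s n \<gamma> X \<noteq> 0" "energy_mass s n \<gamma> Y \<noteq> 0"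
  shows "Qrad p s ((\<gamma> - p) / 2) X Y < ennreal (Jrad_const \<gamma> p * J0) * (energy_mass s n \<gamma> X * energy_mass s n \<gamma> Y)"
proof -
  let ?g = "ennreal (Jrad_const \<gamma> p * J0) * (energy_mass s n \<gamma> X * energy_mass s n \<gamma> Y)"
  let ?f = "lborel \<Otimes>\<^sub>M lborel"
  let ?l = "\<lambda>z. ennreal ((X (fst z))\<^sup>2 * (Y (snd z))\<^sup>2) * Jrad p s ((\<gamma> - p) / 2) (fst z) (snd z)"
  let ?r = "\<lambda>z. ennreal (Jrad_const \<gamma> p * J0) * (energy_weight s n \<gamma> X (fst z) * energy_weight s n \<gamma> Y (snd z))"
  have r: "integral\<^sup>N ?f ?r = ?g"
    by (subst lborel.nn_integral_fst[symmetric], measurable) (simp add: nn_integral_weight_product[OF X Y])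
  have r0: "?g \<noteq> 0"
    using nz J0 Jrad_const_pos by (simp add: not_le[symmetric] mult_le_0_iff)
  have rfin: "?g < \<infinity>"
    using fin by (auto simp: ennreal_mult_less_top)
  have lm: "?l \<in> borel_measurable ?f" by measurable
  have le: "?l z \<le> ?r z" for z
    by (rule weight_le) (use J0 less_imp_le[OF J] in auto)
  have "Qrad p s ((\<gamma> - p) / 2) X Y \<le> (\<integral>\<^sup>+a. \<integral>\<^sup>+b. ennreal ((X a)\<^sup>2 * (Y b)\<^sup>2) * Jrad p s ((\<gamma> - p) / 2) a b \<partial>lborel \<partial>lborel)"
    by (rule Qrad_le[OF X Y nn])
  also have "\<dots> = integral\<^sup>N ?f ?l"
    using lborel.nn_integral_fst[OF lm] by simp
  also have "\<dots> < integral\<^sup>N ?f ?r"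
  proof (rule nn_integral_less)
    show "?l \<in> borel_measurable ?f" "?r \<in> borel_measurable ?f" by measurable
    have "integral\<^sup>N ?f ?l \<le> integral\<^sup>N ?f ?r" by (rule nn_integral_mono) (rule le)
    then show "integral\<^sup>N ?f ?l \<noteq> \<infinity>" using rfin unfolding r by auto
    show "AE z in lborel \<Otimes>\<^sub>M lborel. ?l z \<le> ?r z" by (rule AE_I2) (rule le)
    show "\<not> (AE z in lborel \<Otimes>\<^sub>M lborel. ?r z \<le> ?l z)"
    proof
      assume "AE z in lborel \<Otimes>\<^sub>M lborel. ?r z \<le> ?l z"
      then have "AE z in lborel \<Otimes>\<^sub>M lborel. ?r z = 0"
      proof eventually_elim
        case (elim z)
        then show ?case using weight_less[OF less_imp_le[OF J0] J, of X "fst z" Y "snd z"] by (cases "energy_weight s n \<gamma> X (fst z) * energy_weight s n \<gamma> Y (snd z) = 0") (auto simp: not_less[symmetric])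
      qed
      then have "integral\<^sup>N ?f ?r = 0" by (subst nn_integral_0_iff_AE) auto
      with r0 show False unfolding r by simp
    qed
  qed
  finally show ?thesis unfolding r .
qed

end

text \<open>k is the product of (2 pi)^-(d + 1) from Plancherel in space-time, the square of the
  factor in \<open>kg_product_fourier\<close>, and the constant of \<open>spectral_sqnorm\<close>.
  Finiteness of Q guarantees that the multiplier image is an \<open>L2\<close> function.\<close>

lemma kg_lhs_square:
  fixes f g :: "'a::euclidean_space \<Rightarrow> complex" and F G :: "real \<Rightarrow> complex" and s \<beta> :: real
  assumes d: "DIM('a) \<ge> 2" and Fm[measurable]: "F \<in> borel_measurable borel" and Gm[measurable]: "G \<in> borel_measurable borel"
    and F2: "(\<lambda>\<eta>::'a. F (phi s (norm \<eta>))) \<in> L2" and G2: "(\<lambda>\<eta>::'a. G (phi s (norm \<eta>))) \<in> L2"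
    and f: "has_fourier f (\<lambda>\<eta>. F (phi s (norm \<eta>)))" and g: "has_fourier g (\<lambda>\<eta>. G (phi s (norm \<eta>)))"
  defines "n \<equiv> real DIM('a)"
  defines "Q \<equiv> Qrad ((n - 3) / 2) s \<beta> (\<lambda>E. \<bar>E\<bar> * cmod (F E)) (\<lambda>E. \<bar>E\<bar> * cmod (G E))"
    and "k \<equiv> 2 * pi / ((2 * pi) ^ DIM('a)) ^ 3 * (2 * half_sphere n * (4 * half_sphere (n - 1) * 2 powr (2 - n))\<^sup>2)"
  assumes fin: "Q < \<infinity>"
  shows "(kg_lhs s \<beta> f g)\<^sup>2 \<le> ennreal k * Q"
    and "(\<And>E. F E = complex_of_real (cmod (F E))) \<Longrightarrow> (\<And>E. G E = complex_of_real (cmod (G E))) \<Longrightarrow> (kg_lhs s \<beta> f g)\<^sup>2 = ennreal k * Q"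
proof -
  let ?g = "ennreal (2 * pi / ((2 * pi) ^ DIM('a)) ^ 3)"
  let ?f = "(kg_lhs s \<beta> f g)\<^sup>2"
  have n: "n \<ge> 2" using d by (simp add: n_def)
  have h: "half_sphere (n - 1) > 0" "half_sphere n > 0" using n by (auto intro!: half_sphere_pos)
  let ?c = "2 * pi / (2 * pi) ^ DIM('a)"
  let ?h = "complex_of_real ?c"
  let ?m = "\<lambda>z::real \<times> 'a. complex_of_real (\<bar>(fst z)\<^sup>2 - (norm (snd z))\<^sup>2\<bar> powr \<beta>)"
  let ?W = "spectral_density s F G :: real \<times> 'a \<Rightarrow> complex"
  let ?L = "sqnorm lborel (\<lambda>z. ?m z * ?W z)"
  let ?k = "2 * half_sphere n * (4 * half_sphere (n - 1) * 2 powr (2 - n))\<^sup>2"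
  note ss = spectral_sqnorm[where s = s and \<beta> = \<beta>, OF d Fm Gm, folded n_def, folded Q_def]
  have [measurable]: "(\<lambda>z::real \<times> 'a. fst z) \<in> borel_measurable borel" "(\<lambda>z::real \<times> 'a. snd z) \<in> borel_measurable borel"
    by (intro borel_measurable_continuous_onI continuous_intros)+
  have [measurable]: "?m \<in> borel_measurable borel" by measurable
  have [measurable]: "?W \<in> borel_measurable borel" by (rule spectral_density_measurable) measurable
  have "sqnorm lborel (\<lambda>z. ?m z * (?h * ?W z)) = sqnorm lborel (\<lambda>z. ?h * (?m z * ?W z))"
    by (simp add: mult.left_commute)
  also have "\<dots> = ennreal ((cmod ?h)\<^sup>2) * ?L" by (rule sqnorm_mult_const) measurable
  also have "(cmod ?h)\<^sup>2 = ?c\<^sup>2" unfolding norm_of_real by (rule power2_abs)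
  finally have e: "sqnorm lborel (\<lambda>z. ?m z * (?h * ?W z)) = ennreal (?c\<^sup>2) * ?L" .
  have Lfin: "?L < \<infinity>" using ss(1) fin by (auto simp: ennreal_mult_less_top intro: le_less_trans)
  have efin: "sqnorm lborel (\<lambda>z. ?m z * (?h * ?W z)) < \<infinity>"
    unfolding e using Lfin by (auto simp: ennreal_mult_less_top)
  have "?f = (multiplier_norm ?m (\<lambda>z. kg_propagator s f z * cnj (kg_propagator s g z)))\<^sup>2"
    by (simp add: kg_lhs_def box_norm_def case_prod_beta')
  also have "\<dots> = ennreal (1 / (2 * pi) ^ DIM(real \<times> 'a)) * (ennreal (?c\<^sup>2) * ?L)"
    unfolding e[symmetric]
    by (rule multiplier_norm_square[OF kg_product_fourier[OF Fm Gm F2 G2 f g d] _ efin]) measurable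
  also have "\<dots> = ?g * ?L"
    unfolding mult.assoc[symmetric] by (subst ennreal_mult[symmetric]) (auto simp: power2_eq_square power3_eq_cube field_simps)
  finally have kl: "?f = ?g * ?L" .
  have k: "?g * (ennreal ?k * Q) = ennreal k * Q"
    unfolding k_def mult.assoc[symmetric] using h by (subst ennreal_mult[symmetric]) (auto simp: mult.assoc)
  show "?f \<le> ennreal k * Q" unfolding kl k[symmetric] by (rule mult_left_mono[OF ss(1)]) simp
  assume "\<And>E. F E = complex_of_real (cmod (F E))" "\<And>E. G E = complex_of_real (cmod (G E))"
  from ss(2)[OF F2 G2 this] show "?f = ennreal k * Q" unfolding kl k[symmetric] by simp
qed

section \<open>The constant of the estimate\<close>

lemma ennreal_square_le: "x\<^sup>2 \<le> y\<^sup>2 \<Longrightarrow> x \<le> y" for x y :: ennreal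
  by (cases x; cases y) (auto simp: ennreal_power power2_le_iff_abs_le top_unique)

text \<open>The constant of \<open>kg_lhs_square\<close> divided by the square of 2 half_sphere N /
  (2 pi)^N, which the two squared norms on the right-hand side contribute.\<close>

definition kg_factor :: "nat \<Rightarrow> real" where
  "kg_factor N = 2 * pi * (4 * half_sphere (real N - 1) * 2 powr (2 - real N))\<^sup>2 / ((2 * pi) ^ N * (2 * half_sphere (real N)))"

lemma kg_factor_pos: "N \<ge> 2 \<Longrightarrow> kg_factor N > 0"
  using half_sphere_pos[of "real N - 1"] half_sphere_pos[of "real N"] by (auto simp: kg_factor_def intro!: divide_pos_pos mult_pos_pos)

text \<open>Powers of 2, powers of pi and Gamma factors are collected separately. The square of
  \<open>Gamma (p + 1)\<close> from the two factors \<open>half_sphere (n - 1)\<close> cancels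
  against the two Beta functions, and the functional equation of Gamma at \<gamma> + p + 1 = d - 2 +
  2 \<beta> produces the linear factor in the denominator.\<close>

lemma F_const_eq:
  assumes N: "N \<ge> 2" and p: "p = (real N - 3) / 2" and \<gamma>: "\<gamma> = 2 * \<beta> + p" and g: "\<gamma> \<ge> - 1 / 2" and gp: "\<gamma> + p + 1 > 0"
  shows "kg_factor N * (Jrad_const \<gamma> p * (2 powr (\<gamma> + 1) * Jang_limit p \<gamma>)) = F_const \<beta> (real N)"
proof -
  let ?h = "Gamma (\<gamma> + 2 * p + 2)"
  let ?g = "Gamma (\<gamma> + p + 1)"
  let ?f = "\<lambda>n. 2 * (4 * 2 powr (2 - n))\<^sup>2 / (2 powr n * 2) * (16 powr p / 2) * 2 powr (\<gamma> + 1) * 2 powr (\<gamma> + 2 * p + 1)"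
  define n where "n = real N"
  have n: "n \<ge> 2" using N by (simp add: n_def)
  have g1: "Gamma (\<gamma> + p + 2) = (\<gamma> + p + 1) * ?g"
  proof -
    have "\<gamma> + p + 1 \<notin> \<int>\<^sub>\<le>\<^sub>0" using gp by (auto dest: nonpos_Ints_nonpos)
    from Gamma_plus1[OF this] show ?thesis by (simp add: add.assoc)
  qed
  have pos: "Gamma (p + 1) > 0" "?g > 0" "Gamma (n / 2) > 0" "Gamma (\<gamma> + 1) > 0" "?h > 0"
  proof -
    have "p \<ge> - 1 / 2" using N by (simp add: p)
    then show "Gamma (p + 1) > 0" "?g > 0" "Gamma (n / 2) > 0" "Gamma (\<gamma> + 1) > 0" "?h > 0"
      using n g gp by (auto intro!: Gamma_real_pos)
  qed
  have e: "n - 2 + 2 * \<beta> = \<gamma> + p + 1" "(n - 1) / 2 + 2 * \<beta> = \<gamma> + 1" "(3 * n - 5) / 2 + 2 * \<beta> = \<gamma> + 2 * p + 2" "(n - 1) / 2 = p + 1"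
    by (auto simp: \<gamma> p n_def field_simps)
  have pw: "(2 * pi) ^ N = 2 powr n * pi powr n"
    by (simp add: n_def powr_realpow[symmetric] powr_mult)
  have two: "?f n = 2 powr (n - 3 + 4 * \<beta>)"
  proof -
    have P: "16 powr p = 2 powr (4 * p)" using powr_powr[of "2::real" 4 p] by simp
    have "4 * 2 powr (2 - n) = 2 powr (4 - n)" using powr_add[of "2::real" 2 "2 - n"] by simp
    then have Q: "(4 * 2 powr (2 - n))\<^sup>2 = 2 powr (8 - 2 * n)" using powr_add[of "2::real" "4 - n" "4 - n"] by (simp add: power2_eq_square)
    have Z: "2 powr n * 2 = 2 powr (n + 1)" by (simp add: powr_add)
    have "8 - 2 * n + 4 * p + (\<gamma> + 1) + (\<gamma> + 2 * p + 1) = (n - 3 + 4 * \<beta>) + (n + 1)"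
      by (simp add: \<gamma> p n_def field_simps)
    then have "2 powr (8 - 2 * n) * 2 powr (4 * p) * 2 powr (\<gamma> + 1) * 2 powr (\<gamma> + 2 * p + 1) = 2 powr (n - 3 + 4 * \<beta>) * 2 powr (n + 1)"
      by (simp only: powr_add[symmetric])
    moreover have "2 * X / Z * (P / 2) * A * B = X * P * A * B / Z" for X Z P A B :: real by simp
    ultimately show ?thesis unfolding P Q Z by simp
  qed
  have pis: "pi * (pi powr ((n - 1) / 2))\<^sup>2 / (pi powr n * pi powr (n / 2)) = pi powr (- n / 2)"
  proof -
    have "pi * (pi powr ((n - 1) / 2))\<^sup>2 = pi powr (1 + ((n - 1) / 2 + (n - 1) / 2))"
      unfolding powr_add power2_eq_square by simp
    also have "1 + ((n - 1) / 2 + (n - 1) / 2) = - n / 2 + (n + n / 2)" by (simp add: field_simps)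
    finally show ?thesis unfolding powr_add by (simp add: field_simps)
  qed
  have "kg_factor N * (Jrad_const \<gamma> p * (2 powr (\<gamma> + 1) * Jang_limit p \<gamma>)) =
    (?f n) *
    (pi * (pi powr ((n - 1) / 2))\<^sup>2 / (pi powr n * pi powr (n / 2))) *
    (Gamma (n / 2) * Gamma (\<gamma> + 1) * (Gamma (p + 1) / Gamma (p + 1))\<^sup>2 * ?g / (Gamma (\<gamma> + p + 2) * ?h))"
    unfolding kg_factor_def Jrad_const_def Jang_limit_def half_sphere_def Beta_def pw n_def[symmetric] e(4)
    by (simp add: power_divide power_mult_distrib add_ac) (simp add: field_simps power2_eq_square)
  also have "\<dots> = 2 powr (n - 3 + 4 * \<beta>) * pi powr (- n / 2) * (Gamma (n / 2) * Gamma (\<gamma> + 1) / ((\<gamma> + p + 1) * ?h))"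
  proof -
    have "?g \<noteq> 0" "Gamma (p + 1) \<noteq> 0" using pos by linarith+
    then show ?thesis unfolding two pis g1 by simp
  qed
  also have "\<dots> = F_const \<beta> n" unfolding F_const_def e(1-3) by simp
  finally show ?thesis by (simp add: n_def)
qed

context
  fixes s \<beta> n p \<gamma> :: real and f g :: "'a::euclidean_space \<Rightarrow> complex"
  assumes s: "s > 0" and d: "DIM('a) \<ge> 2" and n_def: "n = real DIM('a)" and p: "p = (n - 3) / 2" and \<gamma>: "\<gamma> = 2 * \<beta> + p"
    and g0: "\<gamma> \<ge> - 1 / 2" and gp: "\<gamma> + p + 1 > 0"
begin

lemma kg_exponent_eq: "kg_exponent TYPE('a) \<beta> \<ge> 0" "2 * kg_exponent TYPE('a) \<beta> - 1 = \<gamma>" "\<beta> = (\<gamma> - p) / 2"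
  using g0 d by (auto simp: kg_exponent_def \<gamma> p n_def field_simps)

lemma kg_constant_split:
  "2 * pi / ((2 * pi) ^ DIM('a)) ^ 3 * (2 * half_sphere n * (4 * half_sphere (n - 1) * 2 powr (2 - n))\<^sup>2) = kg_factor DIM('a) * (2 * half_sphere n / (2 * pi) ^ DIM('a))\<^sup>2"
proof -
  have "half_sphere n > 0" using d by (intro half_sphere_pos) (simp add: n_def)
  moreover have "2 * pi / T ^ 3 * (2 * h * A\<^sup>2) = 2 * pi * A\<^sup>2 / (T * (2 * h)) * (2 * h / T)\<^sup>2" if "T \<noteq> 0" "h \<noteq> 0" for A T h :: real
    using that by (simp add: power2_eq_square power3_eq_cube field_simps)
  ultimately show ?thesis unfolding kg_factor_def n_def[symmetric] by (metis less_irrefl pi_neq_zero power_not_zero mult_eq_0_iff zero_neq_numeral)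
qed

text \<open>J0 is left open so that one argument serves twice: with a crude bound on the angular
  average for the mere existence of a constant, and with the sharp strict bound for the optimal
  one.\<close>

lemma kg_upper:
  assumes f: "f \<in> radial_data s \<beta>" and g: "g \<in> radial_data s \<beta>" and J0: "J0 > 0"
    and J: "\<And>a b. a > s \<Longrightarrow> b > s \<Longrightarrow> Jang p s \<beta> a b \<le> ennreal (J0 * (a * b) powr \<gamma>)"
  shows "kg_lhs s \<beta> f g \<le> ennreal (sqrt (kg_factor DIM('a) * (Jrad_const \<gamma> p * J0))) * kg_rhs s \<beta> f g"
    and "(\<And>a b. a > s \<Longrightarrow> b > s \<Longrightarrow> Jang p s \<beta> a b < ennreal (J0 * (a * b) powr \<gamma>)) \<Longrightarrow>
      \<not> (AE x in lborel. f x = 0) \<Longrightarrow> \<not> (AE x in lborel. g x = 0) \<Longrightarrow>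
      kg_lhs s \<beta> f g \<noteq> ennreal (sqrt (kg_factor DIM('a) * (Jrad_const \<gamma> p * J0))) * kg_rhs s \<beta> f g"
proof -
  let ?B = "kg_lhs s \<beta> f g"
  let ?A = "kg_exponent TYPE('a) \<beta>"
  let ?h = "2 * half_sphere n / (2 * pi) ^ DIM('a)"
  let ?g = "ennreal (Jrad_const \<gamma> p * J0)"
  let ?f = "ennreal (sqrt (kg_factor DIM('a) * (Jrad_const \<gamma> p * J0))) * kg_rhs s \<beta> f g"
  have n2: "n \<ge> 2" using d by (simp add: n_def)
  have h: "half_sphere n > 0" using n2 by (intro half_sphere_pos) simp
  note K = Jrad_const_pos[OF s n2 p gp g0]
  note kf = kg_factor_pos[OF d]
  obtain F where F: "F \<in> borel_measurable borel" "(\<lambda>\<xi>::'a. F (phi s (norm \<xi>))) \<in> L2" "has_fourier f (\<lambda>\<xi>. F (phi s (norm \<xi>)))"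
    "energy_mass s n \<gamma> (\<lambda>E. \<bar>E\<bar> * cmod (F E)) < \<infinity>" "\<And>E. E \<le> s \<Longrightarrow> F E = 0" "\<not> (AE x in lborel. f x = 0) \<Longrightarrow> energy_mass s n \<gamma> (\<lambda>E. \<bar>E\<bar> * cmod (F E)) \<noteq> 0"
    by (rule radial_data_profile[OF s f kg_exponent_eq(1), unfolded kg_exponent_eq(2), folded n_def]) blast
  obtain G where G: "G \<in> borel_measurable borel" "(\<lambda>\<xi>::'a. G (phi s (norm \<xi>))) \<in> L2" "has_fourier g (\<lambda>\<xi>. G (phi s (norm \<xi>)))"
    "energy_mass s n \<gamma> (\<lambda>E. \<bar>E\<bar> * cmod (G E)) < \<infinity>" "\<And>E. E \<le> s \<Longrightarrow> G E = 0" "\<not> (AE x in lborel. g x = 0) \<Longrightarrow> energy_mass s n \<gamma> (\<lambda>E. \<bar>E\<bar> * cmod (G E)) \<noteq> 0"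
    by (rule radial_data_profile[OF s g kg_exponent_eq(1), unfolded kg_exponent_eq(2), folded n_def]) blast
  note [measurable] = F(1) G(1)
  let ?X = "\<lambda>E. \<bar>E\<bar> * cmod (F E)" and ?Y = "\<lambda>E. \<bar>E\<bar> * cmod (G E)"
  let ?M = "energy_mass s n \<gamma> ?X * energy_mass s n \<gamma> ?Y"
  let ?Q = "Qrad p s \<beta> ?X ?Y"
  let ?k = "kg_factor DIM('a) * ?h\<^sup>2"
  have X: "?X \<in> borel_measurable borel" "?Y \<in> borel_measurable borel" by measurable
  have Q: "?Q \<le> ?g * ?M"
    using Qrad_mass_le[OF s n2 p gp g0 X _ _ less_imp_le[OF J0]] J unfolding kg_exponent_eq(3)[symmetric] by simp
  have Mfin: "?g * ?M < \<infinity>" using F(4) G(4) by (auto simp: ennreal_mult_less_top)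
  then have Qfin: "?Q < \<infinity>" using Q by (rule le_less_trans[rotated])
  have L: "?B\<^sup>2 \<le> ennreal ?k * ?Q"
    using kg_lhs_square(1)[OF d F(1) G(1) F(2) G(2) F(3) G(3), of \<beta>, folded n_def, folded p, OF Qfin] unfolding kg_constant_split .
  have pf: "(phi_norm s ?A f)\<^sup>2 = ennreal ?h * energy_mass s n \<gamma> ?X"
    using phi_norm_square[OF F(1) s F(3), of "?A"] F(4) unfolding kg_exponent_eq(2) n_def[symmetric] by simp
  have pg: "(phi_norm s ?A g)\<^sup>2 = ennreal ?h * energy_mass s n \<gamma> ?Y"
    using phi_norm_square[OF G(1) s G(3), of "?A"] G(4) unfolding kg_exponent_eq(2) n_def[symmetric] by simp
  have R: "(kg_rhs s \<beta> f g)\<^sup>2 = ennreal (?h\<^sup>2) * ?M"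
  proof -
    have "ennreal v * A * (ennreal v * B) = ennreal (v\<^sup>2) * (A * B)" if "v \<ge> 0" for v A B
      using that by (simp add: power2_eq_square ennreal_mult mult_ac)
    then show ?thesis unfolding kg_rhs_def power_mult_distrib pf pg using h by simp
  qed
  have CR: "?f\<^sup>2 = ennreal ?k * (?g * ?M)"
    unfolding power_mult_distrib R using kf K J0 h by (simp add: ennreal_power ennreal_mult mult_ac)
  have "?B\<^sup>2 \<le> ?f\<^sup>2"
    unfolding CR using L mult_left_mono[OF Q, of "ennreal ?k"] by auto
  then show "?B \<le> ?f" by (rule ennreal_square_le)
  assume J': "\<And>a b. a > s \<Longrightarrow> b > s \<Longrightarrow> Jang p s \<beta> a b < ennreal (J0 * (a * b) powr \<gamma>)"
    and nz: "\<not> (AE x in lborel. f x = 0)" "\<not> (AE x in lborel. g x = 0)"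
  have "?Q < ?g * ?M"
    using Qrad_mass_less[OF s n2 p gp g0 X _ _ J0 _ F(4) G(4) F(6)[OF nz(1)] G(6)[OF nz(2)]] J' unfolding kg_exponent_eq(3)[symmetric] by simp
  then have "ennreal ?k * ?Q < ennreal ?k * (?g * ?M)"
    using kf h by (intro ennreal_mult_strict_left_mono) auto
  with L have "?B\<^sup>2 < ?f\<^sup>2" unfolding CR by simp
  then show "?B \<noteq> ?f" by auto
qed

end

section \<open>Optimality\<close>

lemma nn_integral_erlang: "l > 0 \<Longrightarrow> (\<integral>\<^sup>+x. ennreal (erlang_density k l x) \<partial>lborel) = 1"
  using prob_space.emeasure_space_1[OF prob_space_erlang_density[of l k]] by (simp add: emeasure_density)

lemma mom_bounds: assumes "s > 0" "a > s" shows "0 < mom s a" "mom s a \<le> a"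
proof -
  have "s\<^sup>2 < a\<^sup>2" using assms by (intro power_strict_mono) auto
  then show "0 < mom s a" by (simp add: mom_def)
  have "sqrt (a\<^sup>2 - s\<^sup>2) \<le> sqrt (a\<^sup>2)" by (rule real_sqrt_le_mono) simp
  then show "mom s a \<le> a" using assms by (simp add: mom_def)
qed

text \<open>An Erlang density of integer order m above the polynomial growth dominates the weighted
  exponential; the factor \<open>s powr (\<kappa> - m)\<close> pays for rounding \<kappa> up to
  m.\<close>

lemma exp_mass_finite:
  assumes s: "s > 0" and e: "\<epsilon> > 0" and n: "n \<ge> 2" and X: "\<And>a. a > s \<Longrightarrow> X a = exp (- (\<epsilon> * a))"
  shows "energy_mass s n \<gamma> X < \<infinity>"
proof -
  let ?f = "\<lambda>a. a powr \<gamma> * mom s a powr (n - 2)"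
  define \<kappa> where "\<kappa> = \<gamma> + n - 2"
  define m where "m = nat \<lceil>\<kappa>\<rceil>"
  have m: "\<kappa> \<le> real m" unfolding m_def by linarith
  define C where "C = s powr (\<kappa> - m) * (fact m / (2 * \<epsilon>) ^ Suc m)"
  have C: "C \<ge> 0" using e by (simp add: C_def)
  have "energy_mass s n \<gamma> X \<le> (\<integral>\<^sup>+a. ennreal C * ennreal (erlang_density m (2 * \<epsilon>) a) \<partial>lborel)"
    unfolding energy_mass_def
  proof (rule nn_integral_mono)
    fix a
    show "ennreal ((X a)\<^sup>2 * (?f a)) * indicator {s<..} a \<le> ennreal C * ennreal (erlang_density m (2 * \<epsilon>) a)"
    proof (cases "a > s")
      case True
      then have a: "a > 0" using s by simp
      have "mom s a powr (n - 2) \<le> a powr (n - 2)"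
        using mom_bounds[OF s True] n by (intro powr_mono2) auto
      then have "?f a \<le> a powr \<gamma> * a powr (n - 2)" by (rule mult_left_mono) simp
      also have "\<dots> = a powr (\<kappa> - m) * a powr m" unfolding powr_add[symmetric] by (simp add: \<kappa>_def algebra_simps)
      also have "\<dots> \<le> s powr (\<kappa> - m) * a powr m"
        using m s True by (intro mult_right_mono powr_mono2') auto
      finally have b: "?f a \<le> s powr (\<kappa> - m) * a ^ m" using a by (simp add: powr_realpow)
      have X2: "(X a)\<^sup>2 = exp (- (2 * \<epsilon> * a))" unfolding X[OF True] by (simp add: power2_eq_square flip: exp_add)
      have "(X a)\<^sup>2 * (?f a) \<le> exp (- (2 * \<epsilon> * a)) * (s powr (\<kappa> - m) * a ^ m)"
        unfolding X2 by (rule mult_left_mono[OF b]) simp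
      also have "\<dots> = C * erlang_density m (2 * \<epsilon>) a"
        using a e by (simp add: C_def erlang_density_def field_simps)
      finally show ?thesis using True C by (simp add: ennreal_mult'[symmetric] ennreal_leI)
    qed simp
  qed
  also have "\<dots> = ennreal C" using e by (subst nn_integral_cmult) (auto simp: nn_integral_erlang)
  finally show ?thesis by (simp add: le_less_trans)
qed

text \<open>The mass below R has a bound B common to all profiles of size at most 1, so B can be
  fixed before the decay rate of the exponential is chosen.\<close>

lemma energy_mass_split:
  fixes s \<gamma> n R :: real
  assumes s: "s > 0" and n: "n \<ge> 2" and R: "R > s"
  obtains B where "B \<ge> 0" "\<And>X. X \<in> borel_measurable borel \<Longrightarrow> (\<And>a. a > s \<Longrightarrow> \<bar>X a\<bar> \<le> 1) \<Longrightarrow>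
    energy_mass s n \<gamma> X \<le> (\<integral>\<^sup>+a. energy_weight s n \<gamma> X a * indicator {R..} a \<partial>lborel) + ennreal B"
proof
  let ?f = "\<lambda>X a. energy_weight s n \<gamma> X a"
  define b where "b = (s powr \<gamma> + R powr \<gamma>) * R powr (n - 2)"
  have b: "b \<ge> 0" by (simp add: b_def)
  show "b * (R - s) \<ge> 0" using b R by simp
  fix X :: "real \<Rightarrow> real" assume [measurable]: "X \<in> borel_measurable borel" and X: "\<And>a. a > s \<Longrightarrow> \<bar>X a\<bar> \<le> 1"
  have "energy_mass s n \<gamma> X \<le> (\<integral>\<^sup>+a. ?f X a * indicator {R..} a + ennreal b * indicator {s..R} a \<partial>lborel)"
    unfolding energy_mass_weight
  proof (rule nn_integral_mono)
    fix a
    consider "a \<le> s" | "a \<ge> R" | "s < a" "a < R" by linarith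
    then show "?f X a \<le> ?f X a * indicator {R..} a + ennreal b * indicator {s..R} a"
    proof cases
      case 3
      \<comment> \<open>The sum covers both signs of \<gamma>: one end of the interval carries the
        maximum.\<close>
      have "a powr \<gamma> \<le> s powr \<gamma> + R powr \<gamma>"
      proof (cases "\<gamma> \<ge> 0")
        case True
        then have "a powr \<gamma> \<le> R powr \<gamma>" using 3 s by (intro powr_mono2) auto
        then show ?thesis by (simp add: add_increasing)
      next
        case False
        then have "a powr \<gamma> \<le> s powr \<gamma>" using 3 s by (intro powr_mono2') auto
        then show ?thesis by (simp add: add_increasing2)
      qed
      moreover have "mom s a powr (n - 2) \<le> R powr (n - 2)"
        using mom_bounds[OF s 3(1)] 3 n by (intro powr_mono2) auto
      ultimately have "a powr \<gamma> * mom s a powr (n - 2) \<le> b" unfolding b_def by (intro mult_mono) auto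
      moreover have "(X a)\<^sup>2 \<le> 1" using X[OF 3(1)] by (simp add: abs_square_le_1)
      ultimately have "(X a)\<^sup>2 * (a powr \<gamma> * mom s a powr (n - 2)) \<le> 1 * b" by (intro mult_mono) auto
      then show ?thesis using 3 by (simp add: energy_weight_def ennreal_leI)
    qed (simp_all add: energy_weight_def)
  qed
  also have "\<dots> = (\<integral>\<^sup>+a. ?f X a * indicator {R..} a \<partial>lborel) + ennreal b * ennreal (R - s)"
    using R by (subst nn_integral_add) (auto simp: nn_integral_cmult_indicator)
  also have "ennreal b * ennreal (R - s) = ennreal (b * (R - s))" using b R by (simp add: ennreal_mult)
  finally show "energy_mass s n \<gamma> X \<le> (\<integral>\<^sup>+a. ?f X a * indicator {R..} a \<partial>lborel) + ennreal (b * (R - s))" .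
qed

text \<open>In the worst case \<gamma> = -1/2, n = 2 the weight still behaves like a^(-1/2), which
  is not integrable at infinity. On [A, 2A] with \<epsilon> = 1/(4A) the squared exponential is at
  least 1/e, so the mass is at least sqrt (A/2) / e; the last entry in the maximum defining A makes
  this at least K.\<close>

lemma exp_mass_unbounded:
  fixes s \<gamma> n R K :: real
  assumes s: "s > 0" and n: "n \<ge> 2" and g: "\<gamma> \<ge> - 1 / 2"
  obtains \<epsilon> where "\<epsilon> > 0" "\<And>X. X \<in> borel_measurable borel \<Longrightarrow> (\<And>a. a > s \<Longrightarrow> X a = exp (- (\<epsilon> * a))) \<Longrightarrow>
    ennreal K \<le> (\<integral>\<^sup>+a. energy_weight s n \<gamma> X a * indicator {R..} a \<partial>lborel)"
proof -
  let ?f = "\<lambda>X. (\<integral>\<^sup>+a. energy_weight s n \<gamma> X a * indicator {R..} a \<partial>lborel)"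
  define A where "A = Max {1, R, s + 1, 2 * (K * exp 1)\<^sup>2}"
  have A: "A \<ge> 1" "A \<ge> R" "A \<ge> s + 1" "A \<ge> 2 * (K * exp 1)\<^sup>2" by (auto simp: A_def)
  define \<epsilon> where "\<epsilon> = 1 / (4 * A)"
  show thesis
  proof
    show "\<epsilon> > 0" using A by (simp add: \<epsilon>_def)
    fix X :: "real \<Rightarrow> real" assume [measurable]: "X \<in> borel_measurable borel" and X: "\<And>a. a > s \<Longrightarrow> X a = exp (- (\<epsilon> * a))"
    define c where "c = exp (- 1) * (2 * A) powr (- 1 / 2)"
    have "K * exp 1 \<le> \<bar>K * exp 1\<bar>" by simp
    also have "\<dots> = sqrt ((K * exp 1)\<^sup>2)" by simp
    also have "\<dots> \<le> sqrt (A / 2)" using A(4) by (intro real_sqrt_le_mono) simp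
    finally have "K \<le> exp (- 1) * sqrt (A / 2)" by (simp add: exp_minus field_simps)
    also have "sqrt (A / 2) = (2 * A) powr (- 1 / 2) * A"
    proof -
      have P: "(2 * A) powr (- 1 / 2) = 1 / sqrt (2 * A)" using A by (simp add: powr_minus_divide powr_half_sqrt)
      have "sqrt (A / 2) * sqrt (2 * A) = A" using A by (simp add: real_sqrt_mult[symmetric])
      moreover have "sqrt (2 * A) \<noteq> 0" using A by simp
      ultimately have "sqrt (A / 2) = A / sqrt (2 * A)" by (simp add: eq_divide_eq)
      then show ?thesis unfolding P by simp
    qed
    finally have K: "K \<le> c * A" by (simp add: c_def mult.assoc)
    have "ennreal K \<le> ennreal (c * A)" by (rule ennreal_leI[OF K])
    also have "\<dots> = ennreal c * ennreal (2 * A - A)" using A by (simp add: c_def ennreal_mult)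
    also have "\<dots> = (\<integral>\<^sup>+a. ennreal c * indicator {A..2 * A} a \<partial>lborel)" using A by (subst nn_integral_cmult_indicator) auto
    also have "\<dots> \<le> ?f X"
    proof (rule nn_integral_mono)
      fix a
      show "ennreal c * indicator {A..2 * A} a \<le> energy_weight s n \<gamma> X a * indicator {R..} a"
      proof (cases "a \<in> {A..2 * A}")
        case True
        then have a: "a > s" "a \<ge> R" "a \<ge> 1" "a \<le> 2 * A" "a \<ge> s + 1" using A by auto
        have "(X a)\<^sup>2 = exp (- (2 * \<epsilon> * a))" unfolding X[OF a(1)] by (simp add: power2_eq_square flip: exp_add)
        moreover have "2 * \<epsilon> * a \<le> 1" using a A by (simp add: \<epsilon>_def field_simps)
        ultimately have x: "exp (- 1) \<le> (X a)\<^sup>2" by simp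
        have "(2 * A) powr (- 1 / 2) \<le> a powr (- 1 / 2)" using a by (intro powr_mono2') auto
        also have "\<dots> \<le> a powr \<gamma>" using g a by (intro powr_mono) auto
        finally have y: "(2 * A) powr (- 1 / 2) \<le> a powr \<gamma>" .
        have "1 \<le> 1 + 2 * s" using s by simp
        also have "\<dots> = (s + 1)\<^sup>2 - s\<^sup>2" by (simp add: power2_eq_square algebra_simps)
        also have "\<dots> \<le> a\<^sup>2 - s\<^sup>2" using a(5) s by (intro diff_right_mono power_mono) auto
        finally have "1 \<le> mom s a" by (simp add: mom_def)
        then have z: "1 \<le> mom s a powr (n - 2)" using n by (intro ge_one_powr_ge_zero) auto
        have "c * 1 \<le> (X a)\<^sup>2 * a powr \<gamma> * mom s a powr (n - 2)"
          unfolding c_def by (intro mult_mono x y z) auto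
        then show ?thesis using a True by (simp add: energy_weight_def ennreal_leI mult.assoc)
      qed simp
    qed
    finally show "ennreal K \<le> ?f X" .
  qed
qed

text \<open>Covers the whole range of \<beta>: nonnegative \<gamma> by the crude bound, negative
  \<gamma> by convexity.\<close>

lemma Jang_bounded:
  assumes s: "s > 0" and p: "p > - 1" and gp: "\<gamma> + p + 1 > 0" and g: "\<gamma> \<ge> - 1 / 2"
  shows "\<exists>J>0. \<forall>a>s. \<forall>b>s. Jang p s ((\<gamma> - p) / 2) a b \<le> ennreal (J * (a * b) powr \<gamma>)"
proof (cases "\<gamma> \<ge> 0")
  case True
  have "2 powr (\<gamma> + 1) * (2 powr \<gamma> * Jang_limit p 0) > 0" using p by (intro mult_pos_pos Jang_limit_pos) auto
  moreover have "Jang p s ((\<gamma> - p) / 2) a b \<le> ennreal (2 powr (\<gamma> + 1) * (2 powr \<gamma> * Jang_limit p 0) * (a * b) powr \<gamma>)" if "a > s" "b > s" for a b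
    using Jang_le_pos[OF s that p g True] by (simp add: mult_ac)
  ultimately show ?thesis by blast
next
  case False
  have "2 powr (\<gamma> + 1) * Jang_limit p \<gamma> > 0" using p gp by (intro mult_pos_pos Jang_limit_pos) auto
  moreover have "Jang p s ((\<gamma> - p) / 2) a b \<le> ennreal (2 powr (\<gamma> + 1) * Jang_limit p \<gamma> * (a * b) powr \<gamma>)" if "a > s" "b > s" for a b
    using Jang_less[OF s that p g _ gp] False by (simp add: mult_ac less_imp_le)
  ultimately show ?thesis by blast
qed

context
  fixes s \<beta> n p \<gamma> :: real and dummy :: "'a::euclidean_space itself"
  assumes s: "s > 0" and d: "DIM('a) \<ge> 2" and n_def: "n = real DIM('a)" and p: "p = (n - 3) / 2" and \<gamma>: "\<gamma> = 2 * \<beta> + p"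
    and g0: "\<gamma> \<ge> - 1 / 2" and gp: "\<gamma> + p + 1 > 0"
begin

text \<open>For exponential profiles the form equals its diagonal majorant, the angular average is
  at least 1 - \<delta> times its limit above R, and for a suitable \<epsilon> the total mass is at
  most 1 + \<delta> times the mass above R. The order of the choices is R, then B, then
  \<epsilon>.\<close>

lemma kg_lower_approx:
  assumes C: "C \<in> kg_constants TYPE('a) s \<beta>" and \<delta>: "0 < \<delta>" "\<delta> < 1"
  shows "kg_factor DIM('a) * (Jrad_const \<gamma> p * (2 powr (\<gamma> + 1) * Jang_limit p \<gamma>)) * (1 - \<delta>) \<le> C\<^sup>2 * (1 + \<delta>)\<^sup>2"
proof -
  let ?D = "kg_exponent TYPE('a) \<beta>"
  let ?B = "\<lambda>r. r * (1 + \<delta>)"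
  let ?A = "\<lambda>F s. \<lambda>\<xi>::'a. F (phi s (norm \<xi>))"
  let ?h = "\<lambda>X a b. ennreal ((X a)\<^sup>2 * (X b)\<^sup>2)"
  let ?g = "\<lambda>v. ennreal (kg_factor DIM('a) * v\<^sup>2)"
  let ?f = "\<lambda>\<gamma> J0. ennreal (Jrad_const \<gamma> p * ((1 - \<delta>) * J0))"
  have n2: "n \<ge> 2" using d by (simp add: n_def)
  have h: "half_sphere n > 0" using n2 by (intro half_sphere_pos) simp
  have C0: "C > 0" and CC: "\<And>f g :: 'a \<Rightarrow> complex. f \<in> radial_data s \<beta> \<Longrightarrow> g \<in> radial_data s \<beta> \<Longrightarrow> kg_lhs s \<beta> f g \<le> ennreal C * kg_rhs s \<beta> f g"
    using C by (auto simp: kg_constants_def)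
  note ex = kg_exponent_eq[OF s d n_def p \<gamma> g0 gp]
  define J0 where "J0 = 2 powr (\<gamma> + 1) * Jang_limit p \<gamma>"
  have p1: "p > - 1" using n2 by (simp add: p)
  have J0: "J0 > 0" unfolding J0_def using Jang_limit_pos[OF p1 gp] by simp
  note K = Jrad_const_pos[OF s n2 p gp g0]
  note kf = kg_factor_pos[OF d]
  obtain R where R: "R > s" and low: "\<And>a b. a \<ge> R \<Longrightarrow> b \<ge> R \<Longrightarrow> ennreal ((1 - \<delta>) * (2 powr (\<gamma> + 1) * (a * b) powr \<gamma> * Jang_limit p \<gamma>)) \<le> Jang p s ((\<gamma> - p) / 2) a b"
    using Jang_lower[OF s p1 g0 gp \<delta>(1)] by blast
  obtain B where B: "B \<ge> 0" "\<And>X. X \<in> borel_measurable borel \<Longrightarrow> (\<And>a. a > s \<Longrightarrow> \<bar>X a\<bar> \<le> 1) \<Longrightarrow>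
    energy_mass s n \<gamma> X \<le> (\<integral>\<^sup>+a. energy_weight s n \<gamma> X a * indicator {R..} a \<partial>lborel) + ennreal B"
    using energy_mass_split[OF s n2 R] by blast
  \<comment> \<open>The threshold B / \<delta> + 1 makes the low-energy mass at most \<delta> times
    the mass above R; the summand 1 keeps the latter positive also if B = 0.\<close>
  obtain \<epsilon> where \<epsilon>: "\<epsilon> > 0" and big: "\<And>X. X \<in> borel_measurable borel \<Longrightarrow> (\<And>a. a > s \<Longrightarrow> X a = exp (- (\<epsilon> * a))) \<Longrightarrow>
    ennreal (B / \<delta> + 1) \<le> (\<integral>\<^sup>+a. energy_weight s n \<gamma> X a * indicator {R..} a \<partial>lborel)"
    using exp_mass_unbounded[OF s n2 g0] by blast
  \<comment> \<open>Division by the energy makes X an exact exponential at positive energies, which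
    is what equality in \<open>Qrad_eq\<close> needs.\<close>
  define F where "F E = complex_of_real (exp (- (\<epsilon> * E)) / \<bar>E\<bar>)" for E
  define X where "X E = \<bar>E\<bar> * cmod (F E)" for E
  have Fm[measurable]: "F \<in> borel_measurable borel" unfolding F_def by measurable
  have Xm[measurable]: "X \<in> borel_measurable borel" unfolding X_def by measurable
  have X_eq: "X a = exp (- (\<epsilon> * a))" if "a > 0" for a using that by (simp add: X_def F_def norm_divide)
  have Xs: "X a = exp (- (\<epsilon> * a))" if "a > s" for a using that s by (intro X_eq) simp
  have Fr: "F E = complex_of_real (cmod (F E))" for E by (simp add: F_def norm_divide norm_of_real)
  have mfin: "energy_mass s n \<gamma>' X < \<infinity>" for \<gamma>' by (rule exp_mass_finite[OF s \<epsilon> n2 Xs])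
  have F2: "(?A F s) \<in> L2"
    unfolding L2_iff
  proof
    have "sqnorm lborel (?A F s) = sqnorm lborel (\<lambda>\<xi>::'a. complex_of_real (phi s (norm \<xi>) powr 0) * F (phi s (norm \<xi>)))"
    proof (rule nn_integral_cong)
      fix \<xi> :: 'a
      have "phi s (norm \<xi>) > 0" using phi_ge[OF s, of "norm \<xi>"] s by linarith
      then show "ennreal ((cmod (F (phi s (norm \<xi>))))\<^sup>2) = ennreal ((cmod (complex_of_real (phi s (norm \<xi>) powr 0) * F (phi s (norm \<xi>))))\<^sup>2)" by simp
    qed
    also have "\<dots> < \<infinity>" unfolding phi_norm_integral[OF Fm s] using mfin[of "2 * 0 - 1"] by (auto simp: X_def[abs_def] n_def ennreal_mult_less_top)
    finally show "sqnorm lborel (?A F s) < \<infinity>" .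
  qed measurable
  define f where "f = inv_fourier (?A F s)"
  have hf: "has_fourier f (\<lambda>\<xi>. F (phi s (norm \<xi>)))" unfolding f_def by (rule has_fourier_inv_fourier[OF F2])
  have rf: "radial f" unfolding f_def by (rule radial_inv_fourier) (auto simp: radial_def)
  define v where "v = 2 * half_sphere n / (2 * pi) ^ DIM('a)"
  have v: "v > 0" using h by (simp add: v_def)
  let ?M = "energy_mass s n \<gamma> X"
  let ?k = "\<lambda>v. ennreal (C\<^sup>2) * ((ennreal v * ?M) * (ennreal v * ?M))"
  have pf: "(phi_norm s ?D f)\<^sup>2 = ennreal v * ?M"
    using phi_norm_square[OF Fm s hf, of "?D"] mfin[of \<gamma>] unfolding ex(2) n_def[symmetric] v_def X_def[symmetric] by simp
  have "(phi_norm s ?D f)\<^sup>2 < \<infinity>" unfolding pf using mfin[of \<gamma>] by (simp add: ennreal_mult_less_top)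
  then have "phi_norm s ?D f < \<infinity>" by (auto simp: power2_eq_square ennreal_mult_less_top less_top[symmetric])
  then have fr: "f \<in> radial_data s \<beta>" using rf by (simp add: radial_data_def)
  let ?Q = "Qrad p s \<beta> X X"
  have Q: "?Q = (\<integral>\<^sup>+a. \<integral>\<^sup>+b. ?h X a b * Jrad p s \<beta> a b \<partial>lborel \<partial>lborel)"
    by (rule Qrad_eq[OF Xm Xm]) (auto simp: X_eq algebra_simps simp flip: exp_add, auto simp: X_def)
  let ?W = "energy_weight s n \<gamma> X"
  define I where "I = (\<integral>\<^sup>+a. ?W a * indicator {R..} a \<partial>lborel)"
  have lowQ: "?f \<gamma> J0 * (I * I) \<le> ?Q"
  proof -
    have "?f \<gamma> J0 * (I * I) = (\<integral>\<^sup>+a. \<integral>\<^sup>+b. ?f \<gamma> J0 * ((?W a * indicator {R..} a) * (?W b * indicator {R..} b)) \<partial>lborel \<partial>lborel)"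
      unfolding I_def by (simp add: nn_integral_cmult nn_integral_multc)
    also have "\<dots> \<le> ?Q" unfolding Q
    proof (rule nn_integral_mono, rule nn_integral_mono)
      fix a b
      show "?f \<gamma> J0 * ((?W a * indicator {R..} a) * (?W b * indicator {R..} b)) \<le> ?h X a b * Jrad p s \<beta> a b"
      proof (cases "a \<ge> R \<and> b \<ge> R")
        case True
        then have ab: "a > s" "b > s" using R by auto
        have "?f \<gamma> J0 * (?W a * ?W b) = ?h X a b * (ennreal (Jrad_const \<gamma> p * (mom s a * mom s b) powr (n - 2)) * ennreal (((1 - \<delta>) * J0) * (a * b) powr \<gamma>))"
          by (rule weight_product[OF s n2 p gp g0 ab, symmetric]) (use \<delta> J0 in auto)
        also have "\<dots> \<le> ?h X a b * (ennreal (Jrad_const \<gamma> p * (mom s a * mom s b) powr (n - 2)) * Jang p s ((\<gamma> - p) / 2) a b)"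
          using low[of a b] True by (intro mult_left_mono) (auto simp: J0_def mult_ac)
        also have "\<dots> = ?h X a b * Jrad p s \<beta> a b"
          unfolding ex(3) by (subst Jrad_weight[OF s n2 p gp g0 ab]) simp
        finally show ?thesis using True by simp
      qed auto
    qed
    finally show ?thesis .
  qed
  \<comment> \<open>A precondition of \<open>kg_lhs_square\<close>; any constant for the angular
    average serves.\<close>
  have Qfin: "?Q < \<infinity>"
  proof -
    obtain J where J: "J > 0" "\<And>a b. a > s \<Longrightarrow> b > s \<Longrightarrow> Jang p s ((\<gamma> - p) / 2) a b \<le> ennreal (J * (a * b) powr \<gamma>)"
      using Jang_bounded[OF s p1 gp g0] by blast
    have "?Q \<le> ennreal (Jrad_const \<gamma> p * J) * (?M * ?M)"
      unfolding ex(3) by (rule Qrad_mass_le[OF s n2 p gp g0 Xm Xm _ _ less_imp_le[OF J(1)] J(2)]) (auto simp: X_def)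
    also have "\<dots> < \<infinity>" using mfin[of \<gamma>] by (auto simp: ennreal_mult_less_top)
    finally show ?thesis .
  qed
  have kl: "(kg_lhs s \<beta> f f)\<^sup>2 = ?g v * ?Q"
    using kg_lhs_square(2)[OF d Fm Fm F2 F2 hf hf, of \<beta>, folded n_def, folded p, folded X_def, OF Qfin Fr Fr]
    unfolding kg_constant_split[OF s d n_def p \<gamma> g0 gp] v_def .
  have "?g v * ?Q \<le> (ennreal C * kg_rhs s \<beta> f f)\<^sup>2"
    unfolding kl[symmetric] by (rule power_mono[OF CC[OF fr fr]]) simp
  also have "\<dots> = ?k v"
    unfolding kg_rhs_def power_mult_distrib pf using C0 by (simp add: ennreal_power)
  finally have main: "?g v * ?Q \<le> ?k v" .
  have IM: "I \<le> ?M" unfolding I_def energy_mass_weight by (rule nn_integral_mono) (auto simp: indicator_def)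
  then have Ifin: "I < \<infinity>" using mfin[of \<gamma>] by (rule le_less_trans)
  then obtain r where r: "I = ennreal r" "r \<ge> 0" by (cases I) auto
  have rB: "B / \<delta> + 1 \<le> r" using big[OF Xm Xs] r unfolding I_def[symmetric] by (simp add: ennreal_le_iff)
  have r0: "r > 0" using rB B(1) \<delta> by (meson add_nonneg_pos divide_nonneg_pos less_le_trans zero_less_one)
  have "?M \<le> I + ennreal B" unfolding I_def by (rule B(2)[OF Xm]) (use \<epsilon> s in \<open>simp add: Xs\<close>)
  also have "\<dots> \<le> ennreal (?B r)"
  proof -
    have "B / \<delta> \<le> r" using rB by simp
    then have "B \<le> r * \<delta>" using \<delta> by (simp add: field_simps)
    then show ?thesis using r B(1) by (simp add: ennreal_plus[symmetric] ennreal_leI algebra_simps del: ennreal_plus)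
  qed
  finally have M: "?M \<le> ennreal (?B r)" .
  have "?g v * (?f \<gamma> J0 * (I * I)) \<le> ?g v * ?Q"
    by (rule mult_left_mono[OF lowQ]) simp
  also note main
  also have "?k v \<le> ennreal (C\<^sup>2) * ((ennreal v * ennreal (?B r)) * (ennreal v * ennreal (?B r)))"
    by (intro mult_left_mono mult_mono M) auto
  finally have "ennreal (kg_factor DIM('a) * v\<^sup>2 * (Jrad_const \<gamma> p * ((1 - \<delta>) * J0) * (r * r))) \<le> ennreal (C\<^sup>2 * ((v * (?B r)) * (v * (?B r))))"
    using kf K J0 v \<delta> r by (simp add: ennreal_mult)
  then have "kg_factor DIM('a) * v\<^sup>2 * (Jrad_const \<gamma> p * ((1 - \<delta>) * J0) * (r * r)) \<le> C\<^sup>2 * ((v * (?B r)) * (v * (?B r)))"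
    by (subst (asm) ennreal_le_iff) (use v r \<delta> in auto)
  then have "(kg_factor DIM('a) * (Jrad_const \<gamma> p * J0) * (1 - \<delta>)) * (v\<^sup>2 * r\<^sup>2) \<le> (C\<^sup>2 * (1 + \<delta>)\<^sup>2) * (v\<^sup>2 * r\<^sup>2)"
    by (simp add: power2_eq_square mult_ac)
  then show ?thesis unfolding J0_def using v r0 by (subst (asm) mult_le_cancel_right_pos) auto
qed

end

theorem corollary1p2:
  fixes s \<beta> d :: real
  defines "d \<equiv> real CARD('d::finite)"
  assumes "d \<ge> 2" and "s > 0" and "\<beta> \<ge> (2 - d) / 4"
    and nondegenerate: "\<not> (d = 2 \<and> \<beta> = 0)"
  shows "(\<exists>C>0. \<forall>f g :: real ^ 'd \<Rightarrow> complex.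
            f \<in> radial_data s \<beta> \<longrightarrow> g \<in> radial_data s \<beta> \<longrightarrow>
            kg_lhs s \<beta> f g \<le> ennreal C * kg_rhs s \<beta> f g) \<and>
         (\<beta> \<in> {(2 - d) / 4 .. (3 - d) / 4} \<union> {(5 - d) / 4 ..} \<longrightarrow>
            sqrt (F_const \<beta> d) \<in> kg_constants TYPE(real ^ 'd) s \<beta> \<and>
            (\<forall>C \<in> kg_constants TYPE(real ^ 'd) s \<beta>. sqrt (F_const \<beta> d) \<le> C) \<and>
            \<not> (\<exists>f g :: real ^ 'd \<Rightarrow> complex.
                  f \<in> radial_data s \<beta> \<and> g \<in> radial_data s \<beta> \<and>
                  \<not> (AE x in lborel. f x = 0) \<and> \<not> (AE x in lborel. g x = 0) \<and>
                  kg_lhs s \<beta> f g = ennreal (sqrt (F_const \<beta> d)) * kg_rhs s \<beta> f g))"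
proof -
  let ?h = "kg_constants TYPE(real ^ 'd) s \<beta>"
  let ?g = "\<lambda>d. sqrt (F_const \<beta> d)"
  let ?f = "radial_data s \<beta>"
  define p where "p = (d - 3) / 2"
  define \<gamma> where "\<gamma> = 2 * \<beta> + p"
  have d2: "DIM(real ^ 'd) \<ge> 2" and dd: "d = real DIM(real ^ 'd)" using assms by (auto simp: d_def)
  have g: "\<gamma> \<ge> - 1 / 2" using assms(4) by (simp add: \<gamma>_def p_def field_simps)
  \<comment> \<open>By the bound on \<beta> the right side is at least (d - 2)/2, so it is positive
    for d > 2, and for d = 2 it vanishes only at the excluded \<beta> = 0.\<close>
  have "\<gamma> + p + 1 = 2 * \<beta> + d - 2" by (simp add: \<gamma>_def p_def field_simps)
  then have gp: "\<gamma> + p + 1 > 0" using assms(2,4) nondegenerate by (cases "d = 2") auto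
  have p1: "p > - 1" using assms(2) by (simp add: p_def)
  note ctxt = \<open>s > 0\<close> d2 dd p_def \<gamma>_def g gp
  note up = kg_upper[OF ctxt]
  have b: "\<beta> = (\<gamma> - p) / 2" by (simp add: \<gamma>_def)
  have K: "Jrad_const \<gamma> p > 0" using Jrad_const_pos[OF \<open>s > 0\<close> \<open>d \<ge> 2\<close> p_def gp g] .
  have kf: "kg_factor DIM(real ^ 'd) > 0" by (rule kg_factor_pos[OF d2])
  obtain J where J: "J > 0" "\<And>x y. x > s \<Longrightarrow> y > s \<Longrightarrow> Jang p s \<beta> x y \<le> ennreal (J * (x * y) powr \<gamma>)"
    using Jang_bounded[OF \<open>s > 0\<close> p1 gp g] unfolding b[symmetric] by blast
  have "\<exists>C>0. \<forall>f g :: real ^ 'd \<Rightarrow> complex. f \<in> ?f \<longrightarrow> g \<in> ?f \<longrightarrow>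
    kg_lhs s \<beta> f g \<le> ennreal C * kg_rhs s \<beta> f g"
  proof (intro exI conjI allI impI)
    show "sqrt (kg_factor DIM(real ^ 'd) * (Jrad_const \<gamma> p * J)) > 0" using kf K J(1) by simp
  qed (rule up(1)[OF _ _ J])
  moreover have "?g d \<in> ?h \<and>
      (\<forall>C \<in> kg_constants TYPE(real ^ 'd) s \<beta>. ?g d \<le> C) \<and>
      \<not> (\<exists>f g :: real ^ 'd \<Rightarrow> complex. f \<in> ?f \<and> g \<in> ?f \<and>
        \<not> (AE x in lborel. f x = 0) \<and> \<not> (AE x in lborel. g x = 0) \<and>
        kg_lhs s \<beta> f g = ennreal (?g d) * kg_rhs s \<beta> f g)"
    if range: "\<beta> \<in> {(2 - d) / 4 .. (3 - d) / 4} \<union> {(5 - d) / 4 ..}"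
  proof -
    have cv: "\<gamma> \<le> 0 \<or> 1 \<le> \<gamma>" using range by (auto simp: \<gamma>_def p_def field_simps)
    define J0 where "J0 = 2 powr (\<gamma> + 1) * Jang_limit p \<gamma>"
    have J0: "J0 > 0" unfolding J0_def using Jang_limit_pos[OF p1 gp] by simp
    have J0_less: "Jang p s \<beta> x y < ennreal (J0 * (x * y) powr \<gamma>)" if "x > s" "y > s" for x y
      using Jang_less[OF \<open>s > 0\<close> that p1 g cv gp] unfolding b[symmetric] by (simp add: J0_def mult_ac)
    have Fc: "F_const \<beta> d = kg_factor DIM(real ^ 'd) * (Jrad_const \<gamma> p * J0)"
      unfolding J0_def dd by (rule F_const_eq[symmetric, OF d2 _ \<gamma>_def g gp]) (simp add: p_def dd)
    have F0: "F_const \<beta> d > 0" unfolding Fc using kf K J0 by simp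
    note up0 = up[OF _ _ J0 less_imp_le[OF J0_less], folded Fc]
    have "?g d \<in> ?h"
      unfolding kg_constants_def using F0 up0(1) by auto
    moreover have "?g d \<le> C" if C: "C \<in> ?h" for C
    proof -
      have C0: "C > 0" using C by (auto simp: kg_constants_def)
      \<comment> \<open>The approximate lower bounds in the limit \<delta> -> 0 from the right; the
        zeros keep the two limits in the shape in which they are proved.\<close>
      have "F_const \<beta> d * (1 - 0) \<le> C\<^sup>2 * (1 + 0)\<^sup>2"
      proof (rule tendsto_le)
        show "((\<lambda>\<delta>. C\<^sup>2 * (1 + \<delta>)\<^sup>2) \<longlongrightarrow> C\<^sup>2 * (1 + 0)\<^sup>2) (at_right 0)" by (intro tendsto_intros)
        show "((\<lambda>\<delta>. F_const \<beta> d * (1 - \<delta>)) \<longlongrightarrow> F_const \<beta> d * (1 - 0)) (at_right 0)" by (intro tendsto_intros)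
        have "F_const \<beta> d * (1 - \<delta>) \<le> C\<^sup>2 * (1 + \<delta>)\<^sup>2" if "\<delta> > 0" "\<delta> < 1" for \<delta>
          using kg_lower_approx[OF ctxt C that] by (simp add: Fc J0_def)
        then show "\<forall>\<^sub>F \<delta> in at_right 0. F_const \<beta> d * (1 - \<delta>) \<le> C\<^sup>2 * (1 + \<delta>)\<^sup>2"
          by (auto simp: eventually_at_right[of 0 1] intro!: exI[of _ 1])
      qed simp
      then show ?thesis using C0 by (intro real_le_lsqrt) auto
    qed
    moreover have "kg_lhs s \<beta> f g \<noteq> ennreal (?g d) * kg_rhs s \<beta> f g"
      if "f \<in> ?f" "g \<in> ?f" "\<not> (AE x in lborel. f x = 0)" "\<not> (AE x in lborel. g x = 0)" for f g :: "real ^ 'd \<Rightarrow> complex"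
      by (rule up0(2)[OF that(1,2) _ _ J0_less that(3,4)])
    ultimately show ?thesis by blast
  qed
  ultimately show ?thesis by blast
qed

end
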